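(* Let $P_T\in C^1(\mathbb{R}^m,M_m(\mathbb{R}))$ be a $C^1$ distribution of orthogonal projections with $P_N=I_m-P_T$. Let $(u,\xi)$ be a smooth critical point of $\mathcal{L}^{1/2}$ in $\mathfrak{E}$. Then $u$ is a critical point of $$E^{1/2}(u)=\int_{S^1}|(-\Delta)^{1/4}u|^2\,d\theta$$ within the space $\mathfrak{H}^{1/2}$ of horizontal $H^{1/2}$-maps, where $$\mathfrak{H}^{1/2}=\Big\{u\in H^{1/2}(S^1,\mathbb{R}^m):\ P_N(u)\tfrac{du}{d\theta}=0\ \text{in }\mathcal{D}'(S^1)\Big\}.$$
   Context: A $C^1$ distribution of orthogonal projections: $P_T,P_N\in C^1(\mathbb{R}^m,M_m(\mathbb{R}))$ with, at every $z$, $P_TP_T=P_T$, $P_NP_N=P_N$, $P_T+P_N=I_m$ and $\langle P_T(z)U,P_N(z)V\rangle=0$ for all $U,V\in\mathbb{R}^m$. For $\alpha\in[0,1]$ and $f=\sum_{n\in\mathbb{Z}}f_ne^{in\theta}$ on $S^1$, $(-\Delta)_0^{-\alpha/2}f:=\sum_{n\ne0}|n|^{-\alpha}f_ne^{in\theta}$, and $(-\Delta)^{1/4}f=\sum_n|n|^{1/2}f_ne^{in\theta}$. The set $\mathfrak{E}$ consists of the pairs $(u,\xi)\in H^{1/2}(S^1,\mathbb{R}^m)\times H^{-1/2}(S^1,\mathbb{R}^m)$ such that $$\Big(P_N(u),\tfrac{du}{d\theta}\Big)_{H^{1/2},H^{-1/2}}=0\in\mathbb{R}^m$$ (the $i$-th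 component of the left side is $\sum_j(P_N^{ij}(u),\frac{du_j}{d\theta})_{H^{1/2},H^{-1/2}}$), $(-\Delta)_0^{-1/4}(P_T(u)\xi)\in L^2(S^1)$ and $(-\Delta)_0^{-1/4}(P_T(u)\frac{du}{d\theta})\in L^2(S^1)$. On $\mathfrak{E}$, $$\mathcal{L}^{1/2}(u,\xi)=\int_{S^1}\tfrac12|(-\Delta)_0^{-1/4}(P_T(u)\xi)|^2d\theta-\int_{S^1}\Big\langle(-\Delta)_0^{-1/4}(P_T(u)\xi),(-\Delta)_0^{-1/4}\big(P_T(u)\tfrac{du}{d\theta}\big)\Big\rangle d\theta-\int_{S^1}\Big\langle(-\Delta)_0^{-1/4}(P_N(u)\xi),(-\Delta)_0^{-1/4}\big(P_N(u)\tfrac{du}{d\theta}\big)\Big\rangle d\theta .$$ $(u,\xi)\in\mathfrak{E}$ is a critical point of $\mathcal{L}^{1/2}$ in $\mathfrak{E}$ if the first variation of $\mathcal{L}^{1/2}$ at $(u,\xi)$ vanishes in every direction $(w,\eta)\in C^\infty(S^1,\mathbb{R}^m)\times C^\infty(S^1,\mathbb{R}^m)$ ($w$ varying $u$, $\eta$ varying $\xi$) for which $w$ satisfies the linearized constraint $$\int_{S^1}P_N(u)\tfrac{dw}{d\theta}\,d\theta+\Big\langle d_wP_N(u),\tfrac{du}{d\theta}\Big\rangle_{H^{1/2},H^{-1/2}}=0,\qquad d_wP_N(u)=\sum_kw_k\,\partial_{z_k}P_N(u).$$ $u\in\mathfrak{H}^{1/2}$ is a critical point of $E^{1/2}$ within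 $\mathfrak{H}^{1/2}$ if $\frac{d}{dt}E^{1/2}(u_t)|_{t=0}=0$ for every path $u_t\in C^1((-1,1),\mathfrak{H}^{1/2})$ with $u_0=u$. *)

theory Defs
  imports "HOL-Analysis.Analysis"
begin

text \<open>Functions on the circle are \<open>2\<pi>\<close>-periodic functions of the angle, integrated over
  one period with respect to Lebesgue measure.  Elements of \<open>L\<^sup>2\<close> and \<open>H\<^bsup>1/2\<^esup>\<close> are given by
  representatives; every notion below depends on them only up to null sets.\<close>

abbreviation circle :: "real measure" where
  "circle \<equiv> lebesgue_on {0..2 * pi}"

definition L2_circle :: "(real \<Rightarrow> 'a::euclidean_space) set" where
  "L2_circle = {f. (\<forall>\<theta>. f (\<theta> + 2 * pi) = f \<theta>) \<and> f \<in> borel_measurable circle \<and>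
     integrable circle (\<lambda>\<theta>. (norm (f \<theta>))\<^sup>2)}"

definition ddth :: "(real \<Rightarrow> 'a::real_normed_vector) \<Rightarrow> real \<Rightarrow> 'a" where
  "ddth f = (\<lambda>\<theta>. vector_derivative f (at \<theta>))"

definition smooth_circle :: "(real \<Rightarrow> 'a::real_normed_vector) set" where
  "smooth_circle = {f. (\<forall>\<theta>. f (\<theta> + 2 * pi) = f \<theta>) \<and>
     (\<forall>k \<theta>. (ddth ^^ k) f differentiable (at \<theta>))}"

text \<open>Real (vector valued) distributions are linear functionals on the real test functions
  \<open>smooth_circle\<close>, continuous for the \<open>C\<^sup>k\<close> seminorms.  Their values outside
  \<open>smooth_circle\<close> carry no information.\<close>

type_synonym 'a dist = "(real \<Rightarrow> real) \<Rightarrow> 'a"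

definition distributions :: "'a::real_normed_vector dist set" where
  "distributions = {T.
     (\<forall>\<phi>\<in>smooth_circle. \<forall>\<psi>\<in>smooth_circle. \<forall>a b.
        T (\<lambda>\<theta>. a * \<phi> \<theta> + b * \<psi> \<theta>) = a *\<^sub>R T \<phi> + b *\<^sub>R T \<psi>) \<and>
     (\<exists>C N. \<forall>\<phi>\<in>smooth_circle. norm (T \<phi>) \<le> C * (\<Sum>k\<le>N. SUP \<theta>. \<bar>(ddth ^^ k) \<phi> \<theta>\<bar>))}"

definition dist_of_fun :: "(real \<Rightarrow> 'a::euclidean_space) \<Rightarrow> 'a dist" where
  "dist_of_fun f = (\<lambda>\<phi>. LINT \<theta>|circle. \<phi> \<theta> *\<^sub>R f \<theta>)"

definition dist_deriv :: "(real \<Rightarrow> 'a::euclidean_space) \<Rightarrow> 'a dist" where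
  "dist_deriv u = (\<lambda>\<phi>. - (LINT \<theta>|circle. ddth \<phi> \<theta> *\<^sub>R u \<theta>))"

definition fourier :: "(real \<Rightarrow> real) \<Rightarrow> int \<Rightarrow> complex" where
  "fourier f n = (LINT \<theta>|circle. complex_of_real (f \<theta>) * cis (- (of_int n * \<theta>))) / (2 * pi)"

text \<open>\<open>T(e\<^bsup>-in\<theta>\<^esup>) / 2\<pi>\<close>, with \<open>T\<close> extended complex linearly.\<close>

definition dist_fourier :: "real dist \<Rightarrow> int \<Rightarrow> complex" where
  "dist_fourier T n =
     Complex (T (\<lambda>\<theta>. cos (of_int n * \<theta>))) (- T (\<lambda>\<theta>. sin (of_int n * \<theta>))) / (2 * pi)"

definition fourier_sq :: "(real \<Rightarrow> 'a::euclidean_space) \<Rightarrow> int \<Rightarrow> real" where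
  "fourier_sq u n = (\<Sum>b\<in>Basis. (cmod (fourier (\<lambda>\<theta>. u \<theta> \<bullet> b) n))\<^sup>2)"

definition H_half :: "(real \<Rightarrow> 'a::euclidean_space) set" where
  "H_half = {u \<in> L2_circle.
     (\<lambda>n. (1 + (of_int n)\<^sup>2) powr (1/2) * fourier_sq u n) summable_on UNIV}"

definition H_half_norm :: "(real \<Rightarrow> 'a::euclidean_space) \<Rightarrow> real" where
  "H_half_norm u = sqrt (\<Sum>\<^sub>\<infinity>n. (1 + (of_int n)\<^sup>2) powr (1/2) * fourier_sq u n)"

definition H_minus_half :: "'a::euclidean_space dist set" where
  "H_minus_half = {T \<in> distributions.
     (\<lambda>n. (1 + (of_int n)\<^sup>2) powr (-1/2) *
        (\<Sum>b\<in>Basis. (cmod (dist_fourier (\<lambda>\<phi>. T \<phi> \<bullet> b) n))\<^sup>2)) summable_on UNIV}"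

text \<open>The duality bracket, written as \<open>2\<pi> \<Sum>\<^sub>n f\<^sub>-\<^sub>n T\<^sub>n\<close>.  The series converges absolutely for
  \<open>f \<in> H\<^bsup>1/2\<^esup>\<close>, \<open>T \<in> H\<^bsup>-1/2\<^esup>\<close>, and also for \<open>f \<in> L\<^sup>2\<close> and smooth \<open>T\<close>, where it is
  \<open>\<integral> f T d\<theta>\<close>.  The second case is needed for \<open>d\<^sub>wP\<^sub>N(u)\<close>, which is merely continuous when
  \<open>u\<close> is smooth and \<open>P\<^sub>N\<close> is \<open>C\<^sup>1\<close>.\<close>

definition pairable :: "(real \<Rightarrow> real) \<Rightarrow> real dist \<Rightarrow> bool" where
  "pairable f T \<longleftrightarrow> (\<lambda>n. cnj (fourier f n) * dist_fourier T n) summable_on UNIV"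

definition pairing :: "(real \<Rightarrow> real) \<Rightarrow> real dist \<Rightarrow> real" where
  "pairing f T = 2 * pi * Re (\<Sum>\<^sub>\<infinity>n. cnj (fourier f n) * dist_fourier T n)"

definition mat_pairing :: "(real \<Rightarrow> real^'m^'m) \<Rightarrow> (real^'m) dist \<Rightarrow> real^'m" where
  "mat_pairing A T = (\<chi> i. \<Sum>j\<in>UNIV. pairing (\<lambda>\<theta>. A \<theta> $ i $ j) (\<lambda>\<phi>. T \<phi> $ j))"

text \<open>The distribution \<open>A T\<close>, for \<open>A \<in> H\<^bsup>1/2\<^esup> \<inter> L\<^sup>\<infinity>\<close> and \<open>T \<in> H\<^bsup>-1/2\<^esup>\<close>.\<close>

definition mat_dist :: "(real \<Rightarrow> real^'m^'m) \<Rightarrow> (real^'m) dist \<Rightarrow> (real^'m) dist" where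
  "mat_dist A T = (\<lambda>\<phi>. mat_pairing (\<lambda>\<theta>. \<phi> \<theta> *\<^sub>R A \<theta>) T)"

text \<open>\<open>is_inv_lap \<alpha> T g\<close>: the function \<open>g \<in> L\<^sup>2\<close> represents \<open>(-\<Delta>)\<^sub>0\<^bsup>-\<alpha>/2\<^esup> T\<close>.\<close>

definition is_inv_lap :: "real \<Rightarrow> 'a::euclidean_space dist \<Rightarrow> (real \<Rightarrow> 'a) \<Rightarrow> bool" where
  "is_inv_lap \<alpha> T g \<longleftrightarrow> g \<in> L2_circle \<and>
     (\<forall>b\<in>Basis. \<forall>n. fourier (\<lambda>\<theta>. g \<theta> \<bullet> b) n =
        (if n = 0 then 0
         else of_real (\<bar>of_int n\<bar> powr (-\<alpha>)) * dist_fourier (\<lambda>\<phi>. T \<phi> \<bullet> b) n))"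

definition inv_lap_L2 :: "real \<Rightarrow> 'a::euclidean_space dist \<Rightarrow> bool" where
  "inv_lap_L2 \<alpha> T \<longleftrightarrow> (\<exists>g. is_inv_lap \<alpha> T g)"

definition inv_lap :: "real \<Rightarrow> 'a::euclidean_space dist \<Rightarrow> real \<Rightarrow> 'a" where
  "inv_lap \<alpha> T = (SOME g. is_inv_lap \<alpha> T g)"

text \<open>\<open>(-\<Delta>)\<^bsup>1/4\<^esup> u\<close> for \<open>u \<in> H\<^bsup>1/2\<^esup>\<close>, as an element of \<open>L\<^sup>2\<close>.\<close>

definition quarter_lap :: "(real \<Rightarrow> 'a::euclidean_space) \<Rightarrow> real \<Rightarrow> 'a" where
  "quarter_lap u = (SOME g. g \<in> L2_circle \<and>
     (\<forall>b\<in>Basis. \<forall>n. fourier (\<lambda>\<theta>. g \<theta> \<bullet> b) n =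
        of_real (\<bar>of_int n\<bar> powr (1/2)) * fourier (\<lambda>\<theta>. u \<theta> \<bullet> b) n))"

definition C1_map :: "('a::real_normed_vector \<Rightarrow> 'b::real_normed_vector) \<Rightarrow> bool" where
  "C1_map f \<longleftrightarrow> (\<exists>f' :: 'a \<Rightarrow> 'a \<Rightarrow>\<^sub>L 'b.
     (\<forall>z. (f has_derivative blinfun_apply (f' z)) (at z)) \<and> continuous_on UNIV f')"

definition C1_projections ::
  "(real^'m \<Rightarrow> real^'m^'m) \<Rightarrow> (real^'m \<Rightarrow> real^'m^'m) \<Rightarrow> bool" where
  "C1_projections PT PN \<longleftrightarrow> C1_map PT \<and> C1_map PN \<and>
     (\<forall>z. PT z ** PT z = PT z \<and> PN z ** PN z = PN z \<and> PT z + PN z = mat 1 \<and>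
        (\<forall>U V. (PT z *v U) \<bullet> (PN z *v V) = 0))"

text \<open>The condition \<open>P\<^sub>N(u) \<in> H\<^bsup>1/2\<^esup>\<close> makes the bracket and the product \<open>P\<^sub>N(u) du/d\<theta>\<close>
  meaningful.  It is automatic if \<open>u\<close> is smooth or \<open>P\<^sub>N\<close> has bounded derivative.\<close>

definition EE ::
  "(real^'m \<Rightarrow> real^'m^'m) \<Rightarrow> (real^'m \<Rightarrow> real^'m^'m) \<Rightarrow> ((real \<Rightarrow> real^'m) \<times> (real^'m) dist) set" where
  "EE PT PN = {(u, \<xi>). u \<in> H_half \<and> \<xi> \<in> H_minus_half \<and>
     PN \<circ> u \<in> H_half \<and> mat_pairing (PN \<circ> u) (dist_deriv u) = 0 \<and>
     inv_lap_L2 (1/2) (mat_dist (PT \<circ> u) \<xi>) \<and>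
     inv_lap_L2 (1/2) (mat_dist (PT \<circ> u) (dist_deriv u))}"

definition L_half ::
  "(real^'m \<Rightarrow> real^'m^'m) \<Rightarrow> (real^'m \<Rightarrow> real^'m^'m) \<Rightarrow> (real \<Rightarrow> real^'m) \<Rightarrow> (real^'m) dist \<Rightarrow> real" where
  "L_half PT PN u \<xi> =
     (LINT \<theta>|circle. 1/2 * (norm (inv_lap (1/2) (mat_dist (PT \<circ> u) \<xi>) \<theta>))\<^sup>2)
   - (LINT \<theta>|circle. inv_lap (1/2) (mat_dist (PT \<circ> u) \<xi>) \<theta> \<bullet>
        inv_lap (1/2) (mat_dist (PT \<circ> u) (dist_deriv u)) \<theta>)
   - (LINT \<theta>|circle. inv_lap (1/2) (mat_dist (PN \<circ> u) \<xi>) \<theta> \<bullet>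
        inv_lap (1/2) (mat_dist (PN \<circ> u) (dist_deriv u)) \<theta>)"

definition dir_deriv ::
  "(real^'m \<Rightarrow> real^'m^'m) \<Rightarrow> (real \<Rightarrow> real^'m) \<Rightarrow> (real \<Rightarrow> real^'m) \<Rightarrow> real \<Rightarrow> real^'m^'m" where
  "dir_deriv P u w =
     (\<lambda>\<theta>. \<Sum>k\<in>UNIV. w \<theta> $ k *\<^sub>R frechet_derivative P (at (u \<theta>)) (axis k 1))"

definition linearized_constraint ::
  "(real^'m \<Rightarrow> real^'m^'m) \<Rightarrow> (real \<Rightarrow> real^'m) \<Rightarrow> (real \<Rightarrow> real^'m) \<Rightarrow> bool" where
  "linearized_constraint PN u w \<longleftrightarrow>
     (\<forall>i j. pairable (\<lambda>\<theta>. dir_deriv PN u w \<theta> $ i $ j) (\<lambda>\<phi>. dist_deriv u \<phi> $ j)) \<and>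
     (LINT \<theta>|circle. PN (u \<theta>) *v ddth w \<theta>) + mat_pairing (dir_deriv PN u w) (dist_deriv u) = 0"

definition critical_L_half ::
  "(real^'m \<Rightarrow> real^'m^'m) \<Rightarrow> (real^'m \<Rightarrow> real^'m^'m) \<Rightarrow> (real \<Rightarrow> real^'m) \<Rightarrow> (real^'m) dist \<Rightarrow> bool" where
  "critical_L_half PT PN u \<xi> \<longleftrightarrow> (u, \<xi>) \<in> EE PT PN \<and>
     (\<forall>w\<in>smooth_circle. \<forall>\<eta>\<in>smooth_circle. linearized_constraint PN u w \<longrightarrow>
        ((\<lambda>t. L_half PT PN (\<lambda>\<theta>. u \<theta> + t *\<^sub>R w \<theta>) (\<lambda>\<phi>. \<xi> \<phi> + t *\<^sub>R dist_of_fun \<eta> \<phi>))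
           has_real_derivative 0) (at 0))"

definition smooth_dist :: "'a::euclidean_space dist \<Rightarrow> bool" where
  "smooth_dist T \<longleftrightarrow> (\<exists>f\<in>smooth_circle. \<forall>\<phi>\<in>smooth_circle. T \<phi> = dist_of_fun f \<phi>)"

definition E_half :: "(real \<Rightarrow> real^'m) \<Rightarrow> real" where
  "E_half u = (LINT \<theta>|circle. (norm (quarter_lap u \<theta>))\<^sup>2)"

definition horizontal :: "(real^'m \<Rightarrow> real^'m^'m) \<Rightarrow> (real \<Rightarrow> real^'m) set" where
  "horizontal PN = {u \<in> H_half. PN \<circ> u \<in> H_half \<and>
     (\<forall>\<phi>\<in>smooth_circle. mat_dist (PN \<circ> u) (dist_deriv u) \<phi> = 0)}"

text \<open>\<open>C\<^sup>1\<close> paths \<open>(-1,1) \<rightarrow> S\<close> for the \<open>H\<^bsup>1/2\<^esup>\<close> norm, \<open>S \<subseteq> H\<^bsup>1/2\<^esup>\<close>.  This is stated by hand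
  because \<open>H\<^bsup>1/2\<^esup>\<close> is not a normed space type here.\<close>

definition C1_path :: "(real \<Rightarrow> 'a::euclidean_space) set \<Rightarrow> (real \<Rightarrow> real \<Rightarrow> 'a) \<Rightarrow> bool" where
  "C1_path S \<gamma> \<longleftrightarrow> (\<forall>t\<in>{-1<..<1}. \<gamma> t \<in> S) \<and>
     (\<exists>\<gamma>'. \<forall>t\<in>{-1<..<1}. \<gamma>' t \<in> H_half \<and>
        ((\<lambda>h. H_half_norm (\<lambda>\<theta>. (\<gamma> (t + h) \<theta> - \<gamma> t \<theta>) /\<^sub>R h - \<gamma>' t \<theta>)) \<longlongrightarrow> 0) (at 0) \<and>
        ((\<lambda>s. H_half_norm (\<lambda>\<theta>. \<gamma>' s \<theta> - \<gamma>' t \<theta>)) \<longlongrightarrow> 0) (at t))"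

definition critical_E_half :: "(real^'m \<Rightarrow> real^'m^'m) \<Rightarrow> (real \<Rightarrow> real^'m) \<Rightarrow> bool" where
  "critical_E_half PN u \<longleftrightarrow> u \<in> horizontal PN \<and>
     (\<forall>\<gamma>. C1_path (horizontal PN) \<gamma> \<and> (AE \<theta> in circle. \<gamma> 0 \<theta> = u \<theta>) \<longrightarrow>
        ((\<lambda>t. E_half (\<gamma> t)) has_real_derivative 0) (at 0))"

end

theory Submission
  imports Defs
begin

text \<open>
Varying \<open>\<xi>\<close> at a critical point gives \<open>PN(u) u' = 0\<close> and shows that \<open>PT(u) (\<xi> - u')\<close> is constant; varying
\<open>u\<close> then shows that, on smooth \<open>w\<close> satisfying the \<open>m\<close> linearized constraints, the \<open>H\<^bsup>1/2\<^esup>\<close> product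
\<open>\<langle>u, w\<rangle>\<close> equals the pairing of the potential of \<open>PN(u) \<xi>\<close> with the linearization of \<open>w \<mapsto> PN(u) u'\<close>.
A finite dimensional Lagrange multiplier removes the constraints: \<open>\<langle>u, w\<rangle>\<close> is the pairing of that
linearization with some bounded \<open>\<Phi> \<in> H\<^bsup>1/2\<^esup>\<close>, for all smooth \<open>w\<close> and by density for all \<open>w \<in> H\<^bsup>1/2\<^esup>\<close>.

Along a path \<open>u\<^sub>t\<close> of horizontal maps the equation \<open>PN(u\<^sub>t) u\<^sub>t' = 0\<close> can be tested against \<open>\<Phi>\<close> times a
cutoff of \<open>u\<^sub>t\<close>. Subtracting the equation at \<open>t = 0\<close>, dividing by \<open>t\<close> and letting \<open>t\<close> tend to \<open>0\<close> shows that the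
linearized constraint in the direction of the velocity \<open>v\<close> pairs to zero with \<open>\<Phi>\<close>, so the derivative
\<open>2 \<langle>u, v\<rangle>\<close> of the energy vanishes. Only weak convergence in \<open>H\<^bsup>1/2\<^esup>\<close> of the test functions is available
and needed.
\<close>

section \<open>Square integrable functions on the circle\<close>

text \<open>Criticality is tested on smooth directions, whereas the velocity of a path is only in
  H^(1/2), and smooth approximations of it need not satisfy the linearized constraint. This is why
  the multiplier comes first: once the constraint is gone, the identity is continuous in
  \<open>w\<close> and survives approximation. A vector of R^m suffices as multiplier because the
  constraint in \<open>EE\<close> prescribes only a mean. The resulting \<open>\<Phi>\<close> is the
  potential of \<open>u' - PN(u) f\<close>, where \<open>f\<close> is the density of \<xi>, plus
  this vector. The second obstacle is that functions in H^(1/2) may be unbounded, so that products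
  can leave the space; bounded ones form an algebra. Hence potentials need representatives bounded
  at every angle, and \<open>PN\<close> along the path is cut off, since its derivative may grow at
  infinity. All pairings are written as Fourier multiplier forms: 1 gives the L^2 product, |n| the
  energy, i n the pairing with a derivative, and 1/|n| the form behind \<open>L_half\<close>. One
  weighted Cauchy-Schwarz inequality then yields every continuity statement.\<close>

lemma finite_measure_circle: "finite_measure circle"
  by (rule finite_measure_lebesgue_on) simp

lemma borel_measurable_circle_continuous:
  fixes f :: "real \<Rightarrow> 'a::euclidean_space"
  assumes "continuous_on UNIV f"
  shows "f \<in> borel_measurable circle"
  using assms continuous_on_subset
  by (intro continuous_imp_measurable_on_sets_lebesgue) auto

lemma L2_circle_real_iff:
  fixes f :: "real \<Rightarrow> real"
  shows "f \<in> L2_circle \<longleftrightarrow> (\<forall>\<theta>. f (\<theta> + 2 * pi) = f \<theta>) \<and> f \<in> borel_measurable circle \<and>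
    integrable circle (\<lambda>\<theta>. (f \<theta>)\<^sup>2)"
  by (simp add: L2_circle_def)

lemma L2_circleD:
  fixes f :: "real \<Rightarrow> real"
  assumes "f \<in> L2_circle"
  shows "f (\<theta> + 2 * pi) = f \<theta>" "f \<in> borel_measurable circle" "integrable circle (\<lambda>\<theta>. (f \<theta>)\<^sup>2)"
    "integrable circle f"
proof -
  show "f (\<theta> + 2 * pi) = f \<theta>" "f \<in> borel_measurable circle" "integrable circle (\<lambda>\<theta>. (f \<theta>)\<^sup>2)"
    using assms by (auto simp: L2_circle_real_iff)
  then show "integrable circle f"
    using finite_measure.square_integrable_imp_integrable[OF finite_measure_circle] by blast
qed

lemma integrable_bounded_mult:
  fixes f :: "'a \<Rightarrow> 'b::{banach, real_normed_algebra, second_countable_topology}"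
  assumes "integrable M f" "g \<in> borel_measurable M" "\<And>x. norm (g x) \<le> C"
  shows "integrable M (\<lambda>x. g x * f x)"
proof (rule Bochner_Integration.integrable_bound)
  show "integrable M (\<lambda>x. C * norm (f x))"
    using assms by auto
  show "(\<lambda>x. g x * f x) \<in> borel_measurable M"
    using assms by auto
  have "norm (g x * f x) \<le> norm (C * norm (f x))" for x
  proof -
    have "norm (g x * f x) \<le> norm (g x) * norm (f x)"
      by (rule norm_mult_ineq)
    also have "\<dots> \<le> C * norm (f x)"
      using assms(3) by (intro mult_right_mono) auto
    finally show ?thesis
      by simp
  qed
  then show "AE x in M. norm (g x * f x) \<le> norm (C * norm (f x))"
    by simp
qed

lemma L2_circle_integrable_mult:
  fixes f g :: "real \<Rightarrow> real"
  assumes "f \<in> L2_circle" "g \<in> L2_circle"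
  shows "integrable circle (\<lambda>\<theta>. f \<theta> * g \<theta>)"
proof (rule Bochner_Integration.integrable_bound)
  show "integrable circle (\<lambda>\<theta>. (f \<theta>)\<^sup>2 + (g \<theta>)\<^sup>2)"
    using assms by (intro Bochner_Integration.integrable_add L2_circleD)
  show "(\<lambda>\<theta>. f \<theta> * g \<theta>) \<in> borel_measurable circle"
    using assms by (intro borel_measurable_times L2_circleD)
  have "\<bar>a * b\<bar> \<le> a\<^sup>2 + b\<^sup>2" for a b :: real
    using sum_squares_bound[of "\<bar>a\<bar>" "\<bar>b\<bar>"] abs_ge_zero[of "a * b"]
    unfolding abs_mult power2_abs by linarith
  then show "AE \<theta> in circle. norm (f \<theta> * g \<theta>) \<le> norm ((f \<theta>)\<^sup>2 + (g \<theta>)\<^sup>2)"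
    by simp
qed

lemma L2_circle_add:
  fixes f g :: "real \<Rightarrow> real"
  assumes "f \<in> L2_circle" "g \<in> L2_circle"
  shows "(\<lambda>\<theta>. f \<theta> + g \<theta>) \<in> L2_circle"
  unfolding L2_circle_real_iff
proof (intro conjI allI)
  have "integrable circle (\<lambda>\<theta>. (f \<theta>)\<^sup>2 + (g \<theta>)\<^sup>2 + 2 * (f \<theta> * g \<theta>))"
    using assms L2_circleD(3) L2_circle_integrable_mult
    by (intro Bochner_Integration.integrable_add integrable_mult_right) auto
  then show "integrable circle (\<lambda>\<theta>. (f \<theta> + g \<theta>)\<^sup>2)"
    by (simp add: power2_sum mult.assoc)
  show "(\<lambda>\<theta>. f \<theta> + g \<theta>) \<in> borel_measurable circle"
    using assms by (intro borel_measurable_add L2_circleD)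
qed (use assms in \<open>simp add: L2_circleD\<close>)

lemma L2_circle_bounded_mult:
  fixes f g :: "real \<Rightarrow> real"
  assumes "f \<in> L2_circle" "g \<in> borel_measurable circle" "\<And>\<theta>. g (\<theta> + 2 * pi) = g \<theta>"
    "\<And>\<theta>. \<bar>g \<theta>\<bar> \<le> C"
  shows "(\<lambda>\<theta>. g \<theta> * f \<theta>) \<in> L2_circle"
  unfolding L2_circle_real_iff
proof (intro conjI allI)
  have "(g \<theta>)\<^sup>2 \<le> C\<^sup>2" for \<theta>
    using power_mono[OF assms(4)[of \<theta>], of 2] by simp
  then have "integrable circle (\<lambda>\<theta>. (g \<theta>)\<^sup>2 * (f \<theta>)\<^sup>2)"
    using L2_circleD(3)[OF assms(1)] borel_measurable_power[OF assms(2)]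
    by (intro integrable_bounded_mult[where C="C\<^sup>2"]) auto
  then show "integrable circle (\<lambda>\<theta>. (g \<theta> * f \<theta>)\<^sup>2)"
    by (simp add: power_mult_distrib)
  show "(\<lambda>\<theta>. g \<theta> * f \<theta>) \<in> borel_measurable circle"
    using assms(2) L2_circleD(2)[OF assms(1)] by (rule borel_measurable_times)
qed (use assms in \<open>simp add: L2_circleD\<close>)

lemma L2_circle_const: "(\<lambda>_. c::real) \<in> L2_circle"
  using finite_measure.integrable_const[OF finite_measure_circle] by (simp add: L2_circle_real_iff)

lemma L2_circle_bounded:
  fixes g :: "real \<Rightarrow> real"
  assumes "g \<in> borel_measurable circle" "\<And>\<theta>. g (\<theta> + 2 * pi) = g \<theta>" "\<And>\<theta>. \<bar>g \<theta>\<bar> \<le> C"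
  shows "g \<in> L2_circle"
  using L2_circle_bounded_mult[OF L2_circle_const[of 1] assms] by simp

lemma L2_circle_cmult:
  fixes f :: "real \<Rightarrow> real"
  assumes "f \<in> L2_circle"
  shows "(\<lambda>\<theta>. c * f \<theta>) \<in> L2_circle"
  using L2_circle_bounded_mult[OF assms, of "\<lambda>_. c" "\<bar>c\<bar>"] by simp

lemma L2_circle_diff:
  fixes f g :: "real \<Rightarrow> real"
  assumes "f \<in> L2_circle" "g \<in> L2_circle"
  shows "(\<lambda>\<theta>. f \<theta> - g \<theta>) \<in> L2_circle"
  using L2_circle_add[OF assms(1) L2_circle_cmult[OF assms(2), of "-1"]] by simp

lemma L2_circle_sum:
  fixes f :: "'i \<Rightarrow> real \<Rightarrow> real"
  assumes "\<And>i. i \<in> I \<Longrightarrow> f i \<in> L2_circle"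
  shows "(\<lambda>\<theta>. \<Sum>i\<in>I. f i \<theta>) \<in> L2_circle"
  using assms
proof (induction I rule: infinite_finite_induct)
  case (insert i I)
  then show ?case
    using L2_circle_add[of "f i" "\<lambda>\<theta>. \<Sum>i\<in>I. f i \<theta>"] by simp
qed (simp_all add: L2_circle_const)

section \<open>Periodicity and reduction to one period\<close>

lemma periodic_multiple:
  assumes "\<And>\<theta>::real. f (\<theta> + 2 * pi) = f \<theta>"
  shows "f (\<theta> + of_int k * (2 * pi)) = f \<theta>"
proof (induction k rule: int_induct[where k=0])
  case (step1 i)
  then show ?case
    using assms[of "\<theta> + of_int i * (2 * pi)"] by (simp add: algebra_simps)
next
  case (step2 i)
  then show ?case
    using assms[of "\<theta> + of_int (i - 1) * (2 * pi)"] by (simp add: algebra_simps)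
qed simp

lemma periodic_representative:
  assumes "\<And>\<theta>::real. f (\<theta> + 2 * pi) = f \<theta>"
  obtains \<theta>' where "\<theta>' \<in> {0..2 * pi}" "f \<theta>' = f \<theta>"
proof
  define k where "k = \<lfloor>\<theta> / (2 * pi)\<rfloor>"
  have "of_int k \<le> \<theta> / (2 * pi)" "\<theta> / (2 * pi) \<le> of_int k + 1"
    unfolding k_def by (linarith, linarith)
  then show "\<theta> + of_int (- k) * (2 * pi) \<in> {0..2 * pi}"
    by (simp add: field_simps)
qed (rule periodic_multiple[of f, OF assms])

lemma periodic_continuous_bounded:
  fixes f :: "real \<Rightarrow> 'a::real_normed_vector"
  assumes "continuous_on UNIV f" "\<And>\<theta>. f (\<theta> + 2 * pi) = f \<theta>"
  obtains C where "C > 0" "\<And>\<theta>. norm (f \<theta>) \<le> C"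
proof -
  have "compact (f ` {0..2 * pi})"
    using assms(1) by (intro compact_continuous_image continuous_on_subset[OF assms(1)]) auto
  then obtain C where C: "C > 0" "\<And>x. x \<in> {0..2 * pi} \<Longrightarrow> norm (f x) \<le> C"
    using compact_imp_bounded bounded_pos by (metis imageI)
  moreover have "norm (f \<theta>) \<le> C" for \<theta>
    using periodic_representative[of f, OF assms(2)] C(2) by metis
  ultimately show ?thesis
    using that by blast
qed

lemma L2_circle_continuous:
  fixes f :: "real \<Rightarrow> real"
  assumes "continuous_on UNIV f" "\<And>\<theta>. f (\<theta> + 2 * pi) = f \<theta>"
  shows "f \<in> L2_circle"
proof -
  obtain C where "\<And>\<theta>. norm (f \<theta>) \<le> C"
    using periodic_continuous_bounded[of f, OF assms] by auto
  then show ?thesis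
    using assms borel_measurable_circle_continuous[OF assms(1)] by (intro L2_circle_bounded[where C=C]) auto
qed

section \<open>Fourier coefficients\<close>

lemma integrable_mult_cis:
  assumes "integrable circle f"
  shows "integrable circle (\<lambda>\<theta>. complex_of_real (f \<theta>) * cis (a * \<theta>))"
proof -
  have "integrable circle (\<lambda>\<theta>. cis (a * \<theta>) * complex_of_real (f \<theta>))"
    using assms by (intro integrable_bounded_mult[where C=1] borel_measurable_circle_continuous)
      (auto intro!: continuous_intros)
  then show ?thesis
    by (simp add: mult.commute)
qed

lemma fourier_add:
  assumes "integrable circle f" "integrable circle g"
  shows "fourier (\<lambda>\<theta>. f \<theta> + g \<theta>) n = fourier f n + fourier g n"
  using integrable_mult_cis[OF assms(1), of "- of_int n"] integrable_mult_cis[OF assms(2), of "- of_int n"]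
  by (simp add: fourier_def ring_distribs add_divide_distrib)

lemma fourier_cmult: "fourier (\<lambda>\<theta>. c * f \<theta>) n = of_real c * fourier f n"
  by (simp add: fourier_def mult.assoc)

lemma fourier_diff:
  assumes "integrable circle f" "integrable circle g"
  shows "fourier (\<lambda>\<theta>. f \<theta> - g \<theta>) n = fourier f n - fourier g n"
  using integrable_mult_cis[OF assms(1), of "- of_int n"] integrable_mult_cis[OF assms(2), of "- of_int n"]
  by (simp add: fourier_def ring_distribs diff_divide_distrib)

lemma fourier_zero [simp]: "fourier (\<lambda>_. 0) n = 0"
  by (simp add: fourier_def)

text \<open>Elements of L^2 are given by representatives; this makes everything expressed by
  coefficients blind to null sets. It is needed because a path starts at \<open>u\<close> only
  almost everywhere.\<close>

lemma fourier_cong_AE: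
  assumes "AE \<theta> in circle. f \<theta> = g \<theta>" "f \<in> borel_measurable circle" "g \<in> borel_measurable circle"
  shows "fourier f n = fourier g n"
proof -
  have m: "(\<lambda>\<theta>. cis (- (of_int n * \<theta>))) \<in> borel_measurable circle"
    by (intro borel_measurable_circle_continuous continuous_intros)
  show ?thesis
    unfolding fourier_def using assms m
    by (intro arg_cong2[where f="(/)"] refl integral_cong_AE borel_measurable_times
        borel_measurable_of_real) auto
qed

lemma fourier_uminus_index: "fourier f (- n) = cnj (fourier f n)"
proof -
  have "cnj (LINT \<theta>|circle. complex_of_real (f \<theta>) * cis (- (of_int n * \<theta>))) =
      (LINT \<theta>|circle. cnj (complex_of_real (f \<theta>) * cis (- (of_int n * \<theta>))))"
    by (simp only: Bochner_Integration.integral_cnj)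
  then show ?thesis
    by (simp add: fourier_def cis_cnj)
qed

section \<open>Orthogonality of characters and trigonometric polynomials\<close>

lemma integral_cis_circle:
  "(LINT \<theta>|circle. cis (of_int k * \<theta>)) = (if k = 0 then 2 * pi else 0)"
proof (cases "k = 0")
  case False
  have "((\<lambda>\<theta>. cis (of_int k * \<theta>)) has_integral
      cis (of_int k * (2 * pi)) / (\<i> * of_int k) - cis (of_int k * 0) / (\<i> * of_int k)) {0..2 * pi}"
  proof (rule fundamental_theorem_of_calculus)
    show "((\<lambda>\<theta>. cis (of_int k * \<theta>) / (\<i> * of_int k)) has_vector_derivative cis (of_int k * x))
        (at x within {0..2 * pi})" for x
    proof -
      have "((\<lambda>\<theta>. exp (\<i> * of_int k * of_real \<theta>) / (\<i> * of_int k)) has_vector_derivative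
          exp (\<i> * of_int k * of_real x)) (at x within {0..2 * pi})"
        using False by (auto intro!: derivative_eq_intros has_vector_derivative_real_field)
      then show ?thesis
        by (simp add: cis_conv_exp mult.assoc)
    qed
  qed simp
  moreover have "cis (of_int k * (2 * pi)) = 1"
    using cis_multiple_2pi[of "of_int k"] by (metis Ints_of_int mult.commute)
  ultimately have "integral {0..2 * pi} (\<lambda>\<theta>. cis (of_int k * \<theta>)) = 0"
    by (simp add: integral_unique)
  moreover have "(LINT \<theta>|circle. cis (of_int k * \<theta>)) = integral {0..2 * pi} (\<lambda>\<theta>. cis (of_int k * \<theta>))"
    by (intro lebesgue_integral_eq_integral continuous_imp_integrable_real continuous_intros) auto
  ultimately show ?thesis
    using False by simp
qed (simp add: measure_restrict_space scaleR_conv_of_real)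

text \<open>The real part makes the function real for arbitrary coefficients. For hermitian
  \<open>c\<close> the sum is already real and nothing is lost, see
  \<open>of_real_trig\<close>.\<close>

definition trig :: "nat \<Rightarrow> (int \<Rightarrow> complex) \<Rightarrow> real \<Rightarrow> real" where
  "trig N c \<theta> = Re (\<Sum>n\<in>{- int N..int N}. c n * cis (of_int n * \<theta>))"

lemma cis_periodic: "cis (of_int n * (\<theta> + 2 * pi)) = cis (of_int n * \<theta>)"
proof -
  have "cis (of_int n * (\<theta> + 2 * pi)) = cis (of_int n * \<theta>) * cis (2 * pi * of_int n)"
    by (simp add: cis_mult algebra_simps)
  then show ?thesis
    by simp
qed

lemma trig_periodic: "trig N c (\<theta> + 2 * pi) = trig N c \<theta>"
  by (simp only: trig_def cis_periodic)

lemma trig_continuous: "continuous_on S (trig N c)"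
  unfolding trig_def by (intro continuous_intros)

lemma trig_L2: "trig N c \<in> L2_circle"
  by (intro L2_circle_continuous trig_continuous trig_periodic)

lemma of_real_trig:
  assumes "\<And>n. c (- n) = cnj (c n)"
  shows "complex_of_real (trig N c \<theta>) = (\<Sum>n\<in>{- int N..int N}. c n * cis (of_int n * \<theta>))"
proof -
  let ?s = "\<Sum>n\<in>{- int N..int N}. c n * cis (of_int n * \<theta>)"
  have "cnj ?s = (\<Sum>n\<in>{- int N..int N}. c (- n) * cis (of_int (- n) * \<theta>))"
    by (simp add: assms cis_cnj)
  also have "\<dots> = ?s"
    by (rule sum.reindex_bij_witness[where i=uminus and j=uminus]) auto
  finally have "Im ?s = 0"
    by (metis Reals_cnj_iff complex_is_Real_iff)
  then show ?thesis
    unfolding trig_def by (intro complex_eqI) simp_all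
qed

lemma fourier_trig:
  assumes "\<And>n. c (- n) = cnj (c n)"
  shows "fourier (trig N c) m = (if \<bar>m\<bar> \<le> int N then c m else 0)"
proof -
  have "complex_of_real (trig N c \<theta>) * cis (- (of_int m * \<theta>)) =
      (\<Sum>n\<in>{- int N..int N}. c n * cis (of_int (n - m) * \<theta>))" for \<theta>
    unfolding of_real_trig[of c, OF assms] sum_distrib_right mult.assoc cis_mult by (simp add: ring_distribs)
  then have "(LINT \<theta>|circle. complex_of_real (trig N c \<theta>) * cis (- (of_int m * \<theta>))) =
      (LINT \<theta>|circle. (\<Sum>n\<in>{- int N..int N}. c n * cis (of_int (n - m) * \<theta>)))"
    by simp
  also have "\<dots> = (\<Sum>n\<in>{- int N..int N}. LINT \<theta>|circle. c n * cis (of_int (n - m) * \<theta>))"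
    by (intro Bochner_Integration.integral_sum integrable_mult_right continuous_imp_integrable_real continuous_intros)
  also have "\<dots> = (\<Sum>n\<in>{- int N..int N}. if n = m then c m * (2 * pi) else 0)"
    by (intro sum.cong refl) (simp add: integral_cis_circle del: of_int_diff)
  finally show ?thesis
    by (auto simp: fourier_def sum.delta')
qed

lemma integral_mult_trig:
  assumes "integrable circle f"
  shows "(LINT \<theta>|circle. f \<theta> * trig N c \<theta>) =
    2 * pi * (\<Sum>n\<in>{- int N..int N}. Re (cnj (fourier f n) * c n))"
proof -
  have i: "integrable circle (\<lambda>\<theta>. complex_of_real (f \<theta>) * cis (of_int n * \<theta>))" for n
    using assms by (rule integrable_mult_cis)
  have "(LINT \<theta>|circle. complex_of_real (f \<theta>) * cis (of_int n * \<theta>)) = 2 * pi * cnj (fourier f n)" for n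
    using fourier_uminus_index[of f n] by (simp add: fourier_def field_simps)
  then have "(LINT \<theta>|circle. complex_of_real (f \<theta>) * cis (of_int n * \<theta>) * c n) = 2 * pi * (cnj (fourier f n) * c n)" for n
    by simp
  then have eq: "(LINT \<theta>|circle. (\<Sum>n\<in>{- int N..int N}. complex_of_real (f \<theta>) * cis (of_int n * \<theta>) * c n)) =
      2 * pi * (\<Sum>n\<in>{- int N..int N}. cnj (fourier f n) * c n)"
    by (simp only: Bochner_Integration.integral_sum[OF integrable_mult_left[OF i]] sum_distrib_left)
  have "(LINT \<theta>|circle. f \<theta> * trig N c \<theta>) =
      (LINT \<theta>|circle. Re (\<Sum>n\<in>{- int N..int N}. complex_of_real (f \<theta>) * cis (of_int n * \<theta>) * c n))"
    by (intro Bochner_Integration.integral_cong refl) (simp add: trig_def sum_distrib_left algebra_simps)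
  also have "\<dots> = Re (LINT \<theta>|circle. (\<Sum>n\<in>{- int N..int N}. complex_of_real (f \<theta>) * cis (of_int n * \<theta>) * c n))"
    by (intro integral_Re Bochner_Integration.integrable_sum integrable_mult_left i)
  also have "\<dots> = 2 * pi * Re (\<Sum>n\<in>{- int N..int N}. cnj (fourier f n) * c n)"
    unfolding eq by simp
  finally show ?thesis
    by (simp only: Re_sum)
qed

section \<open>Completeness of the trigonometric system\<close>

lemma fourier_0: "fourier f 0 = of_real ((LINT \<theta>|circle. f \<theta>) / (2 * pi))"
  by (simp add: fourier_def)

lemma fourier_mult_cos:
  assumes "integrable circle F"
  shows "fourier (\<lambda>\<theta>. F \<theta> * cos \<theta>) n = (fourier F (n - 1) + fourier F (n + 1)) / 2"
proof -
  have i: "integrable circle (\<lambda>\<theta>. complex_of_real (F \<theta>) * cis (- (of_int k * \<theta>)))" for k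
    using integrable_mult_cis[OF assms, of "- of_int k"] by simp
  have "complex_of_real (F \<theta> * cos \<theta>) * cis (- (of_int n * \<theta>)) =
      (complex_of_real (F \<theta>) * cis (- (of_int (n - 1) * \<theta>)) +
       complex_of_real (F \<theta>) * cis (- (of_int (n + 1) * \<theta>))) / 2" for \<theta>
    by (simp add: complex_eq_iff cos_add sin_add cos_diff sin_diff field_simps)
  then show ?thesis
    unfolding fourier_def by (simp only: integral_divide_zero Bochner_Integration.integral_add[OF i i])
      (simp add: add_divide_distrib)
qed

lemma fourier_mult_sin:
  assumes "integrable circle F"
  shows "fourier (\<lambda>\<theta>. F \<theta> * sin \<theta>) n = - \<i> / 2 * (fourier F (n - 1) - fourier F (n + 1))"
proof -
  have i: "integrable circle (\<lambda>\<theta>. complex_of_real (F \<theta>) * cis (- (of_int k * \<theta>)))" for k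
    using integrable_mult_cis[OF assms, of "- of_int k"] by simp
  have "complex_of_real (F \<theta> * sin \<theta>) * cis (- (of_int n * \<theta>)) =
      - \<i> / 2 * (complex_of_real (F \<theta>) * cis (- (of_int (n - 1) * \<theta>)) -
       complex_of_real (F \<theta>) * cis (- (of_int (n + 1) * \<theta>)))" for \<theta>
    by (simp add: complex_eq_iff cos_add sin_add cos_diff sin_diff field_simps)
  then show ?thesis
    unfolding fourier_def by (simp only: integral_mult_right_zero Bochner_Integration.integral_diff[OF i i])
      (simp add: diff_divide_distrib right_diff_distrib)
qed

text \<open>Multiplication by cos or sin only shifts and combines coefficients, so functions with
  vanishing coefficients are closed under it, and hence under multiplication by any polynomial in
  the point \<open>cis \<theta>\<close>. \<open>F\<close> is generalized in the induction because,
  for a product, \<open>F\<close> times the first factor takes the place of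
  \<open>F\<close>.\<close>

lemma fourier_zero_mult_polynomial:
  fixes p :: "complex \<Rightarrow> real"
  assumes "real_polynomial_function p" "integrable circle F" "\<And>n. fourier F n = 0"
  shows "integrable circle (\<lambda>\<theta>. F \<theta> * p (cis \<theta>)) \<and> (\<forall>n. fourier (\<lambda>\<theta>. F \<theta> * p (cis \<theta>)) n = 0)"
  using assms
proof (induction p arbitrary: F rule: real_polynomial_function.induct)
  case (linear h)
  have h: "h (cis \<theta>) = cos \<theta> * h 1 + sin \<theta> * h \<i>" for \<theta>
  proof -
    have "cis \<theta> = cos \<theta> *\<^sub>R 1 + sin \<theta> *\<^sub>R \<i>"
      by (simp add: complex_eq_iff)
    then show ?thesis
      using linear(1) by (simp add: bounded_linear.linear linear_add linear_scale)
  qed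
  have i: "integrable circle (\<lambda>\<theta>. F \<theta> * cos \<theta>)" "integrable circle (\<lambda>\<theta>. F \<theta> * sin \<theta>)"
    using integrable_bounded_mult[OF linear(2), of cos 1] integrable_bounded_mult[OF linear(2), of sin 1]
      borel_measurable_circle_continuous[of cos] borel_measurable_circle_continuous[of sin]
    by (simp_all add: mult.commute[of "F _"] continuous_on_cos continuous_on_sin continuous_on_id)
  have eq: "(\<lambda>\<theta>. F \<theta> * h (cis \<theta>)) = (\<lambda>\<theta>. h 1 * (F \<theta> * cos \<theta>) + h \<i> * (F \<theta> * sin \<theta>))"
    by (simp add: h algebra_simps)
  show ?case
    unfolding eq using i linear
    by (simp add: fourier_add fourier_cmult fourier_mult_cos fourier_mult_sin)
next
  case (const c)
  then show ?case
    using fourier_cmult[of c F] by (simp add: mult.commute)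
next
  case (add f g)
  then show ?case
    by (simp add: ring_distribs fourier_add)
next
  case (mult f g)
  then show ?case
    using mult.IH(2)[of "\<lambda>\<theta>. F \<theta> * f (cis \<theta>)"] by (simp add: mult.assoc)
qed

text \<open>On a closed period \<open>cis\<close> glues only the two endpoints, so an interior point
  is determined by its image. This is why the compact sets below avoid the endpoints.\<close>

lemma cis_eq_interior:
  assumes "cis a = cis b" "a \<in> {0..2 * pi}" "b \<in> {0<..<2 * pi}"
  shows "a = b"
proof -
  obtain n :: int where n: "a = b + 2 * pi * n"
    using assms(1) sin_cos_eq_iff[of a b] by (auto simp: complex_eq_iff)
  then have "- (2 * pi) < 2 * pi * n" "2 * pi * n < 2 * pi"
    using assms(2,3) unfolding atLeastAtMost_iff greaterThanLessThan_iff by linarith+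
  then have "2 * pi * (- 1) < 2 * pi * n" "2 * pi * n < 2 * pi * 1"
    by simp_all
  then have "- 1 < real_of_int n" "real_of_int n < 1"
    using mult_less_cancel_left_pos[of "2 * pi" "- 1" "real_of_int n"]
      mult_less_cancel_left_pos[of "2 * pi" "real_of_int n" 1] pi_gt_zero by simp_all
  then show ?thesis
    using n by auto
qed

text \<open>The indicator of \<open>K\<close> is a pointwise limit of continuous functions on the
  unit circle, and by Stone-Weierstrass those are uniform limits of polynomials, against which
  \<open>F\<close> integrates to zero.\<close>

lemma fourier_zero_integral_compact:
  assumes F: "integrable circle F" and z: "\<And>n. fourier F n = 0"
    and K: "compact K" "K \<subseteq> {0<..<2 * pi}"
  shows "(LINT \<theta>|circle. F \<theta> * indicator K \<theta>) = 0"
proof (cases "K = {}")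
  case False
  define C where "C = cis ` K"
  have C: "closed C" "C \<noteq> {}"
    using K False unfolding C_def
    by (auto intro!: compact_imp_closed compact_continuous_image continuous_intros)
  \<comment> \<open>Tent functions around \<open>C\<close>: equal to 1 on \<open>C\<close>, and 0 at
    distance at least \<open>1 / k\<close> from it.\<close>
  define G where "G k z = max 0 (1 - real k * infdist z C)" for k and z :: complex
  have cG: "continuous_on UNIV (G k)" for k
    unfolding G_def by (intro continuous_intros)
  have Gb: "\<bar>G k z\<bar> \<le> 1" for k z
    unfolding G_def using infdist_nonneg[of z C] by auto
  have mG: "(\<lambda>\<theta>. G k (cis \<theta>)) \<in> borel_measurable circle" for k
    by (intro borel_measurable_circle_continuous continuous_on_compose2[OF cG] continuous_intros) auto
  have iG: "integrable circle (\<lambda>\<theta>. F \<theta> * G k (cis \<theta>))" for k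
    using integrable_bounded_mult[OF F mG[of k], of 1] Gb by (simp add: mult.commute)
  have zero: "(LINT \<theta>|circle. F \<theta> * G k (cis \<theta>)) = 0" for k
  proof (rule ccontr)
    define I where "I = (LINT \<theta>|circle. F \<theta> * G k (cis \<theta>))"
    define J where "J = (LINT \<theta>|circle. \<bar>F \<theta>\<bar>)"
    assume "(LINT \<theta>|circle. F \<theta> * G k (cis \<theta>)) \<noteq> 0"
    then have I: "\<bar>I\<bar> > 0"
      by (simp add: I_def)
    have J: "J \<ge> 0"
      unfolding J_def by simp
    \<comment> \<open>With this accuracy a nonzero \<open>I\<close> would satisfy
      \<open>\<bar>I\<bar> \<le> J * (\<bar>I\<bar> / (J + 1)) < \<bar>I\<bar>\<close>. The added 1
      covers \<open>J = 0\<close>.\<close>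
    have e: "\<bar>I\<bar> / (J + 1) > 0"
      using I J by simp
    obtain p where p: "real_polynomial_function p" "\<And>x. x \<in> sphere 0 1 \<Longrightarrow> \<bar>G k x - p x\<bar> < \<bar>I\<bar> / (J + 1)"
      using Stone_Weierstrass_real_polynomial_function[OF compact_sphere _ e, of 0 1 "G k"] cG
        continuous_on_subset by blast
    have ip: "integrable circle (\<lambda>\<theta>. F \<theta> * p (cis \<theta>))" "fourier (\<lambda>\<theta>. F \<theta> * p (cis \<theta>)) 0 = 0"
      using fourier_zero_mult_polynomial[OF p(1) F z] by auto
    have "I = I - (LINT \<theta>|circle. F \<theta> * p (cis \<theta>))"
      using ip(2) by (simp add: fourier_0)
    also have "\<dots> = (LINT \<theta>|circle. F \<theta> * (G k (cis \<theta>) - p (cis \<theta>)))"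
      unfolding I_def by (simp add: ring_distribs iG ip(1))
    also have "\<bar>\<dots>\<bar> \<le> (LINT \<theta>|circle. \<bar>F \<theta>\<bar> * (\<bar>I\<bar> / (J + 1)))"
    proof (rule order_trans[OF integral_abs_bound integral_mono])
      show "integrable circle (\<lambda>\<theta>. \<bar>F \<theta> * (G k (cis \<theta>) - p (cis \<theta>))\<bar>)"
        by (simp add: ring_distribs iG ip(1))
      show "\<bar>F \<theta> * (G k (cis \<theta>) - p (cis \<theta>))\<bar> \<le> \<bar>F \<theta>\<bar> * (\<bar>I\<bar> / (J + 1))" for \<theta>
        unfolding abs_mult using p(2)[of "cis \<theta>"] by (intro mult_left_mono) auto
    qed (use F in auto)
    also have "\<dots> = J * (\<bar>I\<bar> / (J + 1))"
      by (simp add: J_def)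
    finally show False
      using I J by (simp add: field_simps)
  qed
  have "(\<lambda>k. LINT \<theta>|circle. F \<theta> * G k (cis \<theta>)) \<longlonglongrightarrow> (LINT \<theta>|circle. F \<theta> * indicator K \<theta>)"
  proof (rule integral_dominated_convergence)
    show "(\<lambda>\<theta>. F \<theta> * indicator K \<theta>) \<in> borel_measurable circle"
    proof -
      have "K \<in> sets lebesgue"
        using K(1) by (simp add: borel_compact)
      then have "(indicator K :: real \<Rightarrow> real) \<in> borel_measurable circle"
        by (intro measurable_restrict_space1 borel_measurable_indicator)
      then show ?thesis
        using borel_measurable_integrable[OF F] by (intro borel_measurable_times)
    qed
    show "AE \<theta> in circle. (\<lambda>k. F \<theta> * G k (cis \<theta>)) \<longlonglongrightarrow> F \<theta> * indicator K \<theta>"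
    proof (rule AE_I2)
      fix \<theta> assume "\<theta> \<in> space circle"
      then have \<theta>: "\<theta> \<in> {0..2 * pi}"
        by simp
      show "(\<lambda>k. F \<theta> * G k (cis \<theta>)) \<longlonglongrightarrow> F \<theta> * indicator K \<theta>"
      proof (cases "\<theta> \<in> K")
        case True
        then have "G k (cis \<theta>) = 1" for k
          by (simp add: G_def C_def)
        then show ?thesis
          using True by simp
      next
        case False
        then have "cis \<theta> \<notin> C"
          using cis_eq_interior[OF _ \<theta>] K(2) unfolding C_def by blast
        then have d: "infdist (cis \<theta>) C > 0"
          using C in_closed_iff_infdist_zero infdist_nonneg by (metis less_eq_real_def)
        then obtain k0 :: nat where "1 / infdist (cis \<theta>) C < k0"
          using reals_Archimedean2 by blast
        then have "G k (cis \<theta>) = 0" if "k \<ge> k0" for k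
        proof -
          have "1 / infdist (cis \<theta>) C \<le> k"
            using that \<open>1 / infdist (cis \<theta>) C < k0\<close> by linarith
          then show ?thesis
            using d by (simp add: G_def field_simps)
        qed
        then have "eventually (\<lambda>k. F \<theta> * G k (cis \<theta>) = 0) sequentially"
          by (auto simp: eventually_sequentially)
        then show ?thesis
          using False by (simp add: tendsto_eventually)
      qed
    qed
    show "integrable circle (\<lambda>\<theta>. \<bar>F \<theta>\<bar>)"
      using F by simp
    show "AE \<theta> in circle. norm (F \<theta> * G k (cis \<theta>)) \<le> \<bar>F \<theta>\<bar>" for k
      using Gb by (simp add: abs_mult mult_left_le)
  qed (use iG in auto)
  then show ?thesis
    by (simp add: zero LIMSEQ_const_iff)
qed simp

text \<open>If \<open>F\<close> were positive on a set of positive measure, inner regularity would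
  give a closed subset that is not null, on which \<open>F\<close> is positive although its integral
  vanishes.\<close>

lemma fourier_zero_AE_nonpos:
  assumes F: "integrable circle F" and z: "\<And>n. fourier F n = 0"
  shows "AE \<theta> in circle. F \<theta> \<le> 0"
proof -
  define E where "E = {\<theta> \<in> {0..2 * pi}. F \<theta> > 0} \<inter> {0<..<2 * pi}"
  have "{\<theta> \<in> space circle. F \<theta> > 0} \<in> sets circle"
    using borel_measurable_integrable[OF F] by measurable
  then have "{\<theta> \<in> {0..2 * pi}. F \<theta> > 0} \<in> sets lebesgue"
    by (simp add: sets_restrict_space_iff)
  then have E: "E \<in> sets lebesgue"
    unfolding E_def by (intro sets.Int) auto
  have "emeasure lebesgue E = 0"
  proof (rule ccontr)
    assume pos: "emeasure lebesgue E \<noteq> 0"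
    have "emeasure lebesgue E \<le> emeasure lebesgue {0..2 * pi}"
      by (rule emeasure_mono) (auto simp: E_def)
    then have fin: "emeasure lebesgue E < \<infinity>"
      using le_less_trans by fastforce
    define m where "m = enn2real (emeasure lebesgue E)"
    have m: "m > 0" "emeasure lebesgue E = ennreal m"
      using pos fin by (auto simp: m_def enn2real_positive_iff zero_less_iff_neq_zero)
    \<comment> \<open>The defect is required to be smaller than the whole measure of
      \<open>E\<close>, so \<open>T\<close> cannot be null.\<close>
    obtain T where T: "closed T" "T \<subseteq> E" "E - T \<in> lmeasurable" "emeasure lebesgue (E - T) < ennreal m"
      using sets_lebesgue_inner_closed[OF E m(1)] by metis
    have Tl: "T \<in> sets lebesgue"
      using T(1) by simp
    have "bounded T"
      using T(2) by (intro bounded_subset[OF bounded_closed_interval[of 0 "2 * pi"]]) (auto simp: E_def)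
    then have "compact T"
      using T(1) by (simp add: compact_eq_bounded_closed)
    then have "(LINT \<theta>|circle. F \<theta> * indicator T \<theta>) = 0"
      using T(2) by (intro fourier_zero_integral_compact[OF F z]) (auto simp: E_def)
    moreover have "integrable circle (\<lambda>\<theta>. F \<theta> * indicator T \<theta>)"
      using integrable_bounded_mult[OF F measurable_restrict_space1[OF borel_measurable_indicator[OF Tl]], of 1]
      by (simp add: mult.commute indicator_le_1)
    moreover have "AE \<theta> in circle. 0 \<le> F \<theta> * indicator T \<theta>"
      using T(2) by (intro AE_I2) (auto simp: indicator_def E_def)
    ultimately have "AE \<theta> in circle. F \<theta> * indicator T \<theta> = 0"
      using integral_nonneg_eq_0_iff_AE by blast
    then have "AE \<theta> in circle. \<theta> \<notin> T"
      by (rule AE_mp) (use T(2) in \<open>auto intro!: AE_I2 simp: indicator_def E_def\<close>)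
    then have "AE \<theta> in lebesgue. \<theta> \<in> {0..2 * pi} \<longrightarrow> \<theta> \<notin> T"
      by (simp add: AE_restrict_space_iff)
    then have "AE \<theta> in lebesgue. \<theta> \<notin> T"
      by (rule AE_mp) (use T(2) in \<open>auto intro!: AE_I2 simp: E_def\<close>)
    then have "T \<in> null_sets lebesgue"
      using Tl by (simp add: AE_iff_null_sets)
    then have "emeasure lebesgue (E - T) = emeasure lebesgue E"
      by (rule emeasure_Diff_null_set) (rule E)
    then show False
      using T(4) m by simp
  qed
  then have "E \<in> null_sets lebesgue"
    using E by auto
  moreover have "{0, 2 * pi} \<in> null_sets lebesgue"
    by (rule finite_imp_null_set_lborel[THEN null_sets_completionI]) auto
  ultimately have "AE \<theta> in lebesgue. \<theta> \<notin> E \<union> {0, 2 * pi}"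
    by (intro AE_not_in null_sets.Un)
  then have "AE \<theta> in lebesgue. \<theta> \<in> {0..2 * pi} \<longrightarrow> F \<theta> \<le> 0"
    by (rule AE_mp) (auto intro!: AE_I2 simp: E_def)
  then show ?thesis
    by (simp add: AE_restrict_space_iff)
qed

lemma fourier_zero_imp_AE_zero:
  assumes "integrable circle F" "\<And>n. fourier F n = 0"
  shows "AE \<theta> in circle. F \<theta> = 0"
proof -
  have "AE \<theta> in circle. F \<theta> \<le> 0"
    by (rule fourier_zero_AE_nonpos[OF assms])
  moreover have "AE \<theta> in circle. - F \<theta> \<le> 0"
    using assms fourier_cmult[of "-1" F] by (intro fourier_zero_AE_nonpos) auto
  ultimately show ?thesis
    by eventually_elim simp
qed

section \<open>Riesz-Fischer and Parseval\<close>

lemma symmetric_interval_cover: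
  fixes F :: "int set"
  assumes "finite F"
  obtains N where "\<And>M. M \<ge> N \<Longrightarrow> F \<subseteq> {- int M..int M}"
proof
  define N where "N = Max (insert 0 ((\<lambda>n. nat \<bar>n\<bar>) ` F))"
  fix M assume "M \<ge> N"
  show "F \<subseteq> {- int M..int M}"
  proof
    fix n assume "n \<in> F"
    then have "nat \<bar>n\<bar> \<le> N"
      using assms unfolding N_def by (intro Max_ge) auto
    then show "n \<in> {- int M..int M}"
      using \<open>M \<ge> N\<close> by auto
  qed
qed

lemma filterlim_symmetric_intervals:
  "filterlim (\<lambda>N. {- int N..int N}) (finite_subsets_at_top UNIV) sequentially"
  unfolding filterlim_finite_subsets_at_top
proof safe
  fix X :: "int set" assume X: "finite X"
  obtain N where "\<And>M. M \<ge> N \<Longrightarrow> X \<subseteq> {- int M..int M}"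
    using symmetric_interval_cover[OF X] by blast
  then show "eventually (\<lambda>M. finite {- int M..int M} \<and> X \<subseteq> {- int M..int M} \<and> {- int M..int M} \<subseteq> UNIV) sequentially"
    unfolding eventually_sequentially by (intro exI[of _ N]) simp
qed

text \<open>Unconditional sums over the integers are thereby reached along symmetric intervals, the
  index sets of \<open>trig\<close>.\<close>

lemma has_sum_tendsto_symmetric:
  assumes "(g has_sum S) UNIV"
  shows "(\<lambda>N. \<Sum>n\<in>{- int N..int N}. g n) \<longlonglongrightarrow> S"
  using assms filterlim_symmetric_intervals unfolding has_sum_def by (rule filterlim_compose)

lemma Re_cnj_mult_self: "Re (cnj z * z) = (cmod z)\<^sup>2"
  unfolding cmod_power2 by (simp add: power2_eq_square)

lemma integral_trig_power2:
  assumes "\<And>n. c (- n) = cnj (c n)"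
  shows "(LINT \<theta>|circle. (trig N c \<theta>)\<^sup>2) = 2 * pi * (\<Sum>n\<in>{- int N..int N}. (cmod (c n))\<^sup>2)"
proof -
  have "(LINT \<theta>|circle. trig N c \<theta> * trig N c \<theta>) =
      2 * pi * (\<Sum>n\<in>{- int N..int N}. Re (cnj (fourier (trig N c) n) * c n))"
    by (rule integral_mult_trig[OF L2_circleD(4)[OF trig_L2]])
  also have "\<dots> = 2 * pi * (\<Sum>n\<in>{- int N..int N}. (cmod (c n))\<^sup>2)"
    by (intro arg_cong[where f="(*) (2 * pi)"] sum.cong refl)
      (auto simp: fourier_trig[of c, OF assms] Re_cnj_mult_self simp del: times_complex.sel)
  finally show ?thesis
    by (simp add: power2_eq_square)
qed

lemma integral_power2_diff:
  fixes f g :: "real \<Rightarrow> real"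
  assumes "f \<in> L2_circle" "g \<in> L2_circle"
  shows "(LINT \<theta>|circle. (f \<theta> - g \<theta>)\<^sup>2) =
    (LINT \<theta>|circle. (f \<theta>)\<^sup>2) - 2 * (LINT \<theta>|circle. f \<theta> * g \<theta>) + (LINT \<theta>|circle. (g \<theta>)\<^sup>2)"
proof -
  have "(f \<theta> - g \<theta>)\<^sup>2 = (f \<theta>)\<^sup>2 - 2 * (f \<theta> * g \<theta>) + (g \<theta>)\<^sup>2" for \<theta>
    by (simp add: power2_diff)
  then show ?thesis
    using assms L2_circleD(3) L2_circle_integrable_mult by simp
qed

lemma Bessel:
  assumes f: "f \<in> L2_circle"
  shows "2 * pi * (\<Sum>n\<in>{- int N..int N}. (cmod (fourier f n))\<^sup>2) \<le> (LINT \<theta>|circle. (f \<theta>)\<^sup>2)"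
proof -
  have eq: "(\<Sum>n\<in>{- int N..int N}. Re (cnj (fourier f n) * fourier f n)) =
      (\<Sum>n\<in>{- int N..int N}. (cmod (fourier f n))\<^sup>2)"
    by (simp only: Re_cnj_mult_self)
  have "0 \<le> (LINT \<theta>|circle. (f \<theta> - trig N (fourier f) \<theta>)\<^sup>2)"
    by simp
  also have "\<dots> = (LINT \<theta>|circle. (f \<theta>)\<^sup>2) - 2 * pi * (\<Sum>n\<in>{- int N..int N}. (cmod (fourier f n))\<^sup>2)"
    unfolding integral_power2_diff[OF f trig_L2] integral_mult_trig[OF L2_circleD(4)[OF f]] eq
      integral_trig_power2[of "fourier f", OF fourier_uminus_index] by simp
  finally show ?thesis
    by simp
qed

lemma nonneg_summable_on_int:
  fixes g :: "int \<Rightarrow> real"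
  assumes "\<And>n. g n \<ge> 0" "\<And>N. (\<Sum>n\<in>{- int N..int N}. g n) \<le> B"
  shows "g summable_on UNIV" "infsum g UNIV \<le> B"
proof -
  have b: "sum g F \<le> B" if fin: "finite F" for F
  proof -
    obtain N where "F \<subseteq> {- int N..int N}"
      using symmetric_interval_cover[OF fin] by (metis order_refl)
    then show ?thesis
      using order_trans[OF sum_mono2[of "{- int N..int N}" F g] assms(2)] assms(1) by auto
  qed
  then show s: "g summable_on UNIV"
    using assms(1) by (intro nonneg_bdd_above_summable_on bdd_aboveI[where M=B]) auto
  then show "infsum g UNIV \<le> B"
    using b by (intro infsum_le_finite_sums) auto
qed

lemma Bessel_summable:
  assumes "f \<in> L2_circle"
  shows "(\<lambda>n. (cmod (fourier f n))\<^sup>2) summable_on UNIV"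
  using Bessel[OF assms] by (intro nonneg_summable_on_int[where B="(LINT \<theta>|circle. (f \<theta>)\<^sup>2) / (2 * pi)"])
    (auto simp: field_simps)

lemma norm_fourier_le:
  assumes "f \<in> L2_circle"
  shows "2 * pi * (cmod (fourier f n))\<^sup>2 \<le> (LINT \<theta>|circle. (f \<theta>)\<^sup>2)"
proof -
  have "(cmod (fourier f n))\<^sup>2 \<le> (\<Sum>k\<in>{- int (nat \<bar>n\<bar>)..int (nat \<bar>n\<bar>)}. (cmod (fourier f k))\<^sup>2)"
    by (rule member_le_sum) auto
  then have "2 * pi * (cmod (fourier f n))\<^sup>2 \<le>
      2 * pi * (\<Sum>k\<in>{- int (nat \<bar>n\<bar>)..int (nat \<bar>n\<bar>)}. (cmod (fourier f k))\<^sup>2)"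
    by (rule mult_left_mono) simp
  also have "\<dots> \<le> (LINT \<theta>|circle. (f \<theta>)\<^sup>2)"
    by (rule Bessel[OF assms])
  finally show ?thesis .
qed

lemma integral_trig_diff_power2:
  assumes c: "\<And>n. c (- n) = cnj (c n)" and "N \<le> M"
  shows "(LINT \<theta>|circle. (trig M c \<theta> - trig N c \<theta>)\<^sup>2) =
    2 * pi * ((\<Sum>n\<in>{- int M..int M}. (cmod (c n))\<^sup>2) - (\<Sum>n\<in>{- int N..int N}. (cmod (c n))\<^sup>2))"
proof -
  have "(LINT \<theta>|circle. trig M c \<theta> * trig N c \<theta>) =
      2 * pi * (\<Sum>n\<in>{- int N..int N}. Re (cnj (fourier (trig M c) n) * c n))"
    by (rule integral_mult_trig[OF L2_circleD(4)[OF trig_L2]])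
  also have "\<dots> = 2 * pi * (\<Sum>n\<in>{- int N..int N}. (cmod (c n))\<^sup>2)"
    using assms(2) by (intro arg_cong[where f="(*) (2 * pi)"] sum.cong refl)
      (auto simp: fourier_trig[of c, OF c] Re_cnj_mult_self simp del: times_complex.sel)
  finally show ?thesis
    unfolding integral_power2_diff[OF trig_L2 trig_L2] integral_trig_power2[of c, OF c]
    by (simp add: algebra_simps)
qed

text \<open>Young's inequality with a free parameter: small L^2 distance gives small L^1 distance
  once \<open>d\<close> is chosen suitably.\<close>

lemma integral_abs_le_power2:
  assumes g: "g \<in> L2_circle" and "d > 0"
  shows "(LINT \<theta>|circle. \<bar>g \<theta>\<bar>) \<le> 2 * pi * d + (LINT \<theta>|circle. (g \<theta>)\<^sup>2) / d"
proof -
  have "\<bar>x\<bar> \<le> d + x\<^sup>2 / d" for x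
  proof -
    have "\<bar>x\<bar> * d \<le> d * d + \<bar>x\<bar> * \<bar>x\<bar>"
      using sum_squares_bound[of "\<bar>x\<bar>" d] abs_ge_zero[of "x"] \<open>d > 0\<close> mult_nonneg_nonneg[of "\<bar>x\<bar>" d]
      unfolding power2_eq_square by linarith
    then show ?thesis
      using \<open>d > 0\<close> by (simp add: field_simps power2_eq_square)
  qed
  then have "(LINT \<theta>|circle. \<bar>g \<theta>\<bar>) \<le> (LINT \<theta>|circle. d + (g \<theta>)\<^sup>2 / d)"
    using L2_circleD[OF g] L2_circleD(4)[OF L2_circle_const[of d]]
    by (intro integral_mono) auto
  also have "\<dots> = 2 * pi * d + (LINT \<theta>|circle. (g \<theta>)\<^sup>2) / d"
    using L2_circleD[OF g] L2_circleD(4)[OF L2_circle_const[of d]]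
    by (simp add: measure_restrict_space)
  finally show ?thesis .
qed

text \<open>Fatou's lemma. It provides both membership in L^2 and the bound, without any
  domination.\<close>

lemma L2_bound_of_tendsto:
  fixes s :: "nat \<Rightarrow> real \<Rightarrow> real" and f :: "real \<Rightarrow> real"
  assumes s: "\<And>k. s k \<in> L2_circle" "\<And>k. (LINT \<theta>|circle. (s k \<theta>)\<^sup>2) \<le> B"
    and f: "f \<in> borel_measurable circle" "\<And>\<theta>. f (\<theta> + 2 * pi) = f \<theta>"
      "AE \<theta> in circle. (\<lambda>k. s k \<theta>) \<longlonglongrightarrow> f \<theta>"
  shows "f \<in> L2_circle" "(LINT \<theta>|circle. (f \<theta>)\<^sup>2) \<le> B"
proof -
  have B: "B \<ge> 0"
    using order_trans[OF Bochner_Integration.integral_nonneg s(2)[of 0]] by simp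
  have "(\<integral>\<^sup>+\<theta>. ennreal ((f \<theta>)\<^sup>2) \<partial>circle) = (\<integral>\<^sup>+\<theta>. liminf (\<lambda>k. ennreal ((s k \<theta>)\<^sup>2)) \<partial>circle)"
  proof (rule nn_integral_cong_AE, use f(3) in eventually_elim)
    fix \<theta> assume "(\<lambda>k. s k \<theta>) \<longlonglongrightarrow> f \<theta>"
    then have "(\<lambda>k. ennreal ((s k \<theta>)\<^sup>2)) \<longlonglongrightarrow> ennreal ((f \<theta>)\<^sup>2)"
      by (intro tendsto_ennrealI tendsto_power)
    then show "ennreal ((f \<theta>)\<^sup>2) = liminf (\<lambda>k. ennreal ((s k \<theta>)\<^sup>2))"
      by (metis lim_imp_Liminf trivial_limit_sequentially)
  qed
  also have "\<dots> \<le> liminf (\<lambda>k. \<integral>\<^sup>+\<theta>. ennreal ((s k \<theta>)\<^sup>2) \<partial>circle)"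
    using s(1) L2_circleD(3) by (intro nn_integral_liminf) (auto intro: borel_measurable_integrable)
  also have "\<dots> = liminf (\<lambda>k. ennreal (LINT \<theta>|circle. (s k \<theta>)\<^sup>2))"
    using s(1) L2_circleD(3) by (subst nn_integral_eq_integral) auto
  also have "\<dots> \<le> liminf (\<lambda>k::nat. ennreal B)"
    using s(2) by (intro Liminf_mono always_eventually allI ennreal_leI)
  finally have le: "(\<integral>\<^sup>+\<theta>. ennreal ((f \<theta>)\<^sup>2) \<partial>circle) \<le> ennreal B"
    by (simp add: Liminf_const)
  then have i: "integrable circle (\<lambda>\<theta>. (f \<theta>)\<^sup>2)"
    using f(1) by (intro integrableI_bounded) (auto intro: le_less_trans)
  then show "f \<in> L2_circle"
    using f by (simp add: L2_circle_real_iff)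
  show "(LINT \<theta>|circle. (f \<theta>)\<^sup>2) \<le> B"
    using le B by (simp add: nn_integral_eq_integral[OF i])
qed

text \<open>The partial sums are Cauchy in L^2, hence in L^1, and an L^1 Cauchy sequence has a
  subsequence converging almost everywhere. Fatou puts the limit in L^2 and bounds its distance to
  each partial sum; as a coefficient is controlled by the L^2 norm, the coefficients of the limit
  follow.\<close>

lemma Riesz_Fischer:
  assumes c: "\<And>n. c (- n) = cnj (c n)" and sm: "(\<lambda>n. (cmod (c n))\<^sup>2) summable_on UNIV"
  obtains f where "f \<in> L2_circle" "\<And>n. fourier f n = c n"
    "(LINT \<theta>|circle. (f \<theta>)\<^sup>2) \<le> 2 * pi * (\<Sum>\<^sub>\<infinity>n. (cmod (c n))\<^sup>2)"
proof -
  define A where "A N = (\<Sum>n\<in>{- int N..int N}. (cmod (c n))\<^sup>2)" for N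
  define S where "S = (\<Sum>\<^sub>\<infinity>n. (cmod (c n))\<^sup>2)"
  define s where "s N = trig N c" for N
  have AS: "A N \<le> S" for N
    unfolding A_def S_def using sm by (intro finite_sum_le_infsum) auto
  have Amono: "A N \<le> A M" if "N \<le> M" for N M
    unfolding A_def using that by (intro sum_mono2) auto
  have Alim: "A \<longlonglongrightarrow> S"
    unfolding A_def S_def by (rule has_sum_tendsto_symmetric) (rule has_sum_infsum[OF sm])
  have sL2: "s N \<in> L2_circle" for N
    unfolding s_def by (rule trig_L2)
  have diff: "(LINT \<theta>|circle. (s i \<theta> - s j \<theta>)\<^sup>2) \<le> 2 * pi * (S - A N)" if "i \<ge> N" "j \<ge> N" for i j N
  proof -
    have *: "(LINT \<theta>|circle. (s j \<theta> - s i \<theta>)\<^sup>2) \<le> 2 * pi * (S - A N)" if "i \<le> j" "i \<ge> N" for i j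
      unfolding s_def integral_trig_diff_power2[of c, OF c that(1)]
      using AS[of j] Amono[OF that(2)] unfolding A_def by (intro mult_left_mono) auto
    show ?thesis
    proof (cases "j \<le> i")
      case False
      have "(s i \<theta> - s j \<theta>)\<^sup>2 = (s j \<theta> - s i \<theta>)\<^sup>2" for \<theta>
        by (rule power2_commute)
      then show ?thesis
        using *[of i j] False that by simp
    qed (rule *[OF _ that(2)])
  qed
  have "\<exists>N. \<forall>i\<ge>N. \<forall>j\<ge>N. (LINT \<theta>|circle. norm (s i \<theta> - s j \<theta>)) < e" if "e > 0" for e
  proof -
    \<comment> \<open>The L^1 distance will be bounded by
      \<open>2 * pi * d + 2 * pi * d\<^sup>2 / d = 4 * pi * d\<close>, which has to stay below
      \<open>e\<close>.\<close>
    define d where "d = e / (4 * pi + 1)"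
    have pos: "4 * pi + 1 > 0"
      using pi_gt_zero by linarith
    have d: "d > 0"
      unfolding d_def using \<open>e > 0\<close> pos by (rule divide_pos_pos)
    have "(4 * pi + 1) * d = e"
      unfolding d_def using pos by simp
    then have d2: "4 * (pi * d) < e"
      using d by (simp add: ring_distribs)
    obtain N where "\<bar>A N - S\<bar> < d\<^sup>2"
      using Alim d unfolding LIMSEQ_iff by (metis order_refl real_norm_def zero_less_power)
    then have N: "S - A N < d\<^sup>2"
      by auto
    have "(LINT \<theta>|circle. norm (s i \<theta> - s j \<theta>)) < e" if "i \<ge> N" "j \<ge> N" for i j
    proof -
      have "(LINT \<theta>|circle. norm (s i \<theta> - s j \<theta>)) \<le> 2 * pi * d + (LINT \<theta>|circle. (s i \<theta> - s j \<theta>)\<^sup>2) / d"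
        using integral_abs_le_power2[OF L2_circle_diff[OF sL2 sL2] d, of i j] by simp
      also have "\<dots> \<le> 2 * pi * d + 2 * pi * d\<^sup>2 / d"
      proof -
        have "2 * pi * (S - A N) \<le> 2 * pi * d\<^sup>2"
          using N by (intro mult_left_mono) auto
        then show ?thesis
          using order_trans[OF diff[OF that]] d by (intro add_left_mono divide_right_mono) auto
      qed
      also have "\<dots> < e"
        using d d2 by (simp add: power2_eq_square)
      finally show ?thesis .
    qed
    then show ?thesis
      by blast
  qed
  then obtain r where r: "strict_mono r" "AE \<theta> in circle. Cauchy (\<lambda>i. s (r i) \<theta>)"
    by (rule cauchy_L1_AE_cauchy_subseq[OF L2_circleD(4)[OF sL2]])
  \<comment> \<open>The limit operator is applied at every angle, also where the sequence diverges:
    the sequences at \<open>\<theta>\<close> and \<open>\<theta> + 2 * pi\<close> are identical, so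
    \<open>f\<close> is periodic everywhere.\<close>
  define f where "f \<theta> = lim (\<lambda>i. s (r i) \<theta>)" for \<theta>
  have f: "f \<in> borel_measurable circle" "\<And>\<theta>. f (\<theta> + 2 * pi) = f \<theta>"
    "AE \<theta> in circle. (\<lambda>k. s (r k) \<theta>) \<longlonglongrightarrow> f \<theta>"
  proof -
    show "f \<in> borel_measurable circle"
      unfolding f_def by (rule borel_measurable_lim_metric) (rule L2_circleD(2)[OF sL2])
    show "f (\<theta> + 2 * pi) = f \<theta>" for \<theta>
      unfolding f_def s_def by (simp only: trig_periodic)
    show "AE \<theta> in circle. (\<lambda>k. s (r k) \<theta>) \<longlonglongrightarrow> f \<theta>"
      using r(2) unfolding f_def
      by eventually_elim (metis Cauchy_convergent convergent_LIMSEQ_iff)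
  qed
  have "(LINT \<theta>|circle. (s k \<theta>)\<^sup>2) \<le> 2 * pi * S" for k
    unfolding s_def integral_trig_power2[of c, OF c] A_def[symmetric] using AS by simp
  then have fL2: "f \<in> L2_circle" "(LINT \<theta>|circle. (f \<theta>)\<^sup>2) \<le> 2 * pi * S"
    using L2_bound_of_tendsto[OF sL2 _ f] by blast+
  \<comment> \<open>Fatou once more, along the subsequence started at \<open>k + N\<close> so that
    all its indices are at least \<open>N\<close>.\<close>
  have close: "(LINT \<theta>|circle. (f \<theta> - s N \<theta>)\<^sup>2) \<le> 2 * pi * (S - A N)" for N
  proof -
    have "(\<lambda>\<theta>. f \<theta> - s N \<theta>) \<in> borel_measurable circle"
      using f(1) L2_circleD(2)[OF sL2] by (intro borel_measurable_diff)
    moreover have "AE \<theta> in circle. (\<lambda>k. s (r (k + N)) \<theta> - s N \<theta>) \<longlonglongrightarrow> f \<theta> - s N \<theta>"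
      using f(3)
    proof eventually_elim
      case (elim \<theta>)
      show ?case
        using LIMSEQ_ignore_initial_segment[OF elim, of N] by (intro tendsto_diff) auto
    qed
    moreover have "(LINT \<theta>|circle. (s (r (k + N)) \<theta> - s N \<theta>)\<^sup>2) \<le> 2 * pi * (S - A N)" for k
      using seq_suble[OF r(1), of "k + N"] by (intro diff) auto
    ultimately show ?thesis
      using L2_bound_of_tendsto(2)[of "\<lambda>k \<theta>. s (r (k + N)) \<theta> - s N \<theta>" _ "\<lambda>\<theta>. f \<theta> - s N \<theta>"]
        L2_circle_diff[OF sL2 sL2] f(2) L2_circleD(1)[OF sL2] by simp
  qed
  have "fourier f n = c n" for n
  proof -
    have "(\<lambda>N. 2 * pi * (S - A N)) \<longlonglongrightarrow> 2 * pi * (S - S)"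
      by (intro tendsto_intros Alim)
    moreover have "\<forall>\<^sub>F N in sequentially. 2 * pi * (cmod (fourier f n - c n))\<^sup>2 \<le> 2 * pi * (S - A N)"
    proof (rule eventually_sequentiallyI)
      fix N assume "N \<ge> nat \<bar>n\<bar>"
      then have "fourier (s N) n = c n"
        unfolding s_def by (subst fourier_trig[of c, OF c]) auto
      then have eq: "fourier (\<lambda>\<theta>. f \<theta> - s N \<theta>) n = fourier f n - c n"
        using fourier_diff[OF L2_circleD(4)[OF fL2(1)] L2_circleD(4)[OF sL2]] by simp
      then show "2 * pi * (cmod (fourier f n - c n))\<^sup>2 \<le> 2 * pi * (S - A N)"
        using norm_fourier_le[OF L2_circle_diff[OF fL2(1) sL2], of N n] close[of N]
        unfolding eq by linarith
    qed
    ultimately have "2 * pi * (cmod (fourier f n - c n))\<^sup>2 \<le> 2 * pi * (S - S)"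
      by (rule tendsto_lowerbound) simp
    then show ?thesis
      using pi_gt_zero by (auto simp: mult_le_0_iff)
  qed
  then show ?thesis
    using that fL2 unfolding S_def by blast
qed

lemma fourier_eq_imp_AE_eq:
  assumes "f \<in> L2_circle" "g \<in> L2_circle" "\<And>n. fourier f n = fourier g n"
  shows "AE \<theta> in circle. f \<theta> = g \<theta>"
proof -
  have "AE \<theta> in circle. f \<theta> - g \<theta> = 0"
    using assms fourier_diff[OF L2_circleD(4) L2_circleD(4), OF assms(1,2)]
    by (intro fourier_zero_imp_AE_zero L2_circleD(4) L2_circle_diff) auto
  then show ?thesis
    by eventually_elim simp
qed

text \<open>The function that Riesz-Fischer builds from the coefficients of \<open>f\<close> agrees
  with \<open>f\<close> almost everywhere by completeness, and it comes with the norm bound opposite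
  to Bessel's.\<close>

lemma Parseval:
  assumes f: "f \<in> L2_circle"
  shows "(LINT \<theta>|circle. (f \<theta>)\<^sup>2) = 2 * pi * (\<Sum>\<^sub>\<infinity>n. (cmod (fourier f n))\<^sup>2)"
proof (rule antisym)
  obtain g where g: "g \<in> L2_circle" "\<And>n. fourier g n = fourier f n"
    "(LINT \<theta>|circle. (g \<theta>)\<^sup>2) \<le> 2 * pi * (\<Sum>\<^sub>\<infinity>n. (cmod (fourier f n))\<^sup>2)"
    using Riesz_Fischer[of "fourier f"] fourier_uminus_index Bessel_summable[OF f] by metis
  have "AE \<theta> in circle. f \<theta> = g \<theta>"
    using fourier_eq_imp_AE_eq[OF f g(1)] g(2) by simp
  then have "(LINT \<theta>|circle. (f \<theta>)\<^sup>2) = (LINT \<theta>|circle. (g \<theta>)\<^sup>2)"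
    using L2_circleD(3)[OF f] L2_circleD(3)[OF g(1)]
    by (intro integral_cong_AE) (auto intro: borel_measurable_integrable)
  then show "(LINT \<theta>|circle. (f \<theta>)\<^sup>2) \<le> 2 * pi * (\<Sum>\<^sub>\<infinity>n. (cmod (fourier f n))\<^sup>2)"
    using g(3) by simp
  have "(\<Sum>\<^sub>\<infinity>n. (cmod (fourier f n))\<^sup>2) \<le> (LINT \<theta>|circle. (f \<theta>)\<^sup>2) / (2 * pi)"
    using Bessel[OF f] by (intro nonneg_summable_on_int) (auto simp: field_simps)
  then show "2 * pi * (\<Sum>\<^sub>\<infinity>n. (cmod (fourier f n))\<^sup>2) \<le> (LINT \<theta>|circle. (f \<theta>)\<^sup>2)"
    by (simp add: field_simps)
qed

section \<open>Fourier multiplier forms\<close>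

lemma infsum_Cauchy_Schwarz:
  fixes a b :: "'i \<Rightarrow> real"
  assumes a: "(\<lambda>i. (a i)\<^sup>2) summable_on I" and b: "(\<lambda>i. (b i)\<^sup>2) summable_on I"
  shows "(\<lambda>i. \<bar>a i\<bar> * \<bar>b i\<bar>) summable_on I"
    "(\<Sum>\<^sub>\<infinity>i\<in>I. \<bar>a i\<bar> * \<bar>b i\<bar>) \<le> sqrt (\<Sum>\<^sub>\<infinity>i\<in>I. (a i)\<^sup>2) * sqrt (\<Sum>\<^sub>\<infinity>i\<in>I. (b i)\<^sup>2)"
proof -
  have le: "(\<Sum>i\<in>F. \<bar>a i\<bar> * \<bar>b i\<bar>) \<le> sqrt (\<Sum>\<^sub>\<infinity>i\<in>I. (a i)\<^sup>2) * sqrt (\<Sum>\<^sub>\<infinity>i\<in>I. (b i)\<^sup>2)"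
    if "finite F" "F \<subseteq> I" for F
  proof -
    have "(\<Sum>i\<in>F. \<bar>a i\<bar> * \<bar>b i\<bar>) \<le> L2_set a F * L2_set b F"
      by (rule L2_set_mult_ineq)
    also have "\<dots> \<le> sqrt (\<Sum>\<^sub>\<infinity>i\<in>I. (a i)\<^sup>2) * sqrt (\<Sum>\<^sub>\<infinity>i\<in>I. (b i)\<^sup>2)"
      unfolding L2_set_def using that a b
      by (intro mult_mono real_sqrt_le_mono finite_sum_le_infsum)
        (auto intro!: real_sqrt_ge_zero infsum_nonneg sum_nonneg)
    finally show ?thesis .
  qed
  show "(\<lambda>i. \<bar>a i\<bar> * \<bar>b i\<bar>) summable_on I"
    using le by (intro nonneg_bdd_above_summable_on
        bdd_aboveI[where M="sqrt (\<Sum>\<^sub>\<infinity>i\<in>I. (a i)\<^sup>2) * sqrt (\<Sum>\<^sub>\<infinity>i\<in>I. (b i)\<^sup>2)"]) auto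
  then show "(\<Sum>\<^sub>\<infinity>i\<in>I. \<bar>a i\<bar> * \<bar>b i\<bar>) \<le> sqrt (\<Sum>\<^sub>\<infinity>i\<in>I. (a i)\<^sup>2) * sqrt (\<Sum>\<^sub>\<infinity>i\<in>I. (b i)\<^sup>2)"
    using le by (intro infsum_le_finite_sums) auto
qed

text \<open>Weight 1 gives L^2, the weight |n| gives H^(1/2) with its homogeneous seminorm, and
  \<open>wbessel\<close> the full norm. Square integrability is built in, so weights may vanish at
  some frequencies.\<close>

definition wdom :: "(int \<Rightarrow> real) \<Rightarrow> (real \<Rightarrow> real) set" where
  "wdom \<omega> = {f \<in> L2_circle. (\<lambda>n. \<omega> n * (cmod (fourier f n))\<^sup>2) summable_on UNIV}"

definition wsq :: "(int \<Rightarrow> real) \<Rightarrow> (real \<Rightarrow> real) \<Rightarrow> real" where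
  "wsq \<omega> f = (\<Sum>\<^sub>\<infinity>n. \<omega> n * (cmod (fourier f n))\<^sup>2)"

text \<open>The bilinear form \<open>\<integral> f (m(D) g)\<close>, with \<open>m(D)\<close> the
  operator of symbol \<open>m\<close>. It is meaningful on \<open>wdom \<omega>\<close> as soon as
  \<omega> dominates \<open>m\<close>, even if \<open>m(D) g\<close> is not a function.\<close>

definition mform :: "(int \<Rightarrow> complex) \<Rightarrow> (real \<Rightarrow> real) \<Rightarrow> (real \<Rightarrow> real) \<Rightarrow> real" where
  "mform m f g = 2 * pi * Re (\<Sum>\<^sub>\<infinity>n. m n * (cnj (fourier f n) * fourier g n))"

lemma wdom_L2: "f \<in> wdom \<omega> \<Longrightarrow> f \<in> L2_circle"
  by (simp add: wdom_def)

lemma wdom_integrable: "f \<in> wdom \<omega> \<Longrightarrow> integrable circle f"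
  by (simp add: wdom_def L2_circleD(4))

lemma wdom_1: "wdom (\<lambda>_. 1) = L2_circle"
  using Bessel_summable by (auto simp: wdom_def)

lemma wsq_1: "f \<in> L2_circle \<Longrightarrow> 2 * pi * wsq (\<lambda>_. 1) f = (LINT \<theta>|circle. (f \<theta>)\<^sup>2)"
  by (simp add: wsq_def Parseval)

lemma wdom_mono:
  assumes "f \<in> wdom \<omega>'" "\<And>n. 0 \<le> \<omega> n" "\<And>n. \<omega> n \<le> K * \<omega>' n"
  shows "f \<in> wdom \<omega>" "wsq \<omega> f \<le> K * wsq \<omega>' f"
proof -
  have s: "(\<lambda>n. K * (\<omega>' n * (cmod (fourier f n))\<^sup>2)) summable_on UNIV"
    using assms(1) by (intro summable_on_cmult_right) (simp add: wdom_def)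
  have le: "\<omega> n * (cmod (fourier f n))\<^sup>2 \<le> K * (\<omega>' n * (cmod (fourier f n))\<^sup>2)" for n
    using mult_right_mono[OF assms(3)[of n], of "(cmod (fourier f n))\<^sup>2"] by (simp add: mult.assoc)
  have s': "(\<lambda>n. \<omega> n * (cmod (fourier f n))\<^sup>2) summable_on UNIV"
    using assms(2) by (intro summable_on_comparison_test[OF s] le) auto
  then show "f \<in> wdom \<omega>"
    using assms(1) by (simp add: wdom_def)
  have "wsq \<omega> f \<le> (\<Sum>\<^sub>\<infinity>n. K * (\<omega>' n * (cmod (fourier f n))\<^sup>2))"
    unfolding wsq_def by (intro infsum_mono s s' le)
  also have "\<dots> = K * wsq \<omega>' f"
    unfolding wsq_def by (rule infsum_cmult_right')
  finally show "wsq \<omega> f \<le> K * wsq \<omega>' f" .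
qed

lemma wsq_cong: "(\<And>n. fourier f n = fourier g n) \<Longrightarrow> wsq \<omega> f = wsq \<omega> g"
  by (simp add: wsq_def)

lemma mform_cong:
  assumes "\<And>n. fourier f n = fourier f' n" "\<And>n. fourier g n = fourier g' n"
  shows "mform m f g = mform m f' g'"
  by (simp add: mform_def assms)

lemma mform_weight_cong:
  assumes "\<And>n. m n * (cnj (fourier f n) * fourier g n) = m' n * (cnj (fourier f' n) * fourier g' n)"
  shows "mform m f g = mform m' f' g'"
  by (simp add: mform_def assms)

lemma mform_commute:
  assumes "\<And>n. m n \<in> \<real>"
  shows "mform m f g = mform m g f"
proof -
  have "cnj (m n * (cnj (fourier f n) * fourier g n)) = m n * (cnj (fourier g n) * fourier f n)" for n
    using assms[of n] by (simp add: Reals_cnj_iff mult_ac)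
  then have "(\<Sum>\<^sub>\<infinity>n. m n * (cnj (fourier g n) * fourier f n)) = cnj (\<Sum>\<^sub>\<infinity>n. m n * (cnj (fourier f n) * fourier g n))"
    by (simp only: infsum_cnj[symmetric])
  then show ?thesis
    by (simp add: mform_def)
qed

context
  fixes \<omega> :: "int \<Rightarrow> real"
  assumes \<omega>_nonneg: "\<And>n. 0 \<le> \<omega> n"
begin

lemma wsq_nonneg: "0 \<le> wsq \<omega> f"
  unfolding wsq_def by (intro infsum_nonneg) (simp add: \<omega>_nonneg)

lemma wdom_add:
  assumes f: "f \<in> wdom \<omega>" and g: "g \<in> wdom \<omega>"
  shows "(\<lambda>\<theta>. f \<theta> + g \<theta>) \<in> wdom \<omega>" "wsq \<omega> (\<lambda>\<theta>. f \<theta> + g \<theta>) \<le> 2 * wsq \<omega> f + 2 * wsq \<omega> g"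
proof -
  let ?F = "\<lambda>n. \<omega> n * (cmod (fourier f n))\<^sup>2" and ?G = "\<lambda>n. \<omega> n * (cmod (fourier g n))\<^sup>2"
  have s: "(\<lambda>n. 2 * ?F n) summable_on UNIV" "(\<lambda>n. 2 * ?G n) summable_on UNIV"
    using assms by (auto simp: wdom_def intro!: summable_on_cmult_right)
  have le: "\<omega> n * (cmod (fourier (\<lambda>\<theta>. f \<theta> + g \<theta>) n))\<^sup>2 \<le> 2 * ?F n + 2 * ?G n" for n
  proof -
    have "(cmod (fourier (\<lambda>\<theta>. f \<theta> + g \<theta>) n))\<^sup>2 \<le> (cmod (fourier f n) + cmod (fourier g n))\<^sup>2"
      using assms by (intro power_mono) (simp_all add: fourier_add wdom_integrable norm_triangle_ineq)
    also have "\<dots> \<le> 2 * (cmod (fourier f n))\<^sup>2 + 2 * (cmod (fourier g n))\<^sup>2"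
      using sum_squares_bound[of "cmod (fourier f n)" "cmod (fourier g n)"] by (simp add: power2_sum)
    finally show ?thesis
      using mult_left_mono[OF _ \<omega>_nonneg[of n]] by (fastforce simp: ring_distribs)
  qed
  have s': "(\<lambda>n. \<omega> n * (cmod (fourier (\<lambda>\<theta>. f \<theta> + g \<theta>) n))\<^sup>2) summable_on UNIV"
    by (intro summable_on_comparison_test[OF summable_on_add[OF s]] le) (simp add: \<omega>_nonneg)
  then show "(\<lambda>\<theta>. f \<theta> + g \<theta>) \<in> wdom \<omega>"
    using assms by (simp add: wdom_def L2_circle_add)
  have "wsq \<omega> (\<lambda>\<theta>. f \<theta> + g \<theta>) \<le> (\<Sum>\<^sub>\<infinity>n. 2 * ?F n + 2 * ?G n)"
    unfolding wsq_def by (intro infsum_mono s' summable_on_add s le)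
  also have "\<dots> = 2 * wsq \<omega> f + 2 * wsq \<omega> g"
    unfolding infsum_add[OF s] wsq_def infsum_cmult_right' ..
  finally show "wsq \<omega> (\<lambda>\<theta>. f \<theta> + g \<theta>) \<le> 2 * wsq \<omega> f + 2 * wsq \<omega> g" .
qed

lemma wdom_cmult:
  assumes f: "f \<in> wdom \<omega>"
  shows "(\<lambda>\<theta>. c * f \<theta>) \<in> wdom \<omega>" "wsq \<omega> (\<lambda>\<theta>. c * f \<theta>) = c\<^sup>2 * wsq \<omega> f"
proof -
  have eq: "\<omega> n * (cmod (fourier (\<lambda>\<theta>. c * f \<theta>) n))\<^sup>2 = c\<^sup>2 * (\<omega> n * (cmod (fourier f n))\<^sup>2)" for n
    by (simp add: fourier_cmult norm_mult power_mult_distrib)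
  have "(\<lambda>n. \<omega> n * (cmod (fourier (\<lambda>\<theta>. c * f \<theta>) n))\<^sup>2) summable_on UNIV"
    unfolding eq using f by (intro summable_on_cmult_right) (simp add: wdom_def)
  then show "(\<lambda>\<theta>. c * f \<theta>) \<in> wdom \<omega>"
    using f by (simp add: wdom_def L2_circle_cmult)
  show "wsq \<omega> (\<lambda>\<theta>. c * f \<theta>) = c\<^sup>2 * wsq \<omega> f"
    unfolding wsq_def eq by (rule infsum_cmult_right')
qed

lemma wdom_diff:
  assumes f: "f \<in> wdom \<omega>" and g: "g \<in> wdom \<omega>"
  shows "(\<lambda>\<theta>. f \<theta> - g \<theta>) \<in> wdom \<omega>" "wsq \<omega> (\<lambda>\<theta>. f \<theta> - g \<theta>) \<le> 2 * wsq \<omega> f + 2 * wsq \<omega> g"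
  using wdom_add[OF f wdom_cmult(1)[OF g, of "-1"]] wdom_cmult(2)[OF g, of "-1"] by simp_all

lemma wdom_divide: "f \<in> wdom \<omega> \<Longrightarrow> (\<lambda>\<theta>. f \<theta> / c) \<in> wdom \<omega>"
  using wdom_cmult(1)[of f "1 / c"] by simp

context
  fixes m :: "int \<Rightarrow> complex"
  assumes m_le: "\<And>n. cmod (m n) \<le> \<omega> n"
begin

text \<open>Cauchy-Schwarz with the square root of the weight given to each factor. All continuity
  of forms below rests on this bound.\<close>

lemma mform_summable_bound:
  assumes f: "f \<in> wdom \<omega>" and g: "g \<in> wdom \<omega>"
  shows "(\<lambda>n. m n * (cnj (fourier f n) * fourier g n)) summable_on UNIV"
    "\<bar>mform m f g\<bar> \<le> 2 * pi * (sqrt (wsq \<omega> f) * sqrt (wsq \<omega> g))"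
proof -
  let ?a = "\<lambda>n. sqrt (\<omega> n) * cmod (fourier f n)" and ?b = "\<lambda>n. sqrt (\<omega> n) * cmod (fourier g n)"
  have eq: "(\<lambda>n. (?a n)\<^sup>2) = (\<lambda>n. \<omega> n * (cmod (fourier f n))\<^sup>2)" "(\<lambda>n. (?b n)\<^sup>2) = (\<lambda>n. \<omega> n * (cmod (fourier g n))\<^sup>2)"
    by (simp_all add: power_mult_distrib \<omega>_nonneg)
  have a: "(\<lambda>n. (?a n)\<^sup>2) summable_on UNIV" "(\<lambda>n. (?b n)\<^sup>2) summable_on UNIV"
    unfolding eq using f g by (auto simp: wdom_def)
  have le: "norm (m n * (cnj (fourier f n) * fourier g n)) \<le> \<bar>?a n\<bar> * \<bar>?b n\<bar>" for n
  proof -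
    have "norm (m n * (cnj (fourier f n) * fourier g n)) \<le> \<omega> n * (cmod (fourier f n) * cmod (fourier g n))"
      unfolding norm_mult complex_mod_cnj using m_le by (intro mult_right_mono) auto
    also have "\<dots> = sqrt (\<omega> n) * sqrt (\<omega> n) * (cmod (fourier f n) * cmod (fourier g n))"
      by (simp add: \<omega>_nonneg)
    also have "\<dots> = \<bar>?a n\<bar> * \<bar>?b n\<bar>"
      by (simp add: \<omega>_nonneg abs_mult mult_ac)
    finally show ?thesis .
  qed
  have abs: "(\<lambda>n. norm (m n * (cnj (fourier f n) * fourier g n))) summable_on UNIV"
    by (intro summable_on_comparison_test[OF infsum_Cauchy_Schwarz(1)[OF a]] le) simp
  then show s: "(\<lambda>n. m n * (cnj (fourier f n) * fourier g n)) summable_on UNIV"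
    by (rule abs_summable_summable)
  have "cmod (\<Sum>\<^sub>\<infinity>n. m n * (cnj (fourier f n) * fourier g n)) \<le> (\<Sum>\<^sub>\<infinity>n. norm (m n * (cnj (fourier f n) * fourier g n)))"
    by (rule norm_infsum_bound[OF abs])
  also have "\<dots> \<le> (\<Sum>\<^sub>\<infinity>n. \<bar>?a n\<bar> * \<bar>?b n\<bar>)"
    by (intro infsum_mono abs infsum_Cauchy_Schwarz(1)[OF a] le)
  also have "\<dots> \<le> sqrt (wsq \<omega> f) * sqrt (wsq \<omega> g)"
    using infsum_Cauchy_Schwarz(2)[OF a] unfolding eq wsq_def .
  finally have "\<bar>Re (\<Sum>\<^sub>\<infinity>n. m n * (cnj (fourier f n) * fourier g n))\<bar> \<le> sqrt (wsq \<omega> f) * sqrt (wsq \<omega> g)"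
    using abs_Re_le_cmod order_trans by blast
  then show "\<bar>mform m f g\<bar> \<le> 2 * pi * (sqrt (wsq \<omega> f) * sqrt (wsq \<omega> g))"
    unfolding mform_def abs_mult by simp
qed

lemma mform_add_left:
  assumes "f \<in> wdom \<omega>" "f' \<in> wdom \<omega>" "g \<in> wdom \<omega>"
  shows "mform m (\<lambda>\<theta>. f \<theta> + f' \<theta>) g = mform m f g + mform m f' g"
proof -
  have "(\<Sum>\<^sub>\<infinity>n. m n * (cnj (fourier (\<lambda>\<theta>. f \<theta> + f' \<theta>) n) * fourier g n)) =
      (\<Sum>\<^sub>\<infinity>n. m n * (cnj (fourier f n) * fourier g n) + m n * (cnj (fourier f' n) * fourier g n))"
    by (simp add: fourier_add[OF wdom_integrable[OF assms(1)] wdom_integrable[OF assms(2)]] algebra_simps)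
  also have "\<dots> = (\<Sum>\<^sub>\<infinity>n. m n * (cnj (fourier f n) * fourier g n)) + (\<Sum>\<^sub>\<infinity>n. m n * (cnj (fourier f' n) * fourier g n))"
    using assms by (intro infsum_add mform_summable_bound)
  finally show ?thesis
    by (simp add: mform_def ring_distribs)
qed

lemma mform_add_right:
  assumes "f \<in> wdom \<omega>" "g \<in> wdom \<omega>" "g' \<in> wdom \<omega>"
  shows "mform m f (\<lambda>\<theta>. g \<theta> + g' \<theta>) = mform m f g + mform m f g'"
proof -
  have "(\<Sum>\<^sub>\<infinity>n. m n * (cnj (fourier f n) * fourier (\<lambda>\<theta>. g \<theta> + g' \<theta>) n)) =
      (\<Sum>\<^sub>\<infinity>n. m n * (cnj (fourier f n) * fourier g n) + m n * (cnj (fourier f n) * fourier g' n))"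
    by (simp add: fourier_add[OF wdom_integrable[OF assms(2)] wdom_integrable[OF assms(3)]] algebra_simps)
  also have "\<dots> = (\<Sum>\<^sub>\<infinity>n. m n * (cnj (fourier f n) * fourier g n)) + (\<Sum>\<^sub>\<infinity>n. m n * (cnj (fourier f n) * fourier g' n))"
    using assms by (intro infsum_add mform_summable_bound)
  finally show ?thesis
    by (simp add: mform_def ring_distribs)
qed

end

end

lemma mform_cmult_left: "mform m (\<lambda>\<theta>. c * f \<theta>) g = c * mform m f g"
proof -
  have "(\<Sum>\<^sub>\<infinity>n. m n * (cnj (fourier (\<lambda>\<theta>. c * f \<theta>) n) * fourier g n)) =
      (\<Sum>\<^sub>\<infinity>n. of_real c * (m n * (cnj (fourier f n) * fourier g n)))"
    by (simp add: fourier_cmult mult_ac)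
  then show ?thesis
    by (simp add: mform_def infsum_cmult_right')
qed

lemma mform_cmult_right: "mform m f (\<lambda>\<theta>. c * g \<theta>) = c * mform m f g"
proof -
  have "(\<Sum>\<^sub>\<infinity>n. m n * (cnj (fourier f n) * fourier (\<lambda>\<theta>. c * g \<theta>) n)) =
      (\<Sum>\<^sub>\<infinity>n. of_real c * (m n * (cnj (fourier f n) * fourier g n)))"
    by (simp add: fourier_cmult mult_ac)
  then show ?thesis
    by (simp add: mform_def infsum_cmult_right')
qed

section \<open>Limits and derivatives of multiplier forms\<close>

context
  fixes \<omega> :: "int \<Rightarrow> real" and m :: "int \<Rightarrow> complex"
  assumes \<omega>: "\<And>n. 0 \<le> \<omega> n" and m: "\<And>n. cmod (m n) \<le> \<omega> n"
begin

lemma mform_diff_left: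
  assumes "f \<in> wdom \<omega>" "f' \<in> wdom \<omega>" "g \<in> wdom \<omega>"
  shows "mform m (\<lambda>\<theta>. f \<theta> - f' \<theta>) g = mform m f g - mform m f' g"
  using mform_add_left[OF \<omega> m assms(1) wdom_cmult(1)[OF \<omega> assms(2), of "-1"] assms(3)]
    mform_cmult_left[of m "-1" f' g] by simp

lemma mform_diff_right:
  assumes "f \<in> wdom \<omega>" "g \<in> wdom \<omega>" "g' \<in> wdom \<omega>"
  shows "mform m f (\<lambda>\<theta>. g \<theta> - g' \<theta>) = mform m f g - mform m f g'"
  using mform_add_right[OF \<omega> m assms(1,2) wdom_cmult(1)[OF \<omega> assms(3), of "-1"]]
    mform_cmult_right[of m f "-1" g'] by simp

lemma mform_tendsto:
  assumes f: "\<forall>\<^sub>F t in F. f t \<in> wdom \<omega>" "f0 \<in> wdom \<omega>" "((\<lambda>t. wsq \<omega> (\<lambda>\<theta>. f t \<theta> - f0 \<theta>)) \<longlongrightarrow> 0) F"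
    and g: "\<forall>\<^sub>F t in F. g t \<in> wdom \<omega>" "g0 \<in> wdom \<omega>" "((\<lambda>t. wsq \<omega> (\<lambda>\<theta>. g t \<theta> - g0 \<theta>)) \<longlongrightarrow> 0) F"
  shows "((\<lambda>t. mform m (f t) (g t)) \<longlongrightarrow> mform m f0 g0) F"
proof -
  let ?df = "\<lambda>t \<theta>. f t \<theta> - f0 \<theta>" and ?dg = "\<lambda>t \<theta>. g t \<theta> - g0 \<theta>"
  \<comment> \<open>The error splits as (df, dg) + (df, g0) + (f0, dg); each piece has a factor
    tending to zero.\<close>
  let ?B = "\<lambda>t. 2 * pi * (sqrt (wsq \<omega> (?df t)) * sqrt (wsq \<omega> (?dg t))) +
      2 * pi * (sqrt (wsq \<omega> (?df t)) * sqrt (wsq \<omega> g0)) + 2 * pi * (sqrt (wsq \<omega> f0) * sqrt (wsq \<omega> (?dg t)))"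
  have "(?B \<longlongrightarrow> 2 * pi * (sqrt 0 * sqrt 0) + 2 * pi * (sqrt 0 * sqrt (wsq \<omega> g0)) +
      2 * pi * (sqrt (wsq \<omega> f0) * sqrt 0)) F"
    by (intro tendsto_intros f g)
  then have B: "(?B \<longlongrightarrow> 0) F"
    by simp
  have le: "\<forall>\<^sub>F t in F. norm (mform m (f t) (g t) - mform m f0 g0) \<le> ?B t"
    using f(1) g(1)
  proof eventually_elim
    case (elim t)
    note d = wdom_diff(1)[OF \<omega> elim(1) f(2)] wdom_diff(1)[OF \<omega> elim(2) g(2)]
    have "mform m (f t) (g t) - mform m f0 g0 =
        mform m (?df t) (?dg t) + mform m (?df t) g0 + mform m f0 (?dg t)"
      using mform_diff_left[OF elim(1) f(2) d(2)] mform_diff_left[OF elim(1) f(2) g(2)]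
        mform_diff_right[OF elim(1) elim(2) g(2)] mform_diff_right[OF f(2) elim(2) g(2)] by simp
    then show ?case
      using mform_summable_bound(2)[OF \<omega> m d] mform_summable_bound(2)[OF \<omega> m d(1) g(2)]
        mform_summable_bound(2)[OF \<omega> m f(2) d(2)] unfolding real_norm_def by linarith
  qed
  show ?thesis
    by (subst Lim_null) (rule Lim_null_comparison[OF le B])
qed

text \<open>The increment is \<open>t\<close> times a quotient that stays bounded in the
  seminorm.\<close>

lemma wsq_tendsto_of_quotient:
  assumes a: "\<forall>\<^sub>F t in at 0. a t \<in> wdom \<omega>" "a 0 \<in> wdom \<omega>" "a' \<in> wdom \<omega>"
      "((\<lambda>t. wsq \<omega> (\<lambda>\<theta>. (a t \<theta> - a 0 \<theta>) / t - a' \<theta>)) \<longlongrightarrow> 0) (at 0)"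
  shows "((\<lambda>t. wsq \<omega> (\<lambda>\<theta>. a t \<theta> - a 0 \<theta>)) \<longlongrightarrow> 0) (at (0::real))"
proof (rule Lim_null_comparison)
  let ?q = "\<lambda>t \<theta>. (a t \<theta> - a 0 \<theta>) / t"
  show "((\<lambda>t. t\<^sup>2 * (2 * wsq \<omega> (\<lambda>\<theta>. ?q t \<theta> - a' \<theta>) + 2 * wsq \<omega> a')) \<longlongrightarrow> 0) (at 0)"
    by (rule tendsto_eq_intros a refl)+ simp
  show "\<forall>\<^sub>F t in at 0. norm (wsq \<omega> (\<lambda>\<theta>. a t \<theta> - a 0 \<theta>)) \<le>
      t\<^sup>2 * (2 * wsq \<omega> (\<lambda>\<theta>. ?q t \<theta> - a' \<theta>) + 2 * wsq \<omega> a')"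
    using a(1) eventually_neq_at_within[of 0]
  proof eventually_elim
    case (elim t)
    have q: "?q t \<in> wdom \<omega>"
      by (intro wdom_divide wdom_diff \<omega> elim a)
    have "wsq \<omega> (\<lambda>\<theta>. t * ?q t \<theta>) = t\<^sup>2 * wsq \<omega> (?q t)"
      by (rule wdom_cmult(2)[OF \<omega> q])
    moreover have "(\<lambda>\<theta>. t * ?q t \<theta>) = (\<lambda>\<theta>. a t \<theta> - a 0 \<theta>)"
      using elim(2) by simp
    moreover have "wsq \<omega> (\<lambda>\<theta>. (?q t \<theta> - a' \<theta>) + a' \<theta>) \<le> 2 * wsq \<omega> (\<lambda>\<theta>. ?q t \<theta> - a' \<theta>) + 2 * wsq \<omega> a'"
      by (rule wdom_add(2)[OF \<omega> wdom_diff(1)[OF \<omega> q a(3)] a(3)])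
    ultimately show ?case
      using wsq_nonneg[of \<omega>, OF \<omega>] by (simp add: mult_left_mono)
  qed
qed

text \<open>The product rule for a continuous bilinear form. The difference quotient splits into the
  quotient of \<open>a\<close> against \<open>b t\<close> and \<open>a 0\<close> against the
  quotient of \<open>b\<close>, so seminorm convergence of quotients is enough.\<close>

lemma mform_has_derivative:
  assumes a: "\<forall>\<^sub>F t in at 0. a t \<in> wdom \<omega>" "a 0 \<in> wdom \<omega>" "a' \<in> wdom \<omega>"
      "((\<lambda>t. wsq \<omega> (\<lambda>\<theta>. (a t \<theta> - a 0 \<theta>) / t - a' \<theta>)) \<longlongrightarrow> 0) (at 0)"
    and b: "\<forall>\<^sub>F t in at 0. b t \<in> wdom \<omega>" "b 0 \<in> wdom \<omega>" "b' \<in> wdom \<omega>"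
      "((\<lambda>t. wsq \<omega> (\<lambda>\<theta>. (b t \<theta> - b 0 \<theta>) / t - b' \<theta>)) \<longlongrightarrow> 0) (at 0)"
  shows "((\<lambda>t. mform m (a t) (b t)) has_real_derivative mform m a' (b 0) + mform m (a 0) b') (at 0)"
proof -
  let ?qa = "\<lambda>t \<theta>. (a t \<theta> - a 0 \<theta>) / t" and ?qb = "\<lambda>t \<theta>. (b t \<theta> - b 0 \<theta>) / t"
  have q: "\<forall>\<^sub>F t in at 0. ?qa t \<in> wdom \<omega>" "\<forall>\<^sub>F t in at 0. ?qb t \<in> wdom \<omega>"
    by (rule eventually_mono[OF a(1)] eventually_mono[OF b(1)], intro wdom_divide wdom_diff \<omega> a b, assumption)+
  have "((\<lambda>t. mform m (?qa t) (b t) + mform m (a 0) (?qb t)) \<longlongrightarrow> mform m a' (b 0) + mform m (a 0) b') (at 0)"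
    using a b q wsq_tendsto_of_quotient[OF b] by (intro tendsto_add mform_tendsto) (auto simp: wsq_def)
  moreover have "\<forall>\<^sub>F t in at 0. mform m (?qa t) (b t) + mform m (a 0) (?qb t) =
      (mform m (a t) (b t) - mform m (a 0) (b 0)) / t"
    using a(1) b(1)
  proof eventually_elim
    case (elim t)
    have "mform m (?qa t) (b t) = (mform m (a t) (b t) - mform m (a 0) (b t)) / t"
      using mform_cmult_left[of m "1 / t" "\<lambda>\<theta>. a t \<theta> - a 0 \<theta>" "b t"] mform_diff_left[OF elim(1) a(2) elim(2)]
      by simp
    moreover have "mform m (a 0) (?qb t) = (mform m (a 0) (b t) - mform m (a 0) (b 0)) / t"
      using mform_cmult_right[of m "a 0" "1 / t" "\<lambda>\<theta>. b t \<theta> - b 0 \<theta>"] mform_diff_right[OF a(2) elim(2) b(2)]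
      by simp
    ultimately show ?case
      by (simp flip: add_divide_distrib)
  qed
  ultimately have "((\<lambda>t. (mform m (a t) (b t) - mform m (a 0) (b 0)) / t) \<longlongrightarrow>
      mform m a' (b 0) + mform m (a 0) b') (at 0)"
    by (rule Lim_transform_eventually)
  then show ?thesis
    by (simp add: has_field_derivative_iff)
qed

end

lemma mform_self:
  assumes "f \<in> wdom \<omega>" "\<And>n. m n = of_real (\<omega> n)"
  shows "mform m f f = 2 * pi * wsq \<omega> f"
proof -
  have eq: "m n * (cnj (fourier f n) * fourier f n) = of_real (\<omega> n * (cmod (fourier f n))\<^sup>2)" for n
    unfolding assms(2) of_real_mult complex_norm_square by (simp only: mult.commute)
  have "(\<Sum>\<^sub>\<infinity>n. complex_of_real (\<omega> n * (cmod (fourier f n))\<^sup>2)) = of_real (wsq \<omega> f)"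
    unfolding wsq_def using assms(1) by (intro infsumI has_sum_of_real has_sum_infsum) (simp add: wdom_def)
  then show ?thesis
    by (simp add: mform_def eq)
qed

text \<open>Polarization: both sides are symmetric and bilinear, and they agree on the diagonal by
  Parseval, in particular at \<open>f - g\<close>.\<close>

lemma Parseval_mform:
  assumes f: "f \<in> L2_circle" and g: "g \<in> L2_circle"
  shows "mform (\<lambda>_. 1) f g = (LINT \<theta>|circle. f \<theta> * g \<theta>)"
proof -
  have self: "mform (\<lambda>_. 1) h h = (LINT \<theta>|circle. (h \<theta>)\<^sup>2)" if "h \<in> L2_circle" for h
    using mform_self[of h "\<lambda>_. 1" "\<lambda>_. 1"] wsq_1[OF that] that by (simp add: wdom_1)
  note w = f[folded wdom_1] g[folded wdom_1]
  have "mform (\<lambda>_. 1) (\<lambda>\<theta>. f \<theta> - g \<theta>) (\<lambda>\<theta>. f \<theta> - g \<theta>) =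
      mform (\<lambda>_. 1) f f - mform (\<lambda>_. 1) f g - (mform (\<lambda>_. 1) g f - mform (\<lambda>_. 1) g g)"
    using mform_diff_left[of "\<lambda>_. 1" "\<lambda>_. 1", OF _ _ w wdom_diff(1)[of "\<lambda>_. 1", OF _ w]]
      mform_diff_right[of "\<lambda>_. 1" "\<lambda>_. 1", OF _ _ w(1) w] mform_diff_right[of "\<lambda>_. 1" "\<lambda>_. 1", OF _ _ w(2) w] by simp
  then show ?thesis
    using mform_commute[of "\<lambda>_. 1" g f] integral_power2_diff[OF f g] self[OF L2_circle_diff[OF f g]]
      self[OF f] self[OF g] by simp
qed

lemma Parseval_summable:
  assumes f: "f \<in> L2_circle" and g: "g \<in> L2_circle"
  shows "(\<lambda>n. cnj (fourier f n) * fourier g n) summable_on UNIV"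
  using mform_summable_bound(1)[of "\<lambda>_. 1" "\<lambda>_. 1"] assms by (simp add: wdom_1)

lemma wdom_1D: "f \<in> wdom \<omega> \<Longrightarrow> f \<in> wdom (\<lambda>_. 1)"
  by (simp add: wdom_1 wdom_L2)

lemma trig_wdom:
  assumes "\<And>n. c (- n) = cnj (c n)"
  shows "trig N c \<in> wdom \<omega>"
proof -
  have "(\<lambda>n. \<omega> n * (cmod (fourier (trig N c) n))\<^sup>2) summable_on {- int N..int N}"
    by simp
  moreover have "(\<lambda>n. \<omega> n * (cmod (fourier (trig N c) n))\<^sup>2) summable_on UNIV \<longleftrightarrow>
      (\<lambda>n. \<omega> n * (cmod (fourier (trig N c) n))\<^sup>2) summable_on {- int N..int N}"
    by (rule summable_on_cong_neutral) (auto simp: fourier_trig[of c, OF assms])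
  ultimately show ?thesis
    by (simp add: wdom_def trig_L2)
qed

lemma wsq_partial_sums_tendsto:
  assumes f: "f \<in> wdom \<omega>" and \<omega>: "\<And>n. 0 \<le> \<omega> n"
  shows "(\<lambda>N. wsq \<omega> (\<lambda>\<theta>. trig N (fourier f) \<theta> - f \<theta>)) \<longlonglongrightarrow> 0"
proof -
  let ?h = "\<lambda>n. \<omega> n * (cmod (fourier f n))\<^sup>2"
  have s: "?h summable_on UNIV"
    using f by (simp add: wdom_def)
  have "wsq \<omega> (\<lambda>\<theta>. trig N (fourier f) \<theta> - f \<theta>) = infsum ?h UNIV - (\<Sum>n\<in>{- int N..int N}. ?h n)" for N
  proof -
    have c: "fourier (\<lambda>\<theta>. trig N (fourier f) \<theta> - f \<theta>) n = (if \<bar>n\<bar> \<le> int N then 0 else - fourier f n)" for n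
      using fourier_diff[OF L2_circleD(4)[OF trig_L2] wdom_integrable[OF f], of N "fourier f" n]
      by (simp add: fourier_trig[of "fourier f", OF fourier_uminus_index])
    have "wsq \<omega> (\<lambda>\<theta>. trig N (fourier f) \<theta> - f \<theta>) = infsum ?h (UNIV - {- int N..int N})"
      unfolding wsq_def by (rule infsum_cong_neutral) (auto simp: c)
    also have "\<dots> = infsum ?h UNIV - infsum ?h {- int N..int N}"
      by (rule infsum_Diff[OF s]) auto
    finally show ?thesis
      by simp
  qed
  moreover have "(\<lambda>N. infsum ?h UNIV - (\<Sum>n\<in>{- int N..int N}. ?h n)) \<longlonglongrightarrow> infsum ?h UNIV - infsum ?h UNIV"
    by (intro tendsto_diff tendsto_const has_sum_tendsto_symmetric has_sum_infsum s)
  ultimately show ?thesis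
    by simp
qed

section \<open>Translations and the half derivative\<close>

text \<open>The translated period is cut in two: \<open>[h, 2 pi]\<close> moves to the left end, and
  \<open>[0, h]\<close>, advanced by one period, fills the rest.\<close>

lemma has_integral_shift_periodic:
  fixes F :: "real \<Rightarrow> 'a::banach"
  assumes per: "\<And>\<theta>. F (\<theta> + 2 * pi) = F \<theta>" and F: "F integrable_on {0..2 * pi}" and h: "h \<in> {0..2 * pi}"
  shows "((\<lambda>\<theta>. F (\<theta> + h)) has_integral integral {0..2 * pi} F) {0..2 * pi}"
proof -
  have i: "F integrable_on {0..h}" "F integrable_on {h..2 * pi}"
    using h by (auto intro: integrable_on_subinterval[OF F])
  have "((F \<circ> (+) h) has_integral integral {h..2 * pi} F) {0..2 * pi - h}"
    unfolding has_integral_shift_Icc_real using i(2) by (simp add: integrable_integral)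
  then have 1: "((\<lambda>\<theta>. F (\<theta> + h)) has_integral integral {h..2 * pi} F) {0..2 * pi - h}"
    by (simp add: o_def add.commute)
  have "((F \<circ> (+) (h - 2 * pi)) has_integral integral {0..h} F) {2 * pi - h..2 * pi}"
    unfolding has_integral_shift_Icc_real using i(1) by (simp add: integrable_integral)
  moreover have "F \<circ> (+) (h - 2 * pi) = (\<lambda>\<theta>. F (\<theta> + h))"
    using per[of "\<theta> + h - 2 * pi" for \<theta>] by (simp add: fun_eq_iff algebra_simps)
  ultimately have 2: "((\<lambda>\<theta>. F (\<theta> + h)) has_integral integral {0..h} F) {2 * pi - h..2 * pi}"
    by simp
  have "integral {h..2 * pi} F + integral {0..h} F = integral {0..2 * pi} F"
    using h Henstock_Kurzweil_Integration.integral_combine[of 0 h "2 * pi" F] F by (simp add: add.commute)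
  then show ?thesis
    using h has_integral_combine[OF _ _ 1 2] by simp
qed

lemma circle_integrable_iff:
  fixes F :: "real \<Rightarrow> 'a::euclidean_space"
  shows "integrable circle F \<longleftrightarrow> F integrable_on {0..2 * pi} \<and> (\<lambda>\<theta>. norm (F \<theta>)) integrable_on {0..2 * pi}"
  using absolutely_integrable_on_def[of "{0..2 * pi}" F] integrable_restrict_space[of "{0..2 * pi}" lebesgue F]
  by (simp add: set_integrable_def)

lemma circle_shift:
  fixes F :: "real \<Rightarrow> 'a::euclidean_space"
  assumes per: "\<And>\<theta>. F (\<theta> + 2 * pi) = F \<theta>" and F: "integrable circle F" and h: "h \<in> {0..2 * pi}"
  shows "integrable circle (\<lambda>\<theta>. F (\<theta> + h))" "(LINT \<theta>|circle. F (\<theta> + h)) = (LINT \<theta>|circle. F \<theta>)"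
proof -
  have F': "F integrable_on {0..2 * pi}" "(\<lambda>\<theta>. norm (F \<theta>)) integrable_on {0..2 * pi}"
    using F by (auto simp: circle_integrable_iff)
  note s = has_integral_shift_periodic[of F, OF per F'(1) h]
    has_integral_shift_periodic[of "\<lambda>\<theta>. norm (F \<theta>)", OF _ F'(2) h]
  show i: "integrable circle (\<lambda>\<theta>. F (\<theta> + h))"
    unfolding circle_integrable_iff using s per by (auto simp: has_integral_integrable)
  show "(LINT \<theta>|circle. F (\<theta> + h)) = (LINT \<theta>|circle. F \<theta>)"
    using lebesgue_integral_eq_integral[OF i] lebesgue_integral_eq_integral[OF F] s(1)
    by (simp add: integral_unique)
qed

lemma L2_circle_shift:
  fixes f :: "real \<Rightarrow> real"
  assumes f: "f \<in> L2_circle" and h: "h \<in> {0..2 * pi}"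
  shows "(\<lambda>\<theta>. f (\<theta> + h)) \<in> L2_circle"
  unfolding L2_circle_real_iff
proof (intro conjI allI)
  show "f (\<theta> + 2 * pi + h) = f (\<theta> + h)" for \<theta>
    using L2_circleD(1)[OF f, of "\<theta> + h"] by (simp add: algebra_simps)
  show "(\<lambda>\<theta>. f (\<theta> + h)) \<in> borel_measurable circle"
    using circle_shift(1)[of f h, OF L2_circleD(1)[OF f] L2_circleD(4)[OF f] h] by simp
  show "integrable circle (\<lambda>\<theta>. (f (\<theta> + h))\<^sup>2)"
    using circle_shift(1)[of "\<lambda>\<theta>. (f \<theta>)\<^sup>2" h] L2_circleD(1,3)[OF f] h by simp
qed

lemma fourier_shift:
  assumes f: "f \<in> L2_circle" and h: "h \<in> {0..2 * pi}"
  shows "fourier (\<lambda>\<theta>. f (\<theta> + h)) n = cis (of_int n * h) * fourier f n"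
proof -
  let ?F = "\<lambda>\<theta>. complex_of_real (f \<theta>) * cis (- (of_int n * \<theta>))"
  have per: "?F (\<theta> + 2 * pi) = ?F \<theta>" for \<theta>
    using L2_circleD(1)[OF f, of \<theta>] cis_periodic[of "- n" \<theta>] by simp
  have i: "integrable circle ?F"
    using integrable_mult_cis[OF L2_circleD(4)[OF f], of "- of_int n"] by simp
  have "complex_of_real (f (\<theta> + h)) * cis (- (of_int n * \<theta>)) = cis (of_int n * h) * ?F (\<theta> + h)" for \<theta>
    by (simp add: cis_mult algebra_simps)
  then have "(LINT \<theta>|circle. complex_of_real (f (\<theta> + h)) * cis (- (of_int n * \<theta>))) =
      cis (of_int n * h) * (LINT \<theta>|circle. ?F (\<theta> + h))"
    by (simp only: integral_mult_right_zero)
  also have "(LINT \<theta>|circle. ?F (\<theta> + h)) = (LINT \<theta>|circle. ?F \<theta>)"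
    by (rule circle_shift(2)[OF per i h])
  finally show ?thesis
    by (simp add: fourier_def)
qed

section \<open>Translation differences and their dyadic sums\<close>

definition shift_sq :: "real \<Rightarrow> (real \<Rightarrow> real) \<Rightarrow> real" where
  "shift_sq h f = (LINT \<theta>|circle. (f (\<theta> + h) - f \<theta>)\<^sup>2)"

lemma cmod_cis_minus_1: "(cmod (cis x - 1))\<^sup>2 = 2 - 2 * cos x"
  using sin_cos_squared_add[of x] by (simp add: cmod_power2 power2_diff)

lemma shift_sq_eq:
  assumes f: "f \<in> L2_circle" and h: "h \<in> {0..2 * pi}"
  shows "f \<in> wdom (\<lambda>n. 2 - 2 * cos (of_int n * h))"
    "shift_sq h f = 2 * pi * wsq (\<lambda>n. 2 - 2 * cos (of_int n * h)) f"
proof -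
  have "fourier (\<lambda>\<theta>. f (\<theta> + h) - f \<theta>) n = (cis (of_int n * h) - 1) * fourier f n" for n
    using fourier_diff[OF L2_circleD(4)[OF L2_circle_shift[OF f h]] L2_circleD(4)[OF f]] fourier_shift[OF f h]
    by (simp add: algebra_simps)
  then have eq: "(cmod (fourier (\<lambda>\<theta>. f (\<theta> + h) - f \<theta>) n))\<^sup>2 = (2 - 2 * cos (of_int n * h)) * (cmod (fourier f n))\<^sup>2" for n
    by (simp add: norm_mult power_mult_distrib cmod_cis_minus_1)
  have d: "(\<lambda>\<theta>. f (\<theta> + h) - f \<theta>) \<in> L2_circle"
    by (intro L2_circle_diff L2_circle_shift f h)
  show "f \<in> wdom (\<lambda>n. 2 - 2 * cos (of_int n * h))"
    using Bessel_summable[OF d] f unfolding eq by (simp add: wdom_def)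
  show "shift_sq h f = 2 * pi * wsq (\<lambda>n. 2 - 2 * cos (of_int n * h)) f"
    unfolding shift_sq_def Parseval[OF d] eq wsq_def ..
qed

definition dyadic :: "nat \<Rightarrow> int \<Rightarrow> real" where
  "dyadic K n = (\<Sum>k<K. 2 ^ k * (2 - 2 * cos (of_int n * (1 / 2 ^ k))))"

lemma shift_symbol_le: "2 - 2 * cos x \<le> (x::real)\<^sup>2"
proof -
  have "\<bar>sin (x / 2)\<bar> \<le> \<bar>x / 2\<bar>"
    by (rule abs_sin_x_le_abs_x)
  then have "(sin (x / 2))\<^sup>2 \<le> (x / 2)\<^sup>2"
    by (rule abs_le_square_iff[THEN iffD1])
  then show ?thesis
    using cos_double_sin[of "x / 2"] by (simp add: power_divide)
qed

text \<open>The dyadic sum telescopes against \<open>24 y s / (s + y)\<close> along \<open>s = 1, 2, 4, \<dots>\<close>, because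
  \<open>s (2 - 2 cos (y / s)) \<le> min (4 s) (y\<^sup>2 / s)\<close>.\<close>

lemma dyadic_step:
  fixes s y :: real
  assumes s: "s > 0" and y: "y > 0"
  shows "s * (2 - 2 * cos (y / s)) \<le> 24 * y * (2 * s) / (2 * s + y) - 24 * y * s / (s + y)"
proof -
  have eq: "24 * y * (2 * s) / (2 * s + y) - 24 * y * s / (s + y) = 24 * y\<^sup>2 * s / ((2 * s + y) * (s + y))"
  proof -
    have "2 * s + y \<noteq> 0" "s + y \<noteq> 0"
      using assms by auto
    then show ?thesis
      by (simp add: divide_simps) (simp add: power2_eq_square algebra_simps)
  qed
  have pos: "(2 * s + y) * (s + y) > 0"
    using assms by (intro mult_pos_pos) auto
  show ?thesis
  \<comment> \<open>For \<open>s \<le> y\<close> the product \<open>(2 * s + y) * (s + y)\<close> is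
    at most \<open>6 * y\<^sup>2\<close>, and 24 = 4 * 6 is what the trivial bound 4 on the symbol
    requires. The other case would do with 6.\<close>
  proof (cases "s \<le> y")
    case True
    have "(2 * s + y) * (s + y) \<le> (3 * y) * (2 * y)"
      using True assms by (intro mult_mono) auto
    then have "4 * s * ((2 * s + y) * (s + y)) \<le> 4 * s * (6 * y\<^sup>2)"
      using s by (intro mult_left_mono) (auto simp: power2_eq_square)
    then have "4 * s \<le> 24 * y\<^sup>2 * s / ((2 * s + y) * (s + y))"
      using pos by (subst le_divide_eq) (simp add: mult_ac)
    moreover have "2 - 2 * cos (y / s) \<le> 4"
      using cos_ge_minus_one[of "y / s"] by linarith
    then have "s * (2 - 2 * cos (y / s)) \<le> s * 4"
      using s by (intro mult_left_mono) auto
    ultimately show ?thesis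
      unfolding eq by linarith
  next
    case False
    have "(2 * s + y) * (s + y) \<le> (3 * s) * (2 * s)"
      using False assms by (intro mult_mono) auto
    then have "(2 * s + y) * (s + y) \<le> 24 * (s * s)"
      using mult_pos_pos[OF s s] by linarith
    then have "y\<^sup>2 * ((2 * s + y) * (s + y)) \<le> y\<^sup>2 * (24 * (s * s))"
      by (intro mult_left_mono) auto
    then have "y\<^sup>2 / s \<le> 24 * y\<^sup>2 * s / ((2 * s + y) * (s + y))"
      using pos s by (simp add: divide_simps mult_ac)
    moreover have "s * (2 - 2 * cos (y / s)) \<le> s * (y / s)\<^sup>2"
      using s shift_symbol_le by (intro mult_left_mono) auto
    moreover have "s * (y / s)\<^sup>2 = y\<^sup>2 / s"
      using s by (simp add: power2_eq_square)
    ultimately show ?thesis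
      unfolding eq by linarith
  qed
qed

lemma dyadic_le: "dyadic K n \<le> 24 * \<bar>of_int n\<bar>"
proof (cases "n = 0")
  case False
  define y where "y = \<bar>real_of_int n\<bar>"
  have y: "y > 0"
    using False by (simp add: y_def)
  have c: "cos (of_int n / 2 ^ k) = cos (y / 2 ^ k)" for k :: nat
    using cos_abs_real[of "of_int n / 2 ^ k"] by (simp add: y_def)
  \<comment> \<open>Telescoped form of \<open>dyadic_step\<close> with \<open>s = 2 ^ K\<close>. The
    right side stays below \<open>24 * y\<close> for every \<open>K\<close>, so the final bound is
    uniform.\<close>
  have "dyadic K n \<le> 24 * y * 2 ^ K / (2 ^ K + y)"
  proof (induction K)
    case (Suc K)
    have "dyadic (Suc K) n = dyadic K n + 2 ^ K * (2 - 2 * cos (y / 2 ^ K))"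
      by (simp add: dyadic_def c)
    also have "\<dots> \<le> 24 * y * 2 ^ K / (2 ^ K + y) + (24 * y * (2 * 2 ^ K) / (2 * 2 ^ K + y) - 24 * y * 2 ^ K / (2 ^ K + y))"
      using dyadic_step[of "2 ^ K" y] y Suc by (intro add_mono) auto
    finally show ?case
      by simp
  qed (use y in \<open>simp add: dyadic_def\<close>)
  also have "\<dots> \<le> 24 * y"
    using y by (simp add: divide_simps add_pos_pos)
  finally show ?thesis
    by (simp add: y_def)
qed (simp add: dyadic_def)

lemma dyadic_nonneg: "0 \<le> dyadic K n"
  unfolding dyadic_def by (intro sum_nonneg) simp

text \<open>A single term suffices: if \<open>2 ^ k\<close> is the largest power of two not
  exceeding |n|, then |n| / 2^k lies in [1, 2], where the cosine is at most cos 1.\<close>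

lemma dyadic_ge:
  assumes "\<bar>n\<bar> \<le> int N"
  shows "(1 - cos 1) * \<bar>of_int n\<bar> \<le> dyadic (Suc N) n"
proof (cases "n = 0")
  case False
  define M where "M = nat \<bar>n\<bar>"
  have M: "\<bar>real_of_int n\<bar> = real M" "M \<ge> 1" "M \<le> N"
    using False assms by (auto simp: M_def)
  obtain k where k: "2 ^ k \<le> M" "M < 2 ^ (k + 1)"
    using ex_power_ivl1[of 2 M] M(2) by auto
  have "k < 2 ^ k"
    by simp
  \<comment> \<open>From \<open>k < 2 ^ k \<le> \<bar>n\<bar> \<le> N\<close> this scale does occur
    in the sum with \<open>Suc N\<close> terms.\<close>
  then have kN: "k < Suc N"
    using k(1) M(3) by linarith
  define x where "x = real M / 2 ^ k"
  have k': "2 ^ k \<le> real M" "real M < 2 * 2 ^ k"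
    using of_nat_mono[OF k(1), where 'a=real] of_nat_less_iff[of M "2 ^ (k + 1)", where 'a=real] k(2) by auto
  then have x: "1 \<le> x" "x \<le> 2"
    by (auto simp: x_def field_simps)
  have "cos x \<le> cos 1"
    using x pi_ge_two by (intro cos_monotone_0_pi_le) auto
  moreover have "cos (of_int n * (1 / 2 ^ k)) = cos x"
    using cos_abs_real[of "of_int n / 2 ^ k"] M(1) by (simp add: x_def)
  ultimately have "2 ^ k * (2 - 2 * cos 1) \<le> 2 ^ k * (2 - 2 * cos (real_of_int n * (1 / 2 ^ k)))"
    by (intro mult_left_mono) auto
  also have "\<dots> \<le> dyadic (Suc N) n"
    unfolding dyadic_def by (rule member_le_sum) (use kN in auto)
  finally have "2 * 2 ^ k * (1 - cos 1) \<le> dyadic (Suc N) n"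
    by (simp add: algebra_simps)
  moreover have "(1 - cos 1) * real M \<le> (1 - cos 1) * (2 * 2 ^ k)"
    using k' by (intro mult_left_mono) auto
  ultimately show ?thesis
    using M(1) by (simp add: mult_ac)
qed (simp add: dyadic_nonneg)

lemma wsq_sum_weights:
  assumes "finite I" "f \<in> L2_circle" "\<And>i. i \<in> I \<Longrightarrow> f \<in> wdom (\<omega> i)"
  shows "f \<in> wdom (\<lambda>n. \<Sum>i\<in>I. a i * \<omega> i n)"
    "wsq (\<lambda>n. \<Sum>i\<in>I. a i * \<omega> i n) f = (\<Sum>i\<in>I. a i * wsq (\<omega> i) f)"
proof -
  have *: "(\<lambda>n. (\<Sum>i\<in>I. a i * \<omega> i n) * (cmod (fourier f n))\<^sup>2) summable_on UNIV \<and>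
      wsq (\<lambda>n. \<Sum>i\<in>I. a i * \<omega> i n) f = (\<Sum>i\<in>I. a i * wsq (\<omega> i) f)"
    using assms(1,3)
  proof (induction I)
    case (insert j I)
    have s: "(\<lambda>n. a j * (\<omega> j n * (cmod (fourier f n))\<^sup>2)) summable_on UNIV"
      using insert.prems by (intro summable_on_cmult_right) (simp add: wdom_def)
    have s': "(\<lambda>n. (\<Sum>i\<in>I. a i * \<omega> i n) * (cmod (fourier f n))\<^sup>2) summable_on UNIV"
      using insert by simp
    have eq: "(\<Sum>i\<in>insert j I. a i * \<omega> i n) * (cmod (fourier f n))\<^sup>2 =
        a j * (\<omega> j n * (cmod (fourier f n))\<^sup>2) + (\<Sum>i\<in>I. a i * \<omega> i n) * (cmod (fourier f n))\<^sup>2" for n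
      using insert.hyps by (simp add: algebra_simps)
    show ?case
      unfolding wsq_def eq infsum_add[OF s s'] using insert summable_on_add[OF s s']
      by (simp add: wsq_def infsum_cmult_right')
  qed (simp add: wsq_def)
  then show "f \<in> wdom (\<lambda>n. \<Sum>i\<in>I. a i * \<omega> i n)"
    using assms(2) by (simp add: wdom_def)
  show "wsq (\<lambda>n. \<Sum>i\<in>I. a i * \<omega> i n) f = (\<Sum>i\<in>I. a i * wsq (\<omega> i) f)"
    using * by blast
qed

lemma inverse_power2_in_period: "1 / 2 ^ k \<in> {0..2 * pi}"
proof -
  have "1 / 2 ^ k \<le> (1::real)"
    by simp
  also have "1 \<le> 2 * pi"
    using pi_ge_two by linarith
  finally show ?thesis
    unfolding atLeastAtMost_iff by (intro conjI) auto
qed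

lemma wsq_dyadic:
  assumes f: "f \<in> L2_circle"
  shows "f \<in> wdom (dyadic (Suc K))"
    "2 * pi * wsq (dyadic (Suc K)) f = (\<Sum>k<Suc K. 2 ^ k * shift_sq (1 / 2 ^ k) f)"
proof -
  note h = inverse_power2_in_period
  note w = wsq_sum_weights[of "{..<Suc K}" f "\<lambda>k n. 2 - 2 * cos (of_int n * (1 / 2 ^ k))" "\<lambda>k. 2 ^ k",
      OF finite_lessThan f shift_sq_eq(1)[OF f h]]
  show "f \<in> wdom (dyadic (Suc K))"
    using w(1) unfolding dyadic_def[abs_def] .
  have "2 * pi * wsq (dyadic (Suc K)) f =
      2 * pi * (\<Sum>k<Suc K. 2 ^ k * wsq (\<lambda>n. 2 - 2 * cos (of_int n * (1 / 2 ^ k))) f)"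
    using w(2) unfolding dyadic_def[abs_def] by simp
  also have "\<dots> = (\<Sum>k<Suc K. 2 ^ k * shift_sq (1 / 2 ^ k) f)"
    unfolding shift_sq_eq(2)[OF f h] sum_distrib_left by (simp only: mult_ac)
  finally show "2 * pi * wsq (dyadic (Suc K)) f = (\<Sum>k<Suc K. 2 ^ k * shift_sq (1 / 2 ^ k) f)" .
qed

abbreviation wabs :: "int \<Rightarrow> real" where
  "wabs n \<equiv> \<bar>real_of_int n\<bar>"

text \<open>Quotient of the upper constant of \<open>dyadic_le\<close> and the lower constant of
  \<open>dyadic_ge\<close>.\<close>

definition half_const :: real where
  "half_const = 24 / (1 - cos 1)"

lemma cos_1_less_1: "cos (1::real) < 1"
  using cos_monotone_0_pi[of 0 1] pi_ge_two by simp

lemma half_const_pos: "half_const > 0"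
  using cos_1_less_1 by (simp add: half_const_def)

text \<open>The seminorm of \<open>H\<^bsup>1/2\<^esup>\<close> is comparable to \<open>\<Sum>\<^sub>k 2\<^sup>k \<parallel>f(\<cdot> + 2\<^sup>-\<^sup>k) - f\<parallel>\<^sup>2\<close>; this replaces the
  Gagliardo double integral and lets pointwise bounds pass to \<open>H\<^bsup>1/2\<^esup>\<close>.\<close>

lemma half_transfer:
  assumes F: "F \<in> L2_circle" and I: "finite I" and f: "\<And>i. i \<in> I \<Longrightarrow> f i \<in> wdom wabs"
    and a: "\<And>i. i \<in> I \<Longrightarrow> 0 \<le> a i"
    and le: "\<And>h. h \<in> {0..2 * pi} \<Longrightarrow> shift_sq h F \<le> (\<Sum>i\<in>I. a i * shift_sq h (f i))"
  shows "F \<in> wdom wabs" "wsq wabs F \<le> half_const * (\<Sum>i\<in>I. a i * wsq wabs (f i))"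
proof -
  define c where "c = 1 - cos (1::real)"
  have c: "c > 0"
    using cos_1_less_1 by (simp add: c_def)
  have dy: "2 * pi * wsq (dyadic (Suc K)) F \<le> 2 * pi * (24 * (\<Sum>i\<in>I. a i * wsq wabs (f i)))" for K
  proof -
    have "2 * pi * wsq (dyadic (Suc K)) F = (\<Sum>k<Suc K. 2 ^ k * shift_sq (1 / 2 ^ k) F)"
      by (rule wsq_dyadic(2)[OF F])
    also have "\<dots> \<le> (\<Sum>k<Suc K. 2 ^ k * (\<Sum>i\<in>I. a i * shift_sq (1 / 2 ^ k) (f i)))"
      by (intro sum_mono mult_left_mono le inverse_power2_in_period) simp
    also have "\<dots> = (\<Sum>i\<in>I. a i * (\<Sum>k<Suc K. 2 ^ k * shift_sq (1 / 2 ^ k) (f i)))"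
      unfolding sum_distrib_left by (subst sum.swap) (simp only: mult_ac)
    also have "\<dots> = (\<Sum>i\<in>I. a i * (2 * pi * wsq (dyadic (Suc K)) (f i)))"
      by (intro sum.cong refl) (simp only: wsq_dyadic(2)[OF wdom_L2[OF f]])
    also have "\<dots> \<le> (\<Sum>i\<in>I. a i * (2 * pi * (24 * wsq wabs (f i))))"
      using a f dyadic_le dyadic_nonneg
      by (intro sum_mono mult_left_mono wdom_mono(2)[of _ wabs]) auto
    also have "\<dots> = 2 * pi * (24 * (\<Sum>i\<in>I. a i * wsq wabs (f i)))"
      by (simp add: sum_distrib_left mult_ac)
    finally show ?thesis .
  qed
  \<comment> \<open>Frequencies up to \<open>N\<close> need \<open>Suc N\<close> scales; the number
    of scales does no harm because \<open>dy\<close> is uniform in it.\<close>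
  have b: "(\<Sum>n\<in>{- int N..int N}. wabs n * (cmod (fourier F n))\<^sup>2) \<le>
      half_const * (\<Sum>i\<in>I. a i * wsq wabs (f i))" for N
  proof -
    have "c * (\<Sum>n\<in>{- int N..int N}. wabs n * (cmod (fourier F n))\<^sup>2) \<le>
        (\<Sum>n\<in>{- int N..int N}. dyadic (Suc N) n * (cmod (fourier F n))\<^sup>2)"
      unfolding sum_distrib_left
    proof (intro sum_mono)
      fix n assume "n \<in> {- int N..int N}"
      then have "c * wabs n \<le> dyadic (Suc N) n"
        unfolding c_def by (intro dyadic_ge) auto
      then show "c * (wabs n * (cmod (fourier F n))\<^sup>2) \<le> dyadic (Suc N) n * (cmod (fourier F n))\<^sup>2"
        using mult_right_mono[of "c * wabs n" _ "(cmod (fourier F n))\<^sup>2"] by (simp add: mult.assoc)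
    qed
    also have "\<dots> \<le> wsq (dyadic (Suc N)) F"
      unfolding wsq_def using wsq_dyadic(1)[OF F, of N] dyadic_nonneg
      by (intro finite_sum_le_infsum) (auto simp: wdom_def)
    also have "\<dots> \<le> 24 * (\<Sum>i\<in>I. a i * wsq wabs (f i))"
      using dy[of N] by simp
    finally show ?thesis
      using c unfolding half_const_def c_def[symmetric] by (simp add: field_simps)
  qed
  show "F \<in> wdom wabs" "wsq wabs F \<le> half_const * (\<Sum>i\<in>I. a i * wsq wabs (f i))"
    using nonneg_summable_on_int[OF _ b] F by (auto simp: wdom_def wsq_def)
qed

section \<open>Bounded products and Lipschitz compositions\<close>

lemma power2_sum_le:
  fixes x y :: real
  shows "(x + y)\<^sup>2 \<le> 2 * x\<^sup>2 + 2 * y\<^sup>2"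
  using sum_squares_bound[of x y] by (simp add: power2_sum)

text \<open>Bounded H^(1/2) functions form an algebra: the difference of a product under a
  translation obeys a discrete Leibniz rule, in which each undifferenced factor is replaced by its
  bound.\<close>

lemma wdom_half_mult:
  assumes f: "f \<in> wdom wabs" "\<And>\<theta>. \<bar>f \<theta>\<bar> \<le> A" and g: "g \<in> wdom wabs" "\<And>\<theta>. \<bar>g \<theta>\<bar> \<le> B"
  shows "(\<lambda>\<theta>. f \<theta> * g \<theta>) \<in> wdom wabs"
    "wsq wabs (\<lambda>\<theta>. f \<theta> * g \<theta>) \<le> half_const * (2 * A\<^sup>2 * wsq wabs g + 2 * B\<^sup>2 * wsq wabs f)"
proof -
  note L2 = wdom_L2[OF f(1)] wdom_L2[OF g(1)]
  have F: "(\<lambda>\<theta>. f \<theta> * g \<theta>) \<in> L2_circle"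
    using L2_circleD[OF L2(1)] f(2) by (intro L2_circle_bounded_mult[OF L2(2)]) auto
  have A: "(f \<theta>)\<^sup>2 \<le> A\<^sup>2" "(g \<theta>)\<^sup>2 \<le> B\<^sup>2" for \<theta>
    using power_mono[OF f(2)[of \<theta>], of 2] power_mono[OF g(2)[of \<theta>], of 2] by simp_all
  \<comment> \<open>The transfer lemma takes a finite family; the two factors are indexed by
    booleans, each weighted by the bound of the other.\<close>
  let ?q = "\<lambda>b. if b then g else f" and ?a = "\<lambda>b. if b then 2 * A\<^sup>2 else 2 * B\<^sup>2"
  have le: "shift_sq h (\<lambda>\<theta>. f \<theta> * g \<theta>) \<le> (\<Sum>b\<in>UNIV. ?a b * shift_sq h (?q b))" if h: "h \<in> {0..2 * pi}" for h
  proof -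
    have i: "integrable circle (\<lambda>\<theta>. (g (\<theta> + h) - g \<theta>)\<^sup>2)" "integrable circle (\<lambda>\<theta>. (f (\<theta> + h) - f \<theta>)\<^sup>2)"
      "integrable circle (\<lambda>\<theta>. (f (\<theta> + h) * g (\<theta> + h) - f \<theta> * g \<theta>)\<^sup>2)"
      using L2_circle_shift[OF _ h] L2 F by (auto intro!: L2_circleD(3) L2_circle_diff)
    have "(f (\<theta> + h) * g (\<theta> + h) - f \<theta> * g \<theta>)\<^sup>2 \<le>
        2 * A\<^sup>2 * (g (\<theta> + h) - g \<theta>)\<^sup>2 + 2 * B\<^sup>2 * (f (\<theta> + h) - f \<theta>)\<^sup>2" for \<theta>
    proof -
      have "(f (\<theta> + h) * g (\<theta> + h) - f \<theta> * g \<theta>)\<^sup>2 =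
          (f (\<theta> + h) * (g (\<theta> + h) - g \<theta>) + (f (\<theta> + h) - f \<theta>) * g \<theta>)\<^sup>2"
        by (simp add: algebra_simps)
      also have "\<dots> \<le> 2 * (f (\<theta> + h) * (g (\<theta> + h) - g \<theta>))\<^sup>2 + 2 * ((f (\<theta> + h) - f \<theta>) * g \<theta>)\<^sup>2"
        by (rule power2_sum_le)
      also have "\<dots> \<le> 2 * (A\<^sup>2 * (g (\<theta> + h) - g \<theta>)\<^sup>2) + 2 * ((f (\<theta> + h) - f \<theta>)\<^sup>2 * B\<^sup>2)"
        unfolding power_mult_distrib using A
        by (intro add_mono mult_left_mono mult_right_mono) auto
      finally show ?thesis
        by (simp add: mult_ac)
    qed
    then have "shift_sq h (\<lambda>\<theta>. f \<theta> * g \<theta>) \<le>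
        (LINT \<theta>|circle. 2 * A\<^sup>2 * (g (\<theta> + h) - g \<theta>)\<^sup>2 + 2 * B\<^sup>2 * (f (\<theta> + h) - f \<theta>)\<^sup>2)"
      unfolding shift_sq_def using i by (intro integral_mono) auto
    then show ?thesis
      using i by (simp add: shift_sq_def UNIV_bool)
  qed
  have "?q b \<in> wdom wabs" "0 \<le> ?a b" for b
    using f(1) g(1) by auto
  note * = half_transfer[OF F finite, where f="?q" and a="?a" and I=UNIV, OF this le]
  show "(\<lambda>\<theta>. f \<theta> * g \<theta>) \<in> wdom wabs"
    "wsq wabs (\<lambda>\<theta>. f \<theta> * g \<theta>) \<le> half_const * (2 * A\<^sup>2 * wsq wabs g + 2 * B\<^sup>2 * wsq wabs f)"
    using * by (simp_all add: UNIV_bool add.commute)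
qed

text \<open>A Lipschitz map shrinks translation differences up to its constant. The result bounds
  the composition in H^(1/2) but gives no continuity in \<open>\<gamma>\<close>, which is the reason
  for working with weak limits later.\<close>

lemma wdom_half_lipschitz:
  fixes \<gamma> :: "real \<Rightarrow> real^'m" and G :: "real^'m \<Rightarrow> real"
  assumes \<gamma>: "\<And>i. (\<lambda>\<theta>. \<gamma> \<theta> $ i) \<in> wdom wabs"
    and G: "(\<lambda>\<theta>. G (\<gamma> \<theta>)) \<in> L2_circle" "\<And>x y. \<bar>G x - G y\<bar> \<le> L * norm (x - y)"
  shows "(\<lambda>\<theta>. G (\<gamma> \<theta>)) \<in> wdom wabs"
    "wsq wabs (\<lambda>\<theta>. G (\<gamma> \<theta>)) \<le> half_const * (\<Sum>i\<in>UNIV. L\<^sup>2 * wsq wabs (\<lambda>\<theta>. \<gamma> \<theta> $ i))"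
proof -
  have le: "shift_sq h (\<lambda>\<theta>. G (\<gamma> \<theta>)) \<le> (\<Sum>i\<in>UNIV. L\<^sup>2 * shift_sq h (\<lambda>\<theta>. \<gamma> \<theta> $ i))" if h: "h \<in> {0..2 * pi}" for h
  proof -
    have i: "integrable circle (\<lambda>\<theta>. (\<gamma> (\<theta> + h) $ i - \<gamma> \<theta> $ i)\<^sup>2)" for i
      using L2_circle_diff[OF L2_circle_shift[OF wdom_L2[OF \<gamma>[of i]] h] wdom_L2[OF \<gamma>[of i]]] by (rule L2_circleD(3))
    have iG: "integrable circle (\<lambda>\<theta>. (G (\<gamma> (\<theta> + h)) - G (\<gamma> \<theta>))\<^sup>2)"
      using L2_circle_diff[OF L2_circle_shift[OF G(1) h] G(1)] by (rule L2_circleD(3))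
    have "(G (\<gamma> (\<theta> + h)) - G (\<gamma> \<theta>))\<^sup>2 \<le> (\<Sum>i\<in>UNIV. L\<^sup>2 * (\<gamma> (\<theta> + h) $ i - \<gamma> \<theta> $ i)\<^sup>2)" for \<theta>
    proof -
      have "(G (\<gamma> (\<theta> + h)) - G (\<gamma> \<theta>))\<^sup>2 \<le> (L * norm (\<gamma> (\<theta> + h) - \<gamma> \<theta>))\<^sup>2"
        using power_mono[OF G(2), of "\<gamma> (\<theta> + h)" "\<gamma> \<theta>" 2] by simp
      also have "\<dots> = L\<^sup>2 * (\<Sum>i\<in>UNIV. (\<gamma> (\<theta> + h) $ i - \<gamma> \<theta> $ i)\<^sup>2)"
        unfolding power_mult_distrib power2_norm_eq_inner inner_vec_def by (simp add: power2_eq_square)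
      finally show ?thesis
        by (simp add: sum_distrib_left)
    qed
    then have "shift_sq h (\<lambda>\<theta>. G (\<gamma> \<theta>)) \<le> (LINT \<theta>|circle. (\<Sum>i\<in>UNIV. L\<^sup>2 * (\<gamma> (\<theta> + h) $ i - \<gamma> \<theta> $ i)\<^sup>2))"
      unfolding shift_sq_def using i iG by (intro integral_mono) auto
    also have "\<dots> = (\<Sum>i\<in>UNIV. L\<^sup>2 * shift_sq h (\<lambda>\<theta>. \<gamma> \<theta> $ i))"
      unfolding shift_sq_def using i by (subst Bochner_Integration.integral_sum) auto
    finally show ?thesis .
  qed
  show "(\<lambda>\<theta>. G (\<gamma> \<theta>)) \<in> wdom wabs"
    "wsq wabs (\<lambda>\<theta>. G (\<gamma> \<theta>)) \<le> half_const * (\<Sum>i\<in>UNIV. L\<^sup>2 * wsq wabs (\<lambda>\<theta>. \<gamma> \<theta> $ i))"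
    using half_transfer[OF G(1) finite, where I=UNIV and f="\<lambda>i \<theta>. \<gamma> \<theta> $ i" and a="\<lambda>_. L\<^sup>2"] \<gamma> le by auto
qed

section \<open>Fejer means\<close>

text \<open>Dominated convergence for series: the tail beyond some \<open>N\<close> is small
  uniformly in \<open>k\<close>, because each term is at most the corresponding term of
  \<open>f\<close>; the finitely many others tend to zero.\<close>

lemma wsq_multiplier_tendsto:
  assumes f: "f \<in> wdom \<omega>" and \<omega>: "\<And>n. 0 \<le> \<omega> n" and g: "\<And>k. g k \<in> wdom \<omega>"
    and eq: "\<And>k n. fourier (g k) n = of_real (\<rho> k n) * fourier f n"
    and \<rho>: "\<And>k n. 0 \<le> \<rho> k n" "\<And>k n. \<rho> k n \<le> 1" "\<And>n. (\<lambda>k. \<rho> k n) \<longlonglongrightarrow> 1"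
  shows "(\<lambda>k. wsq \<omega> (\<lambda>\<theta>. g k \<theta> - f \<theta>)) \<longlonglongrightarrow> 0"
proof (rule tendstoI)
  fix e :: real assume e: "e > 0"
  define h where "h n = \<omega> n * (cmod (fourier f n))\<^sup>2" for n
  have h: "h summable_on UNIV" "\<And>n. h n \<ge> 0"
    using f \<omega> by (auto simp: h_def[abs_def] wdom_def)
  define d where "d k n = (\<rho> k n - 1)\<^sup>2 * h n" for k n
  have c: "fourier (\<lambda>\<theta>. g k \<theta> - f \<theta>) n = of_real (\<rho> k n - 1) * fourier f n" for k n
    using fourier_diff[OF wdom_integrable[OF g] wdom_integrable[OF f]] by (simp add: eq algebra_simps)
  have w: "wsq \<omega> (\<lambda>\<theta>. g k \<theta> - f \<theta>) = infsum (d k) UNIV" for k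
    unfolding wsq_def c by (simp add: norm_mult power_mult_distrib d_def[abs_def] h_def mult_ac del: of_real_diff)
  have dh: "0 \<le> d k n" "d k n \<le> h n" for k n
    using \<rho>(1,2)[of k n] h(2)[of n] by (auto simp: d_def abs_square_le_1 intro!: mult_left_le_one_le)
  have ds: "d k summable_on A" for k A
    using summable_on_subset_banach[OF summable_on_comparison_test[OF h(1), of "d k"]] dh by blast
  have "(\<lambda>N. infsum h UNIV - (\<Sum>n\<in>{- int N..int N}. h n)) \<longlonglongrightarrow> infsum h UNIV - infsum h UNIV"
    by (intro tendsto_diff tendsto_const has_sum_tendsto_symmetric has_sum_infsum h)
  then have "\<forall>\<^sub>F N in sequentially. infsum h UNIV - (\<Sum>n\<in>{- int N..int N}. h n) < e / 2"
    using e by (intro order_tendstoD(2)) auto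
  then obtain N where N: "infsum h UNIV - (\<Sum>n\<in>{- int N..int N}. h n) < e / 2"
    by (auto simp: eventually_sequentially)
  have le: "infsum (d k) UNIV \<le> (\<Sum>n\<in>{- int N..int N}. d k n) + e / 2" for k
  proof -
    have "infsum (d k) UNIV = (\<Sum>n\<in>{- int N..int N}. d k n) + infsum (d k) (UNIV - {- int N..int N})"
      using infsum_Diff[OF ds ds, of "{- int N..int N}" UNIV k] by simp
    also have "infsum (d k) (UNIV - {- int N..int N}) \<le> infsum h (UNIV - {- int N..int N})"
      by (intro infsum_mono ds dh summable_on_subset_banach[OF h(1)]) auto
    also have "\<dots> = infsum h UNIV - (\<Sum>n\<in>{- int N..int N}. h n)"
      using infsum_Diff[OF h(1), of "{- int N..int N}"] by simp
    finally show ?thesis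
      using N by simp
  qed
  have "(\<lambda>k. \<Sum>n\<in>{- int N..int N}. d k n) \<longlonglongrightarrow> (\<Sum>n\<in>{- int N..int N}. (1 - 1)\<^sup>2 * h n)"
    unfolding d_def by (intro tendsto_intros \<rho>)
  then have "\<forall>\<^sub>F k in sequentially. (\<Sum>n\<in>{- int N..int N}. d k n) < e / 2"
    using e by (intro order_tendstoD(2)) auto
  then show "\<forall>\<^sub>F k in sequentially. dist (wsq \<omega> (\<lambda>\<theta>. g k \<theta> - f \<theta>)) 0 < e"
  proof eventually_elim
    case (elim k)
    then show ?case
      using le[of k] infsum_nonneg[of UNIV "d k"] dh(1) by (simp add: w)
  qed
qed

lemma symmetric_interval_Suc:
  "{- int (Suc N)..int (Suc N)} = insert (int (Suc N)) (insert (- int (Suc N)) {- int N..int N})"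
  by auto

lemma sum_symmetric_interval:
  fixes g :: "int \<Rightarrow> real"
  shows "(\<Sum>n\<in>{- int N..int N}. g n) = g 0 + (\<Sum>j\<in>{1..N}. g (int j) + g (- int j))"
proof (induction N)
  case (Suc N)
  then show ?case
    unfolding symmetric_interval_Suc by (subst sum.insert, simp, simp)+ simp
qed simp

text \<open>The right side is the squared modulus of the sum of \<open>cis (k * x)\<close> over
  \<open>k \<le> N\<close>; expanding it, the frequency \<open>n\<close> arises from
  \<open>Suc N - \<bar>n\<bar>\<close> pairs.\<close>

lemma fejer_kernel:
  "(\<Sum>n\<in>{- int N..int N}. (real (Suc N) - \<bar>of_int n\<bar>) * cos (of_int n * x)) =
    (\<Sum>k\<le>N. cos (real k * x))\<^sup>2 + (\<Sum>k\<le>N. sin (real k * x))\<^sup>2"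
proof (induction N)
  case (Suc N)
  let ?A = "\<Sum>k\<le>N. cos (real k * x)" and ?B = "\<Sum>k\<le>N. sin (real k * x)"
  let ?C = "cos (real (Suc N) * x)" and ?S = "sin (real (Suc N) * x)"
  have L: "(\<Sum>n\<in>{- int N..int N}. (real (Suc N) - \<bar>of_int n\<bar>) * cos (of_int n * x)) =
      real (Suc N) + (\<Sum>j\<in>{1..N}. 2 * (real (Suc N) - real j) * cos (real j * x))" for N
    unfolding sum_symmetric_interval by (simp add: algebra_simps)
  have "(\<Sum>j\<in>{1..Suc N}. 2 * (real (Suc (Suc N)) - real j) * cos (real j * x)) =
      (\<Sum>j\<in>{1..Suc N}. 2 * (real (Suc N) - real j) * cos (real j * x)) + (\<Sum>j\<in>{1..Suc N}. 2 * cos (real j * x))"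
    by (simp add: algebra_simps flip: sum.distrib)
  also have "(\<Sum>j\<in>{1..Suc N}. 2 * (real (Suc N) - real j) * cos (real j * x)) =
      (\<Sum>j\<in>{1..N}. 2 * (real (Suc N) - real j) * cos (real j * x))"
    by simp
  finally have step: "(\<Sum>n\<in>{- int (Suc N)..int (Suc N)}. (real (Suc (Suc N)) - \<bar>of_int n\<bar>) * cos (of_int n * x)) =
      ?A\<^sup>2 + ?B\<^sup>2 + (1 + 2 * (\<Sum>j\<in>{1..Suc N}. cos (real j * x)))"
    using Suc.IH unfolding L by (simp add: sum_distrib_left)
  \<comment> \<open>By the cosine difference formula and reversal of the index, the cross terms of
    the new squares are the cosine sum by which the left side grows.\<close>
  have "?C * ?A + ?S * ?B = (\<Sum>k\<le>N. cos (real (Suc N - k) * x))"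
    unfolding sum_distrib_left sum.distrib[symmetric]
    by (intro sum.cong refl) (simp add: cos_diff left_diff_distrib of_nat_diff)
  also have "\<dots> = (\<Sum>j\<in>{1..Suc N}. cos (real j * x))"
    by (rule sum.reindex_bij_witness[where i="\<lambda>j. Suc N - j" and j="\<lambda>k. Suc N - k"]) auto
  finally have "(?A + ?C)\<^sup>2 + (?B + ?S)\<^sup>2 = ?A\<^sup>2 + ?B\<^sup>2 + (?C\<^sup>2 + ?S\<^sup>2) + 2 * (\<Sum>j\<in>{1..Suc N}. cos (real j * x))"
    by (simp only: power2_sum) (simp only: algebra_simps)
  then show ?case
    unfolding step by simp
qed simp

definition fejer_weight :: "nat \<Rightarrow> int \<Rightarrow> real" where
  "fejer_weight N n = 1 - \<bar>of_int n\<bar> / real (Suc N)"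

definition fejer :: "nat \<Rightarrow> (real \<Rightarrow> real) \<Rightarrow> real \<Rightarrow> real" where
  "fejer N f = trig N (\<lambda>n. of_real (fejer_weight N n) * fourier f n)"

lemma fejer_coeffs_hermitian:
  "of_real (fejer_weight N (- n)) * fourier f (- n) = cnj (of_real (fejer_weight N n) * fourier f n)"
  by (simp add: fejer_weight_def fourier_uminus_index)

lemma fourier_fejer:
  "fourier (fejer N f) n = of_real (if \<bar>n\<bar> \<le> int N then fejer_weight N n else 0) * fourier f n"
  unfolding fejer_def
  by (simp add: fourier_trig[of "\<lambda>n. of_real (fejer_weight N n) * fourier f n", OF fejer_coeffs_hermitian])

lemma fejer_weight_bounds:
  assumes "\<bar>n\<bar> \<le> int N"
  shows "0 \<le> fejer_weight N n" "fejer_weight N n \<le> 1"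
  using assms by (auto simp: fejer_weight_def field_simps)

lemma fejer_weight_tendsto: "(\<lambda>N. if \<bar>n\<bar> \<le> int N then fejer_weight N n else 0) \<longlonglongrightarrow> 1"
proof (rule Lim_transform_eventually)
  have "(\<lambda>N. 1 - \<bar>of_int n\<bar> * (1 / real (Suc N))) \<longlonglongrightarrow> 1 - \<bar>of_int n\<bar> * 0"
    by (intro tendsto_intros LIMSEQ_Suc lim_1_over_n)
  then show "(\<lambda>N. fejer_weight N n) \<longlonglongrightarrow> 1"
    by (simp add: fejer_weight_def)
  show "\<forall>\<^sub>F N in sequentially. fejer_weight N n = (if \<bar>n\<bar> \<le> int N then fejer_weight N n else 0)"
    by (rule eventually_sequentiallyI[of "nat \<bar>n\<bar>"]) auto
qed

lemma fejer_wdom: "fejer N f \<in> wdom \<omega>"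
  unfolding fejer_def by (rule trig_wdom) (rule fejer_coeffs_hermitian)

lemma wsq_fejer_tendsto:
  assumes "f \<in> wdom \<omega>" "\<And>n. 0 \<le> \<omega> n"
  shows "(\<lambda>N. wsq \<omega> (\<lambda>\<theta>. fejer N f \<theta> - f \<theta>)) \<longlonglongrightarrow> 0"
  by (rule wsq_multiplier_tendsto[OF assms fejer_wdom fourier_fejer])
    (auto simp: fejer_weight_bounds intro: fejer_weight_tendsto)

lemma wsq_fejer_le:
  assumes f: "f \<in> wdom \<omega>" and \<omega>: "\<And>n. 0 \<le> \<omega> n"
  shows "wsq \<omega> (fejer N f) \<le> wsq \<omega> f"
  unfolding wsq_def
proof (rule infsum_mono)
  show "(\<lambda>n. \<omega> n * (cmod (fourier (fejer N f) n))\<^sup>2) summable_on UNIV"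
    using fejer_wdom[of N f \<omega>] by (simp add: wdom_def)
  show "(\<lambda>n. \<omega> n * (cmod (fourier f n))\<^sup>2) summable_on UNIV"
    using f by (simp add: wdom_def)
  show "\<omega> n * (cmod (fourier (fejer N f) n))\<^sup>2 \<le> \<omega> n * (cmod (fourier f n))\<^sup>2" for n
    unfolding fourier_fejer norm_mult
    by (intro mult_left_mono \<omega> power_mono mult_left_le_one_le) (auto simp: fejer_weight_bounds)
qed

lemma fourier_const: "fourier (\<lambda>_. 1) n = (if n = 0 then 1 else 0)"
  using integral_cis_circle[of "- n"] by (simp add: fourier_def)

text \<open>Fejer means are averages against the nonnegative Fejer kernel, so they obey the same bound.\<close>

lemma fejer_bound:
  assumes f: "f \<in> L2_circle" and C: "\<And>\<theta>. \<bar>f \<theta>\<bar> \<le> C"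
  shows "\<bar>fejer N f \<theta>\<bar> \<le> C"
proof -
  \<comment> \<open>Coefficients of the Fejer kernel centred at \<open>\<theta>\<close>, so that the
    mean at this angle is the integral of \<open>f\<close> against \<open>trig N c\<close>.\<close>
  define c where "c n = complex_of_real (fejer_weight N n) * cis (- (of_int n * \<theta>))" for n
  have K: "trig N c t = ((\<Sum>k\<le>N. cos (real k * (t - \<theta>)))\<^sup>2 + (\<Sum>k\<le>N. sin (real k * (t - \<theta>)))\<^sup>2) / real (Suc N)" for t
  proof -
    have "c n * cis (of_int n * t) = of_real (fejer_weight N n) * cis (of_int n * (t - \<theta>))" for n
      by (simp add: c_def mult.assoc cis_mult algebra_simps)
    then have "trig N c t = (\<Sum>n\<in>{- int N..int N}. fejer_weight N n * cos (of_int n * (t - \<theta>)))"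
      by (simp add: trig_def)
    also have "\<dots> = (\<Sum>n\<in>{- int N..int N}. (real (Suc N) - \<bar>of_int n\<bar>) * cos (of_int n * (t - \<theta>))) / real (Suc N)"
      unfolding sum_divide_distrib by (intro sum.cong refl) (simp add: fejer_weight_def field_simps)
    finally show ?thesis
      unfolding fejer_kernel .
  qed
  have pos: "0 \<le> trig N c t" for t
    unfolding K by simp
  have i: "integrable circle (\<lambda>t. f t * trig N c t)" "integrable circle (trig N c)"
    using L2_circle_integrable_mult[OF f trig_L2] L2_circleD(4)[OF trig_L2] by blast+
  have "Re (cnj (fourier f n) * c n) = Re (of_real (fejer_weight N n) * fourier f n * cis (of_int n * \<theta>))" for n
    by (simp add: c_def algebra_simps)
  then have "2 * pi * fejer N f \<theta> = (LINT t|circle. f t * trig N c t)"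
    unfolding integral_mult_trig[OF L2_circleD(4)[OF f]] by (simp only: fejer_def trig_def Re_sum)
  also have "\<bar>\<dots>\<bar> \<le> (LINT t|circle. C * trig N c t)"
  proof (rule order_trans[OF integral_abs_bound integral_mono])
    show "\<bar>f t * trig N c t\<bar> \<le> C * trig N c t" for t
      using C[of t] pos[of t] by (simp add: abs_mult mult_right_mono)
  qed (use i in auto)
  also have "\<dots> = C * (2 * pi)"
  proof -
    have "(LINT t|circle. 1 * trig N c t) = 2 * pi * (\<Sum>n\<in>{- int N..int N}. Re (cnj (fourier (\<lambda>_. 1) n) * c n))"
      by (rule integral_mult_trig[OF L2_circleD(4)[OF L2_circle_const]])
    also have "\<dots> = 2 * pi * (\<Sum>n\<in>{- int N..int N}. if n = 0 then 1 else 0)"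
      by (intro arg_cong[where f="(*) (2 * pi)"] sum.cong refl) (simp add: fourier_const c_def fejer_weight_def)
    finally show ?thesis
      using i by simp
  qed
  finally show ?thesis
    by (simp add: abs_mult)
qed

section \<open>Smoothness of trigonometric polynomials\<close>

lemma trig_has_vector_derivative:
  "(trig N c has_vector_derivative trig N (\<lambda>n. \<i> * of_int n * c n) \<theta>) (at \<theta>)"
proof -
  have "((\<lambda>x. c n * cis (of_int n * x)) has_vector_derivative \<i> * of_int n * c n * cis (of_int n * \<theta>)) (at \<theta>)" for n
  proof -
    have "((\<lambda>x. c n * exp (\<i> * of_int n * of_real x)) has_vector_derivative
        c n * (\<i> * of_int n * exp (\<i> * of_int n * of_real \<theta>))) (at \<theta>)"
      by (auto intro!: derivative_eq_intros has_vector_derivative_real_field)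
    then show ?thesis
      by (simp add: cis_conv_exp mult_ac)
  qed
  then have "((\<lambda>x. \<Sum>n\<in>{- int N..int N}. c n * cis (of_int n * x)) has_vector_derivative
      (\<Sum>n\<in>{- int N..int N}. \<i> * of_int n * c n * cis (of_int n * \<theta>))) (at \<theta>)"
    by (intro has_vector_derivative_sum)
  from bounded_linear.has_vector_derivative[OF bounded_linear_Re this] show ?thesis
    by (simp only: trig_def[abs_def])
qed

lemma ddth_trig: "ddth (trig N c) = trig N (\<lambda>n. \<i> * of_int n * c n)"
  unfolding ddth_def by (intro ext vector_derivative_at trig_has_vector_derivative)

lemma trig_smooth: "trig N c \<in> smooth_circle"
proof -
  have "\<exists>c'. (ddth ^^ k) (trig N c) = trig N c'" for k
    by (induction k) (auto simp: ddth_trig)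
  then show ?thesis
    using trig_periodic differentiableI_vector[OF trig_has_vector_derivative]
    unfolding smooth_circle_def mem_Collect_eq by metis
qed

section \<open>Weak continuity on the half Sobolev space\<close>

lemma wsq_1_bounded_mult:
  assumes f: "f \<in> L2_circle" and g: "g \<in> borel_measurable circle" "\<And>\<theta>. g (\<theta> + 2 * pi) = g \<theta>"
    "\<And>\<theta>. \<bar>g \<theta>\<bar> \<le> C"
  shows "wsq (\<lambda>_. 1) (\<lambda>\<theta>. g \<theta> * f \<theta>) \<le> C\<^sup>2 * wsq (\<lambda>_. 1) f"
proof -
  have gf: "(\<lambda>\<theta>. g \<theta> * f \<theta>) \<in> L2_circle"
    by (rule L2_circle_bounded_mult[OF f g])
  have "2 * pi * wsq (\<lambda>_. 1) (\<lambda>\<theta>. g \<theta> * f \<theta>) = (LINT \<theta>|circle. (g \<theta> * f \<theta>)\<^sup>2)"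
    by (rule wsq_1[OF gf])
  also have "\<dots> \<le> (LINT \<theta>|circle. C\<^sup>2 * (f \<theta>)\<^sup>2)"
  proof (rule integral_mono)
    show "(g \<theta> * f \<theta>)\<^sup>2 \<le> C\<^sup>2 * (f \<theta>)\<^sup>2" for \<theta>
      unfolding power_mult_distrib using power_mono[OF g(3)[of \<theta>], of 2] by (intro mult_right_mono) auto
  qed (use L2_circleD(3)[OF f] L2_circleD(3)[OF gf] in auto)
  also have "\<dots> = 2 * pi * (C\<^sup>2 * wsq (\<lambda>_. 1) f)"
    using wsq_1[OF f] by (simp add: mult.left_commute)
  finally show ?thesis
    by (rule mult_left_le_imp_le) simp
qed

text \<open>An H^(1/2) bound with L^2 convergence amounts to weak convergence in H^(1/2). Replacing
  \<open>g\<close> by a partial sum costs little, uniformly in \<open>k\<close>, thanks to the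
  bound; against a partial sum only finitely many frequencies matter, and there L^2 convergence is
  enough.\<close>

lemma mform_half_weak:
  assumes m: "\<And>n. cmod (m n) \<le> wabs n"
    and f: "\<forall>\<^sub>F k in F. f k \<in> wdom wabs \<and> wsq wabs (f k) \<le> C" "f0 \<in> wdom wabs"
      "((\<lambda>k. wsq (\<lambda>_. 1) (\<lambda>\<theta>. f k \<theta> - f0 \<theta>)) \<longlongrightarrow> 0) F"
    and g: "g \<in> wdom wabs"
  shows "((\<lambda>k. mform m (f k) g) \<longlongrightarrow> mform m f0 g) F"
proof (rule tendstoI)
  fix e :: real assume e: "e > 0"
  \<comment> \<open>Bound for \<open>f k - f0\<close> in H^(1/2), times the constant of
    Cauchy-Schwarz. The absolute value keeps the radicand nonnegative when \<open>F\<close> is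
    trivial and \<open>C\<close> arbitrary.\<close>
  define D where "D = 2 * pi * sqrt (2 * \<bar>C\<bar> + 2 * wsq wabs f0)"
  have D: "D \<ge> 0"
    by (simp add: D_def wsq_nonneg)
  have w: "\<And>n. 0 \<le> wabs n"
    by simp
  have "(\<lambda>N. D * sqrt (wsq wabs (\<lambda>\<theta>. trig N (fourier g) \<theta> - g \<theta>))) \<longlonglongrightarrow> D * sqrt 0"
    by (intro tendsto_intros wsq_partial_sums_tendsto g) simp
  then have "\<forall>\<^sub>F N in sequentially. D * sqrt (wsq wabs (\<lambda>\<theta>. trig N (fourier g) \<theta> - g \<theta>)) < e / 2"
    using e by (intro order_tendstoD(2)) auto
  then obtain N where N: "D * sqrt (wsq wabs (\<lambda>\<theta>. trig N (fourier g) \<theta> - g \<theta>)) < e / 2"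
    by (auto simp: eventually_sequentially)
  define gN where "gN = trig N (fourier g)"
  have gN: "gN \<in> wdom \<omega>" for \<omega>
    unfolding gN_def by (rule trig_wdom) (rule fourier_uminus_index)
  \<comment> \<open>Cutting the symbol at \<open>N\<close> leaves the form with \<open>gN\<close>
    unchanged and makes it bounded by the constant weight \<open>N\<close>.\<close>
  define m' where "m' n = (if \<bar>n\<bar> \<le> int N then m n else 0)" for n
  have m': "cmod (m' n) \<le> real N" for n
    using m[of n] by (auto simp: m'_def)
  have trunc: "mform m h gN = mform m' h gN" for h
    by (rule mform_weight_cong) (simp add: m'_def gN_def fourier_trig[of "fourier g", OF fourier_uminus_index])
  define E where "E = 2 * pi * (sqrt (real N) * sqrt (wsq (\<lambda>_. real N) gN))"
  have low: "\<bar>mform m h gN\<bar> \<le> E * sqrt (wsq (\<lambda>_. 1) h)" if "h \<in> L2_circle" for h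
  proof -
    have h: "h \<in> wdom (\<lambda>_. real N)" "wsq (\<lambda>_. real N) h \<le> real N * wsq (\<lambda>_. 1) h"
      using wdom_mono[of h "\<lambda>_. 1" "\<lambda>_. real N" "real N"] that by (auto simp: wdom_1)
    have "\<bar>mform m' h gN\<bar> \<le> 2 * pi * (sqrt (wsq (\<lambda>_. real N) h) * sqrt (wsq (\<lambda>_. real N) gN))"
      by (rule mform_summable_bound(2)[OF _ m' h(1) gN]) simp
    also have "\<dots> \<le> 2 * pi * (sqrt (real N * wsq (\<lambda>_. 1) h) * sqrt (wsq (\<lambda>_. real N) gN))"
      using h(2) by (intro mult_left_mono mult_right_mono real_sqrt_le_mono) (auto simp: wsq_nonneg)
    finally show ?thesis
      by (simp add: trunc E_def real_sqrt_mult mult_ac)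
  qed
  have "((\<lambda>k. E * sqrt (wsq (\<lambda>_. 1) (\<lambda>\<theta>. f k \<theta> - f0 \<theta>))) \<longlongrightarrow> E * sqrt 0) F"
    by (intro tendsto_intros f)
  then have "\<forall>\<^sub>F k in F. E * sqrt (wsq (\<lambda>_. 1) (\<lambda>\<theta>. f k \<theta> - f0 \<theta>)) < e / 2"
    using e by (intro order_tendstoD(2)) auto
  then show "\<forall>\<^sub>F k in F. dist (mform m (f k) g) (mform m f0 g) < e"
    using f(1)
  proof eventually_elim
    case (elim k)
    let ?h = "\<lambda>\<theta>. f k \<theta> - f0 \<theta>" and ?r = "\<lambda>\<theta>. gN \<theta> - g \<theta>"
    have h: "?h \<in> wdom wabs" "wsq wabs ?h \<le> 2 * \<bar>C\<bar> + 2 * wsq wabs f0"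
      using wdom_diff[of wabs "f k" f0] elim f(2) by (auto intro: order_trans)
    have r: "?r \<in> wdom wabs"
      by (rule wdom_diff(1)[of wabs, OF w gN g])
    have "mform m (f k) g - mform m f0 g = mform m ?h gN - mform m ?h ?r"
      using mform_diff_left[of wabs m, OF w m _ f(2) g, of "f k"] elim
        mform_diff_right[of wabs m, OF w m h(1) gN g] by simp
    moreover have "\<bar>mform m ?h ?r\<bar> \<le> D * sqrt (wsq wabs ?r)"
    proof -
      have "\<bar>mform m ?h ?r\<bar> \<le> 2 * pi * (sqrt (wsq wabs ?h) * sqrt (wsq wabs ?r))"
        by (rule mform_summable_bound(2)[of wabs, OF w m h(1) r])
      also have "\<dots> \<le> 2 * pi * (sqrt (2 * \<bar>C\<bar> + 2 * wsq wabs f0) * sqrt (wsq wabs ?r))"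
        using h(2) by (intro mult_left_mono mult_right_mono real_sqrt_le_mono) (auto simp: wsq_nonneg)
      finally show ?thesis
        by (simp add: D_def mult_ac)
    qed
    moreover have "\<bar>mform m ?h gN\<bar> \<le> E * sqrt (wsq (\<lambda>_. 1) ?h)"
      by (rule low[OF wdom_L2[OF h(1)]])
    ultimately show ?case
      using elim N unfolding gN_def[symmetric] dist_real_def by linarith
  qed
qed

text \<open>Smooth test functions may be replaced by bounded \<open>H\<^bsup>1/2\<^esup>\<close> ones: the Fejer means stay bounded
  in \<open>L\<^sup>\<infinity> \<inter> H\<^bsup>1/2\<^esup>\<close>, hence so do their products with \<open>A j\<close>.\<close>

lemma mform_half_test_extend:
  assumes m: "\<And>n. cmod (m n) \<le> wabs n"
    and A: "\<And>j. j \<in> J \<Longrightarrow> A j \<in> wdom wabs" "\<And>j \<theta>. j \<in> J \<Longrightarrow> \<bar>A j \<theta>\<bar> \<le> B"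
    and g: "\<And>j. j \<in> J \<Longrightarrow> g j \<in> wdom wabs"
    and f: "f \<in> wdom wabs" "\<And>\<theta>. \<bar>f \<theta>\<bar> \<le> C"
    and zero: "\<And>\<phi>. \<phi> \<in> smooth_circle \<Longrightarrow> (\<Sum>j\<in>J. mform m (\<lambda>\<theta>. \<phi> \<theta> * A j \<theta>) (g j)) = 0"
  shows "(\<Sum>j\<in>J. mform m (\<lambda>\<theta>. f \<theta> * A j \<theta>) (g j)) = 0"
proof -
  have "(\<lambda>k. mform m (\<lambda>\<theta>. fejer k f \<theta> * A j \<theta>) (g j)) \<longlonglongrightarrow> mform m (\<lambda>\<theta>. f \<theta> * A j \<theta>) (g j)"
    if j: "j \<in> J" for j
  proof (rule mform_half_weak[OF m])
    let ?K = "half_const * (2 * C\<^sup>2 * wsq wabs (A j) + 2 * B\<^sup>2 * wsq wabs f)"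
    show "\<forall>\<^sub>F k in sequentially. (\<lambda>\<theta>. fejer k f \<theta> * A j \<theta>) \<in> wdom wabs \<and> wsq wabs (\<lambda>\<theta>. fejer k f \<theta> * A j \<theta>) \<le> ?K"
    proof (intro always_eventually allI conjI)
      fix k
      note p = wdom_half_mult[OF fejer_wdom fejer_bound[OF wdom_L2[OF f(1)] f(2)] A(1)[OF j] A(2)[OF j], of k]
      show "(\<lambda>\<theta>. fejer k f \<theta> * A j \<theta>) \<in> wdom wabs"
        by (rule p(1))
      note p(2)
      also have "half_const * (2 * C\<^sup>2 * wsq wabs (A j) + 2 * B\<^sup>2 * wsq wabs (fejer k f)) \<le> ?K"
        using half_const_pos wsq_fejer_le[OF f(1)] by (intro mult_left_mono add_left_mono) auto
      finally show "wsq wabs (\<lambda>\<theta>. fejer k f \<theta> * A j \<theta>) \<le> ?K" .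
    qed
    show "(\<lambda>\<theta>. f \<theta> * A j \<theta>) \<in> wdom wabs"
      by (rule wdom_half_mult(1)[OF f A(1)[OF j] A(2)[OF j]])
    note AL = L2_circleD[OF wdom_L2[OF A(1)[OF j]]] and fL = wdom_L2[OF f(1)] wdom_L2[OF fejer_wdom]
    show "(\<lambda>k. wsq (\<lambda>_. 1) (\<lambda>\<theta>. fejer k f \<theta> * A j \<theta> - f \<theta> * A j \<theta>)) \<longlonglongrightarrow> 0"
    proof (rule Lim_null_comparison)
      show "(\<lambda>k. B\<^sup>2 * wsq (\<lambda>_. 1) (\<lambda>\<theta>. fejer k f \<theta> - f \<theta>)) \<longlonglongrightarrow> 0"
        using fL(1) by (intro tendsto_mult_right_zero wsq_fejer_tendsto) (auto simp: wdom_1)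
      have "wsq (\<lambda>_. 1) (\<lambda>\<theta>. A j \<theta> * (fejer k f \<theta> - f \<theta>)) \<le> B\<^sup>2 * wsq (\<lambda>_. 1) (\<lambda>\<theta>. fejer k f \<theta> - f \<theta>)" for k
        by (rule wsq_1_bounded_mult[OF L2_circle_diff[OF fL(2) fL(1)] AL(2,1) A(2)[OF j]])
      then show "\<forall>\<^sub>F k in sequentially. norm (wsq (\<lambda>_. 1) (\<lambda>\<theta>. fejer k f \<theta> * A j \<theta> - f \<theta> * A j \<theta>)) \<le>
          B\<^sup>2 * wsq (\<lambda>_. 1) (\<lambda>\<theta>. fejer k f \<theta> - f \<theta>)"
        by (intro always_eventually allI) (simp add: wsq_nonneg algebra_simps)
    qed
  qed (rule g[OF j])
  then have "(\<lambda>k. \<Sum>j\<in>J. mform m (\<lambda>\<theta>. fejer k f \<theta> * A j \<theta>) (g j)) \<longlonglongrightarrow> (\<Sum>j\<in>J. mform m (\<lambda>\<theta>. f \<theta> * A j \<theta>) (g j))"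
    by (rule tendsto_sum)
  moreover have "(\<Sum>j\<in>J. mform m (\<lambda>\<theta>. fejer k f \<theta> * A j \<theta>) (g j)) = 0" for k
    unfolding fejer_def by (intro zero trig_smooth)
  ultimately show ?thesis
    by (simp add: LIMSEQ_const_iff)
qed

section \<open>Vector valued functions\<close>

lemma sum_Basis_vec:
  fixes g :: "'a::euclidean_space^'m \<Rightarrow> 'b::comm_monoid_add"
  shows "(\<Sum>b\<in>Basis. g b) = (\<Sum>i\<in>UNIV. \<Sum>u\<in>Basis. g (axis i u))"
proof -
  have eq: "(Basis :: ('a^'m) set) = (\<lambda>(i, u). axis i u) ` (UNIV \<times> Basis)"
    by (auto simp: Basis_vec_def)
  have inj: "inj_on (\<lambda>(i, u). axis i u :: 'a^'m) (UNIV \<times> Basis)"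
    by (auto simp: inj_on_def axis_eq_axis)
  show ?thesis
    unfolding eq sum.reindex[OF inj] by (simp add: sum.cartesian_product case_prod_unfold)
qed

lemma borel_measurable_vec_iff:
  fixes f :: "'b \<Rightarrow> 'a::euclidean_space^'m"
  shows "f \<in> borel_measurable M \<longleftrightarrow> (\<forall>i. (\<lambda>x. f x $ i) \<in> borel_measurable M)"
proof
  show "\<forall>i. (\<lambda>x. f x $ i) \<in> borel_measurable M" if "f \<in> borel_measurable M"
  proof
    fix i
    have "(\<lambda>v::'a^'m. v $ i) \<in> borel_measurable borel"
      by (intro borel_measurable_continuous_onI continuous_intros)
    then show "(\<lambda>x. f x $ i) \<in> borel_measurable M"
      by (rule measurable_compose[OF that])
  qed
  show "f \<in> borel_measurable M" if "\<forall>i. (\<lambda>x. f x $ i) \<in> borel_measurable M"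
    unfolding borel_measurable_euclidean_space[of f M]
    using that by (auto simp: Basis_vec_def inner_axis intro!: borel_measurable_inner)
qed

lemma power2_norm_vec: "(norm (x :: 'a::real_inner^'m))\<^sup>2 = (\<Sum>i\<in>UNIV. (norm (x $ i))\<^sup>2)"
  by (simp add: power2_norm_eq_inner inner_vec_def)

lemma L2_circle_vec_iff:
  fixes f :: "real \<Rightarrow> 'a::euclidean_space^'m"
  shows "f \<in> L2_circle \<longleftrightarrow> (\<forall>i. (\<lambda>\<theta>. f \<theta> $ i) \<in> L2_circle)"
proof
  assume f: "f \<in> L2_circle"
  show "\<forall>i. (\<lambda>\<theta>. f \<theta> $ i) \<in> L2_circle"
  proof
    fix i
    have m: "(\<lambda>\<theta>. f \<theta> $ i) \<in> borel_measurable circle"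
      using f borel_measurable_vec_iff[of f circle] by (auto simp: L2_circle_def)
    have "integrable circle (\<lambda>\<theta>. (norm (f \<theta> $ i))\<^sup>2)"
    proof (rule Bochner_Integration.integrable_bound)
      show "integrable circle (\<lambda>\<theta>. (norm (f \<theta>))\<^sup>2)"
        using f by (simp add: L2_circle_def)
      show "AE \<theta> in circle. norm ((norm (f \<theta> $ i))\<^sup>2) \<le> norm ((norm (f \<theta>))\<^sup>2)"
        by (simp add: power_mono Finite_Cartesian_Product.norm_nth_le)
    qed (use m in measurable)
    then show "(\<lambda>\<theta>. f \<theta> $ i) \<in> L2_circle"
      using f m by (simp add: L2_circle_def)
  qed
next
  assume f: "\<forall>i. (\<lambda>\<theta>. f \<theta> $ i) \<in> L2_circle"
  then have "integrable circle (\<lambda>\<theta>. \<Sum>i\<in>UNIV. (norm (f \<theta> $ i))\<^sup>2)"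
    by (intro Bochner_Integration.integrable_sum) (simp add: L2_circle_def)
  then show "f \<in> L2_circle"
    using f borel_measurable_vec_iff[of f circle] by (auto simp: L2_circle_def power2_norm_vec vec_eq_iff)
qed

lemma fourier_sq_real: "fourier_sq f n = (cmod (fourier f n))\<^sup>2"
  by (simp add: fourier_sq_def)

lemma fourier_sq_vec: "fourier_sq f n = (\<Sum>i\<in>UNIV. fourier_sq (\<lambda>\<theta>. f \<theta> $ i) n)"
  unfolding fourier_sq_def sum_Basis_vec by (simp add: inner_axis)

lemma fourier_sq_nonneg: "0 \<le> fourier_sq f n"
  unfolding fourier_sq_def by (intro sum_nonneg) simp

lemma summable_on_sum_iff:
  fixes g :: "'i \<Rightarrow> 'j \<Rightarrow> real"
  assumes "finite I" "\<And>i n. i \<in> I \<Longrightarrow> 0 \<le> g i n"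
  shows "(\<lambda>n. \<Sum>i\<in>I. g i n) summable_on A \<longleftrightarrow> (\<forall>i\<in>I. g i summable_on A)"
proof
  assume s: "(\<lambda>n. \<Sum>i\<in>I. g i n) summable_on A"
  show "\<forall>i\<in>I. g i summable_on A"
    using assms by (auto intro!: summable_on_comparison_test[OF s] member_le_sum)
next
  show "\<forall>i\<in>I. g i summable_on A \<Longrightarrow> (\<lambda>n. \<Sum>i\<in>I. g i n) summable_on A"
    using assms(1) by (induction I) (auto intro: summable_on_add)
qed

lemma infsum_sum:
  fixes g :: "'i \<Rightarrow> 'j \<Rightarrow> real"
  assumes "finite I" "\<And>i. i \<in> I \<Longrightarrow> g i summable_on A"
  shows "(\<lambda>n. \<Sum>i\<in>I. g i n) summable_on A \<and> infsum (\<lambda>n. \<Sum>i\<in>I. g i n) A = (\<Sum>i\<in>I. infsum (g i) A)"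
  using assms
proof (induction I)
  case (insert j I)
  then show ?case
    using infsum_add[of "g j" A "\<lambda>n. \<Sum>i\<in>I. g i n"] summable_on_add[of "g j" A "\<lambda>n. \<Sum>i\<in>I. g i n"] by auto
qed simp

section \<open>The half Sobolev space in coordinates\<close>

abbreviation wbessel :: "int \<Rightarrow> real" where
  "wbessel n \<equiv> (1 + (of_int n)\<^sup>2) powr (1/2)"

lemma wbessel_bounds: "0 \<le> wbessel n" "1 \<le> wbessel n" "wabs n \<le> wbessel n" "wbessel n \<le> 1 + wabs n"
proof -
  have eq: "wbessel n = sqrt (1 + (of_int n)\<^sup>2)"
    by (simp add: powr_half_sqrt)
  show "0 \<le> wbessel n" "1 \<le> wbessel n"
    unfolding eq by auto
  show "wabs n \<le> wbessel n"
    unfolding eq by (rule real_le_rsqrt) simp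
  show "wbessel n \<le> 1 + wabs n"
    unfolding eq by (rule real_le_lsqrt) (auto simp: power2_sum)
qed

lemma H_half_vec_iff: "f \<in> H_half \<longleftrightarrow> (\<forall>i. (\<lambda>\<theta>. f \<theta> $ i) \<in> H_half)"
proof -
  have "(\<lambda>n. wbessel n * fourier_sq f n) summable_on UNIV \<longleftrightarrow>
      (\<forall>i. (\<lambda>n. wbessel n * fourier_sq (\<lambda>\<theta>. f \<theta> $ i) n) summable_on UNIV)"
    unfolding fourier_sq_vec[of f] sum_distrib_left
    by (subst summable_on_sum_iff) (auto simp: fourier_sq_nonneg)
  then show ?thesis
    using L2_circle_vec_iff[of f] by (auto simp: H_half_def)
qed

lemma H_half_real_wbessel: "f \<in> H_half \<longleftrightarrow> f \<in> wdom wbessel"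
  by (simp add: H_half_def wdom_def fourier_sq_real)

text \<open>The homogeneous weight loses the mean and the L^2 part of the norm, but Bessel restores
  both from square integrability.\<close>

lemma H_half_real_iff: "f \<in> H_half \<longleftrightarrow> f \<in> wdom wabs"
proof
  assume f: "f \<in> H_half"
  show "f \<in> wdom wabs"
    using wdom_mono(1)[OF f[unfolded H_half_real_wbessel], of wabs 1] wbessel_bounds by simp
next
  assume f: "f \<in> wdom wabs"
  have "(\<lambda>n. (cmod (fourier f n))\<^sup>2 + wabs n * (cmod (fourier f n))\<^sup>2) summable_on UNIV"
    using f Bessel_summable[OF wdom_L2[OF f]] by (intro summable_on_add) (auto simp: wdom_def)
  then have "f \<in> wdom (\<lambda>n. 1 + wabs n)"
    using f by (simp add: wdom_def ring_distribs)
  then show "f \<in> H_half"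
    unfolding H_half_real_wbessel by (rule wdom_mono(1)[where K=1]) (use wbessel_bounds in auto)
qed

lemma H_half_vec: "f \<in> H_half \<longleftrightarrow> (\<forall>i. (\<lambda>\<theta>. f \<theta> $ i) \<in> wdom wabs)" for f :: "real \<Rightarrow> real^'m"
  unfolding H_half_vec_iff[of f] H_half_real_iff ..

text \<open>Used for the weights 1 and |n|: convergence of a path in the norm gives convergence of
  every component in L^2 and in the seminorm.\<close>

lemma H_half_norm_ge:
  fixes u :: "real \<Rightarrow> real^'m"
  assumes u: "u \<in> H_half" and \<omega>: "\<And>n. 0 \<le> \<omega> n" "\<And>n. \<omega> n \<le> wbessel n"
  shows "wsq \<omega> (\<lambda>\<theta>. u \<theta> $ i) \<le> (H_half_norm u)\<^sup>2"
proof -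
  have w: "(\<lambda>\<theta>. u \<theta> $ j) \<in> wdom wbessel" for j
    using u by (simp add: H_half_vec_iff[of u] H_half_real_wbessel)
  have s: "(\<Sum>\<^sub>\<infinity>n. wbessel n * fourier_sq u n) = (\<Sum>j\<in>UNIV. wsq wbessel (\<lambda>\<theta>. u \<theta> $ j))"
    unfolding fourier_sq_vec[of u] sum_distrib_left fourier_sq_real wsq_def
    using infsum_sum[of UNIV "\<lambda>j n. wbessel n * (cmod (fourier (\<lambda>\<theta>. u \<theta> $ j) n))\<^sup>2" UNIV] w
    by (auto simp: wdom_def)
  have nn: "0 \<le> wsq wbessel (\<lambda>\<theta>. u \<theta> $ j)" for j
    by (intro wsq_nonneg wbessel_bounds)
  have "wsq \<omega> (\<lambda>\<theta>. u \<theta> $ i) \<le> wsq wbessel (\<lambda>\<theta>. u \<theta> $ i)"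
    using wdom_mono(2)[OF w[of i], of \<omega> 1] \<omega> by simp
  also have "\<dots> \<le> (\<Sum>j\<in>UNIV. wsq wbessel (\<lambda>\<theta>. u \<theta> $ j))"
    using nn by (intro member_le_sum) auto
  also have "\<dots> = (H_half_norm u)\<^sup>2"
    using sum_nonneg[of UNIV "\<lambda>j. wsq wbessel (\<lambda>\<theta>. u \<theta> $ j)"] nn by (simp add: H_half_norm_def s)
  finally show ?thesis .
qed

lemma integrable_vec_component:
  fixes F :: "'b \<Rightarrow> 'a::euclidean_space^'m"
  assumes "integrable M F"
  shows "integrable M (\<lambda>x. F x $ i)" "(\<integral>x. F x $ i \<partial>M) = (\<integral>x. F x \<partial>M) $ i"
  using integrable_bounded_linear[OF bounded_linear_vec_nth assms]
    integral_bounded_linear[OF bounded_linear_vec_nth assms] by blast+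

lemma L2_circle_integrable:
  fixes f :: "real \<Rightarrow> 'a::euclidean_space"
  assumes "f \<in> L2_circle"
  shows "integrable circle f"
proof (rule Bochner_Integration.integrable_bound)
  show "integrable circle (\<lambda>\<theta>. 1 + (norm (f \<theta>))\<^sup>2)"
    using assms finite_measure.integrable_const[OF finite_measure_circle] by (simp add: L2_circle_def)
  show "AE \<theta> in circle. norm (f \<theta>) \<le> norm (1 + (norm (f \<theta>))\<^sup>2)"
  proof (intro AE_I2)
    fix \<theta>
    have "2 * norm (f \<theta>) * 1 \<le> (norm (f \<theta>))\<^sup>2 + 1\<^sup>2"
      by (rule sum_squares_bound)
    then have "2 * norm (f \<theta>) \<le> (norm (f \<theta>))\<^sup>2 + 1"
      by simp
    moreover have "norm (1 + (norm (f \<theta>))\<^sup>2) = 1 + (norm (f \<theta>))\<^sup>2"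
      by simp
    ultimately show "norm (f \<theta>) \<le> norm (1 + (norm (f \<theta>))\<^sup>2)"
      using norm_ge_zero[of "f \<theta>"] by linarith
  qed
qed (use assms in \<open>simp add: L2_circle_def\<close>)

section \<open>Distributions and their Fourier coefficients\<close>

text \<open>A distribution carries information only on smooth functions, so the cosines and sines
  evaluated by \<open>dist_fourier\<close> must be known to be smooth. This is kept as the premise
  \<open>cs\<close> and discharged in \<open>dist_fourier_eq\<close>.\<close>

lemma dist_fourier_eq_fourier:
  assumes f: "integrable circle f"
    and T: "\<And>\<phi>. \<phi> \<in> smooth_circle \<Longrightarrow> T \<phi> = (LINT \<theta>|circle. \<phi> \<theta> * f \<theta>)"
    and cs: "\<And>n::int. (\<lambda>\<theta>. cos (of_int n * \<theta>)) \<in> smooth_circle" "\<And>n::int. (\<lambda>\<theta>. sin (of_int n * \<theta>)) \<in> smooth_circle"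
  shows "dist_fourier T n = fourier f n"
proof -
  have i: "integrable circle (\<lambda>\<theta>. complex_of_real (f \<theta>) * cis (- (of_int n * \<theta>)))"
    using integrable_mult_cis[OF f, of "- of_int n"] by simp
  have "Re (LINT \<theta>|circle. complex_of_real (f \<theta>) * cis (- (of_int n * \<theta>))) = (LINT \<theta>|circle. cos (of_int n * \<theta>) * f \<theta>)"
    unfolding integral_Re[OF i, symmetric] by (intro Bochner_Integration.integral_cong refl) (simp add: mult.commute)
  moreover have "Im (LINT \<theta>|circle. complex_of_real (f \<theta>) * cis (- (of_int n * \<theta>))) = - (LINT \<theta>|circle. sin (of_int n * \<theta>) * f \<theta>)"
    unfolding integral_Im[OF i, symmetric] Bochner_Integration.integral_minus[symmetric]
    by (intro Bochner_Integration.integral_cong refl) (simp add: mult.commute)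
  ultimately have "(LINT \<theta>|circle. complex_of_real (f \<theta>) * cis (- (of_int n * \<theta>))) =
      Complex (T (\<lambda>\<theta>. cos (of_int n * \<theta>))) (- T (\<lambda>\<theta>. sin (of_int n * \<theta>)))"
    by (simp add: complex_eq_iff T[OF cs(1)] T[OF cs(2)])
  then show ?thesis
    by (simp add: dist_fourier_def fourier_def)
qed

lemma cos_sin_eq_trig:
  "(\<lambda>\<theta>. cos (of_int n * \<theta>)) = trig (nat \<bar>n\<bar>) (\<lambda>k. if k = n then 1 else 0)"
  "(\<lambda>\<theta>. sin (of_int n * \<theta>)) = trig (nat \<bar>n\<bar>) (\<lambda>k. if k = n then - \<i> else 0)"
proof -
  have n: "n \<in> {- int (nat \<bar>n\<bar>)..int (nat \<bar>n\<bar>)}"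
    by auto
  have "trig (nat \<bar>n\<bar>) (\<lambda>k. if k = n then z else 0) \<theta> = Re (z * cis (of_int n * \<theta>))" for z \<theta>
    unfolding trig_def using n by (simp add: if_distrib[of "\<lambda>x. x * _"] sum.delta cong: if_cong)
  then show "(\<lambda>\<theta>. cos (of_int n * \<theta>)) = trig (nat \<bar>n\<bar>) (\<lambda>k. if k = n then 1 else 0)"
    "(\<lambda>\<theta>. sin (of_int n * \<theta>)) = trig (nat \<bar>n\<bar>) (\<lambda>k. if k = n then - \<i> else 0)"
    by (auto simp: fun_eq_iff)
qed

lemma cos_sin_smooth:
  "(\<lambda>\<theta>. cos (real_of_int n * \<theta>)) \<in> smooth_circle" "(\<lambda>\<theta>. sin (real_of_int n * \<theta>)) \<in> smooth_circle"
  unfolding cos_sin_eq_trig by (rule trig_smooth)+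

lemmas dist_fourier_eq = dist_fourier_eq_fourier[OF _ _ cos_sin_smooth]

lemma smooth_circleD:
  assumes "u \<in> smooth_circle"
  shows "u (\<theta> + 2 * pi) = u \<theta>" "(u has_vector_derivative ddth u \<theta>) (at \<theta>)" "continuous_on S u"
    "continuous_on S (ddth u)" "ddth u (\<theta> + 2 * pi) = ddth u \<theta>"
proof -
  have p: "u (\<theta> + 2 * pi) = u \<theta>" for \<theta>
    using assms by (simp add: smooth_circle_def)
  have d: "(ddth ^^ k) u differentiable (at \<theta>)" for k \<theta>
    using assms by (simp add: smooth_circle_def)
  have v: "(u has_vector_derivative ddth u \<theta>) (at \<theta>)" for \<theta>
    using d[of 0 \<theta>] unfolding ddth_def by (simp add: vector_derivative_works)
  show "u (\<theta> + 2 * pi) = u \<theta>" "(u has_vector_derivative ddth u \<theta>) (at \<theta>)"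
    by (fact p v)+
  show "continuous_on S u" "continuous_on S (ddth u)"
    using d[of 0] d[of 1] by (auto intro!: continuous_at_imp_continuous_on differentiable_imp_continuous_within)
  have "((u \<circ> (\<lambda>x. x + 2 * pi)) has_vector_derivative 1 *\<^sub>R ddth u (\<theta> + 2 * pi)) (at \<theta>)"
    by (rule vector_diff_chain_at) (auto intro!: derivative_eq_intros v)
  then have "(u has_vector_derivative ddth u (\<theta> + 2 * pi)) (at \<theta>)"
    by (simp add: o_def p)
  then show "ddth u (\<theta> + 2 * pi) = ddth u \<theta>"
    using v vector_derivative_unique_at by blast
qed

lemma L2_circle_continuous_vec:
  fixes f :: "real \<Rightarrow> real^'m"
  assumes "continuous_on UNIV f" "\<And>\<theta>. f (\<theta> + 2 * pi) = f \<theta>"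
  shows "f \<in> L2_circle"
  unfolding L2_circle_vec_iff
  using assms by (auto intro!: L2_circle_continuous continuous_intros)

lemma smooth_circle_L2:
  fixes u :: "real \<Rightarrow> real^'m"
  assumes "u \<in> smooth_circle"
  shows "u \<in> L2_circle" "ddth u \<in> L2_circle"
  by (rule L2_circle_continuous_vec; fact smooth_circleD[OF assms])+

lemma dist_fourier_dist_of_fun:
  fixes f :: "real \<Rightarrow> real^'m"
  assumes f: "f \<in> L2_circle" and T: "\<And>\<phi>. \<phi> \<in> smooth_circle \<Longrightarrow> T \<phi> = dist_of_fun f \<phi>"
  shows "dist_fourier (\<lambda>\<phi>. T \<phi> $ j) n = fourier (\<lambda>\<theta>. f \<theta> $ j) n"
proof (rule dist_fourier_eq)
  show "integrable circle (\<lambda>\<theta>. f \<theta> $ j)"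
    using f by (intro integrable_vec_component L2_circle_integrable)
  fix \<phi> :: "real \<Rightarrow> real" assume \<phi>: "\<phi> \<in> smooth_circle"
  obtain C where C: "\<And>\<theta>. norm (\<phi> \<theta>) \<le> C"
    using periodic_continuous_bounded[of \<phi>] smooth_circleD[OF \<phi>] by metis
  have "(\<lambda>\<theta>. \<phi> \<theta> *\<^sub>R f \<theta>) \<in> L2_circle"
    unfolding L2_circle_vec_iff using f[unfolded L2_circle_vec_iff] C smooth_circleD[OF \<phi>]
    by (auto intro!: L2_circle_bounded_mult borel_measurable_circle_continuous)
  then show "T \<phi> $ j = (LINT \<theta>|circle. \<phi> \<theta> * f \<theta> $ j)"
    using integrable_vec_component(2)[OF L2_circle_integrable, of "\<lambda>\<theta>. \<phi> \<theta> *\<^sub>R f \<theta>" j]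
    by (simp add: T[OF \<phi>] dist_of_fun_def)
qed

text \<open>For \<open>u\<close> merely in L^2 the derivative falls on the cosines and sines of the
  definition, which are exchanged up to the factor \<open>n\<close>.\<close>

lemma dist_fourier_dist_deriv:
  fixes u :: "real \<Rightarrow> real^'m"
  assumes u: "u \<in> L2_circle"
  shows "dist_fourier (\<lambda>\<phi>. dist_deriv u \<phi> $ j) n = \<i> * of_int n * fourier (\<lambda>\<theta>. u \<theta> $ j) n"
proof -
  have uj: "(\<lambda>\<theta>. u \<theta> $ j) \<in> L2_circle"
    using u L2_circle_vec_iff by blast
  have dd: "ddth (\<lambda>\<theta>. cos (of_int n * \<theta>)) = (\<lambda>\<theta>. - (of_int n * sin (of_int n * \<theta>)))"
    "ddth (\<lambda>\<theta>. sin (of_int n * \<theta>)) = (\<lambda>\<theta>. of_int n * cos (of_int n * \<theta>))"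
    unfolding ddth_def
    by (auto intro!: ext vector_derivative_at derivative_eq_intros simp flip: has_real_derivative_iff_has_vector_derivative)
  have comp: "(LINT \<theta>|circle. \<psi> \<theta> *\<^sub>R u \<theta>) $ j = (LINT \<theta>|circle. \<psi> \<theta> * u \<theta> $ j)"
    if \<psi>: "continuous_on UNIV \<psi>" "\<And>\<theta>. \<psi> (\<theta> + 2 * pi) = \<psi> \<theta>" for \<psi>
  proof -
    obtain C where C: "\<And>\<theta>. norm (\<psi> \<theta>) \<le> C"
      using periodic_continuous_bounded[OF \<psi>] by metis
    have "(\<lambda>\<theta>. \<psi> \<theta> *\<^sub>R u \<theta>) \<in> L2_circle"
      unfolding L2_circle_vec_iff using u[unfolded L2_circle_vec_iff] C \<psi>
      by (auto intro!: L2_circle_bounded_mult borel_measurable_circle_continuous)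
    then show ?thesis
      using integrable_vec_component(2)[OF L2_circle_integrable, of "\<lambda>\<theta>. \<psi> \<theta> *\<^sub>R u \<theta>" j] by simp
  qed
  have per: "cos (of_int n * (\<theta> + 2 * pi)) = cos (of_int n * \<theta>)" "sin (of_int n * (\<theta> + 2 * pi)) = sin (of_int n * \<theta>)" for \<theta>
    using cis_periodic[of n \<theta>] by (auto simp: complex_eq_iff)
  have T: "dist_deriv u (\<lambda>\<theta>. cos (of_int n * \<theta>)) $ j = of_int n * (LINT \<theta>|circle. sin (of_int n * \<theta>) * u \<theta> $ j)"
    "dist_deriv u (\<lambda>\<theta>. sin (of_int n * \<theta>)) $ j = - of_int n * (LINT \<theta>|circle. cos (of_int n * \<theta>) * u \<theta> $ j)"
  proof -
    have "(LINT \<theta>|circle. (- (of_int n * sin (of_int n * \<theta>))) *\<^sub>R u \<theta>) $ j =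
        (LINT \<theta>|circle. (- of_int n) * (sin (of_int n * \<theta>) * u \<theta> $ j))"
      by (subst comp) (auto intro!: continuous_intros simp: per mult.assoc)
    then show "dist_deriv u (\<lambda>\<theta>. cos (of_int n * \<theta>)) $ j = of_int n * (LINT \<theta>|circle. sin (of_int n * \<theta>) * u \<theta> $ j)"
      unfolding dist_deriv_def dd vector_uminus_component integral_mult_right_zero by simp
    have "(LINT \<theta>|circle. (of_int n * cos (of_int n * \<theta>)) *\<^sub>R u \<theta>) $ j =
        (LINT \<theta>|circle. of_int n * (cos (of_int n * \<theta>) * u \<theta> $ j))"
      by (subst comp) (auto intro!: continuous_intros simp: per mult.assoc)
    then show "dist_deriv u (\<lambda>\<theta>. sin (of_int n * \<theta>)) $ j = - of_int n * (LINT \<theta>|circle. cos (of_int n * \<theta>) * u \<theta> $ j)"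
      unfolding dist_deriv_def dd vector_uminus_component integral_mult_right_zero by simp
  qed
  let ?S = "\<lambda>\<phi>. (LINT \<theta>|circle. \<phi> \<theta> * u \<theta> $ j)"
  have "dist_fourier ?S n = fourier (\<lambda>\<theta>. u \<theta> $ j) n"
    by (rule dist_fourier_eq[OF L2_circleD(4)[OF uj]]) simp
  then have "fourier (\<lambda>\<theta>. u \<theta> $ j) n =
      Complex (LINT \<theta>|circle. cos (of_int n * \<theta>) * u \<theta> $ j) (- (LINT \<theta>|circle. sin (of_int n * \<theta>) * u \<theta> $ j)) / (2 * pi)"
    by (simp add: dist_fourier_def)
  then show ?thesis
    unfolding dist_fourier_def T by (simp add: complex_eq_iff)
qed

text \<open>Integration by parts over one period, where the boundary terms cancel. With the
  preceding lemma it identifies the distributional and the classical derivative of a smooth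
  map.\<close>

lemma fourier_ddth:
  fixes u :: "real \<Rightarrow> real^'m"
  assumes u: "u \<in> smooth_circle"
  shows "fourier (\<lambda>\<theta>. ddth u \<theta> $ j) n = \<i> * of_int n * fourier (\<lambda>\<theta>. u \<theta> $ j) n"
proof -
  let ?e = "\<lambda>\<theta>. cis (- (of_int n * \<theta>))"
  have d: "((\<lambda>\<theta>. complex_of_real (u \<theta> $ j)) has_vector_derivative complex_of_real (ddth u x $ j)) (at x)" for x
    using bounded_linear.has_vector_derivative[OF bounded_linear_compose[OF bounded_linear_of_real[where 'a=complex] bounded_linear_vec_nth[of j]]
        smooth_circleD(2)[OF u]] by simp
  have de: "(?e has_vector_derivative - (\<i> * of_int n) * ?e x) (at x)" for x
  proof -
    have "((\<lambda>x. exp (- (\<i> * of_int n) * of_real x)) has_vector_derivative - (\<i> * of_int n) * exp (- (\<i> * of_int n) * of_real x)) (at x)"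
      by (auto intro!: derivative_eq_intros has_vector_derivative_real_field)
    moreover have "exp (- (\<i> * of_int n) * complex_of_real x) = ?e x" for x
      by (simp add: cis_conv_exp mult.assoc)
    ultimately show ?thesis
      by simp
  qed
  have i: "integrable circle (\<lambda>\<theta>. complex_of_real (u \<theta> $ j) * ?e \<theta>)" "integrable circle (\<lambda>\<theta>. complex_of_real (ddth u \<theta> $ j) * ?e \<theta>)"
    using integrable_mult_cis[OF integrable_vec_component(1)[OF L2_circle_integrable[OF smooth_circle_L2(1)[OF u]]], of j "- of_int n"]
      integrable_mult_cis[OF integrable_vec_component(1)[OF L2_circle_integrable[OF smooth_circle_L2(2)[OF u]]], of j "- of_int n"]
    by simp_all
  have "((\<lambda>\<theta>. complex_of_real (u \<theta> $ j) * (- (\<i> * of_int n) * ?e \<theta>) + complex_of_real (ddth u \<theta> $ j) * ?e \<theta>) has_integral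
      complex_of_real (u (2 * pi) $ j) * ?e (2 * pi) - complex_of_real (u 0 $ j) * ?e 0) {0..2 * pi}"
    by (rule fundamental_theorem_of_calculus[OF _ has_vector_derivative_at_within[OF has_vector_derivative_mult[OF d de]]])
      simp
  moreover have "complex_of_real (u (2 * pi) $ j) * ?e (2 * pi) = complex_of_real (u 0 $ j) * ?e 0"
    using smooth_circleD(1)[OF u, of 0] cis_periodic[of "- n" 0] by simp
  ultimately have "integral {0..2 * pi} (\<lambda>\<theta>. complex_of_real (u \<theta> $ j) * (- (\<i> * of_int n) * ?e \<theta>) + complex_of_real (ddth u \<theta> $ j) * ?e \<theta>) = 0"
    by (simp add: integral_unique)
  moreover have ii: "integrable circle (\<lambda>\<theta>. - (\<i> * of_int n) * (complex_of_real (u \<theta> $ j) * ?e \<theta>) + complex_of_real (ddth u \<theta> $ j) * ?e \<theta>)"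
    using i by (intro Bochner_Integration.integrable_add integrable_mult_right)
  ultimately have "(LINT \<theta>|circle. - (\<i> * of_int n) * (complex_of_real (u \<theta> $ j) * ?e \<theta>) + complex_of_real (ddth u \<theta> $ j) * ?e \<theta>) = 0"
    using lebesgue_integral_eq_integral[OF ii] by (simp add: mult_ac)
  then have "(LINT \<theta>|circle. complex_of_real (ddth u \<theta> $ j) * ?e \<theta>) = \<i> * of_int n * (LINT \<theta>|circle. complex_of_real (u \<theta> $ j) * ?e \<theta>)"
    using i by (simp add: Bochner_Integration.integral_add[OF integrable_mult_right[OF i(1)] i(2)] integral_mult_right_zero)
  then show ?thesis
    by (simp add: fourier_def)
qed

section \<open>The energies as Fourier multiplier forms\<close>

definition vform :: "(int \<Rightarrow> complex) \<Rightarrow> (real \<Rightarrow> real^'m) \<Rightarrow> (real \<Rightarrow> real^'m) \<Rightarrow> real" where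
  "vform m a b = (\<Sum>i\<in>UNIV. mform m (\<lambda>\<theta>. a \<theta> $ i) (\<lambda>\<theta>. b \<theta> $ i))"

text \<open>Symbol of the square of (-Delta)_0^(-1/4). The value 0 at \<open>n = 0\<close> is the
  projection away from the mean that the subscript 0 stands for.\<close>

definition winv :: "int \<Rightarrow> real" where
  "winv n = (if n = 0 then 0 else 1 / \<bar>of_int n\<bar>)"

lemma winv_bounds: "0 \<le> winv n" "winv n \<le> 1"
  by (auto simp: winv_def)

lemma winv_uminus: "winv (- n) = winv n"
  by (simp add: winv_def)

text \<open>Evenness of \<open>r\<close> keeps the new coefficients hermitian, so that Riesz-Fischer
  returns a real function.\<close>

lemma multiplier_exists:
  assumes r: "\<And>n. r (- n) = r n" and s: "(\<lambda>n. (r n)\<^sup>2 * (cmod (fourier f n))\<^sup>2) summable_on UNIV"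
  obtains g where "g \<in> L2_circle" "\<And>n. fourier g n = of_real (r n) * fourier f n"
proof -
  have "(\<lambda>n. (cmod (complex_of_real (r n) * fourier f n))\<^sup>2) summable_on UNIV"
    using s by (simp add: norm_mult power_mult_distrib)
  moreover have "of_real (r (- n)) * fourier f (- n) = cnj (of_real (r n) * fourier f n)" for n
    by (simp add: r fourier_uminus_index)
  ultimately show ?thesis
    using Riesz_Fischer[of "\<lambda>n. of_real (r n) * fourier f n"] that by metis
qed

lemma vec_multiplier_exists:
  fixes f :: "real \<Rightarrow> real^'m"
  assumes r: "\<And>n. r (- n) = r n"
    and s: "\<And>i. (\<lambda>n. (r n)\<^sup>2 * (cmod (fourier (\<lambda>\<theta>. f \<theta> $ i) n))\<^sup>2) summable_on UNIV"
  obtains g :: "real \<Rightarrow> real^'m" where "g \<in> L2_circle"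
    "\<And>i n. fourier (\<lambda>\<theta>. g \<theta> $ i) n = of_real (r n) * fourier (\<lambda>\<theta>. f \<theta> $ i) n"
proof -
  have "\<exists>g. g \<in> L2_circle \<and> (\<forall>n. fourier g n = of_real (r n) * fourier (\<lambda>\<theta>. f \<theta> $ i) n)" for i
    using multiplier_exists[of r, OF r s[of i]] by metis
  then obtain G where G: "\<And>i. G i \<in> L2_circle"
    "\<And>i n. fourier (G i) n = of_real (r n) * fourier (\<lambda>\<theta>. f \<theta> $ i) n"
    by metis
  show ?thesis
    by (rule that[of "\<lambda>\<theta>. \<chi> i. G i \<theta>"]) (simp_all add: L2_circle_vec_iff G)
qed

lemma integral_inner_vec:
  fixes g h :: "real \<Rightarrow> real^'m"
  assumes "g \<in> L2_circle" "h \<in> L2_circle"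
  shows "(LINT \<theta>|circle. g \<theta> \<bullet> h \<theta>) = vform (\<lambda>_. 1) g h"
proof -
  have gh: "(\<lambda>\<theta>. g \<theta> $ i) \<in> L2_circle" "(\<lambda>\<theta>. h \<theta> $ i) \<in> L2_circle" for i
    using assms L2_circle_vec_iff by blast+
  have "(LINT \<theta>|circle. g \<theta> \<bullet> h \<theta>) = (\<Sum>i\<in>UNIV. LINT \<theta>|circle. g \<theta> $ i * h \<theta> $ i)"
    unfolding inner_vec_def inner_real_def
    by (rule Bochner_Integration.integral_sum) (rule L2_circle_integrable_mult[OF gh])
  then show ?thesis
    by (simp add: vform_def Parseval_mform[OF gh])
qed

lemma is_inv_lap_vec:
  fixes g :: "real \<Rightarrow> real^'m"
  shows "is_inv_lap \<alpha> T g \<longleftrightarrow> g \<in> L2_circle \<and> (\<forall>i n. fourier (\<lambda>\<theta>. g \<theta> $ i) n =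
    (if n = 0 then 0 else of_real (\<bar>of_int n\<bar> powr (-\<alpha>)) * dist_fourier (\<lambda>\<phi>. T \<phi> $ i) n))"
  unfolding is_inv_lap_def by (auto simp: Basis_vec_def inner_axis)

text \<open>\<open>inv_lap\<close> is a choice of representative, so its properties depend on
  existence, which Riesz-Fischer supplies because \<open>winv \<le> 1\<close>. Only the coefficients
  of the chosen function are used afterwards.\<close>

lemma inv_lap_vec:
  fixes h :: "real \<Rightarrow> real^'m"
  assumes h: "h \<in> L2_circle" and T: "\<And>i n. dist_fourier (\<lambda>\<phi>. T \<phi> $ i) n = fourier (\<lambda>\<theta>. h \<theta> $ i) n"
  shows "inv_lap (1/2) T \<in> L2_circle"
    "fourier (\<lambda>\<theta>. inv_lap (1/2) T \<theta> $ i) n = of_real (sqrt (winv n)) * fourier (\<lambda>\<theta>. h \<theta> $ i) n"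
proof -
  have p: "(if n = 0 then 0 else \<bar>of_int n\<bar> powr - (1/2)) = sqrt (winv n)" for n
    by (simp add: winv_def powr_minus powr_half_sqrt real_sqrt_divide inverse_eq_divide)
  then have p': "of_real (sqrt (winv n)) * z = (if n = 0 then 0 else of_real (\<bar>of_int n\<bar> powr - (1/2)) * z)" for n and z :: complex
    by (metis mult_zero_left of_real_0)
  have "(\<lambda>n. (sqrt (winv n))\<^sup>2 * (cmod (fourier (\<lambda>\<theta>. h \<theta> $ i) n))\<^sup>2) summable_on UNIV" for i
    using h L2_circle_vec_iff[of h] winv_bounds
    by (intro summable_on_comparison_test[OF Bessel_summable[of "\<lambda>\<theta>. h \<theta> $ i"]]) (auto intro!: mult_left_le_one_le)
  then obtain g :: "real \<Rightarrow> real^'m" where g: "g \<in> L2_circle"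
    "\<And>i n. fourier (\<lambda>\<theta>. g \<theta> $ i) n = of_real (sqrt (winv n)) * fourier (\<lambda>\<theta>. h \<theta> $ i) n"
    using vec_multiplier_exists[of "\<lambda>n. sqrt (winv n)" h] winv_uminus by metis
  have "is_inv_lap (1/2) T g"
    unfolding is_inv_lap_vec T using g by (simp add: p')
  then have "is_inv_lap (1/2) T (inv_lap (1/2) T)"
    unfolding inv_lap_def by (rule someI[of "is_inv_lap (1/2) T"])
  then show "inv_lap (1/2) T \<in> L2_circle"
    "fourier (\<lambda>\<theta>. inv_lap (1/2) T \<theta> $ i) n = of_real (sqrt (winv n)) * fourier (\<lambda>\<theta>. h \<theta> $ i) n"
    unfolding is_inv_lap_vec T p' by auto
qed

lemma integral_inv_lap_inner:
  fixes h1 h2 :: "real \<Rightarrow> real^'m"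
  assumes 1: "h1 \<in> L2_circle" "\<And>i n. dist_fourier (\<lambda>\<phi>. T1 \<phi> $ i) n = fourier (\<lambda>\<theta>. h1 \<theta> $ i) n"
    and 2: "h2 \<in> L2_circle" "\<And>i n. dist_fourier (\<lambda>\<phi>. T2 \<phi> $ i) n = fourier (\<lambda>\<theta>. h2 \<theta> $ i) n"
  shows "(LINT \<theta>|circle. inv_lap (1/2) T1 \<theta> \<bullet> inv_lap (1/2) T2 \<theta>) = vform winv h1 h2"
proof -
  have s: "complex_of_real (sqrt (winv n)) * complex_of_real (sqrt (winv n)) = of_real (winv n)" for n
    by (simp add: winv_bounds flip: of_real_mult)
  show ?thesis
    unfolding integral_inner_vec[OF inv_lap_vec(1)[OF 1] inv_lap_vec(1)[OF 2]] vform_def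
  proof (intro sum.cong refl mform_weight_cong)
    fix i n
    show "1 * (cnj (fourier (\<lambda>\<theta>. inv_lap (1/2) T1 \<theta> $ i) n) * fourier (\<lambda>\<theta>. inv_lap (1/2) T2 \<theta> $ i) n) =
        of_real (winv n) * (cnj (fourier (\<lambda>\<theta>. h1 \<theta> $ i) n) * fourier (\<lambda>\<theta>. h2 \<theta> $ i) n)"
      unfolding inv_lap_vec(2)[OF 1] inv_lap_vec(2)[OF 2] s[symmetric] by simp
  qed
qed

lemma E_half_eq:
  fixes u :: "real \<Rightarrow> real^'m"
  assumes u: "u \<in> H_half"
  shows "E_half u = vform wabs u u"
proof -
  have w: "(\<lambda>\<theta>. u \<theta> $ i) \<in> wdom wabs" for i
    using u by (simp add: H_half_vec)
  have p: "\<bar>of_int n\<bar> powr (1/2) = sqrt (wabs n)" for n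
    by (simp add: powr_half_sqrt)
  define P where "P g \<longleftrightarrow> g \<in> L2_circle \<and> (\<forall>b\<in>Basis. \<forall>n. fourier (\<lambda>\<theta>. g \<theta> \<bullet> b) n =
        of_real (\<bar>of_int n\<bar> powr (1/2)) * fourier (\<lambda>\<theta>. u \<theta> \<bullet> b) n)" for g
  have P: "P g \<longleftrightarrow> g \<in> L2_circle \<and> (\<forall>i n. fourier (\<lambda>\<theta>. g \<theta> $ i) n =
      of_real (sqrt (wabs n)) * fourier (\<lambda>\<theta>. u \<theta> $ i) n)" for g
    unfolding P_def p by (auto simp: Basis_vec_def inner_axis)
  obtain g :: "real \<Rightarrow> real^'m" where "g \<in> L2_circle"
    "\<And>i n. fourier (\<lambda>\<theta>. g \<theta> $ i) n = of_real (sqrt (wabs n)) * fourier (\<lambda>\<theta>. u \<theta> $ i) n"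
    using vec_multiplier_exists[of "\<lambda>n. sqrt (wabs n)" u] w by (auto simp: wdom_def)
  then have "P g"
    by (simp add: P)
  then have "P (quarter_lap u)"
    unfolding quarter_lap_def P_def[symmetric] by (rule someI[of P])
  then have q: "quarter_lap u \<in> L2_circle"
    "\<And>i n. fourier (\<lambda>\<theta>. quarter_lap u \<theta> $ i) n = of_real (sqrt (wabs n)) * fourier (\<lambda>\<theta>. u \<theta> $ i) n"
    unfolding P by auto
  have s: "complex_of_real (sqrt (wabs n)) * complex_of_real (sqrt (wabs n)) = of_real (wabs n)" for n
    by (simp flip: of_real_mult)
  have "E_half u = vform (\<lambda>_. 1) (quarter_lap u) (quarter_lap u)"
    using integral_inner_vec[OF q(1) q(1)] by (simp add: E_half_def power2_norm_eq_inner)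
  also have "\<dots> = vform wabs u u"
    unfolding vform_def
  proof (intro sum.cong refl mform_weight_cong)
    fix i n
    show "1 * (cnj (fourier (\<lambda>\<theta>. quarter_lap u \<theta> $ i) n) * fourier (\<lambda>\<theta>. quarter_lap u \<theta> $ i) n) =
        of_real (wabs n) * (cnj (fourier (\<lambda>\<theta>. u \<theta> $ i) n) * fourier (\<lambda>\<theta>. u \<theta> $ i) n)"
      unfolding q(2) s[symmetric] by simp
  qed
  finally show ?thesis .
qed

section \<open>Products with matrix valued functions\<close>

text \<open>Matrices that multiply L^2 into itself. Regularity of order 1/2 is not demanded, because
  the derivative of \<open>PN\<close> along a smooth map is in general only continuous.\<close>

definition bdd_matrix :: "(real \<Rightarrow> real^'m^'m) \<Rightarrow> bool" where
  "bdd_matrix A \<longleftrightarrow> (\<exists>C. \<forall>i j. (\<lambda>\<theta>. A \<theta> $ i $ j) \<in> borel_measurable circle \<and>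
    (\<forall>\<theta>. A (\<theta> + 2 * pi) $ i $ j = A \<theta> $ i $ j \<and> \<bar>A \<theta> $ i $ j\<bar> \<le> C))"

lemma bdd_matrix_continuous:
  fixes A :: "real \<Rightarrow> real^'m^'m"
  assumes "continuous_on UNIV A" "\<And>\<theta>. A (\<theta> + 2 * pi) = A \<theta>"
  shows "bdd_matrix A"
proof -
  obtain C where C: "\<And>\<theta>. norm (A \<theta>) \<le> C"
    using periodic_continuous_bounded[of A, OF assms] by metis
  have "\<bar>A \<theta> $ i $ j\<bar> \<le> C" for \<theta> i j
    using order_trans[OF component_le_norm_cart order_trans[OF Finite_Cartesian_Product.norm_nth_le C]] by blast
  then show ?thesis
    unfolding bdd_matrix_def using assms
    by (intro exI[of _ C]) (auto intro!: borel_measurable_circle_continuous continuous_intros)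
qed

lemma bdd_matrix_entry_L2:
  assumes "bdd_matrix A"
  shows "(\<lambda>\<theta>. A \<theta> $ i $ j) \<in> L2_circle"
  using assms unfolding bdd_matrix_def by (auto intro: L2_circle_bounded)

lemma bdd_matrix_mult_entry_L2:
  fixes f :: "real \<Rightarrow> real^'m"
  assumes "bdd_matrix A" "f \<in> L2_circle"
  shows "(\<lambda>\<theta>. A \<theta> $ i $ j * f \<theta> $ j) \<in> L2_circle"
  using assms unfolding bdd_matrix_def L2_circle_vec_iff by (auto intro!: L2_circle_bounded_mult)

lemma matrix_vector_mult_nth: "(A *v x) $ i = (\<Sum>j\<in>UNIV. A $ i $ j * x $ j)"
  by (simp add: matrix_vector_mult_def)

lemma bdd_matrix_mult_L2:
  fixes f :: "real \<Rightarrow> real^'m"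
  assumes "bdd_matrix A" "f \<in> L2_circle"
  shows "(\<lambda>\<theta>. A \<theta> *v f \<theta>) \<in> L2_circle"
  unfolding L2_circle_vec_iff matrix_vector_mult_nth
  using bdd_matrix_mult_entry_L2[OF assms] by (auto intro!: L2_circle_sum)

lemma pairing_fourier:
  assumes "f \<in> L2_circle" "g \<in> L2_circle" "\<And>n. dist_fourier T n = fourier g n"
  shows "pairing f T = (LINT \<theta>|circle. f \<theta> * g \<theta>)" "pairable f T"
  using Parseval_mform[OF assms(1,2)] Parseval_summable[OF assms(1,2)]
  by (simp_all add: pairing_def pairable_def mform_def assms(3))

lemma pairing_dist_deriv:
  fixes u :: "real \<Rightarrow> real^'m"
  assumes "u \<in> L2_circle"
  shows "pairing f (\<lambda>\<phi>. dist_deriv u \<phi> $ j) = mform (\<lambda>n. \<i> * of_int n) f (\<lambda>\<theta>. u \<theta> $ j)"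
  by (simp add: pairing_def mform_def dist_fourier_dist_deriv[OF assms] mult_ac)

lemma mat_pairing_nth:
  fixes f :: "real \<Rightarrow> real^'m"
  assumes A: "bdd_matrix A" and f: "f \<in> L2_circle"
    and T: "\<And>j n. dist_fourier (\<lambda>\<phi>. T \<phi> $ j) n = fourier (\<lambda>\<theta>. f \<theta> $ j) n"
  shows "mat_pairing A T $ i = (LINT \<theta>|circle. (A \<theta> *v f \<theta>) $ i)"
proof -
  have fj: "(\<lambda>\<theta>. f \<theta> $ j) \<in> L2_circle" for j
    using f L2_circle_vec_iff by blast
  have "mat_pairing A T $ i = (\<Sum>j\<in>UNIV. LINT \<theta>|circle. A \<theta> $ i $ j * f \<theta> $ j)"
    by (simp add: mat_pairing_def pairing_fourier(1)[OF bdd_matrix_entry_L2[OF A] fj T])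
  then show ?thesis
    unfolding matrix_vector_mult_nth
    by (subst Bochner_Integration.integral_sum) (auto intro: L2_circleD(4) bdd_matrix_mult_entry_L2[OF A f])
qed

lemma bdd_matrix_scaleR:
  assumes A: "bdd_matrix A" and \<phi>: "\<phi> \<in> smooth_circle"
  shows "bdd_matrix (\<lambda>\<theta>. \<phi> \<theta> *\<^sub>R A \<theta>)"
proof -
  obtain C where C: "\<And>\<theta>. norm (\<phi> \<theta>) \<le> C"
    using periodic_continuous_bounded[of \<phi>] smooth_circleD[OF \<phi>] by metis
  obtain B where B: "\<And>i j. (\<lambda>\<theta>. A \<theta> $ i $ j) \<in> borel_measurable circle"
    "\<And>i j \<theta>. A (\<theta> + 2 * pi) $ i $ j = A \<theta> $ i $ j" "\<And>i j \<theta>. \<bar>A \<theta> $ i $ j\<bar> \<le> B"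
    using A unfolding bdd_matrix_def by metis
  have "\<bar>\<phi> \<theta> * A \<theta> $ i $ j\<bar> \<le> C * B" for \<theta> i j
    unfolding abs_mult using C[of \<theta>] B(3)[of \<theta> i j] by (intro mult_mono) auto
  moreover have "(\<lambda>\<theta>. \<phi> \<theta> * A \<theta> $ i $ j) \<in> borel_measurable circle" for i j
    using borel_measurable_circle_continuous[OF smooth_circleD(3)[OF \<phi>]] B(1) by (rule borel_measurable_times)
  ultimately show ?thesis
    unfolding bdd_matrix_def using B smooth_circleD(1)[OF \<phi>] by (intro exI[of _ "C * B"]) simp
qed

lemma mat_dist_nth:
  fixes f :: "real \<Rightarrow> real^'m"
  assumes A: "bdd_matrix A" and f: "f \<in> L2_circle"
    and T: "\<And>j n. dist_fourier (\<lambda>\<phi>. T \<phi> $ j) n = fourier (\<lambda>\<theta>. f \<theta> $ j) n"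
  shows "\<phi> \<in> smooth_circle \<Longrightarrow> mat_dist A T \<phi> $ i = (LINT \<theta>|circle. \<phi> \<theta> * (A \<theta> *v f \<theta>) $ i)"
    "dist_fourier (\<lambda>\<phi>. mat_dist A T \<phi> $ i) n = fourier (\<lambda>\<theta>. (A \<theta> *v f \<theta>) $ i) n"
proof -
  show *: "mat_dist A T \<phi> $ i = (LINT \<theta>|circle. \<phi> \<theta> * (A \<theta> *v f \<theta>) $ i)" if "\<phi> \<in> smooth_circle" for \<phi>
    unfolding mat_dist_def mat_pairing_nth[OF bdd_matrix_scaleR[OF A that] f T]
    by (simp add: scaleR_matrix_vector_assoc[symmetric])
  show "dist_fourier (\<lambda>\<phi>. mat_dist A T \<phi> $ i) n = fourier (\<lambda>\<theta>. (A \<theta> *v f \<theta>) $ i) n"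
  proof -
    have "(\<lambda>\<theta>. (A \<theta> *v f \<theta>) $ i) \<in> L2_circle"
      using bdd_matrix_mult_L2[OF A f] L2_circle_vec_iff[of "\<lambda>\<theta>. A \<theta> *v f \<theta>"] by blast
    then show ?thesis
      by (intro dist_fourier_eq[OF L2_circleD(4) *])
  qed
qed

text \<open>Once \<xi> and \<open>u'\<close> have densities, the functional consists of forms with
  symbol \<open>winv\<close>. As this symbol is bounded by 1, L^2 convergence suffices to
  differentiate it.\<close>

lemma L_half_eq:
  fixes f v :: "real \<Rightarrow> real^'m"
  assumes PT: "bdd_matrix (PT \<circ> u)" and PN: "bdd_matrix (PN \<circ> u)"
    and f: "f \<in> L2_circle" "\<And>j n. dist_fourier (\<lambda>\<phi>. T \<phi> $ j) n = fourier (\<lambda>\<theta>. f \<theta> $ j) n"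
    and v: "v \<in> L2_circle" "\<And>j n. dist_fourier (\<lambda>\<phi>. dist_deriv u \<phi> $ j) n = fourier (\<lambda>\<theta>. v \<theta> $ j) n"
  shows "L_half PT PN u T =
    1/2 * vform winv (\<lambda>\<theta>. PT (u \<theta>) *v f \<theta>) (\<lambda>\<theta>. PT (u \<theta>) *v f \<theta>)
    - vform winv (\<lambda>\<theta>. PT (u \<theta>) *v f \<theta>) (\<lambda>\<theta>. PT (u \<theta>) *v v \<theta>)
    - vform winv (\<lambda>\<theta>. PN (u \<theta>) *v f \<theta>) (\<lambda>\<theta>. PN (u \<theta>) *v v \<theta>)"
proof -
  note Tf = bdd_matrix_mult_L2[OF PT f(1)] mat_dist_nth(2)[OF PT f]
  note Tv = bdd_matrix_mult_L2[OF PT v(1)] mat_dist_nth(2)[OF PT v]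
  note Nf = bdd_matrix_mult_L2[OF PN f(1)] mat_dist_nth(2)[OF PN f]
  note Nv = bdd_matrix_mult_L2[OF PN v(1)] mat_dist_nth(2)[OF PN v]
  show ?thesis
    unfolding L_half_def power2_norm_eq_inner
    using integral_inv_lap_inner[OF Tf Tf] integral_inv_lap_inner[OF Tf Tv] integral_inv_lap_inner[OF Nf Nv]
    by (simp add: o_def)
qed

section \<open>Continuously differentiable families of projections\<close>

lemma C1_projectionsD:
  assumes "C1_projections PT PN"
  shows "PT z *v (PT z *v x) = PT z *v x" "PN z *v (PN z *v x) = PN z *v x" "PT z *v x + PN z *v x = x"
    "PT z *v (PN z *v x) = 0" "PN z *v (PT z *v x) = 0"
    "(PT z *v x) \<bullet> y = x \<bullet> (PT z *v y)" "(PN z *v x) \<bullet> y = x \<bullet> (PN z *v y)"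
proof -
  have P: "PT z ** PT z = PT z" "PN z ** PN z = PN z" "PT z + PN z = mat 1"
    and o: "\<And>U V. (PT z *v U) \<bullet> (PN z *v V) = 0"
    using assms by (auto simp: C1_projections_def)
  show 1: "PT z *v (PT z *v x) = PT z *v x" for x
    by (simp add: matrix_vector_mul_assoc P)
  show 2: "PN z *v (PN z *v x) = PN z *v x" for x
    by (simp add: matrix_vector_mul_assoc P)
  show 3: "PT z *v x + PN z *v x = x" for x
    by (simp add: P flip: matrix_vector_mult_add_rdistrib)
  show "PT z *v (PN z *v x) = 0" "PN z *v (PT z *v x) = 0"
    using 3[of "PN z *v x"] 3[of "PT z *v x"] by (simp_all add: 1 2)
  have "(PT z *v x) \<bullet> (PT z *v y + PN z *v y) = (PT z *v x + PN z *v x) \<bullet> (PT z *v y)"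
    using o[of x y] o[of y x] by (simp add: inner_add_left inner_add_right inner_commute)
  then show "(PT z *v x) \<bullet> y = x \<bullet> (PT z *v y)"
    by (simp add: 3)
  have "(PN z *v x) \<bullet> (PT z *v y + PN z *v y) = (PT z *v x + PN z *v x) \<bullet> (PN z *v y)"
    using o[of x y] o[of y x] by (simp add: inner_add_left inner_add_right inner_commute)
  then show "(PN z *v x) \<bullet> y = x \<bullet> (PN z *v y)"
    by (simp add: 3)
qed

lemma norm_le_of_entries:
  fixes A :: "real^'m^'m"
  assumes "\<And>i j. \<bar>A $ i $ j\<bar> \<le> c"
  shows "norm A \<le> real (CARD('m)) * (real (CARD('m)) * c)"
proof -
  have "norm (A $ i) \<le> real (CARD('m)) * c" for i
    using norm_le_l1_cart[of "A $ i"] sum_bounded_above[of UNIV "\<lambda>j. \<bar>A $ i $ j\<bar>" c] assms by auto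
  then have "(\<Sum>i\<in>UNIV. norm (A $ i)) \<le> real (CARD('m)) * (real (CARD('m)) * c)"
    using sum_bounded_above[of UNIV "\<lambda>i. norm (A $ i)" "real (CARD('m)) * c"] by auto
  moreover have "norm A \<le> (\<Sum>i\<in>UNIV. norm (A $ i))"
    unfolding norm_vec_def by (rule L2_set_le_sum) simp
  ultimately show ?thesis
    by linarith
qed

text \<open>Pythagoras: orthogonal projections are contractions. The values are thus bounded
  uniformly in \<open>z\<close>, in contrast to the derivatives.\<close>

lemma C1_projections_bounded:
  fixes PT PN :: "real^'m \<Rightarrow> real^'m^'m"
  assumes P: "C1_projections PT PN"
  shows "\<bar>PT z $ i $ j\<bar> \<le> 1" "\<bar>PN z $ i $ j\<bar> \<le> 1"
proof -
  have n: "norm (PT z *v x) \<le> norm x \<and> norm (PN z *v x) \<le> norm x" for x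
  proof -
    have "(norm x)\<^sup>2 = (norm (PT z *v x))\<^sup>2 + (norm (PN z *v x))\<^sup>2"
    proof -
      have "x \<bullet> x = (PT z *v x + PN z *v x) \<bullet> (PT z *v x + PN z *v x)"
        by (simp add: C1_projectionsD(3)[OF P])
      moreover have "(PT z *v x) \<bullet> (PN z *v x) = 0"
        by (simp add: C1_projectionsD(4,6)[OF P])
      ultimately show ?thesis
        by (simp add: power2_norm_eq_inner inner_add_left inner_add_right inner_commute)
    qed
    then show ?thesis
      by (metis add_increasing add_increasing2 norm_ge_zero order_refl power2_le_imp_le zero_le_power2)
  qed
  have "\<bar>A $ i $ j\<bar> \<le> 1" if "\<And>x. norm (A *v x) \<le> norm x" for A :: "real^'m^'m"
  proof -
    have "A $ i $ j = (A *v axis j 1) $ i"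
      by (simp add: matrix_vector_mul_component inner_axis)
    then have "\<bar>A $ i $ j\<bar> \<le> norm (A *v axis j 1)"
      using component_le_norm_cart[of "A *v axis j 1" i] by simp
    also have "\<dots> \<le> norm (axis j 1 :: real^'m)"
      by (rule that)
    finally show ?thesis
      by simp
  qed
  then show "\<bar>PT z $ i $ j\<bar> \<le> 1" "\<bar>PN z $ i $ j\<bar> \<le> 1"
    using n by blast+
qed

text \<open>The mean value inequality on a small ball, with the derivative uniformly continuous on a
  compact ball. The radius \<open>R + 1\<close> leaves room for points within distance 1 of
  \<open>y\<close>, hence the minimum with 1.\<close>

lemma C1_expansion:
  fixes P :: "'a::euclidean_space \<Rightarrow> 'b::euclidean_space" and P' :: "'a \<Rightarrow> 'a \<Rightarrow>\<^sub>L 'b"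
  assumes d: "\<And>z. (P has_derivative blinfun_apply (P' z)) (at z)" and c: "continuous_on UNIV P'" and e: "e > 0"
  obtains \<delta> where "\<delta> > 0" "\<And>y z. norm y \<le> R \<Longrightarrow> norm (z - y) < \<delta> \<Longrightarrow>
    norm (P z - P y - P' y (z - y)) \<le> e * norm (z - y)"
proof -
  have "uniformly_continuous_on (cball 0 (R + 1)) P'"
    by (intro compact_uniformly_continuous continuous_on_subset[OF c]) auto
  then obtain \<delta> where \<delta>: "\<delta> > 0" "\<And>x y. x \<in> cball 0 (R + 1) \<Longrightarrow> y \<in> cball 0 (R + 1) \<Longrightarrow> dist x y < \<delta> \<Longrightarrow> dist (P' x) (P' y) < e"
    unfolding uniformly_continuous_on_def using e by metis
  show ?thesis
  proof (rule that[of "min \<delta> 1"])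
    fix y z :: 'a assume y: "norm y \<le> R" and z: "norm (z - y) < min \<delta> 1"
    have "norm (P z - P y - blinfun_apply (P' y) (z - y)) \<le> norm (z - y) * e"
    proof (rule differentiable_bound_linearization[where S="ball y (min \<delta> 1)"])
      show "y + t *\<^sub>R (z - y) \<in> ball y (min \<delta> 1)" if "t \<in> {0..1}" for t
      proof -
        have "norm (t *\<^sub>R (z - y)) \<le> norm (z - y)"
          using that by (simp add: mult_left_le_one_le)
        then show ?thesis
          using z by (simp add: dist_norm)
      qed
      show "(P has_derivative blinfun_apply (P' x)) (at x within ball y (min \<delta> 1))" for x
        by (rule has_derivative_at_withinI[OF d])
      show "onorm (blinfun_apply (P' x) - blinfun_apply (P' y)) \<le> e" if "x \<in> ball y (min \<delta> 1)" for x
      proof -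
        have x: "norm (x - y) < \<delta>" "norm (x - y) < 1"
          using that by (auto simp: dist_norm norm_minus_commute)
        then have "norm x \<le> R + 1"
          using y norm_triangle_ineq[of "x - y" y] by simp
        then have "norm (P' x - P' y) < e"
          using \<delta>(2)[of x y] x y by (simp add: dist_norm)
        then show ?thesis
          by (simp add: norm_blinfun.rep_eq minus_blinfun.rep_eq fun_diff_def)
      qed
    qed (use \<delta> in auto)
    then show "norm (P z - P y - P' y (z - y)) \<le> e * norm (z - y)"
      by (simp add: mult.commute)
  qed (use \<delta> in auto)
qed

text \<open>Away from the diagonal boundedness of \<open>P\<close> is used, so the quadratic term absorbs the
  lack of any bound on the derivative far from the ball.\<close>

lemma C1_bounded_expansion:
  fixes P :: "'a::euclidean_space \<Rightarrow> 'b::euclidean_space" and P' :: "'a \<Rightarrow> 'a \<Rightarrow>\<^sub>L 'b"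
  assumes d: "\<And>z. (P has_derivative blinfun_apply (P' z)) (at z)" and c: "continuous_on UNIV P'" and e: "e > 0"
    and G: "\<And>z. norm z \<le> R + 1 \<Longrightarrow> G z = P z" "\<And>z. norm (G z) \<le> M"
  obtains K where "K \<ge> 0" "\<And>y z. norm y \<le> R \<Longrightarrow>
    norm (G z - G y - P' y (z - y)) \<le> e * norm (z - y) + K * (norm (z - y))\<^sup>2"
proof -
  obtain \<delta>0 where \<delta>0: "\<delta>0 > 0" "\<And>y z. norm y \<le> R \<Longrightarrow> norm (z - y) < \<delta>0 \<Longrightarrow>
    norm (P z - P y - P' y (z - y)) \<le> e * norm (z - y)"
    using C1_expansion[OF d c e, of R] by blast
  define \<delta> where "\<delta> = min \<delta>0 1"
  have \<delta>: "\<delta> > 0" "\<delta> \<le> 1" "\<delta> \<le> \<delta>0"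
    using \<delta>0(1) by (auto simp: \<delta>_def)
  have "compact (P' ` cball 0 R)"
    by (intro compact_continuous_image continuous_on_subset[OF c]) auto
  then obtain D where D: "D > 0" "\<And>y. norm y \<le> R \<Longrightarrow> norm (P' y) \<le> D"
    using compact_imp_bounded bounded_pos by (metis imageI mem_cball_0)
  have M: "M \<ge> 0"
    using G(2) norm_ge_zero order_trans by blast
  \<comment> \<open>At distance at least \<delta> the difference of values costs
    \<open>2 * M\<close> and the linear term at most \<open>D * r\<close>, with \<open>r\<close> the
    distance; multiplying by powers of \<open>r / \<delta> \<ge> 1\<close> turns both into multiples
    of \<open>r\<^sup>2\<close>.\<close>
  define K where "K = 2 * M / \<delta>\<^sup>2 + D / \<delta>"
  have K: "K \<ge> 0"
    using M D \<delta> by (simp add: K_def)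
  have "norm (G z - G y - P' y (z - y)) \<le> e * norm (z - y) + K * (norm (z - y))\<^sup>2" if y: "norm y \<le> R" for y z
  proof (cases "norm (z - y) < \<delta>")
    case True
    have "norm z \<le> R + 1"
      using y True \<delta>(2) norm_triangle_ineq[of "z - y" y] by simp
    then have "norm (G z - G y - P' y (z - y)) \<le> e * norm (z - y)"
      using \<delta>0(2)[OF y, of z] True \<delta>(3) G(1)[of z] G(1)[of y] y by simp
    then show ?thesis
      using K by (simp add: add_increasing2)
  next
    case False
    let ?r = "norm (z - y)"
    have r: "1 \<le> ?r / \<delta>" "?r > 0"
      using False \<delta>(1) by (auto simp: field_simps)
    have "norm (G z - G y - P' y (z - y)) \<le> norm (G z) + norm (G y) + norm (P' y (z - y))"
      by (meson norm_triangle_ineq4 order_trans add_right_mono)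
    also have "\<dots> \<le> 2 * M + D * ?r"
      using G(2)[of z] G(2)[of y] norm_blinfun[of "P' y" "z - y"] mult_right_mono[OF D(2)[OF y], of ?r] by simp
    also have "\<dots> \<le> 2 * M * (?r / \<delta>)\<^sup>2 + D * ?r * (?r / \<delta>)"
    proof (rule add_mono)
      have "1 \<le> (?r / \<delta>)\<^sup>2"
        using r(1) by (rule one_le_power)
      then show "2 * M \<le> 2 * M * (?r / \<delta>)\<^sup>2"
        using M mult_left_mono[of 1 "(?r / \<delta>)\<^sup>2" "2 * M"] by simp
      show "D * ?r \<le> D * ?r * (?r / \<delta>)"
        using r D(1) mult_left_mono[of 1 "?r / \<delta>" "D * ?r"] by simp
    qed
    also have "\<dots> = K * ?r\<^sup>2"
      by (simp add: K_def power_divide power2_eq_square algebra_simps)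
    finally show ?thesis
      using e r(2) by (simp add: add_increasing)
  qed
  then show ?thesis
    using that K by blast
qed

section \<open>Uniform differentiability along smooth maps\<close>

lemma bounded_bilinear_matrix_vector: "bounded_bilinear ((*v) :: real^'m^'m \<Rightarrow> real^'m \<Rightarrow> real^'m)"
  unfolding bilinear_conv_bounded_bilinear[symmetric] bilinear_def
  by (auto intro!: linearI simp: matrix_vector_mult_add_rdistrib matrix_vector_right_distrib
      scaleR_matrix_vector_assoc matrix_vector_mult_scaleR)

lemma bounded_range_periodic:
  fixes f :: "real \<Rightarrow> 'a::real_normed_vector"
  assumes "continuous_on UNIV f" "\<And>\<theta>. f (\<theta> + 2 * pi) = f \<theta>"
  shows "bounded (range f)"
  using periodic_continuous_bounded[of f, OF assms] unfolding bounded_iff by (metis rangeE)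

text \<open>The remainder estimate is uniform over the bounded range of \<open>u\<close>, so the
  quotients converge uniformly in the angle and therefore in L^2.\<close>

lemma uniform_limit_C1_quotient:
  fixes P :: "real^'m \<Rightarrow> real^'m^'m" and u w :: "real \<Rightarrow> real^'m" and P' :: "real^'m \<Rightarrow> (real^'m) \<Rightarrow>\<^sub>L (real^'m^'m)"
  assumes d: "\<And>z. (P has_derivative blinfun_apply (P' z)) (at z)" and cont: "continuous_on UNIV P'"
    and M: "\<And>z. norm (P z) \<le> M" and u: "\<And>\<theta>. norm (u \<theta>) \<le> R" and w: "\<And>\<theta>. norm (w \<theta>) \<le> W"
  shows "uniform_limit UNIV (\<lambda>t \<theta>. (P (u \<theta> + t *\<^sub>R w \<theta>) - P (u \<theta>)) /\<^sub>R t) (\<lambda>\<theta>. P' (u \<theta>) (w \<theta>)) (at 0)"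
  unfolding uniform_limit_at_le_iff
proof (intro allI impI)
  fix e :: real assume e: "e > 0"
  have W: "W \<ge> 0"
    using w norm_ge_zero order_trans by blast
  \<comment> \<open>After division by \<open>t\<close> the linear error is \<open>e' * W\<close> and
    the quadratic one \<open>K * W\<^sup>2 * \<bar>t\<bar>\<close>; \<open>e'\<close> and \<delta>
    make each at most \<open>e / 2\<close>. The added ones avoid division by zero.\<close>
  define e' where "e' = e / (2 * (W + 1))"
  have e': "e' > 0" "e' * W \<le> e / 2"
    using e W by (auto simp: e'_def field_simps)
  obtain K where K: "K \<ge> 0" "\<And>y z. norm y \<le> R \<Longrightarrow>
    norm (P z - P y - P' y (z - y)) \<le> e' * norm (z - y) + K * (norm (z - y))\<^sup>2"
    using C1_bounded_expansion[OF d cont e'(1), of R P M] M by blast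
  define c where "c = K * W\<^sup>2 + 1"
  define \<delta> where "\<delta> = e / (2 * c)"
  have KW: "K * W\<^sup>2 \<ge> 0"
    using K by simp
  then have c: "c > 0"
    by (simp add: c_def)
  have \<delta>: "\<delta> > 0" "K * W\<^sup>2 * \<delta> \<le> e / 2"
  proof -
    show "\<delta> > 0"
      unfolding \<delta>_def using e c by (intro divide_pos_pos) auto
    then have "K * W\<^sup>2 * \<delta> \<le> c * \<delta>"
      by (simp add: c_def)
    also have "\<dots> = e / 2"
      using c by (simp add: \<delta>_def)
    finally show "K * W\<^sup>2 * \<delta> \<le> e / 2" .
  qed
  have "dist ((P (u \<theta> + t *\<^sub>R w \<theta>) - P (u \<theta>)) /\<^sub>R t) (P' (u \<theta>) (w \<theta>)) \<le> e"
    if t: "0 < dist t 0" "dist t 0 < \<delta>" for t \<theta>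
  proof -
    have t': "t \<noteq> 0" "\<bar>t\<bar> < \<delta>"
      using t by auto
    let ?x = "P (u \<theta> + t *\<^sub>R w \<theta>) - P (u \<theta>) - P' (u \<theta>) (t *\<^sub>R w \<theta>)"
    have "(P (u \<theta> + t *\<^sub>R w \<theta>) - P (u \<theta>)) /\<^sub>R t - P' (u \<theta>) (w \<theta>) = ?x /\<^sub>R t"
      using t' by (simp add: blinfun.scaleR_right scaleR_right_diff_distrib)
    then have "dist ((P (u \<theta> + t *\<^sub>R w \<theta>) - P (u \<theta>)) /\<^sub>R t) (P' (u \<theta>) (w \<theta>)) = norm ?x / \<bar>t\<bar>"
      by (simp add: dist_norm divide_inverse mult.commute)
    also have "\<dots> \<le> (e' * (\<bar>t\<bar> * W) + K * (\<bar>t\<bar> * W)\<^sup>2) / \<bar>t\<bar>"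
    proof (rule divide_right_mono)
      have tw: "norm (t *\<^sub>R w \<theta>) \<le> \<bar>t\<bar> * W"
        using w by (simp add: mult_left_mono)
      have "norm ?x \<le> e' * norm (t *\<^sub>R w \<theta>) + K * (norm (t *\<^sub>R w \<theta>))\<^sup>2"
        using K(2)[OF u[of \<theta>], of "u \<theta> + t *\<^sub>R w \<theta>"] by simp
      also have "\<dots> \<le> e' * (\<bar>t\<bar> * W) + K * (\<bar>t\<bar> * W)\<^sup>2"
        using tw e' K(1) by (intro add_mono mult_left_mono power_mono) auto
      finally show "norm ?x \<le> e' * (\<bar>t\<bar> * W) + K * (\<bar>t\<bar> * W)\<^sup>2" .
    qed simp
    also have "\<dots> = e' * W + K * W\<^sup>2 * \<bar>t\<bar>"
      using t'(1) by (simp add: field_simps power2_eq_square)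
    also have "\<dots> \<le> e / 2 + K * W\<^sup>2 * \<delta>"
      using e' t'(2) KW by (intro add_mono mult_left_mono) auto
    finally show ?thesis
      using \<delta>(2) by linarith
  qed
  then show "\<exists>d>0. \<forall>z. 0 < dist z 0 \<and> dist z 0 < d \<longrightarrow>
      (\<forall>x\<in>UNIV. dist ((P (u x + z *\<^sub>R w x) - P (u x)) /\<^sub>R z) (P' (u x) (w x)) \<le> e)"
    using \<delta>(1) by blast
qed

text \<open>The Leibniz rule with uniform limits. Boundedness of the limits is required because
  uniform convergence passes to products only of bounded functions.\<close>

lemma uniform_limit_product_quotient:
  fixes A :: "real \<Rightarrow> real \<Rightarrow> real^'m^'m" and F H :: "real \<Rightarrow> real^'m"
  assumes A: "uniform_limit UNIV (\<lambda>t \<theta>. (A t \<theta> - A 0 \<theta>) /\<^sub>R t) A' (at 0)"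
    and b: "bounded (range (A 0))" "bounded (range A')" "bounded (range F)" "bounded (range H)"
  shows "uniform_limit UNIV (\<lambda>t \<theta>. (A t \<theta> *v (F \<theta> + t *\<^sub>R H \<theta>) - A 0 \<theta> *v F \<theta>) /\<^sub>R t)
    (\<lambda>\<theta>. A' \<theta> *v F \<theta> + A 0 \<theta> *v H \<theta>) (at 0)"
proof -
  interpret mv: bounded_bilinear "(*v) :: real^'m^'m \<Rightarrow> real^'m \<Rightarrow> real^'m"
    by (rule bounded_bilinear_matrix_vector)
  have "uniform_limit UNIV (\<lambda>t \<theta>::real. t) (\<lambda>_. 0) (at (0::real))"
    unfolding uniform_limit_at_le_iff by (auto simp: dist_norm intro: less_imp_le)
  \<comment> \<open>\<open>A t\<close> is recovered as \<open>A 0\<close> plus \<open>t\<close>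
    times its quotient, so that its uniform convergence follows from that of the quotient.\<close>
  then have "uniform_limit UNIV (\<lambda>t \<theta>. t *\<^sub>R ((A t \<theta> - A 0 \<theta>) /\<^sub>R t)) (\<lambda>\<theta>. 0 *\<^sub>R A' \<theta>) (at 0)"
    by (rule bounded_bilinear.bounded_uniform_limit[OF bounded_bilinear_scaleR _ A b(2)]) simp
  then have "uniform_limit UNIV (\<lambda>t \<theta>. t *\<^sub>R ((A t \<theta> - A 0 \<theta>) /\<^sub>R t) + A 0 \<theta>) (\<lambda>\<theta>. 0 *\<^sub>R A' \<theta> + A 0 \<theta>) (at 0)"
    by (intro uniform_limit_add uniform_limit_const)
  then have "uniform_limit UNIV (\<lambda>t \<theta>. (t *\<^sub>R ((A t \<theta> - A 0 \<theta>) /\<^sub>R t) + A 0 \<theta>) *v H \<theta>)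
      (\<lambda>\<theta>. (0 *\<^sub>R A' \<theta> + A 0 \<theta>) *v H \<theta>) (at 0)"
    by (rule mv.bounded_uniform_limit[OF _ uniform_limit_const]) (use b in auto)
  then have "uniform_limit UNIV (\<lambda>t \<theta>. ((A t \<theta> - A 0 \<theta>) /\<^sub>R t) *v F \<theta> + (t *\<^sub>R ((A t \<theta> - A 0 \<theta>) /\<^sub>R t) + A 0 \<theta>) *v H \<theta>)
      (\<lambda>\<theta>. A' \<theta> *v F \<theta> + (0 *\<^sub>R A' \<theta> + A 0 \<theta>) *v H \<theta>) (at 0)"
    by (intro uniform_limit_add mv.bounded_uniform_limit[OF A uniform_limit_const] b)
  moreover have "\<forall>\<^sub>F t in at 0. \<forall>\<theta>\<in>UNIV. ((A t \<theta> - A 0 \<theta>) /\<^sub>R t) *v F \<theta> + (t *\<^sub>R ((A t \<theta> - A 0 \<theta>) /\<^sub>R t) + A 0 \<theta>) *v H \<theta> =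
      (A t \<theta> *v (F \<theta> + t *\<^sub>R H \<theta>) - A 0 \<theta> *v F \<theta>) /\<^sub>R t"
    using eventually_neq_at_within[of "0::real" 0 UNIV]
  proof eventually_elim
    case (elim t)
    show ?case
    proof
      fix \<theta>
      have "t *\<^sub>R ((A t \<theta> - A 0 \<theta>) /\<^sub>R t) + A 0 \<theta> = A t \<theta>"
        using elim by simp
      then show "((A t \<theta> - A 0 \<theta>) /\<^sub>R t) *v F \<theta> + (t *\<^sub>R ((A t \<theta> - A 0 \<theta>) /\<^sub>R t) + A 0 \<theta>) *v H \<theta> =
          (A t \<theta> *v (F \<theta> + t *\<^sub>R H \<theta>) - A 0 \<theta> *v F \<theta>) /\<^sub>R t"
        using elim by (simp add: mv.scaleR_left mv.scaleR_right mv.diff_left mv.add_right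
            scaleR_right_diff_distrib scaleR_right_distrib)
    qed
  qed
  ultimately show ?thesis
    by (subst (asm) uniform_limit_cong) auto
qed

lemma wsq_1_le_of_bound:
  assumes h: "h \<in> L2_circle" "\<And>\<theta>. \<bar>h \<theta>\<bar> \<le> e"
  shows "wsq (\<lambda>_. 1) h \<le> e\<^sup>2"
proof -
  have "wsq (\<lambda>_. 1) (\<lambda>\<theta>. h \<theta> * 1) \<le> e\<^sup>2 * wsq (\<lambda>_. 1) (\<lambda>_. 1)"
    by (rule wsq_1_bounded_mult[OF L2_circle_const L2_circleD(2,1)[OF h(1)] h(2)])
  moreover have "2 * pi * wsq (\<lambda>_. 1) (\<lambda>_. 1) = 2 * pi * 1"
    using wsq_1[OF L2_circle_const[of 1]] by (simp add: measure_restrict_space)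
  then have "wsq (\<lambda>_. 1) (\<lambda>_. 1) = 1"
    by (subst (asm) mult_left_cancel) auto
  ultimately show ?thesis
    by simp
qed

lemma L2_circle_vec_nth:
  fixes c :: "real \<Rightarrow> 'a::euclidean_space^'m"
  shows "c \<in> L2_circle \<Longrightarrow> (\<lambda>\<theta>. c \<theta> $ i) \<in> L2_circle"
  by (simp add: L2_circle_vec_iff[of c])

lemma vform_has_derivative:
  fixes a b :: "real \<Rightarrow> real \<Rightarrow> real^'m"
  assumes m: "\<And>n. cmod (m n) \<le> 1"
    and a: "\<And>t. a t \<in> L2_circle" "a' \<in> L2_circle" "uniform_limit UNIV (\<lambda>t \<theta>. (a t \<theta> - a 0 \<theta>) /\<^sub>R t) a' (at 0)"
    and b: "\<And>t. b t \<in> L2_circle" "b' \<in> L2_circle" "uniform_limit UNIV (\<lambda>t \<theta>. (b t \<theta> - b 0 \<theta>) /\<^sub>R t) b' (at 0)"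
  shows "((\<lambda>t. vform m (a t) (b t)) has_real_derivative vform m a' (b 0) + vform m (a 0) b') (at 0)"
proof -
  have q: "((\<lambda>t. wsq (\<lambda>_. 1) (\<lambda>\<theta>. (c t \<theta> $ i - c 0 \<theta> $ i) / t - c' \<theta> $ i)) \<longlongrightarrow> 0) (at 0)"
    if c: "\<And>t. c t \<in> L2_circle" "c' \<in> L2_circle" "uniform_limit UNIV (\<lambda>t \<theta>. (c t \<theta> - c 0 \<theta>) /\<^sub>R t) c' (at 0)"
    for c :: "real \<Rightarrow> real \<Rightarrow> real^'m" and c' i
  proof (rule tendstoI)
    fix e :: real assume e: "e > 0"
    have "\<forall>\<^sub>F t in at 0. \<forall>\<theta>\<in>UNIV. dist ((c t \<theta> - c 0 \<theta>) /\<^sub>R t) (c' \<theta>) < sqrt (e / 2)"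
      using e by (intro uniform_limitD[OF c(3)]) simp
    then show "\<forall>\<^sub>F t in at 0. dist (wsq (\<lambda>_. 1) (\<lambda>\<theta>. (c t \<theta> $ i - c 0 \<theta> $ i) / t - c' \<theta> $ i)) 0 < e"
    proof eventually_elim
      case (elim t)
      have "(\<lambda>\<theta>. (1 / t) * (c t \<theta> $ i - c 0 \<theta> $ i) - c' \<theta> $ i) \<in> L2_circle"
        by (rule L2_circle_diff[OF L2_circle_cmult[OF L2_circle_diff[OF L2_circle_vec_nth[OF c(1)] L2_circle_vec_nth[OF c(1)]]]
              L2_circle_vec_nth[OF c(2)]])
      then have L: "(\<lambda>\<theta>. (c t \<theta> $ i - c 0 \<theta> $ i) / t - c' \<theta> $ i) \<in> L2_circle"
        by simp
      have "\<bar>(c t \<theta> $ i - c 0 \<theta> $ i) / t - c' \<theta> $ i\<bar> \<le> sqrt (e / 2)" for \<theta>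
      proof -
        define x where "x = (c t \<theta> - c 0 \<theta>) /\<^sub>R t - c' \<theta>"
        have "norm x < sqrt (e / 2)"
          using bspec[OF elim UNIV_I, of \<theta>] unfolding dist_norm x_def .
        then have "\<bar>x $ i\<bar> \<le> sqrt (e / 2)"
          using component_le_norm_cart[of x i] by linarith
        moreover have "x $ i = (c t \<theta> $ i - c 0 \<theta> $ i) / t - c' \<theta> $ i"
          unfolding x_def by (simp add: divide_inverse_commute)
        ultimately show ?thesis
          by simp
      qed
      then have "wsq (\<lambda>_. 1) (\<lambda>\<theta>. (c t \<theta> $ i - c 0 \<theta> $ i) / t - c' \<theta> $ i) \<le> (sqrt (e / 2))\<^sup>2"
        by (rule wsq_1_le_of_bound[OF L])
      then show ?case
        using e wsq_nonneg[of "\<lambda>_. 1" "\<lambda>\<theta>. (c t \<theta> $ i - c 0 \<theta> $ i) / t - c' \<theta> $ i"]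
        by (simp add: real_sqrt_pow2)
    qed
  qed
  have L: "(\<lambda>\<theta>. c \<theta> $ i) \<in> wdom (\<lambda>_. 1)" if "c \<in> L2_circle" for c :: "real \<Rightarrow> real^'m" and i
    using L2_circle_vec_nth[OF that] by (simp add: wdom_1)
  have "((\<lambda>t. mform m (\<lambda>\<theta>. a t \<theta> $ i) (\<lambda>\<theta>. b t \<theta> $ i)) has_real_derivative
      mform m (\<lambda>\<theta>. a' \<theta> $ i) (\<lambda>\<theta>. b 0 \<theta> $ i) + mform m (\<lambda>\<theta>. a 0 \<theta> $ i) (\<lambda>\<theta>. b' \<theta> $ i)) (at 0)" for i
    by (rule mform_has_derivative[where \<omega>="\<lambda>_. 1"])
      (auto intro: m L a(1,2) b(1,2) always_eventually q[OF a] q[OF b])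
  then have "((\<lambda>t. vform m (a t) (b t)) has_real_derivative
      (\<Sum>i\<in>UNIV. mform m (\<lambda>\<theta>. a' \<theta> $ i) (\<lambda>\<theta>. b 0 \<theta> $ i) + mform m (\<lambda>\<theta>. a 0 \<theta> $ i) (\<lambda>\<theta>. b' \<theta> $ i))) (at 0)"
    unfolding vform_def by (rule DERIV_sum)
  then show ?thesis
    by (simp add: vform_def sum.distrib)
qed

section \<open>The first variation\<close>

lemma vform_diff_left:
  assumes "\<And>n. cmod (m n) \<le> 1" "a \<in> L2_circle" "a' \<in> L2_circle" "b \<in> L2_circle"
  shows "vform m (\<lambda>\<theta>. a \<theta> - a' \<theta>) b = vform m a b - vform m a' b"
  using mform_diff_left[of "\<lambda>_. 1" m, unfolded wdom_1, OF _ assms(1) L2_circle_vec_nth[OF assms(2)]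
      L2_circle_vec_nth[OF assms(3)] L2_circle_vec_nth[OF assms(4)]]
  by (simp add: vform_def sum_subtractf)

lemma vform_diff_right:
  assumes "\<And>n. cmod (m n) \<le> 1" "a \<in> L2_circle" "b \<in> L2_circle" "b' \<in> L2_circle"
  shows "vform m a (\<lambda>\<theta>. b \<theta> - b' \<theta>) = vform m a b - vform m a b'"
  using mform_diff_right[of "\<lambda>_. 1" m, unfolded wdom_1, OF _ assms(1) L2_circle_vec_nth[OF assms(2)]
      L2_circle_vec_nth[OF assms(3)] L2_circle_vec_nth[OF assms(4)]]
  by (simp add: vform_def sum_subtractf)

lemma vform_commute: "(\<And>n. m n \<in> \<real>) \<Longrightarrow> vform m a b = vform m b a"
  unfolding vform_def by (intro sum.cong refl mform_commute)

lemma mform_zero [simp]: "mform m (\<lambda>_. 0) g = 0" "mform m f (\<lambda>_. 0) = 0"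
  by (simp_all add: mform_def)

lemma vform_zero [simp]: "vform m (\<lambda>_. 0) b = 0" "vform m a (\<lambda>_. 0) = 0"
  by (simp_all add: vform_def)

lemma winv_cmod: "cmod (complex_of_real (winv n)) \<le> 1"
  using winv_bounds[of n] by simp

text \<open>The form is nonnegative and vanishes on the diagonal only for functions without nonzero
  frequencies, that is, constants up to null sets; these it does not see in either argument.\<close>

lemma vform_winv_self_zero:
  fixes h :: "real \<Rightarrow> real^'m"
  assumes h: "h \<in> L2_circle" and z: "vform winv h h = 0"
  shows "n \<noteq> 0 \<Longrightarrow> fourier (\<lambda>\<theta>. h \<theta> $ i) n = 0" "vform winv x h = 0" "vform winv h x = 0"
proof -
  have w: "(\<lambda>\<theta>. h \<theta> $ i) \<in> wdom winv" for i
    using wdom_mono(1)[of "\<lambda>\<theta>. h \<theta> $ i" "\<lambda>_. 1" winv 1] winv_bounds L2_circle_vec_nth[OF h] by (simp add: wdom_1)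
  have "(\<Sum>i\<in>UNIV. 2 * pi * wsq winv (\<lambda>\<theta>. h \<theta> $ i)) = 0"
    using z mform_self[OF w] by (simp add: vform_def)
  then have "wsq winv (\<lambda>\<theta>. h \<theta> $ i) = 0" for i
    using wsq_nonneg[of winv] winv_bounds by (subst (asm) sum_nonneg_eq_0_iff) auto
  then have "winv n * (cmod (fourier (\<lambda>\<theta>. h \<theta> $ i) n))\<^sup>2 = 0" for i n
    using w[of i] winv_bounds unfolding wsq_def wdom_def
    by (intro nonneg_infsum_le_0D[where A=UNIV and f="\<lambda>n. winv n * (cmod (fourier (\<lambda>\<theta>. h \<theta> $ i) n))\<^sup>2"]) auto
  then have c: "winv n = 0 \<or> fourier (\<lambda>\<theta>. h \<theta> $ i) n = 0" for i n
    by simp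
  show "n \<noteq> 0 \<Longrightarrow> fourier (\<lambda>\<theta>. h \<theta> $ i) n = 0"
    using c[of n i] by (simp add: winv_def)
  have "of_real (winv n) * (cnj (fourier (\<lambda>\<theta>. x \<theta> $ i) n) * fourier (\<lambda>\<theta>. h \<theta> $ i) n) = 0" for i n
    using c[of n i] by auto
  then show "vform winv x h = 0"
    by (simp only: vform_def mform_def) simp
  then show "vform winv h x = 0"
    by (subst vform_commute) auto
qed

section \<open>Linear operations on smooth maps and densities\<close>

lemma ddth_works: "g differentiable (at \<theta>) \<Longrightarrow> (g has_vector_derivative ddth g \<theta>) (at \<theta>)"
  by (simp add: ddth_def vector_derivative_works)

lemma smooth_circle_linear_combination:
  assumes "u \<in> smooth_circle" "w \<in> smooth_circle"
  shows "(\<lambda>\<theta>. u \<theta> + t *\<^sub>R w \<theta>) \<in> smooth_circle"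
    "ddth (\<lambda>\<theta>. u \<theta> + t *\<^sub>R w \<theta>) = (\<lambda>\<theta>. ddth u \<theta> + t *\<^sub>R ddth w \<theta>)"
proof -
  have d: "(ddth ^^ k) u differentiable (at \<theta>)" "(ddth ^^ k) w differentiable (at \<theta>)" for k \<theta>
    using assms by (auto simp: smooth_circle_def)
  have eq: "(ddth ^^ k) (\<lambda>\<theta>. u \<theta> + t *\<^sub>R w \<theta>) = (\<lambda>\<theta>. (ddth ^^ k) u \<theta> + t *\<^sub>R (ddth ^^ k) w \<theta>)" for k
  proof (induction k)
    case (Suc k)
    have "ddth (\<lambda>\<theta>. (ddth ^^ k) u \<theta> + t *\<^sub>R (ddth ^^ k) w \<theta>) \<theta> = ddth ((ddth ^^ k) u) \<theta> + t *\<^sub>R ddth ((ddth ^^ k) w) \<theta>" for \<theta>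
      unfolding ddth_def[of "\<lambda>\<theta>. (ddth ^^ k) u \<theta> + t *\<^sub>R (ddth ^^ k) w \<theta>"]
      by (intro vector_derivative_at has_vector_derivative_add bounded_linear.has_vector_derivative[OF bounded_linear_scaleR_right]
          ddth_works d)
    then show ?case
      by (simp add: Suc.IH fun_eq_iff)
  qed simp
  show "(\<lambda>\<theta>. u \<theta> + t *\<^sub>R w \<theta>) \<in> smooth_circle"
    unfolding smooth_circle_def mem_Collect_eq eq
    using assms d by (auto simp: smooth_circle_def intro!: differentiable_add differentiable_scaleR)
  show "ddth (\<lambda>\<theta>. u \<theta> + t *\<^sub>R w \<theta>) = (\<lambda>\<theta>. ddth u \<theta> + t *\<^sub>R ddth w \<theta>)"
    using eq[of 1] by simp
qed

lemma ddth_const: "ddth (\<lambda>_. c) = (\<lambda>_. 0)"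
  unfolding ddth_def by (intro ext vector_derivative_at has_vector_derivative_const)

lemma smooth_circle_const: "(\<lambda>_. c) \<in> smooth_circle"
proof -
  have "\<exists>c'. (ddth ^^ k) (\<lambda>_. c) = (\<lambda>_. c')" for k
    by (induction k) (auto simp: ddth_const)
  then show ?thesis
    unfolding smooth_circle_def mem_Collect_eq by (metis differentiable_const)
qed

lemma smooth_circle_scaleR_const:
  fixes v :: "'a::real_normed_vector"
  assumes "\<phi> \<in> smooth_circle"
  shows "(\<lambda>\<theta>. \<phi> \<theta> *\<^sub>R v) \<in> smooth_circle" "ddth (\<lambda>\<theta>. \<phi> \<theta> *\<^sub>R v) = (\<lambda>\<theta>. ddth \<phi> \<theta> *\<^sub>R v)"
proof -
  have d: "(ddth ^^ k) \<phi> differentiable (at \<theta>)" for k \<theta>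
    using assms by (auto simp: smooth_circle_def)
  have eq: "(ddth ^^ k) (\<lambda>\<theta>. \<phi> \<theta> *\<^sub>R v) = (\<lambda>\<theta>. (ddth ^^ k) \<phi> \<theta> *\<^sub>R v)" for k
  proof (induction k)
    case (Suc k)
    have "ddth (\<lambda>\<theta>. (ddth ^^ k) \<phi> \<theta> *\<^sub>R v) \<theta> = ddth ((ddth ^^ k) \<phi>) \<theta> *\<^sub>R v" for \<theta>
      unfolding ddth_def[of "\<lambda>\<theta>. (ddth ^^ k) \<phi> \<theta> *\<^sub>R v"]
      by (intro vector_derivative_at bounded_linear.has_vector_derivative[OF bounded_linear_scaleR_left] ddth_works d)
    then show ?case
      by (simp add: Suc.IH fun_eq_iff)
  qed simp
  show "(\<lambda>\<theta>. \<phi> \<theta> *\<^sub>R v) \<in> smooth_circle"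
    unfolding smooth_circle_def mem_Collect_eq eq
    using assms d by (auto simp: smooth_circle_def intro!: differentiable_scaleR)
  show "ddth (\<lambda>\<theta>. \<phi> \<theta> *\<^sub>R v) = (\<lambda>\<theta>. ddth \<phi> \<theta> *\<^sub>R v)"
    using eq[of 1] by simp
qed

lemma dist_of_fun_linear_combination:
  fixes f \<eta> :: "real \<Rightarrow> real^'m"
  assumes "f \<in> smooth_circle" "\<eta> \<in> smooth_circle" "\<phi> \<in> smooth_circle"
  shows "dist_of_fun (\<lambda>\<theta>. f \<theta> + t *\<^sub>R \<eta> \<theta>) \<phi> = dist_of_fun f \<phi> + t *\<^sub>R dist_of_fun \<eta> \<phi>"
proof -
  have i: "integrable circle (\<lambda>\<theta>. \<phi> \<theta> *\<^sub>R g \<theta>)" if "g \<in> smooth_circle" for g :: "real \<Rightarrow> real^'m"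
    by (rule continuous_imp_integrable_real)
      (rule continuous_on_scaleR[OF smooth_circleD(3)[OF assms(3)] smooth_circleD(3)[OF that]])
  have "dist_of_fun (\<lambda>\<theta>. f \<theta> + t *\<^sub>R \<eta> \<theta>) \<phi> = (LINT \<theta>|circle. \<phi> \<theta> *\<^sub>R f \<theta> + t *\<^sub>R (\<phi> \<theta> *\<^sub>R \<eta> \<theta>))"
    by (simp add: dist_of_fun_def scaleR_right_distrib mult.commute)
  also have "\<dots> = dist_of_fun f \<phi> + t *\<^sub>R dist_of_fun \<eta> \<phi>"
    unfolding dist_of_fun_def
    using Bochner_Integration.integral_add[OF i[OF assms(1)] integrable_scaleR_right[OF i[OF assms(2)], of t]]
      Bochner_Integration.integral_scaleR_right[of circle t "\<lambda>\<theta>. \<phi> \<theta> *\<^sub>R \<eta> \<theta>"]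
    by (simp only:)
  finally show ?thesis .
qed

text \<open>Fixes the objects that the hypotheses only assert to exist: the derivatives of the
  projections and a smooth density \<open>f\<close> of \<xi>.\<close>

locale smooth_critical_pair =
  fixes PT PN :: "real^'m \<Rightarrow> real^'m^'m" and PT' PN' :: "real^'m \<Rightarrow> (real^'m) \<Rightarrow>\<^sub>L (real^'m^'m)"
    and u f :: "real \<Rightarrow> real^'m" and \<xi> :: "(real^'m) dist"
  assumes proj: "C1_projections PT PN"
    and dT: "\<And>z. (PT has_derivative blinfun_apply (PT' z)) (at z)" and cT: "continuous_on UNIV PT'"
    and dN: "\<And>z. (PN has_derivative blinfun_apply (PN' z)) (at z)" and cN: "continuous_on UNIV PN'"
    and u: "u \<in> smooth_circle" and f: "f \<in> smooth_circle"
    and \<xi>: "\<And>\<phi>. \<phi> \<in> smooth_circle \<Longrightarrow> \<xi> \<phi> = dist_of_fun f \<phi>"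
    and crit: "critical_L_half PT PN u \<xi>"
begin

abbreviation "U \<equiv> ddth u"

abbreviation "V \<equiv> vform winv"

lemma continuous_PT: "continuous_on S PT"
  using dT by (meson continuous_at_imp_continuous_on has_derivative_continuous)

lemma continuous_PN: "continuous_on S PN"
  using dN by (meson continuous_at_imp_continuous_on has_derivative_continuous)

lemma PT_along:
  assumes "v \<in> smooth_circle"
  shows "continuous_on UNIV (\<lambda>\<theta>. PT (v \<theta>))" "bdd_matrix (\<lambda>\<theta>. PT (v \<theta>))" "bounded (range (\<lambda>\<theta>. PT (v \<theta>)))"
proof -
  show c: "continuous_on UNIV (\<lambda>\<theta>. PT (v \<theta>))"
    by (rule continuous_on_compose2[OF continuous_PT[of UNIV] smooth_circleD(3)[OF assms]]) simp
  have p: "PT (v (\<theta> + 2 * pi)) = PT (v \<theta>)" for \<theta>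
    by (simp add: smooth_circleD(1)[OF assms])
  show "bdd_matrix (\<lambda>\<theta>. PT (v \<theta>))" "bounded (range (\<lambda>\<theta>. PT (v \<theta>)))"
    by (rule bdd_matrix_continuous[OF c p], rule bounded_range_periodic[OF c p])
qed

lemma PN_along:
  assumes "v \<in> smooth_circle"
  shows "continuous_on UNIV (\<lambda>\<theta>. PN (v \<theta>))" "bdd_matrix (\<lambda>\<theta>. PN (v \<theta>))" "bounded (range (\<lambda>\<theta>. PN (v \<theta>)))"
proof -
  show c: "continuous_on UNIV (\<lambda>\<theta>. PN (v \<theta>))"
    by (rule continuous_on_compose2[OF continuous_PN[of UNIV] smooth_circleD(3)[OF assms]]) simp
  have p: "PN (v (\<theta> + 2 * pi)) = PN (v \<theta>)" for \<theta>
    by (simp add: smooth_circleD(1)[OF assms])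
  show "bdd_matrix (\<lambda>\<theta>. PN (v \<theta>))" "bounded (range (\<lambda>\<theta>. PN (v \<theta>)))"
    by (rule bdd_matrix_continuous[OF c p], rule bounded_range_periodic[OF c p])
qed

lemma PT'_along:
  assumes "w \<in> smooth_circle"
  shows "bdd_matrix (\<lambda>\<theta>. PT' (u \<theta>) (w \<theta>))" "bounded (range (\<lambda>\<theta>. blinfun_apply (PT' (u \<theta>)) (w \<theta>)))"
proof -
  have c: "continuous_on UNIV (\<lambda>\<theta>. blinfun_apply (PT' (u \<theta>)) (w \<theta>))"
    by (rule bounded_bilinear.continuous_on[OF bounded_bilinear_blinfun_apply
        continuous_on_compose2[OF cT smooth_circleD(3)[OF u]] smooth_circleD(3)[OF assms]]) simp
  have p: "blinfun_apply (PT' (u (\<theta> + 2 * pi))) (w (\<theta> + 2 * pi)) = PT' (u \<theta>) (w \<theta>)" for \<theta>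
    by (simp add: smooth_circleD(1)[OF assms] smooth_circleD(1)[OF u])
  show "bdd_matrix (\<lambda>\<theta>. PT' (u \<theta>) (w \<theta>))" "bounded (range (\<lambda>\<theta>. blinfun_apply (PT' (u \<theta>)) (w \<theta>)))"
    by (rule bdd_matrix_continuous[OF c p], rule bounded_range_periodic[OF c p])
qed

lemma PN'_along:
  assumes "w \<in> smooth_circle"
  shows "bdd_matrix (\<lambda>\<theta>. PN' (u \<theta>) (w \<theta>))" "bounded (range (\<lambda>\<theta>. blinfun_apply (PN' (u \<theta>)) (w \<theta>)))"
proof -
  have c: "continuous_on UNIV (\<lambda>\<theta>. blinfun_apply (PN' (u \<theta>)) (w \<theta>))"
    by (rule bounded_bilinear.continuous_on[OF bounded_bilinear_blinfun_apply
        continuous_on_compose2[OF cN smooth_circleD(3)[OF u]] smooth_circleD(3)[OF assms]]) simp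
  have p: "blinfun_apply (PN' (u (\<theta> + 2 * pi))) (w (\<theta> + 2 * pi)) = PN' (u \<theta>) (w \<theta>)" for \<theta>
    by (simp add: smooth_circleD(1)[OF assms] smooth_circleD(1)[OF u])
  show "bdd_matrix (\<lambda>\<theta>. PN' (u \<theta>) (w \<theta>))" "bounded (range (\<lambda>\<theta>. blinfun_apply (PN' (u \<theta>)) (w \<theta>)))"
    by (rule bdd_matrix_continuous[OF c p], rule bounded_range_periodic[OF c p])
qed

text \<open>Pointwise derivative of \<open>PN(u) u'\<close> in the direction \<open>w\<close>. The
  linearized constraint asks only for its integral over the circle to vanish.\<close>

definition dconstr :: "(real \<Rightarrow> real^'m) \<Rightarrow> real \<Rightarrow> real^'m" where
  "dconstr w \<theta> = PN' (u \<theta>) (w \<theta>) *v U \<theta> + PN (u \<theta>) *v ddth w \<theta>"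

lemma smooth_L2: "v \<in> smooth_circle \<Longrightarrow> v \<in> L2_circle" "v \<in> smooth_circle \<Longrightarrow> ddth v \<in> L2_circle"
  for v :: "real \<Rightarrow> real^'m"
  by (rule smooth_circle_L2, assumption)+

lemma smooth_bounded: "v \<in> smooth_circle \<Longrightarrow> bounded (range v)" "v \<in> smooth_circle \<Longrightarrow> bounded (range (ddth v))"
  for v :: "real \<Rightarrow> real^'m"
  using bounded_range_periodic[of v] bounded_range_periodic[of "ddth v"] smooth_circleD[of v] by metis+

lemma vec_L2_add: "a \<in> L2_circle \<Longrightarrow> b \<in> L2_circle \<Longrightarrow> (\<lambda>\<theta>. a \<theta> + b \<theta>) \<in> L2_circle"
  and vec_L2_diff: "a \<in> L2_circle \<Longrightarrow> b \<in> L2_circle \<Longrightarrow> (\<lambda>\<theta>. a \<theta> - b \<theta>) \<in> L2_circle"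
  for a b :: "real \<Rightarrow> real^'m"
  by (simp_all add: L2_circle_vec_iff L2_circle_add L2_circle_diff)

text \<open>The alternatives cover two situations: \<open>f\<close> varied by \<eta>, and
  \<open>u'\<close> varied by \<open>w'\<close>.\<close>

lemma uniform_quotients:
  assumes w: "w \<in> smooth_circle" and F: "F \<in> smooth_circle \<or> F = U" and H: "H \<in> smooth_circle \<or> H = ddth w"
  shows "uniform_limit UNIV (\<lambda>t \<theta>. (PT (u \<theta> + t *\<^sub>R w \<theta>) *v (F \<theta> + t *\<^sub>R H \<theta>) - PT (u \<theta>) *v F \<theta>) /\<^sub>R t)
      (\<lambda>\<theta>. PT' (u \<theta>) (w \<theta>) *v F \<theta> + PT (u \<theta>) *v H \<theta>) (at 0)"
    "uniform_limit UNIV (\<lambda>t \<theta>. (PN (u \<theta> + t *\<^sub>R w \<theta>) *v (F \<theta> + t *\<^sub>R H \<theta>) - PN (u \<theta>) *v F \<theta>) /\<^sub>R t)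
      (\<lambda>\<theta>. PN' (u \<theta>) (w \<theta>) *v F \<theta> + PN (u \<theta>) *v H \<theta>) (at 0)"
proof -
  obtain R where R: "\<And>\<theta>. norm (u \<theta>) \<le> R"
    using smooth_bounded(1)[OF u] unfolding bounded_iff by blast
  obtain W where W: "\<And>\<theta>. norm (w \<theta>) \<le> W"
    using smooth_bounded(1)[OF w] unfolding bounded_iff by blast
  have FH: "bounded (range F)" "bounded (range H)"
    using smooth_bounded(1)[of F] smooth_bounded(2)[OF u] smooth_bounded(1)[of H] smooth_bounded(2)[OF w] F H by auto
  have b: "norm (PT z) \<le> real CARD('m) * (real CARD('m) * 1)" "norm (PN z) \<le> real CARD('m) * (real CARD('m) * 1)" for z
    by (intro norm_le_of_entries C1_projections_bounded[OF proj])+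
  note q = uniform_limit_C1_quotient[OF dT cT b(1) R W] uniform_limit_C1_quotient[OF dN cN b(2) R W]
  show "uniform_limit UNIV (\<lambda>t \<theta>. (PT (u \<theta> + t *\<^sub>R w \<theta>) *v (F \<theta> + t *\<^sub>R H \<theta>) - PT (u \<theta>) *v F \<theta>) /\<^sub>R t)
      (\<lambda>\<theta>. PT' (u \<theta>) (w \<theta>) *v F \<theta> + PT (u \<theta>) *v H \<theta>) (at 0)"
    using uniform_limit_product_quotient[of "\<lambda>t \<theta>. PT (u \<theta> + t *\<^sub>R w \<theta>)", OF _ _ PT'_along(2)[OF w] FH] q(1) PT_along(3)[OF u]
    by simp
  show "uniform_limit UNIV (\<lambda>t \<theta>. (PN (u \<theta> + t *\<^sub>R w \<theta>) *v (F \<theta> + t *\<^sub>R H \<theta>) - PN (u \<theta>) *v F \<theta>) /\<^sub>R t)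
      (\<lambda>\<theta>. PN' (u \<theta>) (w \<theta>) *v F \<theta> + PN (u \<theta>) *v H \<theta>) (at 0)"
    using uniform_limit_product_quotient[of "\<lambda>t \<theta>. PN (u \<theta> + t *\<^sub>R w \<theta>)", OF _ _ PN'_along(2)[OF w] FH] q(2) PN_along(3)[OF u]
    by simp
qed

lemma L_half_has_derivative:
  assumes w: "w \<in> smooth_circle" and \<eta>: "\<eta> \<in> smooth_circle"
  defines "a \<equiv> \<lambda>\<theta>. PT (u \<theta>) *v f \<theta>" and "b \<equiv> \<lambda>\<theta>. PT (u \<theta>) *v U \<theta>"
    and "c \<equiv> \<lambda>\<theta>. PN (u \<theta>) *v f \<theta>" and "d \<equiv> \<lambda>\<theta>. PN (u \<theta>) *v U \<theta>"
    and "a' \<equiv> \<lambda>\<theta>. PT' (u \<theta>) (w \<theta>) *v f \<theta> + PT (u \<theta>) *v \<eta> \<theta>"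
    and "b' \<equiv> \<lambda>\<theta>. PT' (u \<theta>) (w \<theta>) *v U \<theta> + PT (u \<theta>) *v ddth w \<theta>"
    and "c' \<equiv> \<lambda>\<theta>. PN' (u \<theta>) (w \<theta>) *v f \<theta> + PN (u \<theta>) *v \<eta> \<theta>"
  shows "((\<lambda>t. L_half PT PN (\<lambda>\<theta>. u \<theta> + t *\<^sub>R w \<theta>) (\<lambda>\<phi>. \<xi> \<phi> + t *\<^sub>R dist_of_fun \<eta> \<phi>)) has_real_derivative
    V a' a - V a' b - V a b' - V c' d - V c (dconstr w)) (at 0)"
proof -
  define ut where "ut t = (\<lambda>\<theta>. u \<theta> + t *\<^sub>R w \<theta>)" for t
  define ft where "ft t = (\<lambda>\<theta>. f \<theta> + t *\<^sub>R \<eta> \<theta>)" for t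
  define Ut where "Ut t = (\<lambda>\<theta>. U \<theta> + t *\<^sub>R ddth w \<theta>)" for t
  define ta tb tc td where "ta t = (\<lambda>\<theta>. PT (ut t \<theta>) *v ft t \<theta>)" and "tb t = (\<lambda>\<theta>. PT (ut t \<theta>) *v Ut t \<theta>)"
    and "tc t = (\<lambda>\<theta>. PN (ut t \<theta>) *v ft t \<theta>)" and "td t = (\<lambda>\<theta>. PN (ut t \<theta>) *v Ut t \<theta>)" for t
  have s: "ut t \<in> smooth_circle" "ddth (ut t) = Ut t" "ft t \<in> smooth_circle" for t
    unfolding ut_def Ut_def ft_def using smooth_circle_linear_combination u w f \<eta> by auto
  have UL: "Ut t \<in> L2_circle" "ft t \<in> L2_circle" for t
    using smooth_L2[OF s(1)] smooth_L2[OF s(3)] by (simp_all add: s(2))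
  have L: "L_half PT PN (ut t) (\<lambda>\<phi>. \<xi> \<phi> + t *\<^sub>R dist_of_fun \<eta> \<phi>) =
      1/2 * V (ta t) (ta t) - V (ta t) (tb t) - V (tc t) (td t)" for t
    unfolding ta_def tb_def tc_def td_def
  proof (rule L_half_eq)
    show "bdd_matrix (PT \<circ> ut t)" "bdd_matrix (PN \<circ> ut t)"
      using PT_along(2)[OF s(1)] PN_along(2)[OF s(1)] by (simp_all add: o_def)
    show "dist_fourier (\<lambda>\<phi>. (\<xi> \<phi> + t *\<^sub>R dist_of_fun \<eta> \<phi>) $ j) n = fourier (\<lambda>\<theta>. ft t \<theta> $ j) n" for j n
      by (rule dist_fourier_dist_of_fun[OF UL(2)]) (simp add: ft_def \<xi> dist_of_fun_linear_combination[OF f \<eta>])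
    show "dist_fourier (\<lambda>\<phi>. dist_deriv (ut t) \<phi> $ j) n = fourier (\<lambda>\<theta>. Ut t \<theta> $ j) n" for j n
      using dist_fourier_dist_deriv[OF smooth_L2(1)[OF s(1)]] fourier_ddth[OF s(1)] by (simp add: s(2))
  qed (fact UL)+
  have m: "cmod (complex_of_real (winv n)) \<le> 1" for n
    by (rule winv_cmod)
  have L2: "ta t \<in> L2_circle" "tb t \<in> L2_circle" "tc t \<in> L2_circle" "td t \<in> L2_circle" for t
    unfolding ta_def tb_def tc_def td_def by (intro bdd_matrix_mult_L2 PT_along(2) PN_along(2) s UL)+
  have L2': "a' \<in> L2_circle" "b' \<in> L2_circle" "c' \<in> L2_circle" "dconstr w \<in> L2_circle"
    unfolding a'_def b'_def c'_def dconstr_def[abs_def]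
    by (intro vec_L2_add bdd_matrix_mult_L2 PT_along(2) PN_along(2) PT'_along(1) PN'_along(1) smooth_L2 u w f \<eta>)+
  have q: "uniform_limit UNIV (\<lambda>t \<theta>. (ta t \<theta> - ta 0 \<theta>) /\<^sub>R t) a' (at 0)"
    "uniform_limit UNIV (\<lambda>t \<theta>. (tb t \<theta> - tb 0 \<theta>) /\<^sub>R t) b' (at 0)"
    "uniform_limit UNIV (\<lambda>t \<theta>. (tc t \<theta> - tc 0 \<theta>) /\<^sub>R t) c' (at 0)"
    "uniform_limit UNIV (\<lambda>t \<theta>. (td t \<theta> - td 0 \<theta>) /\<^sub>R t) (dconstr w) (at 0)"
    using uniform_quotients[OF w, of f \<eta>] uniform_quotients[OF w, of U "ddth w"] f \<eta>
    by (simp_all add: ta_def tb_def tc_def td_def ut_def ft_def Ut_def a'_def b'_def c'_def dconstr_def[abs_def])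
  have "((\<lambda>t. 1/2 * V (ta t) (ta t) - V (ta t) (tb t) - V (tc t) (td t)) has_real_derivative
      1/2 * (V a' (ta 0) + V (ta 0) a') - (V a' (tb 0) + V (ta 0) b') - (V c' (td 0) + V (tc 0) (dconstr w))) (at 0)"
    by (intro DERIV_diff DERIV_cmult vform_has_derivative m L2 L2' q)
  moreover have "ta 0 = a" "tb 0 = b" "tc 0 = c" "td 0 = d"
    by (simp_all add: ta_def tb_def tc_def td_def ut_def ft_def Ut_def a_def b_def c_def d_def)
  moreover have "V a a' = V a' a"
    by (rule vform_commute) simp
  ultimately show ?thesis
    unfolding L[symmetric] by (simp add: ut_def algebra_simps)
qed

end

lemma vform_multiplier:
  assumes "\<And>i n. fourier (\<lambda>\<theta>. K \<theta> $ i) n = of_real (r n) * fourier (\<lambda>\<theta>. h \<theta> $ i) n"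
  shows "vform r x h = vform (\<lambda>_. 1) x K"
  unfolding vform_def by (intro sum.cong refl mform_weight_cong) (simp add: assms)

text \<open>Testing with cosines and sines along a coordinate axis isolates each single
  coefficient.\<close>

lemma orthogonal_to_smooth:
  fixes G :: "real \<Rightarrow> real^'m"
  assumes G: "G \<in> L2_circle" and z: "\<And>\<eta>. \<eta> \<in> smooth_circle \<Longrightarrow> (LINT \<theta>|circle. \<eta> \<theta> \<bullet> G \<theta>) = 0"
  shows "fourier (\<lambda>\<theta>. G \<theta> $ i) n = 0"
proof -
  have "dist_fourier (\<lambda>\<phi>. 0) n = fourier (\<lambda>\<theta>. G \<theta> $ i) n"
  proof (rule dist_fourier_eq[OF L2_circleD(4)[OF L2_circle_vec_nth[OF G]]])
    fix \<phi> :: "real \<Rightarrow> real" assume "\<phi> \<in> smooth_circle"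
    then have "(LINT \<theta>|circle. (\<phi> \<theta> *\<^sub>R axis i 1) \<bullet> G \<theta>) = 0"
      by (intro z smooth_circle_scaleR_const)
    then show "0 = (LINT \<theta>|circle. \<phi> \<theta> * G \<theta> $ i)"
      by (simp add: inner_axis')
  qed
  then show ?thesis
    by (simp add: dist_fourier_def complex_eq_iff)
qed

section \<open>Stationarity in \<xi> and in \<open>u\<close>\<close>

context smooth_critical_pair
begin

lemma fourier_U:
  "dist_fourier (\<lambda>\<phi>. dist_deriv u \<phi> $ j) n = fourier (\<lambda>\<theta>. U \<theta> $ j) n"
  using dist_fourier_dist_deriv[OF smooth_L2(1)[OF u]] fourier_ddth[OF u] by simp

lemma dir_deriv_PN: "dir_deriv PN u w = (\<lambda>\<theta>. PN' (u \<theta>) (w \<theta>))"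
proof
  fix \<theta>
  have "frechet_derivative PN (at (u \<theta>)) = blinfun_apply (PN' (u \<theta>))"
    by (rule frechet_derivative_at[OF dN, symmetric])
  then have "dir_deriv PN u w \<theta> = PN' (u \<theta>) (\<Sum>k\<in>UNIV. w \<theta> $ k *\<^sub>R axis k 1)"
    by (simp add: dir_deriv_def blinfun.sum_right blinfun.scaleR_right)
  also have "(\<Sum>k\<in>UNIV. w \<theta> $ k *\<^sub>R axis k 1) = w \<theta>"
    using basis_expansion[of "w \<theta>"] by (simp add: scalar_mult_eq_scaleR)
  finally show "dir_deriv PN u w \<theta> = PN' (u \<theta>) (w \<theta>)" .
qed

lemma dconstr_L2: "w \<in> smooth_circle \<Longrightarrow> dconstr w \<in> L2_circle"
  unfolding dconstr_def[abs_def]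
  by (intro vec_L2_add bdd_matrix_mult_L2 PN_along(2) PN'_along(1) smooth_L2 u)

text \<open>For smooth \<open>u\<close> the bracket in the constraint is an ordinary integral, and
  both terms together form the integral of \<open>dconstr w\<close>.\<close>

lemma linearized_constraintI:
  assumes w: "w \<in> smooth_circle" and z: "\<And>i. (LINT \<theta>|circle. dconstr w \<theta> $ i) = 0"
  shows "linearized_constraint PN u w"
  unfolding linearized_constraint_def
proof (intro conjI allI)
  have b: "bdd_matrix (dir_deriv PN u w)"
    unfolding dir_deriv_PN by (rule PN'_along(1)[OF w])
  show "pairable (\<lambda>\<theta>. dir_deriv PN u w \<theta> $ i $ j) (\<lambda>\<phi>. dist_deriv u \<phi> $ j)" for i j
    using pairing_fourier(2)[OF bdd_matrix_entry_L2[OF b] L2_circle_vec_nth[OF smooth_L2(2)[OF u]] fourier_U] .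
  have L: "(\<lambda>\<theta>. PN' (u \<theta>) (w \<theta>) *v U \<theta>) \<in> L2_circle" "(\<lambda>\<theta>. PN (u \<theta>) *v ddth w \<theta>) \<in> L2_circle"
    by (intro bdd_matrix_mult_L2 PN_along(2) PN'_along(1) smooth_L2 u w)+
  have "((LINT \<theta>|circle. PN (u \<theta>) *v ddth w \<theta>) + mat_pairing (dir_deriv PN u w) (dist_deriv u)) $ i = 0" for i
  proof -
    have "((LINT \<theta>|circle. PN (u \<theta>) *v ddth w \<theta>) + mat_pairing (dir_deriv PN u w) (dist_deriv u)) $ i =
        (LINT \<theta>|circle. (PN (u \<theta>) *v ddth w \<theta>) $ i) + (LINT \<theta>|circle. (PN' (u \<theta>) (w \<theta>) *v U \<theta>) $ i)"
      using integrable_vec_component(2)[OF L2_circle_integrable[OF L(2)], of i]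
        mat_pairing_nth[OF b smooth_L2(2)[OF u] fourier_U, of i] by (simp add: dir_deriv_PN)
    also have "\<dots> = (LINT \<theta>|circle. (PN (u \<theta>) *v ddth w \<theta>) $ i + (PN' (u \<theta>) (w \<theta>) *v U \<theta>) $ i)"
      by (rule Bochner_Integration.integral_add[symmetric])
        (rule integrable_vec_component(1)[OF L2_circle_integrable[OF L(2)]]
          integrable_vec_component(1)[OF L2_circle_integrable[OF L(1)]])+
    also have "\<dots> = (LINT \<theta>|circle. dconstr w \<theta> $ i)"
      by (simp add: dconstr_def add.commute)
    finally show ?thesis
      using z by simp
  qed
  then show "(LINT \<theta>|circle. PN (u \<theta>) *v ddth w \<theta>) + mat_pairing (dir_deriv PN u w) (dist_deriv u) = 0"
    by (simp add: vec_eq_iff)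
qed

lemma variation_zero:
  assumes w: "w \<in> smooth_circle" and \<eta>: "\<eta> \<in> smooth_circle"
    and z: "\<And>i. (LINT \<theta>|circle. dconstr w \<theta> $ i) = 0"
  shows "V (\<lambda>\<theta>. PT' (u \<theta>) (w \<theta>) *v f \<theta> + PT (u \<theta>) *v \<eta> \<theta>) (\<lambda>\<theta>. PT (u \<theta>) *v f \<theta>)
    - V (\<lambda>\<theta>. PT' (u \<theta>) (w \<theta>) *v f \<theta> + PT (u \<theta>) *v \<eta> \<theta>) (\<lambda>\<theta>. PT (u \<theta>) *v U \<theta>)
    - V (\<lambda>\<theta>. PT (u \<theta>) *v f \<theta>) (\<lambda>\<theta>. PT' (u \<theta>) (w \<theta>) *v U \<theta> + PT (u \<theta>) *v ddth w \<theta>)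
    - V (\<lambda>\<theta>. PN' (u \<theta>) (w \<theta>) *v f \<theta> + PN (u \<theta>) *v \<eta> \<theta>) (\<lambda>\<theta>. PN (u \<theta>) *v U \<theta>)
    - V (\<lambda>\<theta>. PN (u \<theta>) *v f \<theta>) (dconstr w) = 0"
proof -
  have "((\<lambda>t. L_half PT PN (\<lambda>\<theta>. u \<theta> + t *\<^sub>R w \<theta>) (\<lambda>\<phi>. \<xi> \<phi> + t *\<^sub>R dist_of_fun \<eta> \<phi>))
      has_real_derivative 0) (at 0)"
    using crit w \<eta> linearized_constraintI[OF w z] unfolding critical_L_half_def by blast
  then show ?thesis
    using DERIV_unique[OF L_half_has_derivative[OF w \<eta>]] by blast
qed

abbreviation (input) "fH \<equiv> \<lambda>\<theta>. PT (u \<theta>) *v f \<theta>"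
abbreviation (input) "fV \<equiv> \<lambda>\<theta>. PN (u \<theta>) *v f \<theta>"
abbreviation (input) "UH \<equiv> \<lambda>\<theta>. PT (u \<theta>) *v U \<theta>"
abbreviation (input) "UV \<equiv> \<lambda>\<theta>. PN (u \<theta>) *v U \<theta>"

lemma split_L2: "fH \<in> L2_circle" "fV \<in> L2_circle" "UH \<in> L2_circle" "UV \<in> L2_circle"
  by (intro bdd_matrix_mult_L2 PT_along(2) PN_along(2) smooth_L2 u f)+

text \<open>With \<open>w = 0\<close> the first variation is linear in \<eta>. Rewritten with
  potentials it says that an L^2 field is orthogonal to all smooth \<eta>, so it vanishes and the
  identity extends to every \<open>x\<close> in L^2. The extension is needed because the next tests
  use products with \<open>PT(u)\<close> and \<open>PN(u)\<close>, which are in general only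
  continuous.\<close>

lemma stationary_in_xi:
  assumes x: "x \<in> L2_circle"
  shows "V (\<lambda>\<theta>. PT (u \<theta>) *v x \<theta>) (\<lambda>\<theta>. fH \<theta> - UH \<theta>) = V (\<lambda>\<theta>. PN (u \<theta>) *v x \<theta>) UV"
proof -
  have k: "(\<lambda>\<theta>. fH \<theta> - UH \<theta>) \<in> L2_circle"
    by (intro vec_L2_diff split_L2)
  have ex: "\<exists>K::real \<Rightarrow> real^'m. K \<in> L2_circle \<and> (\<forall>i n. fourier (\<lambda>\<theta>. K \<theta> $ i) n = of_real (winv n) * fourier (\<lambda>\<theta>. h \<theta> $ i) n)"
    if h: "h \<in> L2_circle" for h :: "real \<Rightarrow> real^'m"
  proof -
    have "(\<lambda>n. (winv n)\<^sup>2 * (cmod (fourier (\<lambda>\<theta>. h \<theta> $ i) n))\<^sup>2) summable_on UNIV" for i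
      using winv_bounds abs_square_le_1
      by (intro summable_on_comparison_test[OF Bessel_summable[OF L2_circle_vec_nth[OF h, of i]]] mult_left_le_one_le) (auto simp: power_le_one)
    then show ?thesis
      using vec_multiplier_exists[of winv h] winv_uminus by metis
  qed
  obtain K1 :: "real \<Rightarrow> real^'m" where K1: "K1 \<in> L2_circle"
    "\<And>i n. fourier (\<lambda>\<theta>. K1 \<theta> $ i) n = of_real (winv n) * fourier (\<lambda>\<theta>. (fH \<theta> - UH \<theta>) $ i) n"
    using ex[OF k] by blast
  obtain K2 :: "real \<Rightarrow> real^'m" where K2: "K2 \<in> L2_circle"
    "\<And>i n. fourier (\<lambda>\<theta>. K2 \<theta> $ i) n = of_real (winv n) * fourier (\<lambda>\<theta>. UV \<theta> $ i) n"
    using ex[OF split_L2(4)] by blast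
  \<comment> \<open>The potentials \<open>K1\<close> and \<open>K2\<close> absorb the symbol
    \<open>winv\<close>, and symmetry of the projections moves them off the test field.\<close>
  define G where "G \<theta> = PT (u \<theta>) *v K1 \<theta> - PN (u \<theta>) *v K2 \<theta>" for \<theta>
  have L: "(\<lambda>\<theta>. PT (u \<theta>) *v x \<theta>) \<in> L2_circle" "(\<lambda>\<theta>. PN (u \<theta>) *v x \<theta>) \<in> L2_circle" if "x \<in> L2_circle" for x
    by (intro bdd_matrix_mult_L2 PT_along(2) PN_along(2) u that)+
  have G: "G \<in> L2_circle"
    unfolding G_def[abs_def] by (intro vec_L2_diff L K1 K2)
  have pair: "V (\<lambda>\<theta>. PT (u \<theta>) *v x \<theta>) (\<lambda>\<theta>. fH \<theta> - UH \<theta>) - V (\<lambda>\<theta>. PN (u \<theta>) *v x \<theta>) UV = (LINT \<theta>|circle. x \<theta> \<bullet> G \<theta>)"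
    if x: "x \<in> L2_circle" for x
  proof -
    note a = C1_projectionsD(6,7)[OF proj]
    have "(LINT \<theta>|circle. x \<theta> \<bullet> G \<theta>) = vform (\<lambda>_. 1) x (\<lambda>\<theta>. PT (u \<theta>) *v K1 \<theta>) - vform (\<lambda>_. 1) x (\<lambda>\<theta>. PN (u \<theta>) *v K2 \<theta>)"
      unfolding integral_inner_vec[OF x G] unfolding G_def[abs_def]
      by (rule vform_diff_right) (simp_all add: x L K1 K2)
    also have "vform (\<lambda>_. 1) x (\<lambda>\<theta>. PT (u \<theta>) *v K1 \<theta>) = vform (\<lambda>_. 1) (\<lambda>\<theta>. PT (u \<theta>) *v x \<theta>) K1"
      unfolding integral_inner_vec[OF x L(1)[OF K1(1)], symmetric] integral_inner_vec[OF L(1)[OF x] K1(1), symmetric] a ..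
    also have "vform (\<lambda>_. 1) x (\<lambda>\<theta>. PN (u \<theta>) *v K2 \<theta>) = vform (\<lambda>_. 1) (\<lambda>\<theta>. PN (u \<theta>) *v x \<theta>) K2"
      unfolding integral_inner_vec[OF x L(2)[OF K2(1)], symmetric] integral_inner_vec[OF L(2)[OF x] K2(1), symmetric] a ..
    finally show ?thesis
      using vform_multiplier[OF K1(2)] vform_multiplier[OF K2(2)] by simp
  qed
  have "(LINT \<theta>|circle. \<eta> \<theta> \<bullet> G \<theta>) = 0" if \<eta>: "\<eta> \<in> smooth_circle" for \<eta>
  proof -
    have d0: "dconstr (\<lambda>_. 0) = (\<lambda>_. 0)"
      by (simp add: dconstr_def[abs_def] ddth_const blinfun.zero_right)
    have "V (\<lambda>\<theta>. PT (u \<theta>) *v \<eta> \<theta>) fH - V (\<lambda>\<theta>. PT (u \<theta>) *v \<eta> \<theta>) UH - V (\<lambda>\<theta>. PN (u \<theta>) *v \<eta> \<theta>) UV = 0"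
      using variation_zero[OF smooth_circle_const[of 0] \<eta>]
      by (simp add: d0 ddth_const blinfun.zero_right)
    moreover have "V (\<lambda>\<theta>. PT (u \<theta>) *v \<eta> \<theta>) (\<lambda>\<theta>. fH \<theta> - UH \<theta>) =
        V (\<lambda>\<theta>. PT (u \<theta>) *v \<eta> \<theta>) fH - V (\<lambda>\<theta>. PT (u \<theta>) *v \<eta> \<theta>) UH"
      by (rule vform_diff_right[OF winv_cmod L(1)[OF smooth_L2(1)[OF \<eta>]] split_L2(1,3)])
    ultimately show ?thesis
      unfolding pair[OF smooth_L2(1)[OF \<eta>], symmetric] by simp
  qed
  then have "fourier (\<lambda>\<theta>. G \<theta> $ i) n = 0" for i n
    by (rule orthogonal_to_smooth[OF G])
  then have "vform (\<lambda>_. 1) x G = 0"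
    by (simp add: vform_def mform_def)
  then show ?thesis
    using pair[OF x] integral_inner_vec[OF x G] by simp
qed

text \<open>Testing with \<open>UV\<close> itself annihilates the \<open>PT\<close> side, so
  \<open>UV\<close> has zero norm for \<open>V\<close> and no nonzero frequencies. Its mean, which
  \<open>V\<close> does not see, vanishes by the constraint contained in \<open>EE\<close>.\<close>

lemma vertical_part:
  "fourier (\<lambda>\<theta>. UV \<theta> $ i) n = 0" "V UV x = 0" "V x UV = 0"
proof -
  have "V (\<lambda>\<theta>. PN (u \<theta>) *v UV \<theta>) UV = V (\<lambda>\<theta>. PT (u \<theta>) *v UV \<theta>) (\<lambda>\<theta>. fH \<theta> - UH \<theta>)"
    by (rule stationary_in_xi[OF split_L2(4), symmetric])
  then have z: "V UV UV = 0"
    by (simp add: C1_projectionsD[OF proj])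
  show "V UV x = 0" "V x UV = 0"
    using vform_winv_self_zero[OF split_L2(4) z] by blast+
  show "fourier (\<lambda>\<theta>. UV \<theta> $ i) n = 0"
  proof (cases "n = 0")
    case True
    have "mat_pairing (PN \<circ> u) (dist_deriv u) = 0"
      using crit by (simp add: critical_L_half_def EE_def)
    moreover have "bdd_matrix (PN \<circ> u)"
      using PN_along(2)[OF u] by (simp add: o_def)
    ultimately have "(LINT \<theta>|circle. UV \<theta> $ i) = 0"
      using mat_pairing_nth[OF _ smooth_L2(2)[OF u] fourier_U, of "PN \<circ> u" i] by simp
    then show ?thesis
      using True by (simp add: fourier_0)
  qed (use vform_winv_self_zero(1)[OF split_L2(4) z] in blast)
qed

text \<open>Testing with the horizontal field \<open>fH - UH\<close> annihilates the
  \<open>PN\<close> side. Only a constant can remain, and \<open>V\<close> ignores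
  constants.\<close>

lemma horizontal_part: "V (\<lambda>\<theta>. fH \<theta> - UH \<theta>) x = 0" "V x (\<lambda>\<theta>. fH \<theta> - UH \<theta>) = 0"
proof -
  have k: "(\<lambda>\<theta>. fH \<theta> - UH \<theta>) \<in> L2_circle"
    by (intro vec_L2_diff split_L2)
  have "V (\<lambda>\<theta>. PT (u \<theta>) *v (fH \<theta> - UH \<theta>)) (\<lambda>\<theta>. fH \<theta> - UH \<theta>) = V (\<lambda>\<theta>. PN (u \<theta>) *v (fH \<theta> - UH \<theta>)) UV"
    by (rule stationary_in_xi[OF k])
  then have "V (\<lambda>\<theta>. fH \<theta> - UH \<theta>) (\<lambda>\<theta>. fH \<theta> - UH \<theta>) = 0"
    by (simp add: C1_projectionsD[OF proj] matrix_vector_mult_diff_distrib)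
  from vform_winv_self_zero(2,3)[OF k this]
  show "V (\<lambda>\<theta>. fH \<theta> - UH \<theta>) x = 0" "V x (\<lambda>\<theta>. fH \<theta> - UH \<theta>) = 0"
    by blast+
qed

lemma PT'_PN': "blinfun_apply (PT' z) x + PN' z x = 0"
proof -
  have "PT = (\<lambda>z. mat 1 - PN z)"
    using proj by (auto simp: C1_projections_def fun_eq_iff eq_diff_eq)
  then have "(PT has_derivative (\<lambda>x. 0 - blinfun_apply (PN' z) x)) (at z)"
    using has_derivative_diff[OF has_derivative_const dN] by metis
  then have "blinfun_apply (PT' z) = (\<lambda>x. 0 - blinfun_apply (PN' z) x)"
    using has_derivative_unique[OF dT] by blast
  then show ?thesis
    by simp
qed

text \<open>Taking \<eta> = 0, the two preceding lemmas replace \<open>fH\<close> by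
  \<open>U\<close> under \<open>V\<close>. The variation of the horizontal part of \<open>u'\<close>
  is \<open>w' - dconstr w\<close>, because the two projections add up to the identity and their
  derivatives to zero.\<close>

lemma stationary_in_u:
  assumes w: "w \<in> smooth_circle" and z: "\<And>i. (LINT \<theta>|circle. dconstr w \<theta> $ i) = 0"
  shows "V U (ddth w) = V (\<lambda>\<theta>. U \<theta> - fV \<theta>) (dconstr w)"
proof -
  let ?a' = "\<lambda>\<theta>. PT' (u \<theta>) (w \<theta>) *v f \<theta>" and ?b' = "\<lambda>\<theta>. PT' (u \<theta>) (w \<theta>) *v U \<theta> + PT (u \<theta>) *v ddth w \<theta>"
  have L: "?a' \<in> L2_circle" "?b' \<in> L2_circle" "ddth w \<in> L2_circle" "U \<in> L2_circle"
    by (intro vec_L2_add bdd_matrix_mult_L2 PT_along(2) PT'_along(1) smooth_L2 u f w)+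
  note d = dconstr_L2[OF w]
  have "V ?a' fH - V ?a' UH - V fH ?b' - V fV (dconstr w) = 0"
    using variation_zero[OF w smooth_circle_const[of 0] z] by (simp add: vertical_part)
  moreover have "V ?a' (\<lambda>\<theta>. fH \<theta> - UH \<theta>) = V ?a' fH - V ?a' UH"
    by (rule vform_diff_right[OF winv_cmod L(1) split_L2(1,3)])
  moreover have "V (\<lambda>\<theta>. fH \<theta> - UH \<theta>) ?b' = V fH ?b' - V UH ?b'"
    by (rule vform_diff_left[OF winv_cmod split_L2(1,3) L(2)])
  moreover have "V UH ?b' = V U ?b'"
  proof -
    have "(\<lambda>\<theta>. U \<theta> - UV \<theta>) = UH"
      using C1_projectionsD(3)[OF proj] by (simp add: fun_eq_iff diff_eq_eq)
    moreover have "V (\<lambda>\<theta>. U \<theta> - UV \<theta>) ?b' = V U ?b' - V UV ?b'"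
      by (rule vform_diff_left[OF winv_cmod L(4) split_L2(4) L(2)])
    ultimately show ?thesis
      by (simp add: vertical_part)
  qed
  moreover have "V U ?b' = V U (ddth w) - V U (dconstr w)"
  proof -
    have "?b' \<theta> + dconstr w \<theta> = ddth w \<theta>" for \<theta>
    proof -
      have "?b' \<theta> + dconstr w \<theta> = (PT' (u \<theta>) (w \<theta>) + PN' (u \<theta>) (w \<theta>)) *v U \<theta> + (PT (u \<theta>) *v ddth w \<theta> + PN (u \<theta>) *v ddth w \<theta>)"
        by (simp add: dconstr_def matrix_vector_mult_add_rdistrib)
      then show ?thesis
        by (simp add: PT'_PN' C1_projectionsD(3)[OF proj])
    qed
    then have "?b' = (\<lambda>\<theta>. ddth w \<theta> - dconstr w \<theta>)"
      by (auto simp: fun_eq_iff eq_diff_eq)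
    then show ?thesis
      by (simp only: vform_diff_right[OF winv_cmod L(4,3) d])
  qed
  moreover have "V (\<lambda>\<theta>. U \<theta> - fV \<theta>) (dconstr w) = V U (dconstr w) - V fV (dconstr w)"
    by (rule vform_diff_left[OF winv_cmod L(4) split_L2(2) d])
  ultimately show ?thesis
    unfolding horizontal_part by linarith
qed

lemma u_horizontal: "u \<in> horizontal PN"
proof -
  have b: "bdd_matrix (PN \<circ> u)"
    using PN_along(2)[OF u] by (simp add: o_def)
  have "mat_dist (PN \<circ> u) (dist_deriv u) \<phi> $ i = 0" if \<phi>: "\<phi> \<in> smooth_circle" for \<phi> i
  proof -
    have "mat_dist (PN \<circ> u) (dist_deriv u) \<phi> $ i = (LINT \<theta>|circle. \<phi> \<theta> * UV \<theta> $ i)"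
      using mat_dist_nth(1)[OF b smooth_L2(2)[OF u] fourier_U \<phi>] by simp
    also have "\<dots> = mform (\<lambda>_. 1) \<phi> (\<lambda>\<theta>. UV \<theta> $ i)"
      using smooth_circleD[OF \<phi>]
      by (intro Parseval_mform[symmetric] L2_circle_continuous L2_circle_vec_nth[OF split_L2(4)]) blast+
    also have "\<dots> = 0"
      by (simp add: mform_def vertical_part)
    finally show ?thesis .
  qed
  then have "\<forall>\<phi>\<in>smooth_circle. mat_dist (PN \<circ> u) (dist_deriv u) \<phi> = 0"
    by (simp add: vec_eq_iff)
  then show ?thesis
    using crit by (simp add: horizontal_def critical_L_half_def EE_def)
qed

end

section \<open>The Lagrange multiplier\<close>

text \<open>The pointwise sum of an absolutely convergent series is bounded by the sum of the moduli
  at every angle, as the product estimates require; dominated convergence identifies its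
  coefficients.\<close>

lemma abs_summable_representative:
  assumes f: "f \<in> L2_circle" and s: "(\<lambda>n. cmod (fourier f n)) summable_on UNIV"
  obtains g C where "g \<in> L2_circle" "\<And>n. fourier g n = fourier f n" "\<And>\<theta>. \<bar>g \<theta>\<bar> \<le> C"
proof -
  define C where "C = (\<Sum>\<^sub>\<infinity>n. cmod (fourier f n))"
  define g where "g \<theta> = Re (\<Sum>\<^sub>\<infinity>n. fourier f n * cis (of_int n * \<theta>))" for \<theta>
  have lim: "(\<lambda>N. trig N (fourier f) \<theta>) \<longlonglongrightarrow> g \<theta>" for \<theta>
  proof -
    have "(\<lambda>n. fourier f n * cis (of_int n * \<theta>)) summable_on UNIV"
      by (rule abs_summable_summable) (simp add: norm_mult s)
    then have "(\<lambda>N. \<Sum>n\<in>{- int N..int N}. fourier f n * cis (of_int n * \<theta>)) \<longlonglongrightarrow> (\<Sum>\<^sub>\<infinity>n. fourier f n * cis (of_int n * \<theta>))"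
      by (intro has_sum_tendsto_symmetric has_sum_infsum)
    then show ?thesis
      unfolding trig_def g_def by (rule tendsto_Re)
  qed
  have tb: "\<bar>trig N (fourier f) \<theta>\<bar> \<le> C" for N \<theta>
  proof -
    have "\<bar>trig N (fourier f) \<theta>\<bar> \<le> cmod (\<Sum>n\<in>{- int N..int N}. fourier f n * cis (of_int n * \<theta>))"
      unfolding trig_def by (rule abs_Re_le_cmod)
    also have "\<dots> \<le> (\<Sum>n\<in>{- int N..int N}. cmod (fourier f n))"
      by (rule order_trans[OF norm_sum]) (simp add: norm_mult)
    also have "\<dots> \<le> C"
      unfolding C_def by (intro finite_sum_le_infsum s) auto
    finally show ?thesis .
  qed
  have gb: "\<bar>g \<theta>\<bar> \<le> C" for \<theta>
    by (rule tendsto_upperbound[OF tendsto_rabs[OF lim]]) (simp_all add: tb)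
  have gm: "g \<in> borel_measurable circle"
    by (rule borel_measurable_LIMSEQ_real[of _ "\<lambda>N. trig N (fourier f)"]) (auto intro: lim L2_circleD(2)[OF trig_L2])
  have gp: "g (\<theta> + 2 * pi) = g \<theta>" for \<theta>
    unfolding g_def by (simp only: cis_periodic)
  have gL: "g \<in> L2_circle"
    by (rule L2_circle_bounded[OF gm gp gb])
  have "fourier g n = fourier f n" for n
  proof -
    let ?e = "\<lambda>\<theta>. cis (- (of_int n * \<theta>))"
    have i: "integrable circle (\<lambda>\<theta>. complex_of_real (h \<theta>) * ?e \<theta>)" if "h \<in> L2_circle" for h
      using integrable_mult_cis[OF L2_circleD(4)[OF that], of "- of_int n"] by simp
    have "(\<lambda>N. LINT \<theta>|circle. complex_of_real (trig N (fourier f) \<theta>) * ?e \<theta>) \<longlonglongrightarrow> (LINT \<theta>|circle. complex_of_real (g \<theta>) * ?e \<theta>)"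
    proof (rule integral_dominated_convergence)
      show "AE \<theta> in circle. (\<lambda>N. complex_of_real (trig N (fourier f) \<theta>) * ?e \<theta>) \<longlonglongrightarrow> complex_of_real (g \<theta>) * ?e \<theta>"
        by (intro AE_I2 tendsto_intros lim)
      show "integrable circle (\<lambda>\<theta>. C)"
        by (rule L2_circleD(4)[OF L2_circle_const])
      show "AE \<theta> in circle. norm (complex_of_real (trig N (fourier f) \<theta>) * ?e \<theta>) \<le> C" for N
        by (simp add: norm_mult tb)
    qed (use borel_measurable_integrable[OF i[OF gL]] borel_measurable_integrable[OF i[OF trig_L2]] in auto)
    then have "(\<lambda>N. fourier (trig N (fourier f)) n) \<longlonglongrightarrow> fourier g n"
      unfolding fourier_def by (intro tendsto_divide tendsto_const) auto
    moreover have "(\<lambda>N. fourier (trig N (fourier f)) n) \<longlonglongrightarrow> fourier f n"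
      by (rule tendsto_eventually) (rule eventually_sequentiallyI[of "nat \<bar>n\<bar>"],
        simp add: fourier_trig[of "fourier f", OF fourier_uminus_index])
    ultimately show ?thesis
      by (rule LIMSEQ_unique)
  qed
  then show ?thesis
    using that gL gb by blast
qed

lemma winv_power2_summable: "(\<lambda>n. (winv n)\<^sup>2) summable_on UNIV"
proof (rule nonneg_summable_on_int(1))
  have s: "summable (\<lambda>k. 2 * inverse (real k ^ 2))"
    by (intro summable_mult inverse_power_summable) simp
  show "(\<Sum>n\<in>{- int N..int N}. (winv n)\<^sup>2) \<le> (\<Sum>k. 2 * inverse (real k ^ 2))" for N
  proof -
    have "(\<Sum>n\<in>{- int N..int N}. (winv n)\<^sup>2) = (\<Sum>j\<in>{1..N}. 2 * inverse (real j ^ 2))"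
      unfolding sum_symmetric_interval winv_def by (simp add: power_divide inverse_eq_divide)
    also have "\<dots> \<le> (\<Sum>k. 2 * inverse (real k ^ 2))"
      by (intro sum_le_suminf s) auto
    finally show ?thesis .
  qed
qed simp

text \<open>Two derivatives are gained in the square summability of \<open>winv n * fourier h n\<close>, so the potential of
  an \<open>L\<^sup>2\<close> function is bounded and lies in \<open>H\<^bsup>1/2\<^esup>\<close>, which is all that is used of its regularity.\<close>

lemma bounded_potential:
  assumes h: "h \<in> L2_circle"
  obtains \<psi> C where "\<psi> \<in> wdom wabs" "\<And>n. fourier \<psi> n = of_real (winv n) * fourier h n" "\<And>\<theta>. \<bar>\<psi> \<theta>\<bar> \<le> C"
proof -
  have le: "(winv n)\<^sup>2 \<le> 1" for n
    using winv_bounds[of n] by (simp add: power_le_one)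
  have "(\<lambda>n. (winv n)\<^sup>2 * (cmod (fourier h n))\<^sup>2) summable_on UNIV"
    by (rule summable_on_comparison_test[OF Bessel_summable[OF h]]) (auto intro: mult_left_le_one_le le)
  then obtain g where g: "g \<in> L2_circle" "\<And>n. fourier g n = of_real (winv n) * fourier h n"
    using multiplier_exists[of winv h] winv_uminus by metis
  have "(\<lambda>n. \<bar>winv n\<bar> * \<bar>cmod (fourier h n)\<bar>) summable_on UNIV"
    by (rule infsum_Cauchy_Schwarz(1)[OF winv_power2_summable Bessel_summable[OF h]])
  then have "(\<lambda>n. cmod (fourier g n)) summable_on UNIV"
    by (simp add: g(2) norm_mult)
  then obtain \<psi> C where \<psi>: "\<psi> \<in> L2_circle" "\<And>n. fourier \<psi> n = fourier g n" "\<And>\<theta>. \<bar>\<psi> \<theta>\<bar> \<le> C"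
    using abs_summable_representative[OF g(1)] by metis
  have "wabs n * (cmod (fourier \<psi> n))\<^sup>2 \<le> (cmod (fourier h n))\<^sup>2" for n
  proof -
    have "wabs n * (cmod (fourier \<psi> n))\<^sup>2 = (wabs n * (winv n)\<^sup>2) * (cmod (fourier h n))\<^sup>2"
      by (simp add: \<psi>(2) g(2) norm_mult power_mult_distrib)
    also have "wabs n * (winv n)\<^sup>2 = winv n"
      by (simp add: winv_def power2_eq_square)
    also have "winv n * (cmod (fourier h n))\<^sup>2 \<le> (cmod (fourier h n))\<^sup>2"
      by (intro mult_left_le_one_le winv_bounds) simp
    finally show ?thesis .
  qed
  then have "(\<lambda>n. wabs n * (cmod (fourier \<psi> n))\<^sup>2) summable_on UNIV"
    by (intro summable_on_comparison_test[OF Bessel_summable[OF h]]) auto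
  then have "\<psi> \<in> wdom wabs"
    using \<psi>(1) by (simp add: wdom_def)
  then show ?thesis
    by (rule that[of \<psi> C]) (simp_all add: \<psi>(2,3) g(2))
qed

text \<open>The values \<open>(M x, l x)\<close> form a subspace, and it does not contain
  \<open>(0, 1)\<close> because \<open>l\<close> vanishes on the kernel of \<open>M\<close>. A
  normal vector with nonzero last component then expresses \<open>l\<close> through
  \<open>M\<close>. \<open>S\<close> is a mere set with abstract linear combinations since the
  smooth maps are not a type.\<close>

lemma lagrange_multiplier:
  fixes M :: "'a \<Rightarrow> 'b::euclidean_space" and l :: "'a \<Rightarrow> real"
  assumes ne: "x0 \<in> S"
    and lin: "\<And>x y t. x \<in> S \<Longrightarrow> y \<in> S \<Longrightarrow> \<exists>z\<in>S. M z = M x + t *\<^sub>R M y \<and> l z = l x + t * l y"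
    and zero: "\<And>x. x \<in> S \<Longrightarrow> M x = 0 \<Longrightarrow> l x = 0"
  obtains \<mu> where "\<And>x. x \<in> S \<Longrightarrow> l x = \<mu> \<bullet> M x"
proof -
  define W where "W = (\<lambda>x. (M x, l x)) ` S"
  have mem: "(M x, l x) \<in> W" if "x \<in> S" for x
    using that by (simp add: W_def)
  have comb: "p + t *\<^sub>R q \<in> W" if pq: "p \<in> W" "q \<in> W" for p q t
  proof -
    obtain x y where "x \<in> S" "y \<in> S" "p = (M x, l x)" "q = (M y, l y)"
      using pq by (auto simp: W_def)
    then show ?thesis
      using lin[of x y t] mem by force
  qed
  have 0: "0 \<in> W"
    using comb[OF mem[OF ne] mem[OF ne], of "-1"] by (simp add: zero_prod_def)
  have "subspace W"
    unfolding subspace_def using 0 comb[of _ _ 1] comb[OF 0] by auto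
  then have span: "span W = W"
    by (simp add: span_eq_iff)
  \<comment> \<open>\<open>z\<close> is the normal part of \<open>(0, 1)\<close>. Its last component
    equals \<open>z \<bullet> z\<close>, so it vanishes only if \<open>z = 0\<close>, that is, if
    \<open>(0, 1)\<close> lies in \<open>W\<close>.\<close>
  obtain y z where yz: "y \<in> W" "\<And>w. w \<in> W \<Longrightarrow> orthogonal z w" "(0, 1) = y + z"
    using orthogonal_subspace_decomp_exists[of W "(0, 1)"] unfolding span by metis
  obtain a b where ab: "z = (a, b)"
    by (cases z)
  have "b \<noteq> 0"
  proof
    assume "b = 0"
    have "z \<bullet> (0, 1) = z \<bullet> z"
      using yz(2)[OF yz(1)] by (simp add: yz(3) inner_add_right orthogonal_def)
    then have "z = 0"
      using \<open>b = 0\<close> by (simp add: ab zero_prod_def)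
    then have "(0, 1) \<in> W"
      using yz by simp
    then show False
      using zero by (auto simp: W_def)
  qed
  have "l x = (- (1 / b) *\<^sub>R a) \<bullet> M x" if "x \<in> S" for x
    using yz(2)[OF mem[OF that]] \<open>b \<noteq> 0\<close> by (simp add: ab orthogonal_def field_simps)
  then show ?thesis
    using that by blast
qed

lemma smooth_circle_vec:
  fixes g :: "'m::finite \<Rightarrow> real \<Rightarrow> real"
  assumes "\<And>i. g i \<in> smooth_circle"
  shows "(\<lambda>\<theta>. \<chi> i. g i \<theta>) \<in> smooth_circle"
proof -
  have "(\<lambda>\<theta>. \<Sum>i\<in>I. g i \<theta> *\<^sub>R axis i (1::real)) \<in> smooth_circle" for I
  proof (induction I rule: infinite_finite_induct)
    case (insert j I)
    then show ?case
      using smooth_circle_linear_combination(1)[OF smooth_circle_scaleR_const(1)[OF assms] insert.IH, of j _ 1] by simp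
  qed (simp_all add: smooth_circle_const)
  moreover have "(\<chi> i. g i \<theta>) = (\<Sum>i\<in>UNIV. g i \<theta> *\<^sub>R axis i (1::real))" for \<theta>
    using basis_expansion[of "\<chi> i. g i \<theta>"] by (simp add: scalar_mult_eq_scaleR)
  ultimately show ?thesis
    by simp
qed

lemma wdom_const: "(\<lambda>_. c) \<in> wdom wabs"
proof -
  have "trig 0 (\<lambda>_. 1) \<in> wdom wabs"
    by (rule trig_wdom) simp
  then have "(\<lambda>_. 1) \<in> wdom wabs"
    by (simp add: trig_def[abs_def])
  from wdom_cmult(1)[of wabs, OF _ this, of c] show ?thesis
    by simp
qed

lemma mform_right_tendsto:
  assumes "\<And>n. 0 \<le> \<omega> n" "\<And>n. cmod (m n) \<le> \<omega> n" "f \<in> wdom \<omega>" "\<forall>\<^sub>F t in F. g t \<in> wdom \<omega>" "g0 \<in> wdom \<omega>"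
    "((\<lambda>t. wsq \<omega> (\<lambda>\<theta>. g t \<theta> - g0 \<theta>)) \<longlongrightarrow> 0) F"
  shows "((\<lambda>t. mform m f (g t)) \<longlongrightarrow> mform m f g0) F"
  using assms by (intro mform_tendsto[of \<omega> m]) (auto simp: wsq_def)

section \<open>The multiplier of the critical pair\<close>

context smooth_critical_pair
begin

text \<open>Zeroth order coefficients of the linearized constraint. They are separated from the
  \<open>PN(u) w'\<close> part because they are only known to be continuous, so they pair with
  \<open>w\<close> in L^2 and not in H^(1/2).\<close>

definition coupling :: "'m \<Rightarrow> 'm \<Rightarrow> real \<Rightarrow> real" where
  "coupling i k \<theta> = (PN' (u \<theta>) (axis k 1) *v U \<theta>) $ i"

lemma coupling_L2: "coupling i k \<in> L2_circle"
  unfolding coupling_def[abs_def]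
  by (intro L2_circle_vec_nth bdd_matrix_mult_L2 smooth_L2 u PN'_along(1) smooth_circle_const)

lemma PN'_expand: "PN' z x *v y = (\<Sum>k\<in>UNIV. x $ k *\<^sub>R (PN' z (axis k 1) *v y))"
proof -
  interpret mv: bounded_bilinear "(*v) :: real^'m^'m \<Rightarrow> real^'m \<Rightarrow> real^'m"
    by (rule bounded_bilinear_matrix_vector)
  have "PN' z x = PN' z (\<Sum>k\<in>UNIV. x $ k *\<^sub>R axis k 1)"
    using basis_expansion[of x] by (simp add: scalar_mult_eq_scaleR)
  also have "\<dots> = (\<Sum>k\<in>UNIV. x $ k *\<^sub>R PN' z (axis k 1))"
    by (simp add: blinfun.sum_right blinfun.scaleR_right)
  finally show ?thesis
    by (simp add: mv.sum_left mv.scaleR_left)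
qed

lemma dconstr_nth:
  "dconstr w \<theta> $ i = (\<Sum>k\<in>UNIV. coupling i k \<theta> * w \<theta> $ k) + (\<Sum>j\<in>UNIV. PN (u \<theta>) $ i $ j * ddth w \<theta> $ j)"
  by (simp add: dconstr_def PN'_expand[of "u \<theta>" "w \<theta>"] coupling_def matrix_vector_mult_nth[of "PN (u \<theta>)"] mult.commute)

lemma PN_u_entry: "(\<lambda>\<theta>. PN (u \<theta>) $ i $ j) \<in> wdom wabs"
proof -
  have "PN \<circ> u \<in> H_half"
    using crit by (simp add: critical_L_half_def EE_def)
  then have "(\<lambda>\<theta>. (PN \<circ> u) \<theta> $ i) \<in> H_half"
    using H_half_vec_iff by blast
  then show ?thesis
    using H_half_vec by fastforce
qed

text \<open>For smooth \<open>v\<close> this is the integral of \<open>\<Phi>\<close> against the linearization of \<open>PN(u) u'\<close> at \<open>u\<close>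
  in the direction \<open>v\<close>; the multiplier \<open>i n\<close> stands for the derivative of \<open>v\<close>.\<close>

definition constraint_form :: "(real \<Rightarrow> real^'m) \<Rightarrow> (real \<Rightarrow> real^'m) \<Rightarrow> real" where
  "constraint_form \<Phi> v = (\<Sum>i\<in>UNIV. (\<Sum>k\<in>UNIV. mform (\<lambda>_. 1) (\<lambda>\<theta>. \<Phi> \<theta> $ i * coupling i k \<theta>) (\<lambda>\<theta>. v \<theta> $ k)) +
    (\<Sum>j\<in>UNIV. mform (\<lambda>n. \<i> * of_int n) (\<lambda>\<theta>. \<Phi> \<theta> $ i * PN (u \<theta>) $ i $ j) (\<lambda>\<theta>. v \<theta> $ j)))"

lemma multiplier_products:
  assumes \<Phi>: "\<And>i. (\<lambda>\<theta>. \<Phi> \<theta> $ i) \<in> wdom wabs" "\<And>\<theta> i. \<bar>\<Phi> \<theta> $ i\<bar> \<le> C"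
  shows "(\<lambda>\<theta>. \<Phi> \<theta> $ i * coupling i k \<theta>) \<in> L2_circle"
    "(\<lambda>\<theta>. \<Phi> \<theta> $ i * PN (u \<theta>) $ i $ j) \<in> wdom wabs"
proof -
  note L = L2_circleD[OF wdom_L2[OF \<Phi>(1)[of i]]]
  show "(\<lambda>\<theta>. \<Phi> \<theta> $ i * coupling i k \<theta>) \<in> L2_circle"
    by (rule L2_circle_bounded_mult[OF coupling_L2 L(2,1) \<Phi>(2)])
  show "(\<lambda>\<theta>. \<Phi> \<theta> $ i * PN (u \<theta>) $ i $ j) \<in> wdom wabs"
    by (rule wdom_half_mult(1)[OF \<Phi> PN_u_entry C1_projections_bounded(2)[OF proj]])
qed

text \<open>The derivative is moved onto the smooth factor, hence \<open>h\<close> may be merely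
  square integrable.\<close>

lemma mform_deriv_smooth:
  fixes w :: "real \<Rightarrow> real^'m"
  assumes h: "h \<in> L2_circle" and w: "w \<in> smooth_circle"
  shows "mform (\<lambda>n. \<i> * of_int n) h (\<lambda>\<theta>. w \<theta> $ j) = (LINT \<theta>|circle. h \<theta> * ddth w \<theta> $ j)"
proof -
  have "mform (\<lambda>n. \<i> * of_int n) h (\<lambda>\<theta>. w \<theta> $ j) = mform (\<lambda>_. 1) h (\<lambda>\<theta>. ddth w \<theta> $ j)"
    by (rule mform_weight_cong) (simp add: fourier_ddth[OF w] mult_ac)
  then show ?thesis
    using Parseval_mform[OF h L2_circle_vec_nth[OF smooth_L2(2)[OF w]]] by simp
qed

lemma constraint_form_smooth:
  assumes \<Phi>: "\<And>i. (\<lambda>\<theta>. \<Phi> \<theta> $ i) \<in> wdom wabs" "\<And>\<theta> i. \<bar>\<Phi> \<theta> $ i\<bar> \<le> C" and w: "w \<in> smooth_circle"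
  shows "constraint_form \<Phi> w = (\<Sum>i\<in>UNIV. LINT \<theta>|circle. \<Phi> \<theta> $ i * dconstr w \<theta> $ i)"
  unfolding constraint_form_def
proof (rule sum.cong[OF refl])
  fix i
  note p = multiplier_products[OF \<Phi>, of i]
  note wL = L2_circle_vec_nth[OF smooth_L2(1)[OF w]] L2_circle_vec_nth[OF smooth_L2(2)[OF w]]
  have i1: "integrable circle (\<lambda>\<theta>. \<Phi> \<theta> $ i * coupling i k \<theta> * w \<theta> $ k)" for k
    by (rule L2_circle_integrable_mult[OF p(1) wL(1)])
  have i2: "integrable circle (\<lambda>\<theta>. \<Phi> \<theta> $ i * PN (u \<theta>) $ i $ j * ddth w \<theta> $ j)" for j
    by (rule L2_circle_integrable_mult[OF wdom_L2[OF p(2)] wL(2)])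
  have "(LINT \<theta>|circle. \<Phi> \<theta> $ i * dconstr w \<theta> $ i) =
      (LINT \<theta>|circle. (\<Sum>k\<in>UNIV. \<Phi> \<theta> $ i * coupling i k \<theta> * w \<theta> $ k) + (\<Sum>j\<in>UNIV. \<Phi> \<theta> $ i * PN (u \<theta>) $ i $ j * ddth w \<theta> $ j))"
    by (simp add: dconstr_nth distrib_left sum_distrib_left mult.assoc)
  also have "\<dots> = (\<Sum>k\<in>UNIV. LINT \<theta>|circle. \<Phi> \<theta> $ i * coupling i k \<theta> * w \<theta> $ k) +
      (\<Sum>j\<in>UNIV. LINT \<theta>|circle. \<Phi> \<theta> $ i * PN (u \<theta>) $ i $ j * ddth w \<theta> $ j)"
    by (simp only: Bochner_Integration.integral_add[OF Bochner_Integration.integrable_sum[OF i1] Bochner_Integration.integrable_sum[OF i2]]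
        Bochner_Integration.integral_sum[OF i1] Bochner_Integration.integral_sum[OF i2])
  finally show "(\<Sum>k\<in>UNIV. mform (\<lambda>_. 1) (\<lambda>\<theta>. \<Phi> \<theta> $ i * coupling i k \<theta>) (\<lambda>\<theta>. w \<theta> $ k)) +
      (\<Sum>j\<in>UNIV. mform (\<lambda>n. \<i> * of_int n) (\<lambda>\<theta>. \<Phi> \<theta> $ i * PN (u \<theta>) $ i $ j) (\<lambda>\<theta>. w \<theta> $ j)) =
      (LINT \<theta>|circle. \<Phi> \<theta> $ i * dconstr w \<theta> $ i)"
    by (simp only: Parseval_mform[OF p(1) wL(1)] mform_deriv_smooth[OF wdom_L2[OF p(2)] w])
qed

text \<open>Two derivatives contribute n^2, and n^2 / |n| = |n|: the left side of the stationarity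
  equation is the H^(1/2) product of the energy.\<close>

lemma vform_U_ddth:
  assumes w: "w \<in> smooth_circle"
  shows "V U (ddth w) = vform wabs u w"
  unfolding vform_def
proof (intro sum.cong refl mform_weight_cong)
  show "of_real (winv n) * (cnj (fourier (\<lambda>\<theta>. U \<theta> $ i) n) * fourier (\<lambda>\<theta>. ddth w \<theta> $ i) n) =
      of_real (wabs n) * (cnj (fourier (\<lambda>\<theta>. u \<theta> $ i) n) * fourier (\<lambda>\<theta>. w \<theta> $ i) n)" for i n
  proof -
    have "winv n * (real_of_int n * real_of_int n) = wabs n"
      by (simp add: winv_def abs_if)
    then have "complex_of_real (winv n) * (of_int n * of_int n) = of_real (wabs n)"
      by (metis of_real_mult of_real_of_int_eq)
    then show ?thesis
      unfolding fourier_ddth[OF u] fourier_ddth[OF w]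
      by (simp add: mult_ac)
  qed
qed

lemma dconstr_linear:
  assumes "w \<in> smooth_circle" "w' \<in> smooth_circle"
  shows "dconstr (\<lambda>\<theta>. w \<theta> + t *\<^sub>R w' \<theta>) = (\<lambda>\<theta>. dconstr w \<theta> + t *\<^sub>R dconstr w' \<theta>)"
proof -
  interpret mv: bounded_bilinear "(*v) :: real^'m^'m \<Rightarrow> real^'m \<Rightarrow> real^'m"
    by (rule bounded_bilinear_matrix_vector)
  show ?thesis
    by (rule ext) (simp add: dconstr_def smooth_circle_linear_combination(2)[OF assms] blinfun.add_right blinfun.scaleR_right
        mv.add_left mv.add_right mv.scaleR_left mv.scaleR_right scaleR_right_distrib)
qed

text \<open>Stationarity says that \<open>l\<close> vanishes wherever the mean \<open>M\<close> of
  \<open>dconstr\<close> does, so \<open>l\<close> is a fixed vector \<open>\<mu>\<close> applied to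
  \<open>M\<close>. Since the remaining term pairs the potential of \<open>\<kappa>\<close> with
  \<open>dconstr w\<close>, adding \<open>\<mu>\<close> to this potential yields one multiplier for
  both.\<close>

lemma multiplier_on_smooth:
  obtains \<Phi> C where "\<And>i. (\<lambda>\<theta>. \<Phi> \<theta> $ i) \<in> wdom wabs" "\<And>\<theta> i. \<bar>\<Phi> \<theta> $ i\<bar> \<le> C"
    "\<And>w. w \<in> smooth_circle \<Longrightarrow> vform wabs u w = constraint_form \<Phi> w"
proof -
  define \<kappa> where "\<kappa> \<theta> = U \<theta> - PN (u \<theta>) *v f \<theta>" for \<theta>
  have \<kappa>: "\<kappa> \<in> L2_circle"
    unfolding \<kappa>_def[abs_def] by (intro vec_L2_diff smooth_L2 split_L2 u)
  have "\<exists>\<psi> C. \<psi> \<in> wdom wabs \<and> (\<forall>n. fourier \<psi> n = of_real (winv n) * fourier (\<lambda>\<theta>. \<kappa> \<theta> $ i) n) \<and> (\<forall>\<theta>. \<bar>\<psi> \<theta>\<bar> \<le> C)" for i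
    using bounded_potential[OF L2_circle_vec_nth[OF \<kappa>, of i]] by metis
  then obtain \<psi> C where \<psi>: "\<And>i. \<psi> i \<in> wdom wabs" "\<And>i n. fourier (\<psi> i) n = of_real (winv n) * fourier (\<lambda>\<theta>. \<kappa> \<theta> $ i) n"
    "\<And>i \<theta>. \<bar>\<psi> i \<theta>\<bar> \<le> C i"
    by metis
  define l where "l w = V U (ddth w) - V \<kappa> (dconstr w)" for w
  define M :: "(real \<Rightarrow> real^'m) \<Rightarrow> real^'m" where "M w = (\<chi> i. LINT \<theta>|circle. dconstr w \<theta> $ i)" for w
  have lin: "\<exists>z\<in>smooth_circle. M z = M w + t *\<^sub>R M w' \<and> l z = l w + t * l w'"
    if w: "w \<in> smooth_circle" "w' \<in> smooth_circle" for w w' t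
  proof (intro bexI conjI)
    let ?z = "\<lambda>\<theta>. w \<theta> + t *\<^sub>R w' \<theta>"
    show z: "?z \<in> smooth_circle"
      by (rule smooth_circle_linear_combination(1)[OF w])
    note d = dconstr_L2[OF w(1)] dconstr_L2[OF w(2)]
    have "M ?z $ i = (M w + t *\<^sub>R M w') $ i" for i
      using L2_circleD(4)[OF L2_circle_vec_nth[OF d(1), of i]] L2_circleD(4)[OF L2_circle_vec_nth[OF d(2), of i]]
      by (simp add: M_def dconstr_linear[OF w])
    then show "M ?z = M w + t *\<^sub>R M w'"
      by (simp add: vec_eq_iff)
    have c: "vform winv x (\<lambda>\<theta>. a \<theta> + t *\<^sub>R b \<theta>) = V x a + t * V x b"
      if "x \<in> L2_circle" "a \<in> L2_circle" "b \<in> L2_circle" for x a b :: "real \<Rightarrow> real^'m"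
    proof -
      have "mform winv (\<lambda>\<theta>. x \<theta> $ i) (\<lambda>\<theta>. a \<theta> $ i + t * b \<theta> $ i) =
          mform winv (\<lambda>\<theta>. x \<theta> $ i) (\<lambda>\<theta>. a \<theta> $ i) + t * mform winv (\<lambda>\<theta>. x \<theta> $ i) (\<lambda>\<theta>. b \<theta> $ i)" for i
        using mform_add_right[of "\<lambda>_. 1" "\<lambda>n. complex_of_real (winv n)", unfolded wdom_1, OF _ winv_cmod
            L2_circle_vec_nth[OF that(1)] L2_circle_vec_nth[OF that(2)] L2_circle_cmult[OF L2_circle_vec_nth[OF that(3)]], of i i t i]
        by (simp add: mform_cmult_right)
      then show ?thesis
        by (simp add: vform_def sum.distrib sum_distrib_left)
    qed
    show "l ?z = l w + t * l w'"
      unfolding l_def dconstr_linear[OF w] smooth_circle_linear_combination(2)[OF w]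
        c[OF smooth_L2(2)[OF u] smooth_L2(2)[OF w(1)] smooth_L2(2)[OF w(2)]] c[OF \<kappa> d]
      by (simp add: algebra_simps)
  qed
  have zero: "l w = 0" if "w \<in> smooth_circle" "M w = 0" for w
  proof -
    have "(LINT \<theta>|circle. dconstr w \<theta> $ i) = 0" for i
      using that(2) by (simp add: M_def vec_eq_iff)
    then show ?thesis
      using stationary_in_u[OF that(1)] by (simp add: l_def \<kappa>_def[abs_def])
  qed
  obtain \<mu> where \<mu>: "\<And>w. w \<in> smooth_circle \<Longrightarrow> l w = \<mu> \<bullet> M w"
    using lagrange_multiplier[of "\<lambda>_. 0" smooth_circle M l, OF smooth_circle_const lin zero] by blast
  define \<Phi> :: "real \<Rightarrow> real^'m" where "\<Phi> \<theta> = (\<chi> i. \<psi> i \<theta> + \<mu> $ i)" for \<theta>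
  have \<Phi>1: "(\<lambda>\<theta>. \<Phi> \<theta> $ i) \<in> wdom wabs" for i
    using wdom_add(1)[of wabs, OF _ \<psi>(1)[of i] wdom_const[of "\<mu> $ i"]] by (simp add: \<Phi>_def)
  have \<Phi>2: "\<bar>\<Phi> \<theta> $ i\<bar> \<le> Max (range (\<lambda>i. C i + \<bar>\<mu> $ i\<bar>))" for \<theta> i
  proof -
    have "\<bar>\<Phi> \<theta> $ i\<bar> \<le> C i + \<bar>\<mu> $ i\<bar>"
      using \<psi>(3)[of i \<theta>] abs_triangle_ineq[of "\<psi> i \<theta>" "\<mu> $ i"] by (simp add: \<Phi>_def)
    also have "\<dots> \<le> Max (range (\<lambda>i. C i + \<bar>\<mu> $ i\<bar>))"
      by (intro Max_ge) auto
    finally show ?thesis .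
  qed
  have "vform wabs u w = constraint_form \<Phi> w" if w: "w \<in> smooth_circle" for w
  proof -
    note d = L2_circle_vec_nth[OF dconstr_L2[OF w]]
    have "V \<kappa> (dconstr w) = (\<Sum>i\<in>UNIV. LINT \<theta>|circle. \<psi> i \<theta> * dconstr w \<theta> $ i)"
      unfolding vform_def Parseval_mform[OF wdom_L2[OF \<psi>(1)] d, symmetric]
      by (intro sum.cong refl mform_weight_cong) (simp add: \<psi>(2))
    moreover have "V U (ddth w) = \<mu> \<bullet> M w + V \<kappa> (dconstr w)"
      using \<mu>[OF w] by (simp add: l_def)
    moreover have "(LINT \<theta>|circle. \<Phi> \<theta> $ i * dconstr w \<theta> $ i) = \<mu> $ i * (LINT \<theta>|circle. dconstr w \<theta> $ i) + (LINT \<theta>|circle. \<psi> i \<theta> * dconstr w \<theta> $ i)" for i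
      using L2_circleD(4)[OF d[of i]] L2_circle_integrable_mult[OF wdom_L2[OF \<psi>(1)[of i]] d[of i]]
      by (simp add: \<Phi>_def distrib_right)
    ultimately show ?thesis
      unfolding constraint_form_smooth[OF \<Phi>1 \<Phi>2 w] vform_U_ddth[OF w, symmetric]
      by (simp add: sum.distrib inner_vec_def M_def)
  qed
  then show ?thesis
    using that \<Phi>1 \<Phi>2 by blast
qed

text \<open>Both sides are continuous in H^(1/2), since the products of \<open>\<Phi>\<close> with
  \<open>PN(u)\<close> lie there and those with \<open>coupling\<close> in L^2. The partial sums of
  \<open>v\<close> are smooth and converge for both weights.\<close>

lemma multiplier_identity:
  obtains \<Phi> C where "\<And>i. (\<lambda>\<theta>. \<Phi> \<theta> $ i) \<in> wdom wabs" "\<And>\<theta> i. \<bar>\<Phi> \<theta> $ i\<bar> \<le> C"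
    "\<And>v. (\<And>i. (\<lambda>\<theta>. v \<theta> $ i) \<in> wdom wabs) \<Longrightarrow> vform wabs u v = constraint_form \<Phi> v"
proof -
  obtain \<Phi> C where \<Phi>: "\<And>i. (\<lambda>\<theta>. \<Phi> \<theta> $ i) \<in> wdom wabs" "\<And>\<theta> i. \<bar>\<Phi> \<theta> $ i\<bar> \<le> C"
    "\<And>w. w \<in> smooth_circle \<Longrightarrow> vform wabs u w = constraint_form \<Phi> w"
    using multiplier_on_smooth by metis
  have "vform wabs u v = constraint_form \<Phi> v" if v: "\<And>i. (\<lambda>\<theta>. v \<theta> $ i) \<in> wdom wabs" for v
  proof -
    define w :: "nat \<Rightarrow> real \<Rightarrow> real^'m" where "w N \<theta> = (\<chi> i. trig N (fourier (\<lambda>\<theta>. v \<theta> $ i)) \<theta>)" for N \<theta>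
    have ws: "w N \<in> smooth_circle" for N
      unfolding w_def[abs_def] by (intro smooth_circle_vec trig_smooth)
    have wd: "(\<lambda>\<theta>. w N \<theta> $ i) \<in> wdom \<omega>" for N i \<omega>
      unfolding w_def by (simp add: trig_wdom[of "fourier (\<lambda>\<theta>. v \<theta> $ i)", OF fourier_uminus_index])
    have lim: "(\<lambda>N. wsq \<omega> (\<lambda>\<theta>. w N \<theta> $ i - v \<theta> $ i)) \<longlonglongrightarrow> 0"
      if "\<And>n. 0 \<le> \<omega> n" "(\<lambda>\<theta>. v \<theta> $ i) \<in> wdom \<omega>" for \<omega> i
      unfolding w_def using wsq_partial_sums_tendsto[OF that(2,1)] by simp
    have t: "(\<lambda>N. mform m h (\<lambda>\<theta>. w N \<theta> $ i)) \<longlonglongrightarrow> mform m h (\<lambda>\<theta>. v \<theta> $ i)"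
      if "\<And>n. cmod (m n) \<le> wabs n" "h \<in> wdom wabs" for m h i
      using that v wd lim[of wabs i] by (intro mform_right_tendsto[of wabs]) auto
    have t1: "(\<lambda>N. mform (\<lambda>_. 1) h (\<lambda>\<theta>. w N \<theta> $ i)) \<longlonglongrightarrow> mform (\<lambda>_. 1) h (\<lambda>\<theta>. v \<theta> $ i)"
      if "h \<in> L2_circle" for h i
      using that wdom_1D[OF v[of i]] wdom_L2[OF wd] lim[of "\<lambda>_. 1" i] by (intro mform_right_tendsto[of "\<lambda>_. 1"]) (auto simp: wdom_1)
    have uH: "(\<lambda>\<theta>. u \<theta> $ i) \<in> wdom wabs" for i
      using crit by (simp add: critical_L_half_def EE_def H_half_vec)
    have "(\<lambda>N. vform wabs u (w N)) \<longlonglongrightarrow> vform wabs u v"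
      unfolding vform_def by (intro tendsto_sum t uH) simp
    moreover have "(\<lambda>N. constraint_form \<Phi> (w N)) \<longlonglongrightarrow> constraint_form \<Phi> v"
      unfolding constraint_form_def
      by (intro tendsto_sum tendsto_add t t1 multiplier_products[OF \<Phi>(1,2)]) (simp add: norm_mult)
    ultimately show ?thesis
      using \<Phi>(3)[OF ws] LIMSEQ_unique by simp
  qed
  then show ?thesis
    using that \<Phi>(1,2) by blast
qed

end

section \<open>Paths of horizontal maps\<close>

text \<open>Equal to 1 up to radius \<open>R + 1\<close> and to 0 from \<open>R + 2\<close> on. With
  \<open>R\<close> bounding \<open>u\<close>, the extra unit is the neighbourhood on which
  \<open>C1_bounded_expansion\<close> wants the function unchanged.\<close>

definition cutoff :: "real \<Rightarrow> 'a::real_normed_vector \<Rightarrow> real" where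
  "cutoff R z = max 0 (min 1 (R + 2 - norm z))"

lemma cutoff_bounds: "0 \<le> cutoff R z" "cutoff R z \<le> 1" "\<bar>cutoff R z\<bar> \<le> 1"
  by (auto simp: cutoff_def)

lemma cutoff_eq: "norm z \<le> R + 1 \<Longrightarrow> cutoff R z = 1" "norm z \<ge> R + 2 \<Longrightarrow> cutoff R z = 0"
  by (auto simp: cutoff_def)

lemma cutoff_lipschitz: "\<bar>cutoff R x - cutoff R y\<bar> \<le> norm (x - y)"
proof -
  have "\<bar>cutoff R x - cutoff R y\<bar> \<le> \<bar>norm x - norm y\<bar>"
    unfolding cutoff_def by (auto simp: max_def min_def)
  also have "\<dots> \<le> norm (x - y)"
    by (rule norm_triangle_ineq3)
  finally show ?thesis .
qed

text \<open>On the ball of radius \<open>R + 2\<close> the derivative is bounded by compactness. If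
  one point lies outside, the product vanishes there, and the Lipschitz bound of the cutoff times
  the bound \<open>M\<close> suffices.\<close>

lemma cutoff_scaleR_lipschitz:
  fixes P :: "'a::euclidean_space \<Rightarrow> 'b::euclidean_space" and P' :: "'a \<Rightarrow> 'a \<Rightarrow>\<^sub>L 'b"
  assumes d: "\<And>z. (P has_derivative blinfun_apply (P' z)) (at z)" and c: "continuous_on UNIV P'"
    and M: "\<And>z. norm (P z) \<le> M"
  obtains L where "\<And>x y. norm (cutoff R x *\<^sub>R P x - cutoff R y *\<^sub>R P y) \<le> L * norm (x - y)"
proof -
  have M0: "M \<ge> 0"
    using M norm_ge_zero order_trans by blast
  have "compact (P' ` cball 0 (R + 2))"
    by (intro compact_continuous_image continuous_on_subset[OF c]) auto
  then obtain D where D: "D > 0" "\<And>y. norm y \<le> R + 2 \<Longrightarrow> norm (P' y) \<le> D"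
    using compact_imp_bounded bounded_pos by (metis imageI mem_cball_0)
  have in_out: "norm (cutoff R x *\<^sub>R P x - cutoff R y *\<^sub>R P y) \<le> (M + D) * norm (x - y)"
    if x: "norm x \<le> R + 2" for x y
  proof (cases "norm y \<le> R + 2")
    case True
    have "norm (P x - P y) \<le> D * norm (x - y)"
    proof (rule differentiable_bound[where S="cball 0 (R + 2)" and f'="\<lambda>z. blinfun_apply (P' z)"])
      show "onorm (blinfun_apply (P' z)) \<le> D" if "z \<in> cball 0 (R + 2)" for z
        using D(2)[of z] that by (simp add: norm_blinfun.rep_eq)
    qed (use x True in \<open>auto intro: has_derivative_at_withinI[OF d]\<close>)
    then have 1: "norm (cutoff R y *\<^sub>R (P x - P y)) \<le> D * norm (x - y)"
      using cutoff_bounds[of R y] mult_left_le_one_le[of "norm (P x - P y)" "cutoff R y"] by simp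
    have 2: "norm ((cutoff R x - cutoff R y) *\<^sub>R P x) \<le> norm (x - y) * M"
      using mult_mono[OF cutoff_lipschitz[of R x y] M[of x]] by simp
    have "cutoff R x *\<^sub>R P x - cutoff R y *\<^sub>R P y = (cutoff R x - cutoff R y) *\<^sub>R P x + cutoff R y *\<^sub>R (P x - P y)"
      by (simp add: algebra_simps)
    then have "norm (cutoff R x *\<^sub>R P x - cutoff R y *\<^sub>R P y) \<le> norm (x - y) * M + D * norm (x - y)"
      using norm_triangle_mono[OF 2 1] by simp
    then show ?thesis
      by (simp add: algebra_simps)
  next
    case False
    then have y: "cutoff R y = 0"
      by (intro cutoff_eq) simp
    have "norm ((cutoff R x - cutoff R y) *\<^sub>R P x) \<le> norm (x - y) * M"
      using mult_mono[OF cutoff_lipschitz[of R x y] M[of x]] by simp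
    also have "\<dots> \<le> (M + D) * norm (x - y)"
      using D(1) by (simp add: algebra_simps)
    finally show ?thesis
      by (simp add: y)
  qed
  have "norm (cutoff R x *\<^sub>R P x - cutoff R y *\<^sub>R P y) \<le> (M + D) * norm (x - y)" for x y
  proof (cases "norm x \<le> R + 2")
    case False
    show ?thesis
    proof (cases "norm y \<le> R + 2")
      case True
      then show ?thesis
        using in_out[of y x] by (simp add: norm_minus_commute)
    next
      case y: False
      then show ?thesis
        using False M0 D(1) by (simp add: cutoff_eq)
    qed
  qed (rule in_out)
  then show ?thesis
    using that by blast
qed

context smooth_critical_pair
begin

definition cutPN :: "real \<Rightarrow> real^'m \<Rightarrow> real^'m^'m" where
  "cutPN R z = cutoff R z *\<^sub>R PN z"

lemma cutPN_entry_bound: "\<bar>cutPN R z $ i $ j\<bar> \<le> 1"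
  using mult_mono[OF cutoff_bounds(3)[of R z] C1_projections_bounded(2)[OF proj, of z i j]]
  by (simp add: cutPN_def abs_mult)

lemma horizontalD:
  assumes y: "y \<in> horizontal PN"
  shows "(\<lambda>\<theta>. y \<theta> $ j) \<in> wdom wabs" "(\<lambda>\<theta>. PN (y \<theta>) $ i $ j) \<in> wdom wabs"
    "\<phi> \<in> smooth_circle \<Longrightarrow> (\<Sum>j\<in>UNIV. mform (\<lambda>n. \<i> * of_int n) (\<lambda>\<theta>. \<phi> \<theta> * PN (y \<theta>) $ i $ j) (\<lambda>\<theta>. y \<theta> $ j)) = 0"
proof -
  have yH: "y \<in> H_half" "PN \<circ> y \<in> H_half"
    using y by (auto simp: horizontal_def)
  show "(\<lambda>\<theta>. y \<theta> $ j) \<in> wdom wabs"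
    using yH(1) H_half_vec by blast
  have "(\<lambda>\<theta>. (PN \<circ> y) \<theta> $ i) \<in> H_half"
    using yH(2) H_half_vec_iff by blast
  then show "(\<lambda>\<theta>. PN (y \<theta>) $ i $ j) \<in> wdom wabs"
    using H_half_vec by fastforce
  have yL: "y \<in> L2_circle"
    using yH(1) by (simp add: H_half_def)
  assume "\<phi> \<in> smooth_circle"
  then have "mat_dist (PN \<circ> y) (dist_deriv y) \<phi> $ i = 0"
    using y by (simp add: horizontal_def)
  then show "(\<Sum>j\<in>UNIV. mform (\<lambda>n. \<i> * of_int n) (\<lambda>\<theta>. \<phi> \<theta> * PN (y \<theta>) $ i $ j) (\<lambda>\<theta>. y \<theta> $ j)) = 0"
    by (simp add: mat_dist_def mat_pairing_def pairing_dist_deriv[OF yL])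
qed

lemma along_L2:
  fixes y :: "real \<Rightarrow> real^'m" and h :: "real^'m \<Rightarrow> real"
  assumes y: "\<And>j. (\<lambda>\<theta>. y \<theta> $ j) \<in> wdom wabs" and h: "continuous_on UNIV h" "\<And>z. \<bar>h z\<bar> \<le> B"
  shows "(\<lambda>\<theta>. h (y \<theta>)) \<in> L2_circle"
proof -
  have yL: "y \<in> L2_circle"
    unfolding L2_circle_vec_iff using wdom_L2[OF y] by blast
  then have "y \<in> borel_measurable circle" "\<And>\<theta>. y (\<theta> + 2 * pi) = y \<theta>"
    by (auto simp: L2_circle_def)
  then show ?thesis
    using measurable_compose[OF _ borel_measurable_continuous_onI[OF h(1)]] h(2)
    by (intro L2_circle_bounded) auto
qed

lemma continuous_cutoff: "continuous_on S (cutoff R)"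
  unfolding cutoff_def[abs_def] by (intro continuous_intros)

text \<open>Horizontality is stated for smooth test functions; \<open>\<Phi>\<close> times the
  cutoff of \<open>y\<close> is a bounded H^(1/2) function, to which it extends.\<close>

lemma horizontal_test_cutoff:
  assumes y: "y \<in> horizontal PN" and \<Phi>: "\<And>i. (\<lambda>\<theta>. \<Phi> \<theta> $ i) \<in> wdom wabs" "\<And>\<theta> i. \<bar>\<Phi> \<theta> $ i\<bar> \<le> C"
  shows "(\<Sum>j\<in>UNIV. mform (\<lambda>n. \<i> * of_int n) (\<lambda>\<theta>. \<Phi> \<theta> $ i * cutPN R (y \<theta>) $ i $ j) (\<lambda>\<theta>. y \<theta> $ j)) = 0"
proof -
  have "(\<lambda>\<theta>. cutoff R (y \<theta>)) \<in> L2_circle"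
    by (rule along_L2[OF horizontalD(1)[OF y] continuous_cutoff cutoff_bounds(3)])
  then have c: "(\<lambda>\<theta>. cutoff R (y \<theta>)) \<in> wdom wabs"
    by (rule wdom_half_lipschitz(1)[OF horizontalD(1)[OF y], where G="cutoff R" and L=1])
      (simp add: cutoff_lipschitz)
  have b: "\<bar>\<Phi> \<theta> $ i * cutoff R (y \<theta>)\<bar> \<le> C * 1" for \<theta>
    unfolding abs_mult using \<Phi>(2)[of \<theta> i] cutoff_bounds(3)[of R "y \<theta>"] by (intro mult_mono) auto
  \<comment> \<open>Here the cutoff belongs to the test function; afterwards it is regrouped with
    \<open>PN\<close> into \<open>cutPN\<close>.\<close>
  have "(\<Sum>j\<in>UNIV. mform (\<lambda>n. \<i> * of_int n) (\<lambda>\<theta>. \<Phi> \<theta> $ i * cutoff R (y \<theta>) * PN (y \<theta>) $ i $ j) (\<lambda>\<theta>. y \<theta> $ j)) = 0"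
  proof (rule mform_half_test_extend[where J=UNIV and B=1 and C="C * 1"])
    show "(\<lambda>\<theta>. \<Phi> \<theta> $ i * cutoff R (y \<theta>)) \<in> wdom wabs"
      by (rule wdom_half_mult(1)[OF \<Phi> c cutoff_bounds(3)])
  qed (auto simp: norm_mult intro: horizontalD[OF y] C1_projections_bounded(2)[OF proj] b[simplified])
  then show ?thesis
    by (simp add: cutPN_def mult.assoc)
qed

text \<open>Near the range of \<open>u\<close> the cutoff is inactive, so the expansion there has
  the derivative of \<open>PN\<close> itself, while far away only boundedness counts.\<close>

lemma cutPN_properties:
  assumes R: "\<And>\<theta>. norm (u \<theta>) \<le> R"
  obtains L where "\<And>x y i j. \<bar>cutPN R x $ i $ j - cutPN R y $ i $ j\<bar> \<le> L * norm (x - y)"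
    "\<And>e. e > 0 \<Longrightarrow> \<exists>K\<ge>0. \<forall>\<theta> z. norm (cutPN R z - cutPN R (u \<theta>) - PN' (u \<theta>) (z - u \<theta>)) \<le>
      e * norm (z - u \<theta>) + K * (norm (z - u \<theta>))\<^sup>2"
proof -
  define M where "M = real CARD('m) * (real CARD('m) * 1)"
  have M: "norm (PN z) \<le> M" "norm (cutPN R z) \<le> M" for z
    unfolding M_def by (intro norm_le_of_entries C1_projections_bounded[OF proj] cutPN_entry_bound)+
  obtain L where L: "\<And>x y. norm (cutPN R x - cutPN R y) \<le> L * norm (x - y)"
    using cutoff_scaleR_lipschitz[OF dN cN M(1), of R] unfolding cutPN_def by metis
  show ?thesis
  proof (rule that)
    fix x y :: "real^'m" and i j
    have "\<bar>(cutPN R x - cutPN R y) $ i $ j\<bar> \<le> norm (cutPN R x - cutPN R y)"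
      by (rule order_trans[OF component_le_norm_cart Finite_Cartesian_Product.norm_nth_le])
    then show "\<bar>cutPN R x $ i $ j - cutPN R y $ i $ j\<bar> \<le> L * norm (x - y)"
      using L[of x y] by simp
  next
    fix e :: real assume e: "e > 0"
    have eq: "cutPN R z = PN z" if "norm z \<le> R + 1" for z
      using that by (simp add: cutPN_def cutoff_eq)
    obtain K where "K \<ge> 0" "\<And>y z. norm y \<le> R \<Longrightarrow>
        norm (cutPN R z - cutPN R y - PN' y (z - y)) \<le> e * norm (z - y) + K * (norm (z - y))\<^sup>2"
      using C1_bounded_expansion[OF dN cN e eq M(2)] by blast
    then show "\<exists>K\<ge>0. \<forall>\<theta> z. norm (cutPN R z - cutPN R (u \<theta>) - PN' (u \<theta>) (z - u \<theta>)) \<le>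
        e * norm (z - u \<theta>) + K * (norm (z - u \<theta>))\<^sup>2"
      using R by blast
  qed
qed

end

section \<open>A path through \<open>u\<close> and its difference quotients\<close>

lemma eventually_near_0: "\<forall>\<^sub>F t in at 0. t \<noteq> 0 \<and> \<bar>t\<bar> < (1::real)"
  by (rule eventually_at_filter[THEN iffD2], rule eventually_mono[OF eventually_nhds_in_open[of "{-1<..<1}"]]) auto

text \<open>\<open>v\<close> is the velocity at time 0. Convergence of the quotients is recorded for
  both weights since the seminorm alone does not control the mean.\<close>

locale horizontal_path = smooth_critical_pair PT PN PT' PN' u f \<xi>
  for PT PN :: "real^'m \<Rightarrow> real^'m^'m" and PT' PN' u f \<xi> +
  fixes g :: "real \<Rightarrow> real \<Rightarrow> real^'m" and v :: "real \<Rightarrow> real^'m"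
  assumes g0: "g 0 = u" and g_horizontal: "\<And>t. \<bar>t\<bar> < 1 \<Longrightarrow> g t \<in> horizontal PN"
    and v: "\<And>i. (\<lambda>\<theta>. v \<theta> $ i) \<in> wdom wabs"
    and q_half: "\<And>i. ((\<lambda>t. wsq wabs (\<lambda>\<theta>. (g t \<theta> $ i - u \<theta> $ i) / t - v \<theta> $ i)) \<longlongrightarrow> 0) (at 0)"
    and q_L2: "\<And>i. ((\<lambda>t. wsq (\<lambda>_. 1) (\<lambda>\<theta>. (g t \<theta> $ i - u \<theta> $ i) / t - v \<theta> $ i)) \<longlongrightarrow> 0) (at 0)"
begin

lemma g_wdom: "\<bar>t\<bar> < 1 \<Longrightarrow> (\<lambda>\<theta>. g t \<theta> $ i) \<in> wdom wabs"
  using horizontalD(1)[OF g_horizontal] .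

lemma u_wdom: "(\<lambda>\<theta>. u \<theta> $ i) \<in> wdom wabs"
  using g_wdom[of 0 i] g0 by simp

lemma g_eventually: "\<forall>\<^sub>F t in at 0. (\<lambda>\<theta>. g t \<theta> $ i) \<in> wdom wabs"
  using eventually_near_0 by (rule eventually_mono) (simp add: g_wdom)

definition q :: "real \<Rightarrow> 'm \<Rightarrow> real \<Rightarrow> real" where
  "q t i \<theta> = (g t \<theta> $ i - u \<theta> $ i) / t"

lemma q_wdom: "\<bar>t\<bar> < 1 \<Longrightarrow> q t i \<in> wdom wabs"
  unfolding q_def[abs_def] by (intro wdom_divide wdom_diff(1) g_wdom u_wdom) auto

lemma energy_has_derivative: "((\<lambda>t. vform wabs (g t) (g t)) has_real_derivative 2 * vform wabs u v) (at 0)"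
proof -
  have "((\<lambda>t. mform wabs (\<lambda>\<theta>. g t \<theta> $ i) (\<lambda>\<theta>. g t \<theta> $ i)) has_real_derivative
      mform wabs (\<lambda>\<theta>. v \<theta> $ i) (\<lambda>\<theta>. g 0 \<theta> $ i) + mform wabs (\<lambda>\<theta>. g 0 \<theta> $ i) (\<lambda>\<theta>. v \<theta> $ i)) (at 0)" for i
    by (rule mform_has_derivative[where \<omega>=wabs]) (simp_all add: g_eventually g0 u_wdom v q_half)
  then have "((\<lambda>t. vform wabs (g t) (g t)) has_real_derivative
      (\<Sum>i\<in>UNIV. mform wabs (\<lambda>\<theta>. v \<theta> $ i) (\<lambda>\<theta>. u \<theta> $ i) + mform wabs (\<lambda>\<theta>. u \<theta> $ i) (\<lambda>\<theta>. v \<theta> $ i))) (at 0)"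
    unfolding vform_def g0 by (intro DERIV_sum)
  moreover have "mform wabs (\<lambda>\<theta>. v \<theta> $ i) (\<lambda>\<theta>. u \<theta> $ i) = mform wabs (\<lambda>\<theta>. u \<theta> $ i) (\<lambda>\<theta>. v \<theta> $ i)" for i
    by (rule mform_commute) simp
  ultimately show ?thesis
    by (simp add: vform_def sum_distrib_left)
qed

text \<open>Divide the constraint along the path, tested against \<open>\<Phi> i * cutoff (g t)\<close>, by \<open>t\<close>.  Without the
  cutoff nothing bounds \<open>PN \<circ> g t\<close> in \<open>H\<^bsup>1/2\<^esup>\<close>, because the derivative of \<open>PN\<close> may be unbounded.\<close>

lemma quotient_identity:
  assumes R: "\<And>\<theta>. norm (u \<theta>) \<le> R"
    and \<Phi>: "\<And>i. (\<lambda>\<theta>. \<Phi> \<theta> $ i) \<in> wdom wabs" "\<And>\<theta> i. \<bar>\<Phi> \<theta> $ i\<bar> \<le> C"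
    and F: "\<And>t j. \<bar>t\<bar> < 1 \<Longrightarrow> (\<lambda>\<theta>. \<Phi> \<theta> $ i * cutPN R (g t \<theta>) $ i $ j) \<in> wdom wabs"
    and t: "t \<noteq> 0" "\<bar>t\<bar> < 1"
  defines "e \<equiv> \<lambda>\<theta>. \<Phi> \<theta> $ i * ((cutPN R (g t \<theta>) - cutPN R (u \<theta>) - PN' (u \<theta>) (g t \<theta> - u \<theta>)) *v U \<theta>) $ i"
  shows "integrable circle e"
    "(LINT \<theta>|circle. e \<theta>) / t + (\<Sum>k\<in>UNIV. mform (\<lambda>_. 1) (\<lambda>\<theta>. \<Phi> \<theta> $ i * coupling i k \<theta>) (q t k)) +
      (\<Sum>j\<in>UNIV. mform (\<lambda>n. \<i> * of_int n) (\<lambda>\<theta>. \<Phi> \<theta> $ i * cutPN R (g t \<theta>) $ i $ j) (q t j)) = 0"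
proof -
  interpret mv: bounded_bilinear "(*v) :: real^'m^'m \<Rightarrow> real^'m \<Rightarrow> real^'m"
    by (rule bounded_bilinear_matrix_vector)
  define Ft where "Ft t j = (\<lambda>\<theta>. \<Phi> \<theta> $ i * cutPN R (g t \<theta>) $ i $ j)" for t j
  let ?m = "\<lambda>n. \<i> * of_int n :: complex"
  have m: "cmod (?m n) \<le> wabs n" for n
    by (simp add: norm_mult)
  have w: "0 \<le> wabs n" for n
    by simp
  have z: "\<bar>0::real\<bar> < 1"
    by simp
  have Fw: "Ft t j \<in> wdom wabs" "Ft 0 j \<in> wdom wabs" for j
    unfolding Ft_def using F[OF t(2)] F[OF z] by blast+
  have dL: "(\<lambda>\<theta>. Ft t j \<theta> - Ft 0 j \<theta>) \<in> L2_circle" for j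
    by (rule L2_circle_diff[OF wdom_L2[OF Fw(1)] wdom_L2[OF Fw(2)]])
  have UL: "(\<lambda>\<theta>. U \<theta> $ j) \<in> L2_circle" for j
    by (intro L2_circle_vec_nth smooth_L2 u)
  note qw = q_wdom[OF t(2)]
  note pL = multiplier_products(1)[OF \<Phi>, of i]
  have g_eq: "(\<lambda>\<theta>. g t \<theta> $ j) = (\<lambda>\<theta>. u \<theta> $ j + t * q t j \<theta>)" for j
    using t(1) by (simp add: q_def)
  \<comment> \<open>Discrete Leibniz rule for the change of the constraint. The increment of
    \<open>Ft\<close> meets the derivative of the smooth \<open>u\<close>, so it enters only through
    L^2; the quotient \<open>q\<close> is paired with \<open>Ft t\<close>.\<close>
  have split: "mform ?m (Ft t j) (\<lambda>\<theta>. g t \<theta> $ j) - mform ?m (Ft 0 j) (\<lambda>\<theta>. u \<theta> $ j) =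
      (LINT \<theta>|circle. (Ft t j \<theta> - Ft 0 j \<theta>) * U \<theta> $ j) + t * mform ?m (Ft t j) (q t j)" for j
  proof -
    have "mform ?m (Ft t j) (\<lambda>\<theta>. g t \<theta> $ j) = mform ?m (Ft t j) (\<lambda>\<theta>. u \<theta> $ j) + t * mform ?m (Ft t j) (q t j)"
      unfolding g_eq using mform_add_right[of wabs ?m, OF w m Fw(1) u_wdom wdom_cmult(1)[of wabs, OF w qw]]
      by (simp add: mform_cmult_right)
    moreover have "mform ?m (\<lambda>\<theta>. Ft t j \<theta> - Ft 0 j \<theta>) (\<lambda>\<theta>. u \<theta> $ j) =
        mform ?m (Ft t j) (\<lambda>\<theta>. u \<theta> $ j) - mform ?m (Ft 0 j) (\<lambda>\<theta>. u \<theta> $ j)"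
      by (rule mform_diff_left[of wabs ?m, OF w m Fw u_wdom])
    ultimately show ?thesis
      using mform_deriv_smooth[OF dL u] by simp
  qed
  have hor: "(\<Sum>j\<in>UNIV. mform ?m (Ft t j) (\<lambda>\<theta>. g t \<theta> $ j)) = 0" "(\<Sum>j\<in>UNIV. mform ?m (Ft 0 j) (\<lambda>\<theta>. u \<theta> $ j)) = 0"
    unfolding Ft_def g0
    using horizontal_test_cutoff[OF g_horizontal[OF t(2)] \<Phi>] horizontal_test_cutoff[OF u_horizontal \<Phi>] by blast+
  have sum0: "(\<Sum>j\<in>UNIV. LINT \<theta>|circle. (Ft t j \<theta> - Ft 0 j \<theta>) * U \<theta> $ j) + t * (\<Sum>j\<in>UNIV. mform ?m (Ft t j) (q t j)) = 0"
    unfolding sum_distrib_left sum.distrib[symmetric] split[symmetric] by (simp add: sum_subtractf hor)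
  define a where "a \<theta> = (\<Sum>j\<in>UNIV. (Ft t j \<theta> - Ft 0 j \<theta>) * U \<theta> $ j)" for \<theta>
  define b where "b \<theta> = (\<Sum>k\<in>UNIV. \<Phi> \<theta> $ i * coupling i k \<theta> * q t k \<theta>)" for \<theta>
  have ia: "integrable circle (\<lambda>\<theta>. (Ft t j \<theta> - Ft 0 j \<theta>) * U \<theta> $ j)" for j
    by (rule L2_circle_integrable_mult[OF dL UL])
  have ib: "integrable circle (\<lambda>\<theta>. \<Phi> \<theta> $ i * coupling i k \<theta> * q t k \<theta>)" for k
    by (rule L2_circle_integrable_mult[OF pL wdom_L2[OF qw]])
  \<comment> \<open>\<open>e\<close> is what remains of the increment of \<open>Ft\<close> against
    \<open>U\<close> after its linear part, \<open>t\<close> times the coupling term, is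
    subtracted.\<close>
  have e_eq: "e \<theta> = a \<theta> - t * b \<theta>" for \<theta>
  proof -
    have "(PN' (u \<theta>) (g t \<theta> - u \<theta>) *v U \<theta>) $ i = (\<Sum>k\<in>UNIV. (g t \<theta> - u \<theta>) $ k * coupling i k \<theta>)"
      by (simp add: PN'_expand[of "u \<theta>" "g t \<theta> - u \<theta>"] coupling_def)
    also have "\<dots> = (\<Sum>k\<in>UNIV. t * (coupling i k \<theta> * q t k \<theta>))"
      using t(1) by (simp add: q_def mult.commute)
    finally have 1: "\<Phi> \<theta> $ i * (PN' (u \<theta>) (g t \<theta> - u \<theta>) *v U \<theta>) $ i = t * b \<theta>"
      by (simp add: b_def sum_distrib_left mult_ac)
    have 2: "\<Phi> \<theta> $ i * ((cutPN R (g t \<theta>) - cutPN R (u \<theta>)) *v U \<theta>) $ i = a \<theta>"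
      by (simp add: a_def Ft_def g0 matrix_vector_mult_nth sum_distrib_left sum_subtractf algebra_simps)
    show ?thesis
      unfolding e_def mv.diff_left[of "cutPN R (g t \<theta>) - cutPN R (u \<theta>)"] vector_minus_component right_diff_distrib 1 2 ..
  qed
  have Ia: "integrable circle a" "(LINT \<theta>|circle. a \<theta>) = (\<Sum>j\<in>UNIV. LINT \<theta>|circle. (Ft t j \<theta> - Ft 0 j \<theta>) * U \<theta> $ j)"
    unfolding a_def[abs_def] by (rule Bochner_Integration.integrable_sum[OF ia], rule Bochner_Integration.integral_sum[OF ia])
  have Ib: "integrable circle b" "(LINT \<theta>|circle. b \<theta>) = (\<Sum>k\<in>UNIV. mform (\<lambda>_. 1) (\<lambda>\<theta>. \<Phi> \<theta> $ i * coupling i k \<theta>) (q t k))"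
    unfolding b_def[abs_def] Parseval_mform[OF pL wdom_L2[OF qw]]
    by (rule Bochner_Integration.integrable_sum[OF ib], rule Bochner_Integration.integral_sum[OF ib])
  show "integrable circle e"
    unfolding e_eq using Ia(1) Ib(1) by simp
  have "(LINT \<theta>|circle. e \<theta>) = (LINT \<theta>|circle. a \<theta>) - t * (LINT \<theta>|circle. b \<theta>)"
    unfolding e_eq using Ia(1) Ib(1) by simp
  then have "(LINT \<theta>|circle. e \<theta>) + t * (LINT \<theta>|circle. b \<theta>) + t * (\<Sum>j\<in>UNIV. mform ?m (Ft t j) (q t j)) = 0"
    using sum0 Ia(2) by simp
  then have "((LINT \<theta>|circle. e \<theta>) + t * (LINT \<theta>|circle. b \<theta>) + t * (\<Sum>j\<in>UNIV. mform ?m (Ft t j) (q t j))) / t = 0"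
    by simp
  then show "(LINT \<theta>|circle. e \<theta>) / t + (\<Sum>k\<in>UNIV. mform (\<lambda>_. 1) (\<lambda>\<theta>. \<Phi> \<theta> $ i * coupling i k \<theta>) (q t k)) +
      (\<Sum>j\<in>UNIV. mform ?m (\<lambda>\<theta>. \<Phi> \<theta> $ i * cutPN R (g t \<theta>) $ i $ j) (q t j)) = 0"
    using t(1) unfolding Ib(2) Ft_def by (simp add: add_divide_distrib)
qed

text \<open>With \<open>g t - u = t q\<close> and \<open>q\<close> bounded in L^2, division by
  \<open>t\<close> leaves a multiple of \<epsilon> from the linear error and of
  \<open>K * \<bar>t\<bar>\<close> from the quadratic one. First \<epsilon> is fixed, then
  \<open>t\<close> tends to 0.\<close>

lemma remainder_tendsto:
  assumes R: "\<And>\<theta>. norm (u \<theta>) \<le> R" and \<Phi>2: "\<And>\<theta>. \<bar>\<Phi> \<theta> $ i\<bar> \<le> C"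
    and K: "\<And>e. e > 0 \<Longrightarrow> \<exists>K\<ge>0. \<forall>\<theta> z. norm (cutPN R z - cutPN R (u \<theta>) - PN' (u \<theta>) (z - u \<theta>)) \<le>
      e * norm (z - u \<theta>) + K * (norm (z - u \<theta>))\<^sup>2"
    and int: "\<And>t. t \<noteq> 0 \<Longrightarrow> \<bar>t\<bar> < 1 \<Longrightarrow> integrable circle
      (\<lambda>\<theta>. \<Phi> \<theta> $ i * ((cutPN R (g t \<theta>) - cutPN R (u \<theta>) - PN' (u \<theta>) (g t \<theta> - u \<theta>)) *v U \<theta>) $ i)"
  shows "((\<lambda>t. (LINT \<theta>|circle. \<Phi> \<theta> $ i * ((cutPN R (g t \<theta>) - cutPN R (u \<theta>) - PN' (u \<theta>) (g t \<theta> - u \<theta>)) *v U \<theta>) $ i) / t)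
    \<longlongrightarrow> 0) (at 0)"
proof (rule tendstoI)
  fix \<eta> :: real assume \<eta>: "\<eta> > 0"
  obtain Kmv where Kmv: "Kmv \<ge> 0" "\<And>A x. norm ((A :: real^'m^'m) *v (x :: real^'m)) \<le> norm A * norm x * Kmv"
    using bounded_bilinear.nonneg_bounded[OF bounded_bilinear_matrix_vector] by blast
  obtain BU where BU: "\<And>\<theta>. norm (U \<theta>) \<le> BU"
    using smooth_bounded(2)[OF u] unfolding bounded_iff by blast
  have C: "C \<ge> 0" "BU \<ge> 0"
    using \<Phi>2[of 0] BU[of 0] norm_ge_zero[of "U 0"] by linarith+
  define C1 where "C1 = C * BU * Kmv"
  have C1: "C1 \<ge> 0"
    using C Kmv by (simp add: C1_def)
  \<comment> \<open>Bounds the integral of the squared quotients for small \<open>t\<close>: each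
    component is within distance 1 of \<open>v\<close>, and
    \<open>(a + b)\<^sup>2 \<le> 2 * a\<^sup>2 + 2 * b\<^sup>2\<close>.\<close>
  define B where "B = 2 * pi * (\<Sum>k\<in>UNIV. 2 + 2 * wsq (\<lambda>_. 1) (\<lambda>\<theta>. v \<theta> $ k))"
  have B: "B \<ge> 0"
    unfolding B_def by (intro mult_nonneg_nonneg sum_nonneg add_nonneg_nonneg wsq_nonneg) auto
  define \<epsilon> where "\<epsilon> = \<eta> / (2 * (C1 + 1) * (2 * pi + B))"
  have den: "2 * pi + B > 0"
    using B pi_gt_zero by linarith
  have \<epsilon>: "\<epsilon> > 0"
    unfolding \<epsilon>_def using \<eta> C1 den by (intro divide_pos_pos mult_pos_pos) auto
  have \<epsilon>2: "C1 * (\<epsilon> * (2 * pi + B)) \<le> \<eta> / 2"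
  proof -
    have "C1 * (\<epsilon> * (2 * pi + B)) \<le> (C1 + 1) * (\<epsilon> * (2 * pi + B))"
      using \<epsilon> den by (intro mult_right_mono) auto
    also have "\<dots> = \<eta> / 2"
      using den C1 by (simp add: \<epsilon>_def divide_simps)
    finally show ?thesis .
  qed
  obtain K where K0: "K \<ge> 0" and K1: "\<And>\<theta> z. norm (cutPN R z - cutPN R (u \<theta>) - PN' (u \<theta>) (z - u \<theta>)) \<le>
      \<epsilon> * norm (z - u \<theta>) + K * (norm (z - u \<theta>))\<^sup>2"
    using K[OF \<epsilon>] by blast
  have "((\<lambda>t. C1 * (K * \<bar>t\<bar> * B)) \<longlongrightarrow> C1 * (K * \<bar>0\<bar> * B)) (at 0)"
    by (intro tendsto_intros)
  then have ev1: "\<forall>\<^sub>F t in at 0. C1 * (K * \<bar>t\<bar> * B) < \<eta> / 2"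
    using \<eta> by (intro order_tendstoD(2)) auto
  have "\<forall>\<^sub>F t in at 0. wsq (\<lambda>_. 1) (\<lambda>\<theta>. q t k \<theta> - v \<theta> $ k) < 1" for k
    using order_tendstoD(2)[OF q_L2[of k], of 1] by (simp add: q_def)
  then have ev2: "\<forall>\<^sub>F t in at 0. \<forall>k\<in>UNIV. wsq (\<lambda>_. 1) (\<lambda>\<theta>. q t k \<theta> - v \<theta> $ k) < 1"
    by (intro eventually_ball_finite) auto
  show "\<forall>\<^sub>F t in at 0. dist ((LINT \<theta>|circle. \<Phi> \<theta> $ i * ((cutPN R (g t \<theta>) - cutPN R (u \<theta>) - PN' (u \<theta>) (g t \<theta> - u \<theta>)) *v U \<theta>) $ i) / t) 0 < \<eta>"
    using eventually_near_0 ev1 ev2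
  proof eventually_elim
    case (elim t)
    then have t: "t \<noteq> 0" "\<bar>t\<bar> < 1"
      by auto
    let ?X = "\<lambda>\<theta>. cutPN R (g t \<theta>) - cutPN R (u \<theta>) - PN' (u \<theta>) (g t \<theta> - u \<theta>)"
    let ?e = "\<lambda>\<theta>. \<Phi> \<theta> $ i * (?X \<theta> *v U \<theta>) $ i"
    let ?s = "\<lambda>\<theta>. \<Sum>k\<in>UNIV. (q t k \<theta>)\<^sup>2"
    have qL: "q t k \<in> L2_circle" for k
      by (rule wdom_L2[OF q_wdom[OF t(2)]])
    have si: "integrable circle ?s" "(LINT \<theta>|circle. ?s \<theta>) = (\<Sum>k\<in>UNIV. 2 * pi * wsq (\<lambda>_. 1) (q t k))"
      using L2_circleD(3)[OF qL] by (simp_all add: Bochner_Integration.integral_sum wsq_1[OF qL])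
    have S: "(LINT \<theta>|circle. ?s \<theta>) \<le> B"
      unfolding si(2) B_def sum_distrib_left
    proof (intro sum_mono mult_left_mono)
      fix k
      have vL: "(\<lambda>\<theta>. v \<theta> $ k) \<in> wdom (\<lambda>_. 1)"
        by (rule wdom_1D[OF v])
      have qv: "(\<lambda>\<theta>. q t k \<theta> - v \<theta> $ k) \<in> wdom (\<lambda>_. 1)"
        by (rule wdom_diff(1)[OF _ wdom_1D[OF q_wdom[OF t(2)]] vL]) simp
      have "wsq (\<lambda>_. 1) (\<lambda>\<theta>. (q t k \<theta> - v \<theta> $ k) + v \<theta> $ k) \<le>
          2 * wsq (\<lambda>_. 1) (\<lambda>\<theta>. q t k \<theta> - v \<theta> $ k) + 2 * wsq (\<lambda>_. 1) (\<lambda>\<theta>. v \<theta> $ k)"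
        by (rule wdom_add(2)[OF _ qv vL]) simp
      moreover have "wsq (\<lambda>_. 1) (\<lambda>\<theta>. q t k \<theta> - v \<theta> $ k) < 1"
        using elim(3) by blast
      ultimately show "wsq (\<lambda>_. 1) (q t k) \<le> 2 + 2 * wsq (\<lambda>_. 1) (\<lambda>\<theta>. v \<theta> $ k)"
        by simp
    qed simp
    have pt: "\<bar>?e \<theta>\<bar> \<le> \<bar>t\<bar> * (C1 * (\<epsilon> + (\<epsilon> + K * \<bar>t\<bar>) * ?s \<theta>))" for \<theta>
    proof -
      let ?r = "norm (g t \<theta> - u \<theta>)"
      have "(g t \<theta> - u \<theta>) $ k = t * q t k \<theta>" for k
        using t(1) by (simp add: q_def)
      then have r2: "?r\<^sup>2 = t\<^sup>2 * ?s \<theta>"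
        by (simp add: power2_norm_vec power_mult_distrib sum_distrib_left)
      have t2: "t\<^sup>2 = \<bar>t\<bar> * \<bar>t\<bar>"
        by (simp add: power2_eq_square)
      have s0: "0 \<le> ?s \<theta>"
        by (intro sum_nonneg) simp
      \<comment> \<open>The length of \<open>q\<close> is at most \<open>1 + ?s \<theta>\<close>, as
        \<open>?s \<theta>\<close> is its square. This turns the linear error into integrable terms
        already controlled by \<open>B\<close>.\<close>
      have r1: "?r \<le> \<bar>t\<bar> * (1 + ?s \<theta>)"
      proof (rule power2_le_imp_le)
        have "?s \<theta> \<le> (1 + ?s \<theta>)\<^sup>2"
          using s0 by (simp add: power2_sum)
        then show "?r\<^sup>2 \<le> (\<bar>t\<bar> * (1 + ?s \<theta>))\<^sup>2"
          unfolding r2 power_mult_distrib by (simp add: mult_left_mono)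
      qed (use s0 in simp)
      have "\<bar>(?X \<theta> *v U \<theta>) $ i\<bar> \<le> norm (?X \<theta> *v U \<theta>)"
        by (rule component_le_norm_cart)
      also have "\<dots> \<le> norm (?X \<theta>) * norm (U \<theta>) * Kmv"
        by (rule Kmv(2))
      also have "\<dots> \<le> norm (?X \<theta>) * BU * Kmv"
        using BU Kmv(1) by (intro mult_right_mono mult_left_mono) auto
      finally have e: "\<bar>?e \<theta>\<bar> \<le> C * (norm (?X \<theta>) * BU * Kmv)"
        unfolding abs_mult using \<Phi>2 C(1) by (intro mult_mono) auto
      have "norm (?X \<theta>) \<le> \<epsilon> * ?r + K * ?r\<^sup>2"
        by (rule K1)
      also have "\<epsilon> * ?r + K * ?r\<^sup>2 \<le> \<epsilon> * (\<bar>t\<bar> * (1 + ?s \<theta>)) + K * (t\<^sup>2 * ?s \<theta>)"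
        unfolding r2 using r1 \<epsilon> by (intro add_right_mono mult_left_mono) auto
      also have "\<dots> = \<bar>t\<bar> * (\<epsilon> + (\<epsilon> + K * \<bar>t\<bar>) * ?s \<theta>)"
        unfolding t2 by algebra
      finally have "C1 * norm (?X \<theta>) \<le> C1 * (\<bar>t\<bar> * (\<epsilon> + (\<epsilon> + K * \<bar>t\<bar>) * ?s \<theta>))"
        using C1 by (rule mult_left_mono)
      then show ?thesis
        using e by (simp add: C1_def mult_ac)
    qed
    have "\<bar>LINT \<theta>|circle. ?e \<theta>\<bar> \<le> (LINT \<theta>|circle. \<bar>t\<bar> * (C1 * (\<epsilon> + (\<epsilon> + K * \<bar>t\<bar>) * ?s \<theta>)))"
    proof (rule order_trans[OF integral_abs_bound integral_mono])
      show "integrable circle (\<lambda>\<theta>. \<bar>?e \<theta>\<bar>)"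
        using int[OF t] by simp
      show "integrable circle (\<lambda>\<theta>. \<bar>t\<bar> * (C1 * (\<epsilon> + (\<epsilon> + K * \<bar>t\<bar>) * ?s \<theta>)))"
        using si(1) L2_circleD(4)[OF L2_circle_const[of \<epsilon>]] by auto
    qed (rule pt)
    also have "\<dots> = \<bar>t\<bar> * (C1 * (\<epsilon> * (2 * pi) + (\<epsilon> + K * \<bar>t\<bar>) * (LINT \<theta>|circle. ?s \<theta>)))"
      using si(1) L2_circleD(4)[OF L2_circle_const[of \<epsilon>]] by (simp add: measure_restrict_space)
    also have "\<dots> \<le> \<bar>t\<bar> * (C1 * (\<epsilon> * (2 * pi) + (\<epsilon> + K * \<bar>t\<bar>) * B))"
      using S C1 \<epsilon> K0 by (intro mult_left_mono add_left_mono) auto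
    finally have "\<bar>LINT \<theta>|circle. ?e \<theta>\<bar> / \<bar>t\<bar> \<le> C1 * (\<epsilon> * (2 * pi) + (\<epsilon> + K * \<bar>t\<bar>) * B)"
      using t(1) by (simp add: divide_le_eq mult.commute)
    also have "\<dots> = C1 * (\<epsilon> * (2 * pi + B)) + C1 * (K * \<bar>t\<bar> * B)"
      by (simp add: algebra_simps)
    also have "\<dots> < \<eta>"
      using \<epsilon>2 elim(2) by linarith
    finally show ?case
      by (simp add: abs_divide)
  qed
qed

text \<open>Limit of \<open>quotient_identity\<close> as \<open>t\<close> tends to 0. The test
  functions \<open>\<Phi>\<close> times \<open>cutPN\<close> along the path converge in L^2 and stay
  bounded in H^(1/2), hence weakly, while the quotients converge strongly to \<open>v\<close>; this
  is enough for the pairing with symbol i n.\<close>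

lemma constraint_form_tangent:
  assumes \<Phi>: "\<And>i. (\<lambda>\<theta>. \<Phi> \<theta> $ i) \<in> wdom wabs" "\<And>\<theta> i. \<bar>\<Phi> \<theta> $ i\<bar> \<le> C"
  shows "constraint_form \<Phi> v = 0"
proof -
  obtain R where R: "\<And>\<theta>. norm (u \<theta>) \<le> R"
    using smooth_bounded(1)[OF u] unfolding bounded_iff by blast
  obtain L where L: "\<And>x y i j. \<bar>cutPN R x $ i $ j - cutPN R y $ i $ j\<bar> \<le> L * norm (x - y)"
    and K: "\<And>e. e > 0 \<Longrightarrow> \<exists>K\<ge>0. \<forall>\<theta> z. norm (cutPN R z - cutPN R (u \<theta>) - PN' (u \<theta>) (z - u \<theta>)) \<le>
      e * norm (z - u \<theta>) + K * (norm (z - u \<theta>))\<^sup>2"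
    using cutPN_properties[OF R] by metis
  have w: "0 \<le> wabs n" for n
    by simp
  have m: "cmod (\<i> * of_int n) \<le> wabs n" for n
    by (simp add: norm_mult)
  have contG: "continuous_on UNIV (\<lambda>z. cutPN R z $ i $ j)" for i j
    unfolding cutPN_def by (intro continuous_intros continuous_cutoff continuous_PN)
  have G: "(\<lambda>\<theta>. cutPN R (g t \<theta>) $ i $ j) \<in> wdom wabs"
    "wsq wabs (\<lambda>\<theta>. cutPN R (g t \<theta>) $ i $ j) \<le> half_const * (\<Sum>k\<in>UNIV. L\<^sup>2 * wsq wabs (\<lambda>\<theta>. g t \<theta> $ k))"
    if t: "\<bar>t\<bar> < 1" for t i j
    using wdom_half_lipschitz[OF g_wdom[OF t] along_L2[OF g_wdom[OF t] contG cutPN_entry_bound] L] by blast+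
  have F: "(\<lambda>\<theta>. \<Phi> \<theta> $ i * cutPN R (g t \<theta>) $ i $ j) \<in> wdom wabs"
    "wsq wabs (\<lambda>\<theta>. \<Phi> \<theta> $ i * cutPN R (g t \<theta>) $ i $ j) \<le>
      half_const * (2 * C\<^sup>2 * wsq wabs (\<lambda>\<theta>. cutPN R (g t \<theta>) $ i $ j) + 2 * 1\<^sup>2 * wsq wabs (\<lambda>\<theta>. \<Phi> \<theta> $ i))"
    if t: "\<bar>t\<bar> < 1" for t i j
    using wdom_half_mult[OF \<Phi> G(1)[OF t] cutPN_entry_bound] by blast+
  have gu: "((\<lambda>t. wsq \<omega> (\<lambda>\<theta>. g t \<theta> $ k - u \<theta> $ k)) \<longlongrightarrow> 0) (at 0)"
    if "\<omega> = wabs \<or> \<omega> = (\<lambda>_. 1)" for \<omega> k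
  proof -
    have "((\<lambda>t. wsq \<omega> (\<lambda>\<theta>. g t \<theta> $ k - g 0 \<theta> $ k)) \<longlongrightarrow> 0) (at 0)"
    proof (rule wsq_tendsto_of_quotient[where a'="\<lambda>\<theta>. v \<theta> $ k"])
      show "\<And>n. 0 \<le> \<omega> n" "\<And>n. cmod (of_real (\<omega> n)) \<le> \<omega> n"
        using that by auto
      show "\<forall>\<^sub>F t in at 0. (\<lambda>\<theta>. g t \<theta> $ k) \<in> wdom \<omega>"
        using g_eventually[of k] by (rule eventually_mono) (use that wdom_1D in auto)
      show "(\<lambda>\<theta>. g 0 \<theta> $ k) \<in> wdom \<omega>" "(\<lambda>\<theta>. v \<theta> $ k) \<in> wdom \<omega>"
        using that wdom_1D[OF u_wdom] u_wdom wdom_1D[OF v] v by (auto simp: g0)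
      show "((\<lambda>t. wsq \<omega> (\<lambda>\<theta>. (g t \<theta> $ k - g 0 \<theta> $ k) / t - v \<theta> $ k)) \<longlongrightarrow> 0) (at 0)"
        using that q_half[of k] q_L2[of k] by (auto simp: g0)
    qed
    then show ?thesis
      by (simp add: g0)
  qed
  \<comment> \<open>Uniform H^(1/2) bound of the test functions, from the product and the Lipschitz
    estimate with \<open>2 + 2 * wsq wabs\<close> of \<open>u\<close> bounding \<open>g t\<close>
    for small \<open>t\<close>.\<close>
  define S where "S = half_const * (2 * C\<^sup>2 * (half_const * (\<Sum>k\<in>(UNIV::'m set). L\<^sup>2 * (2 + 2 * wsq wabs (\<lambda>\<theta>. u \<theta> $ k)))) +
      (\<Sum>i\<in>UNIV. 2 * wsq wabs (\<lambda>\<theta>. \<Phi> \<theta> $ i)))"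
  have "\<forall>\<^sub>F t in at 0. wsq wabs (\<lambda>\<theta>. g t \<theta> $ k - u \<theta> $ k) < 1" for k
    using gu[of wabs k] by (intro order_tendstoD(2)[of _ 0]) auto
  then have "\<forall>\<^sub>F t in at 0. \<forall>k\<in>UNIV. wsq wabs (\<lambda>\<theta>. g t \<theta> $ k - u \<theta> $ k) < 1"
    by (intro eventually_ball_finite) auto
  then have bdd: "\<forall>\<^sub>F t in at 0. \<forall>i j. wsq wabs (\<lambda>\<theta>. \<Phi> \<theta> $ i * cutPN R (g t \<theta>) $ i $ j) \<le> S"
    using eventually_near_0
  proof eventually_elim
    case (elim t)
    then have t: "\<bar>t\<bar> < 1"
      by blast
    have gk: "wsq wabs (\<lambda>\<theta>. g t \<theta> $ k) \<le> 2 + 2 * wsq wabs (\<lambda>\<theta>. u \<theta> $ k)" for k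
    proof -
      have "wsq wabs (\<lambda>\<theta>. (g t \<theta> $ k - u \<theta> $ k) + u \<theta> $ k) \<le> 2 * wsq wabs (\<lambda>\<theta>. g t \<theta> $ k - u \<theta> $ k) + 2 * wsq wabs (\<lambda>\<theta>. u \<theta> $ k)"
        by (rule wdom_add(2)[of wabs, OF w wdom_diff(1)[of wabs, OF w g_wdom[OF t] u_wdom] u_wdom])
      moreover have "wsq wabs (\<lambda>\<theta>. g t \<theta> $ k - u \<theta> $ k) < 1"
        using elim(1) by blast
      ultimately show ?thesis
        by simp
    qed
    have Gb: "wsq wabs (\<lambda>\<theta>. cutPN R (g t \<theta>) $ i $ j) \<le> half_const * (\<Sum>k\<in>UNIV. L\<^sup>2 * (2 + 2 * wsq wabs (\<lambda>\<theta>. u \<theta> $ k)))" for i j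
      using half_const_pos gk by (intro order_trans[OF G(2)[OF t]] mult_left_mono sum_mono) auto
    have "wsq wabs (\<lambda>\<theta>. \<Phi> \<theta> $ i * cutPN R (g t \<theta>) $ i $ j) \<le> S" for i j
    proof -
      have "2 * wsq wabs (\<lambda>\<theta>. \<Phi> \<theta> $ i) \<le> (\<Sum>i\<in>UNIV. 2 * wsq wabs (\<lambda>\<theta>. \<Phi> \<theta> $ i))"
        by (rule member_le_sum) (auto simp: wsq_nonneg)
      then show ?thesis
        unfolding S_def using half_const_pos Gb
        by (intro order_trans[OF F(2)[OF t]] mult_left_mono add_mono) auto
    qed
    then show ?case
      by blast
  qed
  \<comment> \<open>Weak times strong: \<open>v\<close> is kept fixed against the weakly convergent
    factor, and the difference \<open>q - v\<close> is handled by Cauchy-Schwarz with the bound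
    \<open>S\<close>.\<close>
  have limF: "((\<lambda>t. mform (\<lambda>n. \<i> * of_int n) (\<lambda>\<theta>. \<Phi> \<theta> $ i * cutPN R (g t \<theta>) $ i $ j) (q t j)) \<longlongrightarrow>
      mform (\<lambda>n. \<i> * of_int n) (\<lambda>\<theta>. \<Phi> \<theta> $ i * cutPN R (u \<theta>) $ i $ j) (\<lambda>\<theta>. v \<theta> $ j)) (at 0)" for i j
  proof -
    let ?m = "\<lambda>n. \<i> * of_int n :: complex" and ?F = "\<lambda>t \<theta>. \<Phi> \<theta> $ i * cutPN R (g t \<theta>) $ i $ j"
    have "((\<lambda>t. mform ?m (?F t) (\<lambda>\<theta>. v \<theta> $ j)) \<longlongrightarrow> mform ?m (?F 0) (\<lambda>\<theta>. v \<theta> $ j)) (at 0)"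
    proof (rule mform_half_weak[OF m _ F(1)])
      show "\<forall>\<^sub>F t in at 0. ?F t \<in> wdom wabs \<and> wsq wabs (?F t) \<le> S"
        using bdd eventually_near_0 by eventually_elim (simp add: F(1))
      show "((\<lambda>t. wsq (\<lambda>_. 1) (\<lambda>\<theta>. ?F t \<theta> - ?F 0 \<theta>)) \<longlongrightarrow> 0) (at 0)"
      proof (rule Lim_null_comparison)
        have "((\<lambda>t. \<Sum>k\<in>UNIV. C\<^sup>2 * (L\<^sup>2 * wsq (\<lambda>_. 1) (\<lambda>\<theta>. g t \<theta> $ k - u \<theta> $ k))) \<longlongrightarrow> (\<Sum>k\<in>(UNIV::'m set). C\<^sup>2 * (L\<^sup>2 * 0))) (at 0)"
          by (intro tendsto_sum tendsto_mult tendsto_const gu) simp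
        then show "((\<lambda>t. \<Sum>k\<in>UNIV. C\<^sup>2 * (L\<^sup>2 * wsq (\<lambda>_. 1) (\<lambda>\<theta>. g t \<theta> $ k - u \<theta> $ k))) \<longlongrightarrow> 0) (at 0)"
          by simp
        show "\<forall>\<^sub>F t in at 0. norm (wsq (\<lambda>_. 1) (\<lambda>\<theta>. ?F t \<theta> - ?F 0 \<theta>)) \<le>
            (\<Sum>k\<in>UNIV. C\<^sup>2 * (L\<^sup>2 * wsq (\<lambda>_. 1) (\<lambda>\<theta>. g t \<theta> $ k - u \<theta> $ k)))"
          using eventually_near_0
        proof eventually_elim
          case (elim t)
          then have t: "\<bar>t\<bar> < 1"
            by blast
          have FL: "(\<lambda>\<theta>. ?F t \<theta> - ?F 0 \<theta>) \<in> L2_circle"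
            using F(1)[OF t, of i j] F(1)[of 0 i j] by (intro L2_circle_diff wdom_L2[of _ wabs]) auto
          have dL: "(\<lambda>\<theta>. g t \<theta> $ k - u \<theta> $ k) \<in> L2_circle" for k
            by (intro L2_circle_diff wdom_L2[OF g_wdom[OF t]] wdom_L2[OF u_wdom])
          have pt: "(?F t \<theta> - ?F 0 \<theta>)\<^sup>2 \<le> (\<Sum>k\<in>UNIV. C\<^sup>2 * (L\<^sup>2 * (g t \<theta> $ k - u \<theta> $ k)\<^sup>2))" for \<theta>
          proof -
            have "\<bar>?F t \<theta> - ?F 0 \<theta>\<bar> = \<bar>\<Phi> \<theta> $ i\<bar> * \<bar>cutPN R (g t \<theta>) $ i $ j - cutPN R (u \<theta>) $ i $ j\<bar>"
              by (simp add: g0 abs_mult flip: right_diff_distrib)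
            also have "\<dots> \<le> C * (L * norm (g t \<theta> - u \<theta>))"
              using \<Phi>(2)[of \<theta> i] L[of "g t \<theta>" i j "u \<theta>"] by (intro mult_mono) auto
            finally have "(?F t \<theta> - ?F 0 \<theta>)\<^sup>2 \<le> (C * (L * norm (g t \<theta> - u \<theta>)))\<^sup>2"
              using power_mono[of "\<bar>?F t \<theta> - ?F 0 \<theta>\<bar>" _ 2] by simp
            also have "\<dots> = C\<^sup>2 * (L\<^sup>2 * (\<Sum>k\<in>UNIV. (g t \<theta> $ k - u \<theta> $ k)\<^sup>2))"
              by (simp add: power_mult_distrib power2_norm_vec)
            finally show ?thesis
              by (simp add: sum_distrib_left)
          qed
          have i: "integrable circle (\<lambda>\<theta>. C\<^sup>2 * (L\<^sup>2 * (g t \<theta> $ k - u \<theta> $ k)\<^sup>2))" for k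
            using L2_circleD(3)[OF dL] by simp
          have "2 * pi * wsq (\<lambda>_. 1) (\<lambda>\<theta>. ?F t \<theta> - ?F 0 \<theta>) \<le> (LINT \<theta>|circle. (\<Sum>k\<in>UNIV. C\<^sup>2 * (L\<^sup>2 * (g t \<theta> $ k - u \<theta> $ k)\<^sup>2)))"
            unfolding wsq_1[OF FL] by (intro integral_mono pt L2_circleD(3)[OF FL] Bochner_Integration.integrable_sum i)
          also have "\<dots> = (\<Sum>k\<in>UNIV. C\<^sup>2 * (L\<^sup>2 * (2 * pi * wsq (\<lambda>_. 1) (\<lambda>\<theta>. g t \<theta> $ k - u \<theta> $ k))))"
            by (simp add: Bochner_Integration.integral_sum[OF i] wsq_1[OF dL])
          also have "\<dots> = 2 * pi * (\<Sum>k\<in>UNIV. C\<^sup>2 * (L\<^sup>2 * wsq (\<lambda>_. 1) (\<lambda>\<theta>. g t \<theta> $ k - u \<theta> $ k)))"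
            by (simp add: sum_distrib_left mult_ac)
          finally have "wsq (\<lambda>_. 1) (\<lambda>\<theta>. ?F t \<theta> - ?F 0 \<theta>) \<le> (\<Sum>k\<in>UNIV. C\<^sup>2 * (L\<^sup>2 * wsq (\<lambda>_. 1) (\<lambda>\<theta>. g t \<theta> $ k - u \<theta> $ k)))"
            by (rule mult_left_le_imp_le) simp
          then show ?case
            using wsq_nonneg[of "\<lambda>_. 1"] by simp
        qed
      qed
    qed (use v in auto)
    moreover have "((\<lambda>t. mform ?m (?F t) (\<lambda>\<theta>. q t j \<theta> - v \<theta> $ j)) \<longlongrightarrow> 0) (at 0)"
    proof (rule Lim_null_comparison)
      have "((\<lambda>t. 2 * pi * (sqrt S * sqrt (wsq wabs (\<lambda>\<theta>. q t j \<theta> - v \<theta> $ j)))) \<longlongrightarrow> 2 * pi * (sqrt S * sqrt 0)) (at 0)"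
        using q_half[of j] by (intro tendsto_intros) (simp add: q_def)
      then show "((\<lambda>t. 2 * pi * (sqrt S * sqrt (wsq wabs (\<lambda>\<theta>. q t j \<theta> - v \<theta> $ j)))) \<longlongrightarrow> 0) (at 0)"
        by simp
      show "\<forall>\<^sub>F t in at 0. norm (mform ?m (?F t) (\<lambda>\<theta>. q t j \<theta> - v \<theta> $ j)) \<le>
          2 * pi * (sqrt S * sqrt (wsq wabs (\<lambda>\<theta>. q t j \<theta> - v \<theta> $ j)))"
        using bdd eventually_near_0
      proof eventually_elim
        case (elim t)
        then have t: "\<bar>t\<bar> < 1"
          by blast
        have qv: "(\<lambda>\<theta>. q t j \<theta> - v \<theta> $ j) \<in> wdom wabs"
          by (rule wdom_diff(1)[of wabs, OF w q_wdom[OF t] v])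
        have "\<bar>mform ?m (?F t) (\<lambda>\<theta>. q t j \<theta> - v \<theta> $ j)\<bar> \<le> 2 * pi * (sqrt (wsq wabs (?F t)) * sqrt (wsq wabs (\<lambda>\<theta>. q t j \<theta> - v \<theta> $ j)))"
          by (rule mform_summable_bound(2)[of wabs, OF w m F(1)[OF t] qv])
        also have "\<dots> \<le> 2 * pi * (sqrt S * sqrt (wsq wabs (\<lambda>\<theta>. q t j \<theta> - v \<theta> $ j)))"
          using elim(1) by (intro mult_left_mono mult_right_mono real_sqrt_le_mono) (auto simp: wsq_nonneg)
        finally show ?case
          by simp
      qed
    qed
    ultimately have "((\<lambda>t. mform ?m (?F t) (\<lambda>\<theta>. v \<theta> $ j) + mform ?m (?F t) (\<lambda>\<theta>. q t j \<theta> - v \<theta> $ j)) \<longlongrightarrow>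
        mform ?m (?F 0) (\<lambda>\<theta>. v \<theta> $ j) + 0) (at 0)"
      by (rule tendsto_add)
    moreover have "\<forall>\<^sub>F t in at 0. mform ?m (?F t) (\<lambda>\<theta>. v \<theta> $ j) + mform ?m (?F t) (\<lambda>\<theta>. q t j \<theta> - v \<theta> $ j) = mform ?m (?F t) (q t j)"
      using eventually_near_0
    proof eventually_elim
      case (elim t)
      then show ?case
        using mform_diff_right[of wabs ?m, OF w m F(1) q_wdom v, of t t i j j j] by simp
    qed
    ultimately show ?thesis
      using Lim_transform_eventually by (fastforce simp: g0)
  qed
  have limq: "((\<lambda>t. mform (\<lambda>_. 1) (\<lambda>\<theta>. \<Phi> \<theta> $ i * coupling i k \<theta>) (q t k)) \<longlongrightarrow>
      mform (\<lambda>_. 1) (\<lambda>\<theta>. \<Phi> \<theta> $ i * coupling i k \<theta>) (\<lambda>\<theta>. v \<theta> $ k)) (at 0)" for i k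
  proof (rule mform_right_tendsto[of "\<lambda>_. 1"])
    show "(\<lambda>\<theta>. \<Phi> \<theta> $ i * coupling i k \<theta>) \<in> wdom (\<lambda>_. 1)"
      unfolding wdom_1 by (rule multiplier_products(1)[OF \<Phi>])
    show "\<forall>\<^sub>F t in at 0. q t k \<in> wdom (\<lambda>_. 1)"
      using eventually_near_0 by eventually_elim (simp add: wdom_1D[OF q_wdom])
    show "(\<lambda>\<theta>. v \<theta> $ k) \<in> wdom (\<lambda>_. 1)"
      by (rule wdom_1D[OF v])
    show "((\<lambda>t. wsq (\<lambda>_. 1) (\<lambda>\<theta>. q t k \<theta> - v \<theta> $ k)) \<longlongrightarrow> 0) (at 0)"
      using q_L2[of k] by (simp add: q_def)
  qed simp_all
  \<comment> \<open>At time 0 the cutoff equals 1, so the limit is the form with \<open>PN\<close>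
    itself.\<close>
  have cu: "cutPN R (u \<theta>) = PN (u \<theta>)" for \<theta>
    using R[of \<theta>] by (simp add: cutPN_def cutoff_eq)
  have "(\<Sum>k\<in>UNIV. mform (\<lambda>_. 1) (\<lambda>\<theta>. \<Phi> \<theta> $ i * coupling i k \<theta>) (\<lambda>\<theta>. v \<theta> $ k)) +
      (\<Sum>j\<in>UNIV. mform (\<lambda>n. \<i> * of_int n) (\<lambda>\<theta>. \<Phi> \<theta> $ i * PN (u \<theta>) $ i $ j) (\<lambda>\<theta>. v \<theta> $ j)) = 0" for i
  proof -
    note id = quotient_identity[OF R \<Phi> F(1), of _ i]
    have "((\<lambda>t. (LINT \<theta>|circle. \<Phi> \<theta> $ i * ((cutPN R (g t \<theta>) - cutPN R (u \<theta>) - PN' (u \<theta>) (g t \<theta> - u \<theta>)) *v U \<theta>) $ i) / t +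
        (\<Sum>k\<in>UNIV. mform (\<lambda>_. 1) (\<lambda>\<theta>. \<Phi> \<theta> $ i * coupling i k \<theta>) (q t k)) +
        (\<Sum>j\<in>UNIV. mform (\<lambda>n. \<i> * of_int n) (\<lambda>\<theta>. \<Phi> \<theta> $ i * cutPN R (g t \<theta>) $ i $ j) (q t j))) \<longlongrightarrow>
        0 + (\<Sum>k\<in>UNIV. mform (\<lambda>_. 1) (\<lambda>\<theta>. \<Phi> \<theta> $ i * coupling i k \<theta>) (\<lambda>\<theta>. v \<theta> $ k)) +
        (\<Sum>j\<in>UNIV. mform (\<lambda>n. \<i> * of_int n) (\<lambda>\<theta>. \<Phi> \<theta> $ i * cutPN R (u \<theta>) $ i $ j) (\<lambda>\<theta>. v \<theta> $ j))) (at 0)"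
      by (intro tendsto_add tendsto_sum limq limF remainder_tendsto[OF R \<Phi>(2) K id(1)])
    moreover have "\<forall>\<^sub>F t in at 0. (LINT \<theta>|circle. \<Phi> \<theta> $ i * ((cutPN R (g t \<theta>) - cutPN R (u \<theta>) - PN' (u \<theta>) (g t \<theta> - u \<theta>)) *v U \<theta>) $ i) / t +
        (\<Sum>k\<in>UNIV. mform (\<lambda>_. 1) (\<lambda>\<theta>. \<Phi> \<theta> $ i * coupling i k \<theta>) (q t k)) +
        (\<Sum>j\<in>UNIV. mform (\<lambda>n. \<i> * of_int n) (\<lambda>\<theta>. \<Phi> \<theta> $ i * cutPN R (g t \<theta>) $ i $ j) (q t j)) = 0"
      using eventually_near_0 by eventually_elim (rule id(2); blast)
    ultimately have "((\<lambda>t. 0) \<longlongrightarrow> 0 + (\<Sum>k\<in>UNIV. mform (\<lambda>_. 1) (\<lambda>\<theta>. \<Phi> \<theta> $ i * coupling i k \<theta>) (\<lambda>\<theta>. v \<theta> $ k)) +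
        (\<Sum>j\<in>UNIV. mform (\<lambda>n. \<i> * of_int n) (\<lambda>\<theta>. \<Phi> \<theta> $ i * cutPN R (u \<theta>) $ i $ j) (\<lambda>\<theta>. v \<theta> $ j))) (at (0::real))"
      by (rule Lim_transform_eventually)
    then show ?thesis
      unfolding cu by (simp add: tendsto_const_iff)
  qed
  then show ?thesis
    by (simp add: constraint_form_def)
qed

lemma energy_stationary: "((\<lambda>t. vform wabs (g t) (g t)) has_real_derivative 0) (at 0)"
proof -
  obtain \<Phi> C where \<Phi>: "\<And>i. (\<lambda>\<theta>. \<Phi> \<theta> $ i) \<in> wdom wabs" "\<And>\<theta> i. \<bar>\<Phi> \<theta> $ i\<bar> \<le> C"
    "\<And>v. (\<And>i. (\<lambda>\<theta>. v \<theta> $ i) \<in> wdom wabs) \<Longrightarrow> vform wabs u v = constraint_form \<Phi> v"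
    using multiplier_identity by metis
  have "vform wabs u v = 0"
    using \<Phi>(3)[OF v] constraint_form_tangent[OF \<Phi>(1,2)] by simp
  then show ?thesis
    using energy_has_derivative by simp
qed

end

theorem theorem5p1:
  fixes PT PN :: "real^'m \<Rightarrow> real^'m^'m"
    and u :: "real \<Rightarrow> real^'m"
    and \<xi> :: "(real^'m) dist"
  assumes "C1_projections PT PN"
    and "critical_L_half PT PN u \<xi>"
    and "u \<in> smooth_circle" and "smooth_dist \<xi>"
  shows "critical_E_half PN u"
proof -
  obtain PT' :: "real^'m \<Rightarrow> (real^'m) \<Rightarrow>\<^sub>L (real^'m^'m)" where PT': "\<And>z. (PT has_derivative blinfun_apply (PT' z)) (at z)" "continuous_on UNIV PT'"
    using assms(1) by (auto simp: C1_projections_def C1_map_def)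
  obtain PN' :: "real^'m \<Rightarrow> (real^'m) \<Rightarrow>\<^sub>L (real^'m^'m)" where PN': "\<And>z. (PN has_derivative blinfun_apply (PN' z)) (at z)" "continuous_on UNIV PN'"
    using assms(1) by (auto simp: C1_projections_def C1_map_def)
  obtain f where f: "f \<in> smooth_circle" "\<And>\<phi>. \<phi> \<in> smooth_circle \<Longrightarrow> \<xi> \<phi> = dist_of_fun f \<phi>"
    using assms(4) by (auto simp: smooth_dist_def)
  interpret smooth_critical_pair PT PN PT' PN' u f \<xi>
    by unfold_locales (fact assms(1) PT' PN' assms(3) f assms(2))+
  show ?thesis
    unfolding critical_E_half_def
  proof (intro conjI allI impI)
    show "u \<in> horizontal PN"
      by (rule u_horizontal)
    fix \<gamma> assume "C1_path (horizontal PN) \<gamma> \<and> (AE \<theta> in circle. \<gamma> 0 \<theta> = u \<theta>)"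
    then have \<gamma>: "\<And>t. t \<in> {-1<..<1} \<Longrightarrow> \<gamma> t \<in> horizontal PN" and ae: "AE \<theta> in circle. \<gamma> 0 \<theta> = u \<theta>"
      and "\<exists>\<gamma>'. \<gamma>' 0 \<in> H_half \<and> ((\<lambda>h. H_half_norm (\<lambda>\<theta>. (\<gamma> (0 + h) \<theta> - \<gamma> 0 \<theta>) /\<^sub>R h - \<gamma>' 0 \<theta>)) \<longlongrightarrow> 0) (at 0)"
      unfolding C1_path_def using bspec[of "{-1<..<1::real}" _ 0] by (blast, blast, fastforce)
    then obtain v where v: "v \<in> H_half" "((\<lambda>h. H_half_norm (\<lambda>\<theta>. (\<gamma> h \<theta> - \<gamma> 0 \<theta>) /\<^sub>R h - v \<theta>)) \<longlongrightarrow> 0) (at 0)"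
      by auto
    have vw: "(\<lambda>\<theta>. v \<theta> $ i) \<in> wdom wabs" for i
      using v(1) H_half_vec by blast
    have \<gamma>w: "(\<lambda>\<theta>. \<gamma> t \<theta> $ i) \<in> wdom wabs" if "\<bar>t\<bar> < 1" for t i
      by (rule horizontalD(1)[OF \<gamma>]) (use that in auto)
    have z: "\<bar>0::real\<bar> < 1"
      by simp
    have uw: "(\<lambda>\<theta>. u \<theta> $ i) \<in> wdom wabs" for i
      by (rule horizontalD(1)[OF u_horizontal])
    have c0: "fourier (\<lambda>\<theta>. \<gamma> 0 \<theta> $ i) n = fourier (\<lambda>\<theta>. u \<theta> $ i) n" for i n
    proof (rule fourier_cong_AE)
      show "AE \<theta> in circle. \<gamma> 0 \<theta> $ i = u \<theta> $ i"
        using ae by eventually_elim simp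
    qed (use L2_circleD(2)[OF wdom_L2[OF \<gamma>w[OF z]]] L2_circleD(2)[OF wdom_L2[OF uw]] in auto)
    \<comment> \<open>\<open>\<gamma> 0\<close> agrees with \<open>u\<close> only almost everywhere.
      Replacing this one value gives a path through \<open>u\<close> itself without changing any
      Fourier coefficient.\<close>
    define g where "g t = (if t = 0 then u else \<gamma> t)" for t
    have q: "((\<lambda>t. wsq \<omega> (\<lambda>\<theta>. (g t \<theta> $ i - u \<theta> $ i) / t - v \<theta> $ i)) \<longlongrightarrow> 0) (at 0)"
      if \<omega>: "\<And>n. 0 \<le> \<omega> n" "\<And>n. \<omega> n \<le> wbessel n" for \<omega> i
    proof (rule Lim_null_comparison)
      let ?d = "\<lambda>h \<theta>. (\<gamma> h \<theta> - \<gamma> 0 \<theta>) /\<^sub>R h - v \<theta>"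
      have "((\<lambda>h. (H_half_norm (?d h))\<^sup>2) \<longlongrightarrow> 0\<^sup>2) (at 0)"
        by (intro tendsto_intros v(2))
      then show "((\<lambda>h. (H_half_norm (?d h))\<^sup>2) \<longlongrightarrow> 0) (at 0)"
        by simp
      show "\<forall>\<^sub>F t in at 0. norm (wsq \<omega> (\<lambda>\<theta>. (g t \<theta> $ i - u \<theta> $ i) / t - v \<theta> $ i)) \<le> (H_half_norm (?d t))\<^sup>2"
        using eventually_near_0
      proof eventually_elim
        case (elim t)
        then have t: "t \<noteq> 0" "\<bar>t\<bar> < 1"
          by auto
        have eq: "(\<lambda>\<theta>. ?d t \<theta> $ j) = (\<lambda>\<theta>. (1 / t) * (\<gamma> t \<theta> $ j - \<gamma> 0 \<theta> $ j) - v \<theta> $ j)" for j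
          by (simp add: inverse_eq_divide)
        have "(\<lambda>\<theta>. ?d t \<theta> $ j) \<in> wdom wabs" for j
          unfolding eq by (intro wdom_diff(1) wdom_cmult(1) \<gamma>w t z vw) auto
        then have d: "?d t \<in> H_half"
          using H_half_vec by blast
        note I = wdom_integrable[OF \<gamma>w[OF t(2)]] wdom_integrable[OF \<gamma>w[OF z]] wdom_integrable[OF uw] wdom_integrable[OF vw]
        have "fourier (\<lambda>\<theta>. (1 / t) * (\<gamma> t \<theta> $ i - \<gamma> 0 \<theta> $ i) - v \<theta> $ i) n =
            fourier (\<lambda>\<theta>. (1 / t) * (\<gamma> t \<theta> $ i - u \<theta> $ i) - v \<theta> $ i) n" for n
          using I by (simp add: fourier_diff fourier_cmult c0 del: times_divide_eq_left)
        then have "wsq \<omega> (\<lambda>\<theta>. (g t \<theta> $ i - u \<theta> $ i) / t - v \<theta> $ i) = wsq \<omega> (\<lambda>\<theta>. ?d t \<theta> $ i)"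
          unfolding eq using t(1) by (intro wsq_cong) (simp add: g_def)
        then show ?case
          using H_half_norm_ge[OF d \<omega>, of i] wsq_nonneg[of \<omega>, OF \<omega>(1)] by simp
      qed
    qed
    interpret horizontal_path PT PN PT' PN' u f \<xi> g v
    proof unfold_locales
      show "g 0 = u"
        by (simp add: g_def)
      show "g t \<in> horizontal PN" if "\<bar>t\<bar> < 1" for t
        using \<gamma>[of t] u_horizontal that by (auto simp: g_def abs_less_iff)
      show "(\<lambda>\<theta>. v \<theta> $ i) \<in> wdom wabs" for i
        by (rule vw)
      show "((\<lambda>t. wsq wabs (\<lambda>\<theta>. (g t \<theta> $ i - u \<theta> $ i) / t - v \<theta> $ i)) \<longlongrightarrow> 0) (at 0)" for i
        by (rule q) (simp_all add: wbessel_bounds)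
      show "((\<lambda>t. wsq (\<lambda>_. 1) (\<lambda>\<theta>. (g t \<theta> $ i - u \<theta> $ i) / t - v \<theta> $ i)) \<longlongrightarrow> 0) (at 0)" for i
        by (rule q) (simp_all add: wbessel_bounds)
    qed
    have E: "vform wabs (g t) (g t) = E_half (\<gamma> t)" if t: "\<bar>t\<bar> < 1" for t
    proof -
      have "\<gamma> t \<in> H_half"
        using \<gamma>w[OF t] H_half_vec by blast
      moreover have "vform wabs (g t) (g t) = vform wabs (\<gamma> t) (\<gamma> t)"
        unfolding vform_def by (intro sum.cong refl mform_cong) (simp_all add: g_def c0)
      ultimately show ?thesis
        by (simp add: E_half_eq)
    qed
    show "((\<lambda>t. E_half (\<gamma> t)) has_real_derivative 0) (at 0)"
      by (rule has_field_derivative_transform_within_open[OF energy_stationary, of "{-1<..<1}"]) (auto simp: E)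
  qed
qed

end
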